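(* Let $F$ be a field of characteristic $0$ containing all roots of unity, with a fixed embedding $\iota\colon\mathbb{Q}/\mathbb{Z}\hookrightarrow F^\times$, and assume that $F$ is an abelian (possibly infinite) extension of a finite extension of $\mathbb{Q}$. Then $X_F$ is path-connected, and the map $\pi_1^{\mathrm{path}}(X_F)\to\pi_1^{\text{ét}}(X_F)\cong\mathrm{Gal}(\overline{F}/F)$ is injective with dense image. Moreover, the loop topology on $\pi_1^{\mathrm{path}}(X_F)$ makes it a complete topological group which can be written as an inverse limit of discrete infinite groups. The map $\pi_1^{\mathrm{path}}(X_F)\to\mathrm{Gal}(\overline{F}/F)$ is continuous for this topology (and the Krull topology on the target), but the topology on $\pi_1^{\mathrm{path}}(X_F)$ is not the subspace topology induced from $\mathrm{Gal}(\overline{F}/F)$.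
   Context: $\mathbb{S}^1\subset\mathbb{C}^\times$ is the unit circle. Let $\overline{F}$ be an algebraic closure of $F$, with $\overline{F}^\times$ discrete. Put $X_{\overline{F}}=\{\chi\in\mathrm{Hom}(\overline{F}^\times,\mathbb{S}^1)\mid \chi(\iota(x))=e^{2\pi i x}\text{ for all }x\in\mathbb{Q}/\mathbb{Z}\}$, with the compact-open topology (pointwise convergence). $G=\mathrm{Gal}(\overline{F}/F)$ acts freely on $X_{\overline{F}}$ by $\sigma(\chi)=\chi\circ\sigma^{-1}$, and $X_F=G\backslash X_{\overline{F}}$ with the quotient topology, a connected compact Hausdorff space. Fix a base point $\tilde\chi\in X_{\overline{F}}$ with image $\chi\in X_F$. $\pi_1^{\mathrm{path}}(X_F)=\pi_1^{\mathrm{path}}(X_F,\chi)$ is the classical fundamental group of homotopy classes of loops at $\chi$, where the product $\gamma*\delta$ means "first $\delta$, then $\gamma$". The loop topology on it is the quotient topology from the loop space $\Omega(X_F,\chi)$ of continuous pointed maps $(\mathbb{S}^1,1)\to(X_F,\chi)$ with the compact-open topology. $\pi_1^{\text{ét}}(X_F)$ is the profinite automorphism group of the fibre functor at $\chi$ on finite covering spaces of $X_F$; it is isomorphic to $G$, with $X_{\overline{F}}\to X_F$ as universal profinite covering, and $\pi_1^{\mathrm{path}}(X_F)$ maps to it by monodromy (lifting of loops). Concretely, each loop $\gamma$ at $\chi$ lifts uniquely to a path $\tilde\gamma$ in $X_{\overline{F}}$ starting at $\tilde\chi$; if $\sigma_\gamma\in G$ is the unique element with $\tilde\gamma(1)=\sigma_\gamma(\tilde\chi)$,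 the homomorphism $\pi_1^{\mathrm{path}}(X_F)\to G$ is $[\gamma]\mapsto\sigma_\gamma^{-1}$. Completeness is with respect to the two-sided uniformity. *)

theory Defs
  imports "HOL-Analysis.Analysis" "HOL-Algebra.Algebraic_Closure"
    "HOL-Algebra.Generated_Fields" "HOL-Algebra.Group_Action" "HOL-Algebra.Product_Groups"
begin

section \<open>Galois extensions and the Krull topology\<close>

text \<open>
  Automorphisms of the field \<open>M\<close> are extensional functions, so that an automorphism is
  determined by its values on \<open>carrier M\<close>; the group law is composition.
\<close>

definition galois_group :: "('a, 'b) ring_scheme \<Rightarrow> 'a set \<Rightarrow> ('a \<Rightarrow> 'a) monoid" where
  "galois_group M K = BijGroup (carrier M)
     \<lparr>carrier := {\<sigma> \<in> Bij (carrier M). \<sigma> \<in> ring_hom M M \<and> (\<forall>x\<in>K. \<sigma> x = x)}\<rparr>"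

definition galois_extension :: "('a, 'b) ring_scheme \<Rightarrow> 'a set \<Rightarrow> bool" where
  "galois_extension M K \<longleftrightarrow> field M \<and> subfield K M
     \<and> (\<forall>x\<in>carrier M. (ring.algebraic M over K) x)
     \<and> {x \<in> carrier M. \<forall>\<sigma>\<in>carrier (galois_group M K). \<sigma> x = x} = K"

definition abelian_extension :: "('a, 'b) ring_scheme \<Rightarrow> 'a set \<Rightarrow> bool" where
  "abelian_extension M K \<longleftrightarrow> galois_extension M K \<and> comm_group (galois_group M K)"

text \<open>The left cosets of the groups \<open>Gal(L/E)\<close>, with \<open>E/F\<close> finite, form a basis.\<close>

definition krull_topology :: "('a, 'b) ring_scheme \<Rightarrow> 'a set \<Rightarrow> ('a \<Rightarrow> 'a) topology" where
  "krull_topology L F = topology_generated_by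
     {\<sigma> <#\<^bsub>galois_group L F\<^esub> carrier (galois_group L E) | \<sigma> E.
        \<sigma> \<in> carrier (galois_group L F) \<and> subfield E L \<and> F \<subseteq> E \<and> ring.finite_dimension L F E}"


section \<open>Quotient topology and compact-open topology\<close>

definition quotient_topology :: "'a topology \<Rightarrow> ('a \<Rightarrow> 'b) \<Rightarrow> 'b topology" where
  "quotient_topology Y q =
     topology (\<lambda>V. V \<subseteq> q ` topspace Y \<and> openin Y {x \<in> topspace Y. q x \<in> V})"

lemma openin_quotient_topology:
  "openin (quotient_topology Y q) V \<longleftrightarrow>
     V \<subseteq> q ` topspace Y \<and> openin Y {x \<in> topspace Y. q x \<in> V}"
proof -
  let ?P = "\<lambda>V. {x \<in> topspace Y. q x \<in> V}"
  have P_Int: "?P (S \<inter> T) = ?P S \<inter> ?P T" for S T by blast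
  have P_Union: "?P (\<Union>\<K>) = \<Union> (?P ` \<K>)" for \<K> by blast
  have "istopology (\<lambda>V. V \<subseteq> q ` topspace Y \<and> openin Y (?P V))"
    unfolding istopology_def
  proof (intro conjI allI impI)
    fix S T
    assume S: "S \<subseteq> q ` topspace Y \<and> openin Y (?P S)"
      and T: "T \<subseteq> q ` topspace Y \<and> openin Y (?P T)"
    show "S \<inter> T \<subseteq> q ` topspace Y" using S by blast
    show "openin Y (?P (S \<inter> T))"
      unfolding P_Int by (rule openin_Int[OF conjunct2[OF S] conjunct2[OF T]])
  next
    fix \<K>
    assume K: "\<forall>V\<in>\<K>. V \<subseteq> q ` topspace Y \<and> openin Y (?P V)"
    show "\<Union>\<K> \<subseteq> q ` topspace Y" using K by blast
    show "openin Y (?P (\<Union>\<K>))"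
      unfolding P_Union by (rule openin_Union) (use K in blast)
  qed
  then show ?thesis
    unfolding quotient_topology_def by (simp only: topology_inverse')
qed

lemma topspace_quotient_topology [simp]: "topspace (quotient_topology Y q) = q ` topspace Y"
proof
  show "topspace (quotient_topology Y q) \<subseteq> q ` topspace Y"
    using openin_topspace[of "quotient_topology Y q"] unfolding openin_quotient_topology by blast
  have "{x \<in> topspace Y. q x \<in> q ` topspace Y} = topspace Y" by blast
  then have "openin (quotient_topology Y q) (q ` topspace Y)"
    unfolding openin_quotient_topology by simp
  then show "q ` topspace Y \<subseteq> topspace (quotient_topology Y q)"
    by (rule openin_subset)
qed

lemma quotient_map_quotient_topology: "quotient_map Y (quotient_topology Y q) q"
  unfolding quotient_map_def topspace_quotient_topology openin_quotient_topology by blast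

text \<open>
  Functions are taken extensional, so that points of the space are exactly the continuous maps
  from \<open>S\<close> to \<open>Y\<close>.
\<close>

definition compact_open_topology :: "'a topology \<Rightarrow> 'b topology \<Rightarrow> ('a \<Rightarrow> 'b) topology" where
  "compact_open_topology S Y = topology_generated_by
     {{f \<in> extensional (topspace S). continuous_map S Y f \<and> f ` C \<subseteq> U} | C U.
        compactin S C \<and> openin Y U}"


section \<open>The fundamental group with the loop topology\<close>

abbreviation unit_circle :: "complex topology" where
  "unit_circle \<equiv> top_of_set (sphere 0 1)"

definition loop_space :: "'a topology \<Rightarrow> 'a \<Rightarrow> (complex \<Rightarrow> 'a) topology" where
  "loop_space Y x0 = subtopology (compact_open_topology unit_circle Y) {\<gamma>. \<gamma> 1 = x0}"

text \<open>
  With \<open>z = exp(2 \<pi> i t)\<close>, the condition \<open>Im z \<ge> 0\<close> on the circle means \<open>0 \<le> t \<le> 1/2\<close>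
  (up to \<open>t = 1\<close>), and \<open>z\<^sup>2\<close> is the point with parameter \<open>2 t\<close>: the product runs first
  through \<open>\<delta>\<close>, then through \<open>\<gamma>\<close>.
\<close>

definition loop_prod :: "(complex \<Rightarrow> 'a) \<Rightarrow> (complex \<Rightarrow> 'a) \<Rightarrow> complex \<Rightarrow> 'a" where
  "loop_prod \<gamma> \<delta> = (\<lambda>z\<in>sphere 0 1. if Im z \<ge> 0 then \<delta> (z\<^sup>2) else \<gamma> (z\<^sup>2))"

definition loop_class :: "'a topology \<Rightarrow> 'a \<Rightarrow> (complex \<Rightarrow> 'a) \<Rightarrow> (complex \<Rightarrow> 'a) set" where
  "loop_class Y x0 \<gamma> =
     {\<delta> \<in> topspace (loop_space Y x0). homotopic_with (\<lambda>h. h 1 = x0) unit_circle Y \<gamma> \<delta>}"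

definition fundamental_group :: "'a topology \<Rightarrow> 'a \<Rightarrow> (complex \<Rightarrow> 'a) set monoid" where
  "fundamental_group Y x0 =
     \<lparr>carrier = loop_class Y x0 ` topspace (loop_space Y x0),
      mult = (\<lambda>A B. \<Union>\<gamma>\<in>A. \<Union>\<delta>\<in>B. loop_class Y x0 (loop_prod \<gamma> \<delta>)),
      one = loop_class Y x0 (\<lambda>z\<in>sphere 0 1. x0)\<rparr>"

definition loop_topology :: "'a topology \<Rightarrow> 'a \<Rightarrow> (complex \<Rightarrow> 'a) set topology" where
  "loop_topology Y x0 = quotient_topology (loop_space Y x0) (loop_class Y x0)"


section \<open>Topological groups, completeness, inverse limits\<close>

definition topological_group :: "('g, 'm) monoid_scheme \<Rightarrow> 'g topology \<Rightarrow> bool" where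
  "topological_group G T \<longleftrightarrow> group G \<and> topspace T = carrier G
     \<and> continuous_map (prod_topology T T) T (\<lambda>(x, y). x \<otimes>\<^bsub>G\<^esub> y)
     \<and> continuous_map T T (\<lambda>x. inv\<^bsub>G\<^esub> x)"

text \<open>
  The two-sided uniformity has the sets of pairs \<open>(x, y)\<close> with \<open>x\<^sup>-\<^sup>1 y \<in> U\<close> and \<open>x y\<^sup>-\<^sup>1 \<in> U\<close>
  as a basis of entourages, for \<open>U\<close> an open neighbourhood of the unit.
\<close>

definition two_sided_cauchy_filter ::
    "('g, 'm) monoid_scheme \<Rightarrow> 'g topology \<Rightarrow> 'g filter \<Rightarrow> bool" where
  "two_sided_cauchy_filter G T \<F> \<longleftrightarrow>
     (\<forall>U. openin T U \<and> \<one>\<^bsub>G\<^esub> \<in> U \<longrightarrow>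
        (\<forall>\<^sub>F (x, y) in \<F> \<times>\<^sub>F \<F>. inv\<^bsub>G\<^esub> x \<otimes>\<^bsub>G\<^esub> y \<in> U \<and> x \<otimes>\<^bsub>G\<^esub> inv\<^bsub>G\<^esub> y \<in> U))"

definition complete_topological_group :: "('g, 'm) monoid_scheme \<Rightarrow> 'g topology \<Rightarrow> bool" where
  "complete_topological_group G T \<longleftrightarrow> topological_group G T \<and>
     (\<forall>\<F>. \<F> \<noteq> bot \<and> (\<forall>\<^sub>F x in \<F>. x \<in> carrier G) \<and> two_sided_cauchy_filter G T \<F>
        \<longrightarrow> (\<exists>x. limitin T (\<lambda>y. y) x \<F>))"

definition inverse_system_of_groups ::
    "'i set \<Rightarrow> ('i \<times> 'i) set \<Rightarrow> ('i \<Rightarrow> ('h, 'm) monoid_scheme) \<Rightarrow> ('i \<Rightarrow> 'i \<Rightarrow> 'h \<Rightarrow> 'h) \<Rightarrow> bool" where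
  "inverse_system_of_groups I r H \<phi> \<longleftrightarrow>
     I \<noteq> {} \<and> partial_order_on I r
     \<and> (\<forall>i\<in>I. \<forall>j\<in>I. \<exists>k\<in>I. (i, k) \<in> r \<and> (j, k) \<in> r)
     \<and> (\<forall>i\<in>I. group (H i))
     \<and> (\<forall>i\<in>I. \<forall>j\<in>I. (i, j) \<in> r \<longrightarrow> \<phi> i j \<in> hom (H j) (H i))
     \<and> (\<forall>i\<in>I. \<forall>x\<in>carrier (H i). \<phi> i i x = x)
     \<and> (\<forall>i\<in>I. \<forall>j\<in>I. \<forall>k\<in>I. (i, j) \<in> r \<and> (j, k) \<in> r \<longrightarrow>
          (\<forall>x\<in>carrier (H k). \<phi> i j (\<phi> j k x) = \<phi> i k x))"

definition inverse_limit ::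
    "'i set \<Rightarrow> ('i \<times> 'i) set \<Rightarrow> ('i \<Rightarrow> ('h, 'm) monoid_scheme) \<Rightarrow> ('i \<Rightarrow> 'i \<Rightarrow> 'h \<Rightarrow> 'h)
      \<Rightarrow> ('i \<Rightarrow> 'h) monoid" where
  "inverse_limit I r H \<phi> = product_group I H
     \<lparr>carrier := {x \<in> carrier (product_group I H).
        \<forall>i\<in>I. \<forall>j\<in>I. (i, j) \<in> r \<longrightarrow> \<phi> i j (x j) = x i}\<rparr>"

definition inverse_limit_topology ::
    "'i set \<Rightarrow> ('i \<times> 'i) set \<Rightarrow> ('i \<Rightarrow> ('h, 'm) monoid_scheme) \<Rightarrow> ('i \<Rightarrow> 'i \<Rightarrow> 'h \<Rightarrow> 'h)
      \<Rightarrow> ('i \<Rightarrow> 'h) topology" where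
  "inverse_limit_topology I r H \<phi> =
     subtopology (product_topology (\<lambda>i. discrete_topology (carrier (H i))) I)
       (carrier (inverse_limit I r H \<phi>))"

text \<open>
  A formula cannot quantify over types, so the groups of the system live on sets of elements of
  \<open>G\<close> and the indices are such sets as well. This leaves room for the quotients of \<open>G\<close> by
  open normal subgroups, indexed by these subgroups.
\<close>

definition is_inverse_limit_of_discrete_infinite_groups ::
    "'g monoid \<Rightarrow> 'g topology \<Rightarrow> bool" where
  "is_inverse_limit_of_discrete_infinite_groups G T \<longleftrightarrow>
     (\<exists>(I :: 'g set set) r (H :: 'g set \<Rightarrow> 'g set monoid) \<phi> \<Psi>.
        inverse_system_of_groups I r H \<phi>
        \<and> (\<forall>i\<in>I. infinite (carrier (H i)))
        \<and> \<Psi> \<in> iso G (inverse_limit I r H \<phi>)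
        \<and> homeomorphic_map T (inverse_limit_topology I r H \<phi>) \<Psi>)"


section \<open>The spaces attached to a field containing all roots of unity\<close>

definition rat_group :: "rat monoid" where
  "rat_group = \<lparr>carrier = UNIV, mult = (+), one = 0\<rparr>"

definition rat_mod_int :: "rat set monoid" where
  "rat_mod_int = rat_group Mod \<int>"

definition circle_group :: "complex monoid" where
  "circle_group = \<lparr>carrier = sphere 0 1, mult = (*), one = 1\<rparr>"

text \<open>
  In the following, \<open>L\<close> is an algebraic closure of its subfield \<open>F\<close>. Since \<open>L\<^sup>\<times>\<close> is discrete,
  the compact-open topology on its characters is the subspace topology from the product
  topology on all maps to the circle; the points of the latter are extensional functions.
\<close>

definition X_closure :: "('a, 'b) ring_scheme \<Rightarrow> (rat set \<Rightarrow> 'a) \<Rightarrow> ('a \<Rightarrow> complex) topology" where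
  "X_closure L \<iota> =
     subtopology (product_topology (\<lambda>_. unit_circle) (carrier (mult_of L)))
       {\<psi> \<in> hom (mult_of L) circle_group.
          \<forall>x::rat. \<psi> (\<iota> (\<int> #>\<^bsub>rat_group\<^esub> x)) = exp (2 * of_real pi * \<i> * of_rat x)}"

definition galois_action ::
    "('a, 'b) ring_scheme \<Rightarrow> 'a set \<Rightarrow> ('a \<Rightarrow> 'a) \<Rightarrow> ('a \<Rightarrow> complex) \<Rightarrow> 'a \<Rightarrow> complex" where
  "galois_action L F \<sigma> \<psi> = compose (carrier (mult_of L)) \<psi> (inv\<^bsub>galois_group L F\<^esub> \<sigma>)"

definition X_proj ::
    "('a, 'b) ring_scheme \<Rightarrow> 'a set \<Rightarrow> ('a \<Rightarrow> complex) \<Rightarrow> ('a \<Rightarrow> complex) set" where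
  "X_proj L F \<psi> = orbit (galois_group L F) (galois_action L F) \<psi>"

definition X_field ::
    "('a, 'b) ring_scheme \<Rightarrow> 'a set \<Rightarrow> (rat set \<Rightarrow> 'a) \<Rightarrow> ('a \<Rightarrow> complex) set topology" where
  "X_field L F \<iota> = quotient_topology (X_closure L \<iota>) (X_proj L F)"

abbreviation pi1_path ::
    "('a, 'b) ring_scheme \<Rightarrow> 'a set \<Rightarrow> (rat set \<Rightarrow> 'a) \<Rightarrow> ('a \<Rightarrow> complex)
      \<Rightarrow> (complex \<Rightarrow> ('a \<Rightarrow> complex) set) set monoid" where
  "pi1_path L F \<iota> \<psi> \<equiv> fundamental_group (X_field L F \<iota>) (X_proj L F \<psi>)"

abbreviation pi1_loop_topology ::
    "('a, 'b) ring_scheme \<Rightarrow> 'a set \<Rightarrow> (rat set \<Rightarrow> 'a) \<Rightarrow> ('a \<Rightarrow> complex)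
      \<Rightarrow> (complex \<Rightarrow> ('a \<Rightarrow> complex) set) set topology" where
  "pi1_loop_topology L F \<iota> \<psi> \<equiv> loop_topology (X_field L F \<iota>) (X_proj L F \<psi>)"

definition is_lift_of_loop ::
    "('a, 'b) ring_scheme \<Rightarrow> 'a set \<Rightarrow> (rat set \<Rightarrow> 'a) \<Rightarrow> ('a \<Rightarrow> complex)
      \<Rightarrow> (complex \<Rightarrow> ('a \<Rightarrow> complex) set) \<Rightarrow> (real \<Rightarrow> 'a \<Rightarrow> complex) \<Rightarrow> bool" where
  "is_lift_of_loop L F \<iota> \<psi> \<gamma> \<xi> \<longleftrightarrow> pathin (X_closure L \<iota>) \<xi> \<and> \<xi> 0 = \<psi>
     \<and> (\<forall>t\<in>{0..1}. X_proj L F (\<xi> t) = \<gamma> (cis (2 * pi * t)))"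

text \<open>
  The composite of the monodromy map from the path fundamental group to the etale fundamental
  group with the isomorphism of the latter to the Galois group: it sends \<open>[\<gamma>]\<close> to the
  inverse of \<open>\<sigma>\<^sub>\<gamma>\<close>, where the lift of \<open>\<gamma>\<close> starting at the base point \<open>\<psi>\<close> ends at
  \<open>\<sigma>\<^sub>\<gamma> \<psi>\<close>. The description asks for this with every loop \<open>\<gamma>\<close> in the class.
\<close>

definition monodromy ::
    "('a, 'b) ring_scheme \<Rightarrow> 'a set \<Rightarrow> (rat set \<Rightarrow> 'a) \<Rightarrow> ('a \<Rightarrow> complex)
      \<Rightarrow> (complex \<Rightarrow> ('a \<Rightarrow> complex) set) set \<Rightarrow> 'a \<Rightarrow> 'a" where
  "monodromy L F \<iota> \<psi> c = (THE \<tau>. \<tau> \<in> carrier (galois_group L F) \<and>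
     (\<forall>\<gamma>\<in>c. \<exists>\<xi>. is_lift_of_loop L F \<iota> \<psi> \<gamma> \<xi>
        \<and> \<xi> 1 = galois_action L F (inv\<^bsub>galois_group L F\<^esub> \<tau>) \<psi>))"

end

theory Submission
 imports Defs "Jordan_Normal_Form.Char_Poly" "HOL-Number_Theory.Residues"
  "HOL-Computational_Algebra.Computational_Algebra"
begin

text \<open>Every path in \<open>X_closure\<close> starting at the base point \<open>ps\<close> has the form \<open>t \<mapsto> ps \<cdot> exp (2 \<pi> i f\<^sub>t)\<close> with additive
functions \<open>f\<^sub>t\<close>, so the fundamental group is the set \<open>W\<close> of all Galois automorphisms \<open>tu\<close> such that
\<open>ps \<circ> tu / ps\<close> has a real logarithm \<open>wind tu\<close>. Its topology is given by the values of \<open>tu\<close> and of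
\<open>wind tu\<close> on finite sets. Such logarithms exist in abundance by the theorem of May: modulo torsion, the
multiplicative group of an abelian extension of a number field is free, here in the form that the saturation of
a finitely generated subgroup is finitely generated modulo the roots of unity. This lets one lift automorphisms
and characters one element of \<open>L\<close> at a time.\<close>

text \<open>The ratio of two characters in X is trivial on roots of unity, yet it need not have a
  real logarithm: L^x modulo torsion is a rational vector space, far from free. For the fields
  \<open>E n\<close>, finite over F with union L, the units modulo torsion are free and logarithms
  exist. From one such field to the next the obstruction is the torsion of the quotient of unit
  groups. There the ratio takes values in the roots of unity, and such a Kummer character comes from
  a Galois automorphism. So a path joins two characters only after one of them has been moved by the
  Galois group. Freeness rests on commutativity of Gal(F/K): a power of a Frobenius automorphism at
  a prime p commutes with enough automorphisms on \<open>E n\<close>, which bounds the Kummer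
  exponents prime to p. One prime does not reach all exponents, so p = 2 and p = 3 are combined. The
  Galois group is profinite, so the projection from X to X_F is not a covering. Paths are lifted
  modulo the groups \<open>G_n n\<close> first, and a limit turns these into genuine lifts. The
  uniform separation that this requires comes from Lagrange resolvents.\<close>

hide_const (open) UnivPoly.coeff UnivPoly.monom Polynomials.degree Polynomials.lead_coeff Module.smult Divisibility.prime Divisibility.irreducible Coset.order Ring_Hom.ring_hom

abbreviation (input) biimp (infixr "<->" 25) where "P <-> Q == P = Q"

section \<open>Algebraic integers\<close>

lemma algebraic_int_if_int_eigenvalue:
 fixes z :: complex and v :: "'i => complex" and a :: "'i => 'i => int"
 assumes "finite I" and "EX i:I. v i ~= 0"
  and eq: "!!i. i:I ==> z * v i = (\<Sum>j\<in>I. of_int (a i j) * v j)"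
 shows "algebraic_int z"
proof -
 define n where "n = card I"
 obtain e where e: "bij_betw e {..<n} I"
  using assms(1) unfolding n_def lessThan_atLeast0 by (metis ex_bij_betw_nat_finite)
 define A :: "int mat" where "A = mat n n (%(i, j). a (e i) (e j))"
 define w where "w = vec n (%i. v (e i))"
 have A: "A:carrier_mat n n" unfolding A_def by simp
 \<comment> \<open>The number \<open>z\<close> is an eigenvalue of an integer matrix, hence a root
   of its characteristic polynomial, which is monic.\<close>
 have "map_mat of_int A *\<^sub>v w = z \<cdot>\<^sub>v w"
 proof (rule eq_vecI)
  fix i assume "i < dim_vec (z \<cdot>\<^sub>v w)"
  hence i: "i < n" unfolding w_def by simp
  hence "e i:I" using e by (auto simp: bij_betw_def)
  have "(map_mat of_int A *\<^sub>v w) $ i = (\<Sum>j<n. of_int (a (e i) (e j)) * v (e j))"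
  using i by (simp add: A_def w_def scalar_prod_def lessThan_atLeast0)
  also have "\<dots> = (\<Sum>j\<in>I. of_int (a (e i) j) * v j)"
  using sum.reindex_bij_betw[OF e] .
  also have "\<dots> = (z \<cdot>\<^sub>v w) $ i" using eq[OF \<open>e i : I\<close>] i by (simp add: w_def)
  finally show "(map_mat of_int A *\<^sub>v w) $ i = (z \<cdot>\<^sub>v w) $ i" .
 qed (simp add: A_def w_def)
 moreover have "w ~= 0\<^sub>v n"
 proof
  assume "w = 0\<^sub>v n"
  hence "v (e i) = 0" if "i < n" for i
  proof -
  have "v (e i) = w $ i" using that unfolding w_def by simp
  also have "\<dots> = 0" using that unfolding \<open>w = 0\<^sub>v n\<close> by simp
  finally show ?thesis .
  qed
  moreover obtain i k where "i:I" "v i ~= 0" "k < n" "e k = i"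
  using assms(2) e by (auto simp: bij_betw_def image_iff)
  ultimately show False by blast
 qed
 ultimately have "eigenvector (map_mat of_int A) w z"
  unfolding eigenvector_def by (simp add: A_def w_def)
 hence "poly (char_poly (map_mat of_int A)) z = 0"
  using eigenvalue_root_char_poly[of "map_mat of_int A :: complex mat" n z] A
  by (auto simp: eigenvalue_def)
 hence "poly (map_poly of_int (char_poly A)) z = 0"
  using of_int_hom.char_poly_hom[OF A] by metis
 moreover have "lead_coeff (char_poly A) = 1"
  using degree_monic_char_poly[OF A] by simp
 ultimately show ?thesis unfolding algebraic_int_altdef_ipoly by blast
qed

text \<open>Multiplication by \<open>z\<close> on its powers below the degree is the companion
  matrix of a monic integer polynomial. The condition \<open>n > 0\<close> puts
  \<open>z ^ 0 = 1\<close> among these powers, so that the vector of powers is nonzero.\<close>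

lemma algebraic_int_powers_closed:
 fixes z :: complex
 assumes "algebraic_int z"
 obtains n :: nat and a :: "nat => nat => int" where "n > 0"
  and "!!i. i < n ==> z * z ^ i = (\<Sum>j<n. of_int (a i j) * z ^ j)"
proof -
 obtain p :: "int poly" where p: "poly (map_poly of_int p) z = 0" "lead_coeff p = 1"
  using assms algebraic_int_altdef_ipoly by blast
 define n where "n = degree p"
 have "n > 0"
 proof (rule ccontr)
  assume "\<not> n > 0"
  then obtain c where "p = [:c:]" unfolding n_def by (metis gr0I degree_eq_zeroE)
  thus False using p by simp
 qed
 have "0 = (\<Sum>j\<le>n. of_int (coeff p j) * z ^ j)"
  using p(1) by (simp add: poly_altdef n_def)
 also have "\<dots> = z ^ n + (\<Sum>j<n. of_int (coeff p j) * z ^ j)"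
  using p(2) by (simp add: n_def lessThan_Suc_atMost[symmetric])
 finally have zn: "z ^ n = (\<Sum>j<n. of_int (- coeff p j) * z ^ j)"
  by (simp add: sum_negf eq_neg_iff_add_eq_0)
 define a where "a = (%i j. if Suc i < n then (if j = Suc i then 1 else 0) else - coeff p j)"
 have "z * z ^ i = (\<Sum>j<n. of_int (a i j) * z ^ j)" if "i < n" for i
 proof (cases "Suc i < n")
  case True
  hence "(\<Sum>j<n. of_int (a i j) * z ^ j) = (\<Sum>j<n. if j = Suc i then z ^ j else 0)"
  by (intro sum.cong) (auto simp: a_def)
  thus ?thesis using True by simp
 next
  case False
  hence "n = Suc i" using that by simp
  thus ?thesis using zn by (simp add: a_def)
 qed
 with \<open>n > 0\<close> show ?thesis using that by blast
qed

text \<open>Both numbers act by integer matrices on the span of the products x^i y^k. Hence so do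
  their sum and their product, and \<open>algebraic_int_if_int_eigenvalue\<close> applies to
  them.\<close>

lemma algebraic_int_add_mult:
 fixes x y :: complex
 assumes "algebraic_int x" "algebraic_int y"
 shows "algebraic_int (x + y) & algebraic_int (x * y)"
proof -
 obtain n a where n: "n > 0" and a: "!!i. i < n ==> x * x ^ i = (\<Sum>j<n. of_int (a i j) * x ^ j)"
  using algebraic_int_powers_closed[OF assms(1)] by blast
 obtain m b where m: "m > 0" and b: "!!i. i < m ==> y * y ^ i = (\<Sum>j<m. of_int (b i j) * y ^ j)"
  using algebraic_int_powers_closed[OF assms(2)] by blast
 define I where "I = {..<n} \<times> {..<m}"
 define v where "v = (%(i, k). x ^ i * y ^ k)"
 have fin: "finite I" and nz: "EX i:I. v i ~= 0"
  using n m by (auto simp: I_def v_def intro!: bexI[of _ "(0, 0)"])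
 define A :: "nat \<times> nat => nat \<times> nat => int"
  where "A = (%(i, k) (j, l). if l = k then a i j else 0)"
 define B :: "nat \<times> nat => nat \<times> nat => int"
  where "B = (%(i, k) (j, l). if j = i then b k l else 0)"
 have A: "x * v i = (\<Sum>j\<in>I. of_int (A i j) * v j)" if "i:I" for i
 proof -
  obtain p q where i: "i = (p, q)" "p < n" "q < m" using \<open>i : I\<close> unfolding I_def by auto
  have "(\<Sum>j\<in>I. of_int (A i j) * v j)
  = (\<Sum>j<n. \<Sum>l<m. of_int (if l = q then a p j else 0) * (x ^ j * y ^ l))"
  unfolding I_def sum.cartesian_product by (intro sum.cong) (auto simp: A_def v_def i)
  also have "\<dots> = (\<Sum>j<n. \<Sum>l<m. if l = q then of_int (a p j) * (x ^ j * y ^ q) else 0)"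
  by (intro sum.cong) auto
  also have "\<dots> = (\<Sum>j<n. of_int (a p j) * x ^ j) * y ^ q"
  using i by (simp add: sum_distrib_right mult.assoc)
  also have "\<dots> = x * v i" unfolding a[OF i(2), symmetric] by (simp add: v_def i)
  finally show ?thesis ..
 qed
 have B: "y * v i = (\<Sum>j\<in>I. of_int (B i j) * v j)" if "i:I" for i
 proof -
  obtain p q where i: "i = (p, q)" "p < n" "q < m" using \<open>i : I\<close> unfolding I_def by auto
  have "(\<Sum>j\<in>I. of_int (B i j) * v j)
  = (\<Sum>j<n. \<Sum>l<m. of_int (if j = p then b q l else 0) * (x ^ j * y ^ l))"
  unfolding I_def sum.cartesian_product by (intro sum.cong) (auto simp: B_def v_def i)
  also have "\<dots> = (\<Sum>j<n. if j = p then (\<Sum>l<m. of_int (b q l) * (x ^ j * y ^ l)) else 0)"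
  by (intro sum.cong) auto
  also have "\<dots> = x ^ p * (\<Sum>l<m. of_int (b q l) * y ^ l)"
  using i by (simp add: sum_distrib_left mult_ac)
  also have "\<dots> = y * v i" unfolding b[OF i(3), symmetric] by (simp add: v_def i)
  finally show ?thesis ..
 qed
 have "(x + y) * v i = (\<Sum>j\<in>I. of_int (A i j + B i j) * v j)" if "i:I" for i
  using A[OF that] B[OF that] by (simp add: distrib_right sum.distrib)
 moreover have "(x * y) * v i = (\<Sum>j\<in>I. of_int (\<Sum>k\<in>I. B i k * A k j) * v j)" if "i:I" for i
 proof -
  have "(x * y) * v i = (\<Sum>k\<in>I. of_int (B i k) * (x * v k))"
  by (simp add: mult.assoc B[OF that] sum_distrib_left mult.left_commute)
  also have "\<dots> = (\<Sum>k\<in>I. \<Sum>j\<in>I. of_int (B i k) * (of_int (A k j) * v j))"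
  by (simp add: A sum_distrib_left)
  also have "\<dots> = (\<Sum>j\<in>I. \<Sum>k\<in>I. of_int (B i k) * (of_int (A k j) * v j))"
  by (rule sum.swap)
  finally show ?thesis by (simp add: sum_distrib_right mult.assoc)
 qed
 ultimately show ?thesis
  using algebraic_int_if_int_eigenvalue[OF fin nz, of "x + y" "%i j. A i j + B i j"]
  algebraic_int_if_int_eigenvalue[OF fin nz, of "x * y" "%i j. \<Sum>k\<in>I. B i k * A k j"] by blast
qed

lemma algebraic_int_plus [intro]: "algebraic_int x ==> algebraic_int y ==> algebraic_int (x + y)"
 for x y :: complex
 using algebraic_int_add_mult by blast

lemma algebraic_int_times [intro]: "algebraic_int x ==> algebraic_int y ==> algebraic_int (x * y)"
 for x y :: complex
 using algebraic_int_add_mult by blast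

lemma algebraic_int_diff [intro]: "algebraic_int x ==> algebraic_int y ==> algebraic_int (x - y)"
 for x y :: complex
 using algebraic_int_plus[of x "- y"] by simp

lemma algebraic_int_power [intro]: "algebraic_int x ==> algebraic_int (x ^ n)" for x :: complex
 by (induction n) auto

lemma algebraic_int_prod [intro]:
 "(!!i. i:I ==> algebraic_int (f i)) ==> algebraic_int (\<Prod>i\<in>I. f i)" for f :: "'i => complex"
 by (induction I rule: infinite_finite_induct) auto

lemma algebraic_int_sum [intro]:
 "(!!i. i:I ==> algebraic_int (f i)) ==> algebraic_int (\<Sum>i\<in>I. f i)" for f :: "'i => complex"
 by (induction I rule: infinite_finite_induct) auto

lemma algebraic_int_poly:
 fixes z :: complex
 assumes "algebraic_int z" "!!i. coeff p i:\<int>"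
 shows "algebraic_int (poly p z)"
proof -
 have "algebraic_int (coeff p i * z ^ i)" for i
  using int_imp_algebraic_int[OF assms(2)] algebraic_int_power[OF assms(1)]
  by (rule algebraic_int_times)
 thus ?thesis unfolding poly_altdef by (rule algebraic_int_sum)
qed

lemma algebraic_int_nth_root:
 fixes z :: complex
 assumes "algebraic_int (z ^ n)" "n > 0"
 shows "algebraic_int z"
proof (rule algebraic_int_root[OF assms(1)])
 show "poly (monom 1 n) z = z ^ n" by (simp add: poly_monom)
 show "ALL i. coeff (monom 1 n :: complex poly) i:\<int>" by simp
 show "lead_coeff (monom 1 n :: complex poly) = 1" by (simp add: degree_monom_eq)
 show "degree (monom 1 n :: complex poly) > 0" using assms(2) by (simp add: degree_monom_eq)
qed

lemma algebraic_int_coeff_prod: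
 fixes f :: "'i => complex"
 assumes "!!i. i:I ==> algebraic_int (f i)"
 shows "algebraic_int (coeff (\<Prod>i\<in>I. [:- f i, 1:]) k)"
 using assms
proof (induction I arbitrary: k rule: infinite_finite_induct)
 case (insert i I)
 have "coeff (\<Prod>i\<in>insert i I. [:- f i, 1:]) k
  = - f i * coeff (\<Prod>i\<in>I. [:- f i, 1:]) k + coeff (pCons 0 (\<Prod>i\<in>I. [:- f i, 1:])) k"
  using insert by (simp add: mult_pCons_left)
 moreover have "algebraic_int (coeff (pCons 0 (\<Prod>i\<in>I. [:- f i, 1:])) k)"
  using insert by (cases k) auto
 ultimately show ?case using insert by auto
qed (auto simp: coeff_1)

text \<open>The bound is the value at 1 of the product of the polynomials X + |f i|. It is the same
  for all coefficients, so a bound on the roots leaves only finitely many integral polynomials of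
  given degree.\<close>

lemma norm_coeff_prod_le:
 fixes f :: "'i => complex"
 shows "cmod (coeff (\<Prod>i\<in>I. [:- f i, 1:]) k) <= (\<Prod>i\<in>I. 1 + cmod (f i))"
proof (induction I arbitrary: k rule: infinite_finite_induct)
 case (insert i I)
 let ?p = "\<Prod>i\<in>I. [:- f i, 1:]" and ?b = "\<Prod>i\<in>I. 1 + cmod (f i)"
 have b: "0 <= ?b" by (intro prod_nonneg) auto
 have "coeff (\<Prod>i\<in>insert i I. [:- f i, 1:]) k = - f i * coeff ?p k + coeff (pCons 0 ?p) k"
  using insert by (simp add: mult_pCons_left)
 moreover have "cmod (coeff (pCons 0 ?p) k) <= ?b"
  using insert b by (cases k) auto
 moreover have "cmod (- f i * coeff ?p k) <= cmod (f i) * ?b"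
  unfolding norm_mult norm_minus_cancel by (intro mult_left_mono insert) auto
 ultimately have "cmod (coeff (\<Prod>i\<in>insert i I. [:- f i, 1:]) k) <= cmod (f i) * ?b + ?b"
  by (metis norm_triangle_mono)
 thus ?case using insert by (simp add: distrib_right)
qed (auto simp: coeff_1)

text \<open>If \<open>ze\<close> and \<open>ze ^ p\<close> had distinct minimal polynomials over the rationals, the derivative of
 \<open>X ^ N - 1\<close> at \<open>ze\<close>, whose norm is prime to \<open>p\<close>, would be divisible by \<open>g(ze)\<close>, whose \<open>p\<close>-th power
 is divisible by \<open>p\<close>. This is the irreducibility of cyclotomic polynomials.\<close>

lemma int_poly_power_prime_cong:
 fixes g :: "int poly"
 assumes p: "prime p"
 shows "EX h. g ^ p = pcompose g (monom 1 p) + of_nat p * h"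
proof (induction g)
 case 0
 show ?case using p by (intro exI[of _ 0]) (simp add: prime_gt_0_nat zero_power)
next
 case (pCons a g)
 then obtain h where h: "g ^ p = pcompose g (monom 1 p) + of_nat p * h" by blast
 have p0: "p > 0" using p prime_gt_0_nat by blast
 have binom: "EX c. (x + y) ^ p = x ^ p + y ^ p + of_nat p * c" for x y :: "int poly"
 proof -
  have "(x + y) ^ p = (\<Sum>k\<le>p. of_nat (p choose k) * x ^ k * y ^ (p - k))"
  by (rule binomial_ring)
  also have "{..p} = insert 0 (insert p {1..<p})" using p0 by auto
  also have "(\<Sum>k\<in>\<dots>. of_nat (p choose k) * x ^ k * y ^ (p - k))
  = y ^ p + x ^ p + (\<Sum>k\<in>{1..<p}. of_nat (p choose k) * x ^ k * y ^ (p - k))"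
  using p0 by (simp add: add.assoc)
  also have "(\<Sum>k\<in>{1..<p}. of_nat (p choose k) * x ^ k * y ^ (p - k))
  = (\<Sum>k\<in>{1..<p}. of_nat p * (of_nat ((p choose k) div p) * x ^ k * y ^ (p - k)))"
  proof (rule sum.cong[OF refl])
  fix k assume "k:{1..<p}"
  hence "p dvd (p choose k)" by (intro dvd_choose_prime) (use p in auto)
  hence "of_nat (p choose k) = (of_nat p * of_nat ((p choose k) div p) :: int poly)"
  by (metis dvd_mult_div_cancel of_nat_mult)
  thus "of_nat (p choose k) * x ^ k * y ^ (p - k)
  = of_nat p * (of_nat ((p choose k) div p) * x ^ k * y ^ (p - k))"
  by (simp add: mult.assoc)
  qed
  finally show ?thesis by (auto simp: sum_distrib_left[symmetric] add.commute)
 qed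
 have p0: "p > 0" using p prime_gt_0_nat by blast
 obtain c where c: "(of_int a + pCons 0 g) ^ p = of_int a ^ p + pCons 0 g ^ p + of_nat p * c"
  using binom by blast
 \<comment> \<open>Fermat's little theorem for the constant coefficient. The residue
   \<open>m\<close> is used in place of \<open>a\<close> because \<open>fermat_theorem\<close>
   concerns natural numbers.\<close>
 have "[a ^ p = a] (mod int p)"
 proof -
  define m where "m = nat (a mod int p)"
  have am: "[a = int m] (mod int p)" using p0 by (simp add: m_def cong_def)
  have "[m ^ p = m] (mod p)"
  proof (cases "p dvd m")
  case True
  hence "p dvd m ^ p" using p0 by (simp add: dvd_power dvd_trans[OF True])
  thus ?thesis using True unfolding cong_def by (simp add: dvd_imp_mod_0)
  next
  case False
  hence "[m * m ^ (p - 1) = m * 1] (mod p)"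
  using fermat_theorem[OF p] cong_scalar_left by blast
  thus ?thesis using p0 by (simp flip: power_Suc)
  qed
  hence "[int m ^ p = int m] (mod int p)" by (metis cong_int_iff of_nat_power)
  thus ?thesis using am by (meson cong_pow cong_sym cong_trans)
 qed
 hence "int p dvd a ^ p - a" by (simp add: cong_iff_dvd_diff)
 then obtain b' where "a ^ p - a = int p * b'" by (rule dvdE)
 then obtain b where b: "a ^ p = a + int p * b" by (metis add_diff_cancel_left' add_diff_eq)
 have "pCons a g = of_int a + pCons 0 g" by (simp add: of_int_poly)
 hence "pCons a g ^ p = of_int (a ^ p) + pCons 0 g ^ p + of_nat p * c" using c by simp
 also have "pCons 0 g ^ p = monom 1 p * g ^ p"
 proof -
  have "pCons 0 g = monom 1 1 * g" by (simp add: monom_altdef)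
  thus ?thesis by (simp add: power_mult_distrib monom_power)
 qed
 also have "of_int (a ^ p) + monom 1 p * g ^ p + of_nat p * c
  = pcompose (pCons a g) (monom 1 p) + of_nat p * (of_int b + monom 1 p * h + c)"
  unfolding h b pcompose_pCons of_int_add of_int_mult of_int_of_nat_eq
  by (simp add: algebra_simps of_int_poly)
 finally show ?case by blast
qed

text \<open>\<open>B\<close> may be any set of \<open>N\<close>-th roots of unity with an integral
  polynomial that separates \<open>ze\<close> from \<open>ze ^ p\<close>;
  \<open>exists_frobenius\<close> takes the complement of the orbit of a primitive root.\<close>

lemma cyclotomic_prime_dvd:
 fixes ze :: complex
 assumes p: "prime p" and N: "N > 0" and ze: "ze ^ N = 1" "ze \<notin> B"
  and B: "B <= {w. w ^ N = 1}" "ze ^ p:B"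
  and int: "!!i. coeff (\<Prod>w\<in>B. [:- w, 1:]) i:\<int>"
 shows "p dvd N"
proof -
 define U where "U = {w::complex. w ^ N = 1}"
 have U: "finite U" unfolding U_def using finite_roots_unity[of N] N by simp
 define q :: "complex poly" where "q = monom 1 N - 1"
 have pd: "poly (pderiv q) w = of_nat N * w ^ (N - 1)" for w
  by (simp add: q_def pderiv_diff pderiv_monom poly_monom)
 have "poly q w ~= 0 \<or> poly (pderiv q) w ~= 0" for w
 proof (cases "w = 0")
  case True
  thus ?thesis using N by (simp add: q_def poly_monom power_0_left)
 qed (use pd N in simp)
 hence "rsquarefree q" unfolding rsquarefree_roots by blast
 moreover have "lead_coeff q = 1"
 proof -
  have "degree q = N"
  unfolding q_def using N degree_add_eq_left[of "- 1" "monom (1::complex) N"]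
  by (simp add: degree_monom_eq)
  thus ?thesis using N by (simp add: q_def coeff_1)
 qed
 moreover have "{z. poly q z = 0} = U" by (simp add: q_def U_def poly_monom)
 ultimately have q: "q = (\<Prod>w\<in>U. [:- w, 1:])"
  using complex_poly_decompose_rsquarefree[of q] by simp
 have alg: "algebraic_int w" if "w ^ N = 1" for w :: complex
  using algebraic_int_nth_root[of w N] that N by simp
 have "q = [:- ze, 1:] * (\<Prod>w\<in>U - {ze}. [:- w, 1:])"
  unfolding q using U ze by (intro prod.remove) (auto simp: U_def)
 hence "poly (pderiv q) ze = (\<Prod>w\<in>U - {ze}. ze - w)"
  by (simp only: pderiv_mult) (simp add: pderiv_pCons poly_prod)
 \<comment> \<open>The derivative of X^N - 1 at its simple root \<open>ze\<close>. The factors with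
   \<open>w\<close> in \<open>B\<close> multiply to g(ze), the remaining ones to
   \<open>v\<close>.\<close>
 hence D: "of_nat N * ze ^ (N - 1) = (\<Prod>w\<in>U - {ze}. ze - w)"
  using pd by simp
 define v where "v = (\<Prod>w\<in>U - {ze} - B. ze - w)"
 obtain g where g: "map_poly of_int g = (\<Prod>w\<in>B. [:- w, 1:] :: complex poly)"
 proof
  show "map_poly of_int (map_poly (%c. \<lfloor>Re c\<rfloor>) (\<Prod>w\<in>B. [:- w, 1:])) = (\<Prod>w\<in>B. [:- w, 1:] :: complex poly)"
  proof (rule poly_eqI)
  fix i
  show "coeff (map_poly of_int (map_poly (%c. \<lfloor>Re c\<rfloor>) (\<Prod>w\<in>B. [:- w, 1:]))) i = coeff (\<Prod>w\<in>B. [:- w, 1:]) i"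
  using int[of i] by (auto simp: coeff_map_poly elim!: Ints_cases)
  qed
 qed
 obtain h where h: "g ^ p = pcompose g (monom 1 p) + of_nat p * h"
  using int_poly_power_prime_cong[OF p] by blast
 have "poly (map_poly of_int (g ^ p)) ze = poly (map_poly of_int g) (ze ^ p) + of_nat p * poly (map_poly of_int h) ze"
  unfolding h by (simp add: hom_distribs poly_pcompose poly_monom)
 moreover have "poly (map_poly of_int g) (ze ^ p) = 0"
  unfolding g poly_prod using B U finite_subset[of B U] by (auto simp: U_def)
 ultimately have gp: "poly (map_poly of_int g) ze ^ p = of_nat p * poly (map_poly of_int h) ze"
  by (simp add: hom_distribs)
 have "of_nat N * ze ^ (N - 1) = poly (map_poly of_int g) ze * v"
  unfolding D v_def g poly_prod using B U ze
  by (subst prod.subset_diff[of B]) (auto simp: U_def mult.commute)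
 hence "(of_nat N * ze ^ (N - 1)) ^ p = of_nat p * (poly (map_poly of_int h) ze * v ^ p)"
  by (simp add: power_mult_distrib gp)
 hence "of_nat N ^ p * (ze ^ (N - 1)) ^ p = of_nat p * (poly (map_poly of_int h) ze * v ^ p)"
  by (simp add: power_mult_distrib)
 hence "of_nat N ^ p * ((ze ^ (N - 1)) ^ p * ze ^ p) = of_nat p * (poly (map_poly of_int h) ze * v ^ p * ze ^ p)"
  by (metis mult.assoc)
 moreover have "(ze ^ (N - 1)) ^ p * ze ^ p = 1"
  using ze N by (simp flip: power_mult_distrib power_Suc2)
 ultimately have "of_nat N ^ p = of_nat p * (poly (map_poly of_int h) ze * v ^ p * ze ^ p)"
  by (metis mult.right_neutral)
 hence t: "of_nat (N ^ p) = of_nat p * (poly (map_poly of_int h) ze * v ^ p * ze ^ p)"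
  by simp
 moreover have "p ~= 0" using p by auto
 \<comment> \<open>The cofactor of p is both an algebraic integer and rational, so it is an integer,
   and p divides N^p.\<close>
 ultimately have "poly (map_poly of_int h) ze * v ^ p * ze ^ p = of_nat (N ^ p) / of_nat p"
  by (simp add: field_simps)
 hence "poly (map_poly of_int h) ze * v ^ p * ze ^ p:\<rat>"
  by (metis Rats_divide Rats_of_nat)
 moreover have "algebraic_int (poly (map_poly of_int h) ze * v ^ p * ze ^ p)"
  unfolding v_def using alg ze
  by (intro algebraic_int_times algebraic_int_power algebraic_int_prod algebraic_int_diff
  algebraic_int_poly[of ze]) (auto simp: U_def coeff_map_poly)
 ultimately obtain k where "poly (map_poly of_int h) ze * v ^ p * ze ^ p = of_int k"
  using rational_algebraic_int_is_int by (metis Ints_cases)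
 with t have "of_nat (N ^ p) = (of_nat p * of_int k :: complex)" by simp
 hence "int (N ^ p) = int p * k"
  by (metis of_int_eq_iff of_int_mult of_int_of_nat_eq)
 hence "p dvd N ^ p" by (metis dvd_triv_left int_dvd_int_iff)
 thus ?thesis using p prime_dvd_power by blast
qed

text \<open>Northcott's argument: the polynomials with root sets \<open>Y\<close> have rational
  coefficients that are algebraic integers of bounded size. So there are finitely many such
  polynomials, each with finitely many roots.\<close>

lemma finite_algebraic_int_bounded:
 fixes A :: "complex set set"
 assumes "!!Y. Y:A ==> finite Y & card Y <= B & (ALL y:Y. algebraic_int y & cmod y <= C)
  & (ALL i. coeff (\<Prod>y\<in>Y. [:- y, 1:]) i:\<rat>)"
 shows "finite (\<Union> A)"
proof -
 define M where "M = (1 + \<bar>C\<bar>) ^ B"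
 define Z where "Z = {c::complex. c:\<int> & cmod c <= M}"
 have "Z <= of_int ` {- \<lceil>M\<rceil>..\<lceil>M\<rceil>}"
 proof
  fix c assume "c:Z"
  then obtain k where k: "c = of_int k" "\<bar>real_of_int k\<bar> <= M"
  unfolding Z_def by (auto elim!: Ints_cases)
  hence "\<bar>k\<bar> <= \<lceil>M\<rceil>" by (simp add: le_ceiling_iff)
  thus "c:of_int ` {- \<lceil>M\<rceil>..\<lceil>M\<rceil>}" using k by (intro image_eqI[of _ _ k]) auto
 qed
 hence "finite Z" using finite_subset by blast
 define P where "P = Poly ` {cs. set cs <= Z & length cs <= Suc B} - {0}"
 have "finite P" unfolding P_def using finite_lists_length_le[OF \<open>finite Z\<close>] by blast
 moreover have *: "(\<Prod>y\<in>Y. [:- y, 1:]):P" if "Y:A" for Y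
 proof -
  let ?p = "\<Prod>y\<in>Y. [:- y, 1:]"
  have Y: "finite Y" "card Y <= B" "!!y. y:Y ==> algebraic_int y" "!!y. y:Y ==> cmod y <= C"
  "!!i. coeff ?p i:\<rat>"
  using assms[OF that] by auto
  have "coeff ?p i:Z" for i
  proof -
  have "coeff ?p i:\<int>"
  using algebraic_int_coeff_prod[of Y "%y. y" i] Y rational_algebraic_int_is_int by blast
  moreover have "(\<Prod>y\<in>Y. 1 + cmod y) <= (\<Prod>y\<in>Y. 1 + \<bar>C\<bar>)"
  using Y(4) by (intro prod_mono) (auto intro: order_trans[OF _ abs_ge_self])
  moreover have "(\<Prod>y\<in>Y. 1 + \<bar>C\<bar>) <= M"
  unfolding M_def prod_constant using Y(2) by (intro power_increasing) auto
  ultimately show ?thesis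
  unfolding Z_def using norm_coeff_prod_le[of "%y. y" Y i] by auto
  qed
  moreover have "degree ?p <= B"
  using Y(2) by (subst degree_prod_eq_sum_degree) auto
  moreover have "?p ~= 0" using Y(1) by simp
  moreover have "Poly (coeffs ?p) = ?p" by simp
  ultimately show ?thesis unfolding P_def
  by (intro DiffI image_eqI[of _ _ "coeffs ?p"]) (auto simp: coeffs_def length_coeffs)
 qed
 hence "\<Union> A\<le> (\<Union>p\<in>P. {y. poly p y = 0})"
 proof (intro Union_least subsetI)
  fix Y y assume "Y:A" "y:Y"
  hence "poly (\<Prod>y\<in>Y. [:- y, 1:]) y = 0" using assms by (auto simp: poly_prod)
  thus "y:(\<Union>p\<in>P. {y. poly p y = 0})" using \<open>Y : A\<close> * by blast
 qed
 moreover have "finite {y. poly p y = 0}" if "p:P" for p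
  using that poly_roots_finite unfolding P_def by blast
 ultimately show ?thesis by (meson finite_UN_I finite_subset)
qed

section \<open>Embeddings of fields into the complex numbers\<close>

definition complex_hom :: "('a, 'b) ring_scheme => ('a => complex) => bool" where
 "complex_hom R tu <-> tu \<one>\<^bsub>R\<^esub> = 1 &
  (ALL a:carrier R. ALL b:carrier R. tu (a \<otimes>\<^bsub>R\<^esub> b) = tu a * tu b & tu (a \<oplus>\<^bsub>R\<^esub> b) = tu a + tu b)"

text \<open>Polynomials of HOL-Algebra are lists with the leading coefficient first, hence the
  exponent \<open>length p\<close>. The translation gives access to the fundamental theorem of
  algebra and to root counting over the type \<open>complex\<close>.\<close>

fun hom_poly :: "('a => complex) => 'a list => complex poly" where
 "hom_poly tu [] = 0"
| "hom_poly tu (a # p) = monom (tu a) (length p) + hom_poly tu p"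

lemma hom_poly_cong: "(!!a. a:set p ==> tu a = tu' a) ==> hom_poly tu p = hom_poly tu' p"
 by (induction p) auto

lemma coeff_hom_poly_ge: "length p <= i ==> coeff (hom_poly tu p) i = 0"
 by (induction p) auto

lemma coeff_hom_poly_Cons: "coeff (hom_poly tu (a # p)) (length p) = tu a"
 by (simp add: coeff_hom_poly_ge)

lemma degree_hom_poly:
 assumes "p ~= []" "tu (hd p) ~= 0"
 shows "degree (hom_poly tu p) = length p - 1" "lead_coeff (hom_poly tu p) = tu (hd p)"
proof -
 obtain a q where p: "p = a # q" using assms by (cases p) auto
 have "coeff (hom_poly tu p) (length q) ~= 0" using assms coeff_hom_poly_Cons[of tu a q] p by simp
 moreover have "degree (hom_poly tu p) <= length q"
  by (rule degree_le) (auto simp: p coeff_hom_poly_ge)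
 ultimately show "degree (hom_poly tu p) = length p - 1"
  using le_degree[of "hom_poly tu p" "length q"] p by simp
 thus "lead_coeff (hom_poly tu p) = tu (hd p)" using coeff_hom_poly_Cons[of tu a q] p by simp
qed

lemma coeff_hom_poly_image: "coeff (hom_poly tu p) i:insert 0 (tu ` set p)"
proof (induction p)
 case (Cons a p)
 thus ?case by (auto simp: coeff_hom_poly_ge)
qed auto

context ring
begin

lemma complex_hom_simps:
 assumes "complex_hom R tu"
 shows "tu \<one> = 1" "tu \<zero> = 0"
  and "!!a b. a:carrier R ==> b:carrier R ==> tu (a \<otimes> b) = tu a * tu b"
  and "!!a b. a:carrier R ==> b:carrier R ==> tu (a \<oplus> b) = tu a + tu b"
  and "!!a. a:carrier R ==> tu (\<ominus> a) = - tu a"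
  and "!!a n. a:carrier R ==> tu (a [^] (n::nat)) = tu a ^ n"
proof -
 show one: "tu \<one> = 1" and mult: "!!a b. a:carrier R ==> b:carrier R ==> tu (a \<otimes> b) = tu a * tu b"
  and add: "!!a b. a:carrier R ==> b:carrier R ==> tu (a \<oplus> b) = tu a + tu b"
  using assms unfolding complex_hom_def by auto
 show zero: "tu \<zero> = 0" using add[of \<zero> \<zero>] by simp
 show "tu (\<ominus> a) = - tu a" if "a:carrier R" for a
  using add[OF that a_inv_closed[OF that]] that zero by (simp add: r_neg eq_neg_iff_add_eq_0 add.commute)
 show "tu (a [^] n) = tu a ^ n" if "a:carrier R" for a and n :: nat
  by (induction n) (auto simp: one mult that)
qed

context
 fixes tu :: "'a => complex"
 assumes tu: "complex_hom R tu"
begin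

lemmas tu_simps = complex_hom_simps[OF tu]

lemma hom_poly_normalize: "hom_poly tu (normalize p) = hom_poly tu p"
 by (induction p) (auto simp: tu_simps)

lemma hom_poly_replicate: "hom_poly tu (replicate n \<zero> @ p) = hom_poly tu p"
 by (induction n) (auto simp: tu_simps)

lemma hom_poly_append_replicate: "hom_poly tu (p @ replicate n \<zero>) = Polynomial.monom 1 n * hom_poly tu p"
proof (induction p)
 case Nil
 thus ?case using hom_poly_replicate[of n "[]"] by simp
next
 case (Cons a p)
 thus ?case by (simp add: distrib_left mult_monom add.commute)
qed

lemma hom_poly_map2:
 assumes "length p = length q" "set p <= carrier R" "set q <= carrier R"
 shows "hom_poly tu (map2 (\<oplus>) p q) = hom_poly tu p + hom_poly tu q"
 using assms by (induction p q rule: list_induct2) (auto simp: tu_simps add_monom[symmetric])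

lemma hom_poly_add:
 assumes "set p <= carrier R" "set q <= carrier R"
 shows "hom_poly tu (poly_add p q) = hom_poly tu p + hom_poly tu q"
proof -
 have *: "hom_poly tu (poly_add p q) = hom_poly tu p + hom_poly tu q"
  if "length p >= length q" "set p <= carrier R" "set q <= carrier R" for p q
 proof -
  have "hom_poly tu (poly_add p q)
  = hom_poly tu (map2 (\<oplus>) p (replicate (length p - length q) \<zero> @ q))"
  using that by (simp add: hom_poly_normalize)
  also have "\<dots> = hom_poly tu p + hom_poly tu q"
  using that by (subst hom_poly_map2) (auto simp: hom_poly_replicate set_replicate_conv_if)
  finally show ?thesis .
 qed
 show ?thesis
 proof (cases "length p >= length q")
  case False
  hence "hom_poly tu (poly_add p q) = hom_poly tu (poly_add q p)" by simp
  also have "\<dots> = hom_poly tu q + hom_poly tu p" using * assms False by auto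
  finally show ?thesis by (simp only: add.commute)
 qed (use * assms in blast)
qed

lemma hom_poly_mult:
 assumes "set p <= carrier R" "set q <= carrier R"
 shows "hom_poly tu (poly_mult p q) = hom_poly tu p * hom_poly tu q"
 using assms(1)
proof (induction p)
 case (Cons a p)
 have sm: "hom_poly tu (map ((\<otimes>) a) q) = smult (tu a) (hom_poly tu q)"
  using assms(2) Cons.prems by (induction q) (auto simp: tu_simps smult_add_right smult_monom)
 have "poly_mult (a # p) q = poly_add (map ((\<otimes>) a) q @ replicate (length p) \<zero>) (poly_mult p q)"
  by simp
 also have "hom_poly tu \<dots> = Polynomial.monom 1 (length p) * smult (tu a) (hom_poly tu q) + hom_poly tu (poly_mult p q)"
  using Cons assms(2) poly_mult_in_carrier[of p q]
  by (subst hom_poly_add) (auto simp: hom_poly_append_replicate sm set_replicate_conv_if)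
 also have "Polynomial.monom 1 (length p) * smult (tu a) (hom_poly tu q) = Polynomial.monom (tu a) (length p) * hom_poly tu q"
  by (metis mult_smult_left mult_smult_right smult_monom mult.right_neutral)
 finally show ?case using Cons by (simp add: distrib_right)
qed simp

lemma poly_hom_poly:
 assumes "set p <= carrier R" "x:carrier R"
 shows "poly (hom_poly tu p) (tu x) = tu (eval p x)"
 using assms(1) by (induction p) (auto simp: tu_simps poly_monom assms(2) eval_in_carrier)

end

end

context field
begin

lemma complex_hom_inj:
 assumes "complex_hom R tu" "a:carrier R" "b:carrier R" "tu a = tu b"
 shows "a = b"
proof (rule ccontr)
 assume "a ~= b"
 note s = complex_hom_simps[OF assms(1)]
 have c: "a \<ominus> b:carrier R" "a \<ominus> b ~= \<zero>" using assms \<open>a ~= b\<close> by (auto simp: r_right_minus_eq)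
 have "tu (a \<ominus> b) = 0" using assms s by (simp add: a_minus_def)
 have u: "a \<ominus> b:Units R" using c field_Units by auto
 hence "tu ((a \<ominus> b) \<otimes> inv (a \<ominus> b)) = 0"
  using \<open>tu (a \<ominus> b) = 0\<close> c(1) s(3)[OF c(1) Units_inv_closed[OF u]] by simp
 thus False using u s(1) by simp
qed

lemma complex_hom_inv:
 assumes "complex_hom R tu" "a:carrier R" "a ~= \<zero>"
 shows "tu (inv a) = inverse (tu a)"
proof -
 note s = complex_hom_simps[OF assms(1)]
 have u: "a:Units R" using assms field_Units by auto
 hence "tu a * tu (inv a) = 1" using s(1,3) assms(2) by (metis Units_inv_closed Units_r_inv)
 thus ?thesis by (metis inverse_unique)
qed

text \<open>The elements of E(x) are the values \<open>eval p x\<close>. A polynomial that vanishes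
  at \<open>x\<close> is a multiple of \<open>Irr E x\<close>, so its image vanishes at
  \<open>z\<close>; hence evaluating at \<open>z\<close> depends only on
  \<open>eval p x\<close>.\<close>

lemma simple_extension_complex_hom:
 assumes E: "subfield E R" and tu: "complex_hom (R\<lparr>carrier := E\<rparr>) tu"
  and x: "x:carrier R" "(algebraic over E) x"
  and z: "poly (hom_poly tu (Irr E x)) z = 0"
 obtains tu' where "complex_hom (R\<lparr>carrier := simple_extension E x\<rparr>) tu'"
  "!!a. a:E ==> tu' a = tu a" "tu' x = z"
proof -
 define R' where "R' = R\<lparr>carrier := E\<rparr>"
 have sr: "subring E R" using E subfieldE(1) by blast
 have EC: "E <= carrier R" using subringE(1)[OF sr] .
 interpret R': ring R' unfolding R'_def using subring_is_ring[OF sr] .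
 interpret EX: ring_hom_ring "E [X]" R "%p. eval p x" using eval_ring_hom[OF sr x(1)] .
 have tu': "complex_hom R' tu" using tu R'_def by simp
 have EX: "univ_poly R' = univ_poly R" unfolding R'_def using univ_poly_consistent[OF sr] by simp
 have set_p: "set p <= E" if "p:carrier (E [X])" for p
  using that unfolding univ_poly_carrier[symmetric] polynomial_def by auto
 have add: "hom_poly tu (p \<oplus>\<^bsub>E [X]\<^esub> q) = hom_poly tu p + hom_poly tu q"
  if "p:carrier (E [X])" "q:carrier (E [X])" for p q
  using R'.hom_poly_add[OF tu', of p q] set_p that unfolding EX[symmetric] univ_poly_add[of R']
  by (simp add: R'_def)
 have mult: "hom_poly tu (p \<otimes>\<^bsub>E [X]\<^esub> q) = hom_poly tu p * hom_poly tu q"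
  if "p:carrier (E [X])" "q:carrier (E [X])" for p q
  using R'.hom_poly_mult[OF tu', of p q] set_p that unfolding EX[symmetric] univ_poly_mult[of R']
  by (simp add: R'_def)
 note Irr = IrrE[OF E x]
 have ker: "poly (hom_poly tu p) z = 0" if p: "p:carrier (E [X])" "eval p x = \<zero>" for p
 proof -
  have "Irr E x pdivides p" using Irr_minimal[OF E x p] .
  then obtain q where q: "q:carrier (E [X])" "p = Irr E x \<otimes>\<^bsub>E [X]\<^esub> q"
  unfolding pdivides_iff_shell[OF E Irr(1) p(1)] by (auto simp: factor_def)
  thus ?thesis using mult[OF Irr(1) q(1)] z by simp
 qed
 have wd: "poly (hom_poly tu p) z = poly (hom_poly tu q) z"
  if p: "p:carrier (E [X])" "q:carrier (E [X])" "eval p x = eval q x" for p q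
 proof -
  have d: "p \<ominus>\<^bsub>E [X]\<^esub> q:carrier (E [X])" using p by simp
  have "eval (p \<ominus>\<^bsub>E [X]\<^esub> q) x = \<zero>" using p EX.hom_closed by (simp add: a_minus_def r_neg)
  hence "poly (hom_poly tu (p \<ominus>\<^bsub>E [X]\<^esub> q)) z = 0" using ker d by blast
  moreover have "hom_poly tu p = hom_poly tu (p \<ominus>\<^bsub>E [X]\<^esub> q) + hom_poly tu q"
  using add[OF d p(2)] p EX.R.minus_eq EX.R.a_assoc EX.R.l_neg EX.R.r_zero by (metis EX.R.a_inv_closed)
  ultimately show ?thesis by simp
 qed
 have img: "simple_extension E x = (%p. eval p x) ` carrier (E [X])"
  using simple_extension_as_eval_img[OF EC x(1)] .
 define tu' where "tu' b = poly (hom_poly tu (SOME p. p:carrier (E [X]) & eval p x = b)) z" for b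
 have ev: "tu' (eval p x) = poly (hom_poly tu p) z" if "p:carrier (E [X])" for p
  using someI[of "%q. q:carrier (E [X]) & eval q x = eval p x" p] that wd
  unfolding tu'_def by blast
 have one: "tu \<one> = 1" using tu unfolding complex_hom_def by simp
 have const: "tu' a = tu a" if "a:E" for a
 proof (cases "a = \<zero>")
  case True
  thus ?thesis using ev[OF univ_poly_zero_closed] R'.complex_hom_simps(2)[OF tu']
  by (simp add: R'_def)
 next
  case False
  hence "[a]:carrier (E [X])" using that unfolding univ_poly_carrier[symmetric] polynomial_def by auto
  thus ?thesis using ev[of "[a]"] that EC by (auto simp: poly_monom)
 qed
 show ?thesis
 proof (rule that[of tu'])
  show "complex_hom (R\<lparr>carrier := simple_extension E x\<rparr>) tu'"
  unfolding complex_hom_def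
  proof (intro conjI ballI)
  show "tu' \<one>\<^bsub>R\<lparr>carrier := simple_extension E x\<rparr>\<^esub> = 1"
  using const[of \<one>] subringE(3)[OF sr] one by simp
  next
  fix a b assume "a:carrier (R\<lparr>carrier := simple_extension E x\<rparr>)" "b:carrier (R\<lparr>carrier := simple_extension E x\<rparr>)"
  then obtain p q where p: "p:carrier (E [X])" "a = eval p x" and q: "q:carrier (E [X])" "b = eval q x"
  unfolding img by auto
  have ab: "a \<otimes> b = eval (p \<otimes>\<^bsub>E [X]\<^esub> q) x" "a \<oplus> b = eval (p \<oplus>\<^bsub>E [X]\<^esub> q) x"
  using p q by auto
  show "tu' (a \<otimes>\<^bsub>R\<lparr>carrier := simple_extension E x\<rparr>\<^esub> b) = tu' a * tu' b"
  using ev[of "p \<otimes>\<^bsub>E [X]\<^esub> q"] ev p q mult ab by simp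
  show "tu' (a \<oplus>\<^bsub>R\<lparr>carrier := simple_extension E x\<rparr>\<^esub> b) = tu' a + tu' b"
  using ev[of "p \<oplus>\<^bsub>E [X]\<^esub> q"] ev p q add ab by simp
  qed
  show "!!a. a:E ==> tu' a = tu a" by (rule const)
  have "eval X x = x" using eval_var x(1) by simp
  thus "tu' x = z"
  using ev[OF var_closed(1)[OF sr]] one R'.complex_hom_simps(2)[OF tu']
  by (simp add: var_def poly_monom R'_def)
 qed
qed

text \<open>Zorn's lemma on graphs of partial homomorphisms, where chains have plain unions as upper
  bounds. The start \<open>E0\<close> is only a subring because \<open>kummer_extension\<close>
  reaches this lemma from a ring of sums. The maximal domain is nevertheless a field: the inverse of
  \<open>k\<close> lies in K(k), which is contained in it. A complex root of a minimal polynomial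
  then extends the homomorphism further.\<close>

lemma complex_hom_extension:
 assumes K: "subfield K R" and alg: "!!x. x:carrier R ==> (algebraic over K) x"
  and E0: "subring E0 R" "K <= E0" and tu: "complex_hom (R\<lparr>carrier := E0\<rparr>) tu"
 obtains h where "complex_hom R h" "!!a. a:E0 ==> h a = tu a"
proof -
 define valid where "valid Gm <-> Gm <= carrier R \<times> UNIV & (ALL a c d. (a, c):Gm --> (a, d):Gm --> c = d)
  & (ALL a:E0. (a, tu a):Gm)
  & (ALL a c b d. (a, c):Gm --> (b, d):Gm --> (a \<oplus> b, c + d):Gm & (a \<otimes> b, c * d):Gm)
  & (ALL a c. (a, c):Gm --> (\<ominus> a, - c):Gm)" for Gm :: "('a \<times> complex) set"
 have graph_valid: "valid {(a, rh a) | a. a:E}"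
  if E: "subring E R" "E0 <= E" and rh: "complex_hom (R\<lparr>carrier := E\<rparr>) rh" "!!a. a:E0 ==> rh a = tu a"
  for E rh
 proof -
  interpret E: ring "R\<lparr>carrier := E\<rparr>" using subring_is_ring[OF E(1)] .
  have neg: "rh (\<ominus> a) = - rh a" if "a:E" for a
  proof -
  have "rh a + rh (\<ominus> a) = rh (a \<oplus> \<ominus> a)"
  using rh(1) subringE(5)[OF E(1) that] that unfolding complex_hom_def by simp
  also have "a \<oplus> \<ominus> a = \<zero>" using that subringE(1)[OF E(1)] r_neg by blast
  also have "rh \<zero> = 0" using E.complex_hom_simps(2)[OF rh(1)] by simp
  finally show ?thesis by (simp add: eq_neg_iff_add_eq_0 add.commute)
  qed
  show ?thesis unfolding valid_def using E rh subringE[OF E(1)] neg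
  unfolding complex_hom_def by auto
 qed
 have "EX M:{Gm. valid Gm}. ALL Y:{Gm. valid Gm}. M <= Y --> Y = M"
 proof (rule subset_Zorn_nonempty)
  show "{Gm. valid Gm} ~= {}" using graph_valid[OF E0(1) order_refl tu] by blast
  fix C assume C: "C ~= {}" "subset.chain {Gm. valid Gm} C"
  have val: "valid Gm" if "Gm:C" for Gm using C that unfolding subset_chain_def by blast
  have pair: "EX Gm:C. p:Gm & q:Gm" if "p:\<Union>C" "q:\<Union>C" for p q
  proof -
  obtain Gm1 Gm2 where 1: "Gm1:C" "p:Gm1" "Gm2:C" "q:Gm2" using \<open>p : \<Union>C\<close> \<open>q : \<Union>C\<close> by blast
  hence "Gm1 <= Gm2 \<or> Gm2 <= Gm1" using C(2) unfolding subset_chain_def by blast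
  thus ?thesis using 1 by blast
  qed
  show "\<Union>C \<in> {Gm. valid Gm}"
  unfolding valid_def mem_Collect_eq
  proof (intro conjI allI impI ballI)
  show "\<Union>C\<le> carrier R \<times> UNIV" using val unfolding valid_def by blast
  next
  fix a c d assume "(a, c):\<Union>C" "(a, d):\<Union>C"
  then obtain Gm where "Gm:C" "(a, c):Gm" "(a, d):Gm" using pair by blast
  thus "c = d" using val unfolding valid_def by blast
  next
  fix a assume "a:E0" thus "(a, tu a):\<Union>C" using C(1) val unfolding valid_def by blast
  next
  fix a c b d assume ab: "(a, c):\<Union>C" "(b, d):\<Union>C"
  then obtain Gm where "Gm:C" "(a, c):Gm" "(b, d):Gm" using pair by blast
  thus "(a \<oplus> b, c + d):\<Union>C" "(a \<otimes> b, c * d):\<Union>C" using val unfolding valid_def by blast+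
  next
  fix a c assume "(a, c):\<Union>C" thus "(\<ominus> a, - c):\<Union>C" using val unfolding valid_def by blast
  qed
 qed
 then obtain Gm where "valid Gm" and max: "!!Y. valid Y ==> Gm <= Y ==> Y = Gm" by blast
 hence Gm: "Gm <= carrier R \<times> UNIV" "!!a c d. (a, c):Gm ==> (a, d):Gm ==> c = d"
  "!!a. a:E0 ==> (a, tu a):Gm"
  "!!a c b d. (a, c):Gm ==> (b, d):Gm ==> (a \<oplus> b, c + d):Gm"
  "!!a c b d. (a, c):Gm ==> (b, d):Gm ==> (a \<otimes> b, c * d):Gm"
  "!!a c. (a, c):Gm ==> (\<ominus> a, - c):Gm"
  unfolding valid_def by blast+
 define E where "E = fst ` Gm"
 define rh where "rh a = (THE c. (a, c):Gm)" for a
 have rh: "rh a = c" if "(a, c):Gm" for a c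
  unfolding rh_def using Gm(2) that by (intro the_equality) blast+
 have E_iff: "a:E <-> (a, rh a):Gm" for a
  unfolding E_def using rh by force
 have mem: "a:E" if "(a, c):Gm" for a c using that unfolding E_def by force
 have E0E: "E0 <= E" using Gm(3) unfolding E_def by force
 have subE: "subring E R"
 proof (rule subringI)
  show "E <= carrier R" using Gm(1) unfolding E_def by auto
  show "\<one>:E" using E0E subringE(3)[OF E0(1)] by blast
 next
  fix a assume "a:E" thus "\<ominus> a:E" using E_iff mem Gm(6) by blast
 next
  fix a b assume "a:E" "b:E"
  hence ab: "(a, rh a):Gm" "(b, rh b):Gm" using E_iff by auto
  show "a \<otimes> b:E" "a \<oplus> b:E" using mem[OF Gm(5)[OF ab]] mem[OF Gm(4)[OF ab]] .
 qed
 have EC: "E <= carrier R" using subringE(1)[OF subE] .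
 have homrh: "complex_hom (R\<lparr>carrier := E\<rparr>) rh"
 proof -
  have "rh \<one> = tu \<one>" using rh Gm(3) subringE(3)[OF E0(1)] by blast
  also have "\<dots> = 1" using tu unfolding complex_hom_def by simp
  finally have "rh \<one> = 1" .
  moreover have "rh (a \<otimes> b) = rh a * rh b" "rh (a \<oplus> b) = rh a + rh b" if "a:E" "b:E" for a b
  using that rh[OF Gm(5)] rh[OF Gm(4)] E_iff by auto
  ultimately show ?thesis unfolding complex_hom_def by simp
 qed
 have subfE: "subfield E R"
 proof (rule subfieldI'[OF subE])
  fix k assume k: "k:E - {\<zero>}"
  hence kR: "k:carrier R" using EC by blast
  have "subfield (simple_extension K k) R"
  using simple_extension_is_subfield[OF K kR] alg[OF kR] by blast
  moreover have "k:simple_extension K k"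
  using simple_extension_mem[OF subfieldE(1)[OF K] kR] .
  ultimately have "inv k:simple_extension K k" using subfield_m_inv(1) k by blast
  moreover have "simple_extension K k <= E"
  using simple_extension_subring_incl[OF subE] E0(2) E0E k by blast
  ultimately show "inv k:E" by blast
 qed
 have "x:E" if x: "x:carrier R" for x
 proof -
  have algx: "(algebraic over E) x" using algebraic_mono[OF _ alg[OF x]] E0(2) E0E by blast
  note Irr = IrrE[OF subfE x algx]
  have "Irr E x ~= []" "length (Irr E x) - 1 >= 1"
  using pirreducible_degree[OF subfE Irr(1,2)] by auto
  moreover have "rh (hd (Irr E x)) = 1" using Irr(3) homrh unfolding complex_hom_def by simp
  ultimately have "degree (hom_poly rh (Irr E x)) >= 1"
  using degree_hom_poly(1)[of "Irr E x" rh] by simp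
  hence "\<not> constant (poly (hom_poly rh (Irr E x)))" using constant_degree by (metis not_one_le_zero)
  then obtain z where "poly (hom_poly rh (Irr E x)) z = 0" using fundamental_theorem_of_algebra by blast
  from simple_extension_complex_hom[OF subfE homrh x algx this]
  obtain rh' where rh': "complex_hom (R\<lparr>carrier := simple_extension E x\<rparr>) rh'" "!!a. a:E ==> rh' a = rh a"
  by metis
  have sub: "E <= simple_extension E x" using simple_extension_incl[OF EC x] .
  have "valid {(a, rh' a) | a. a:simple_extension E x}"
  proof (rule graph_valid[OF simple_extension_is_subring[OF subE x] _ rh'(1)])
  show "E0 <= simple_extension E x" using E0E sub by blast
  show "rh' a = tu a" if "a:E0" for a using that rh'(2) E0E rh Gm(3) by force
  qed
  moreover have "Gm <= {(a, rh' a) | a. a:simple_extension E x}"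
  proof
  fix p assume "p:Gm"
  moreover obtain a c where "p = (a, c)" by (cases p)
  ultimately have "(a, c):Gm" "a:E" "rh a = c" using rh E_iff by auto
  thus "p:{(a, rh' a) | a. a:simple_extension E x}" using \<open>p = (a, c)\<close> sub rh'(2) by auto
  qed
  ultimately have "{(a, rh' a) | a. a:simple_extension E x} = Gm" using max by blast
  thus ?thesis using simple_extension_mem[OF subE x] unfolding E_def by force
 qed
 hence "E = carrier R" using EC by blast
 hence "complex_hom R rh" using homrh by (simp add: complex_hom_def)
 moreover have "rh a = tu a" if "a:E0" for a using rh Gm(3) that by blast
 ultimately show ?thesis using that by blast
qed

definition prime_field :: "'a set" where "prime_field = generate_field R {}"

lemma subfield_prime_field: "subfield prime_field R"
 unfolding prime_field_def by (rule generate_field_is_subfield) simp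

lemma complex_hom_prime_field:
 assumes "complex_hom R h" "complex_hom R ph" "a:prime_field"
 shows "h a = ph a" "ph a:\<rat>"
proof -
 have C: "b:carrier R" if "b:generate_field R {}" for b
  using generate_field_in_carrier[of "{}"] that by blast
 note sh = complex_hom_simps[OF assms(1)] and sph = complex_hom_simps[OF assms(2)]
 show "h a = ph a" using assms(3) unfolding prime_field_def
  by (induction rule: generate_field.induct)
  (auto simp: sh sph C complex_hom_inv[OF assms(1)] complex_hom_inv[OF assms(2)])
 show "ph a:\<rat>" using assms(3) unfolding prime_field_def
  by (induction rule: generate_field.induct)
  (auto simp: sph C complex_hom_inv[OF assms(2)])
qed

text \<open>The field generated by the empty set consists of fractions: \<open>rep a c\<close>
  expresses n a = m with integers m, n and c = m / n. Characteristic 0 makes \<open>c\<close>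
  unique.\<close>

lemma exists_complex_hom_prime_field:
 assumes char0: "!!n::nat. n > 0 ==> add_pow R n \<one> ~= \<zero>"
 shows "EX tu. complex_hom (R\<lparr>carrier := prime_field\<rparr>) tu"
proof -
 define e where "e m = add_pow R (m::int) \<one>" for m
 have eC[simp]: "e m:carrier R" for m unfolding e_def by simp
 have e1: "e 1 = \<one>" unfolding e_def using add.int_pow_1[of \<one>] by simp
 have e_add: "e (m + n) = e m \<oplus> e n" for m n
  unfolding e_def using add.int_pow_mult[of \<one> m n] by simp
 have e_mult: "e (m * n) = e m \<otimes> e n" for m n
 proof -
  have "e m \<otimes> e n = add_pow R m (\<one> \<otimes> e n)" unfolding e_def using add_pow_ldistr_int by simp
  also have "\<dots> = add_pow R m (add_pow R n \<one>)" unfolding e_def by simp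
  also have "\<dots> = e (m * n)" unfolding e_def using add.int_pow_pow[of \<one> m n] by (simp add: mult.commute)
  finally show ?thesis ..
 qed
 have e_neg: "e (- m) = \<ominus> e m" for m
  using e_add[of "- m" m] by (metis eC e1 e_add add_0 add_cancel_right_right add.l_cancel_one' minus_equality add.left_inverse)
 have e0: "e m = \<zero> <-> m = 0" for m
 proof
  assume "e m = \<zero>"
  hence "e \<bar>m\<bar> = \<zero>" using e_neg[of m] by (auto simp: abs_if)
  hence "add_pow R (nat \<bar>m\<bar>) \<one> = \<zero>" unfolding e_def by (simp add: add_pow_int_ge)
  thus "m = 0" using char0[of "nat \<bar>m\<bar>"] by auto
 next
  assume "m = 0" thus "e m = \<zero>" using e_add[of 0 0] eC by (metis add.r_cancel_one' add_0)
 qed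
 define rep where "rep a c <-> (EX m n. n ~= 0 & e n \<otimes> a = e m & c = of_int m / (of_int n :: complex))" for a c
 have C: "b:carrier R" if "b:prime_field" for b
  using generate_field_in_carrier[of "{}"] that unfolding prime_field_def by blast
 have rep_add: "rep (a \<oplus> b) (c + d)" and rep_mult: "rep (a \<otimes> b) (c * d)"
  if r: "rep a c" "rep b d" "a:carrier R" "b:carrier R" for a b c d
 proof -
  obtain m n where "n ~= 0" "e n \<otimes> a = e m" "c = of_int m / of_int n"
  using r(1) unfolding rep_def by blast
  moreover obtain m' n' where "n' ~= 0" "e n' \<otimes> b = e m'" "d = of_int m' / of_int n'"
  using r(2) unfolding rep_def by blast
  ultimately have 1: "n ~= 0" "e n \<otimes> a = e m" "c = of_int m / of_int n"
  "n' ~= 0" "e n' \<otimes> b = e m'" "d = of_int m' / of_int n'" .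
  have "e (n * n') \<otimes> (a \<oplus> b) = e n' \<otimes> (e n \<otimes> a) \<oplus> e n \<otimes> (e n' \<otimes> b)"
  using that(3,4) unfolding e_mult by (simp add: r_distr m_ac)
  also have "\<dots> = e (m * n' + m' * n)" unfolding 1 e_mult e_add by (simp add: m_ac)
  finally show "rep (a \<oplus> b) (c + d)" unfolding rep_def using 1
  by (intro exI[of _ "m * n' + m' * n"] exI[of _ "n * n'"]) (auto simp: field_simps)
  have "e (n * n') \<otimes> (a \<otimes> b) = (e n \<otimes> a) \<otimes> (e n' \<otimes> b)"
  using that(3,4) unfolding e_mult by (simp add: m_ac)
  also have "\<dots> = e (m * m')" unfolding 1 e_mult ..
  finally show "rep (a \<otimes> b) (c * d)" unfolding rep_def using 1
  by (intro exI[of _ "m * m'"] exI[of _ "n * n'"]) auto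
 qed
 have rep1: "rep \<one> 1" unfolding rep_def by (intro exI[of _ 1]) (simp add: e1)
 have ex: "EX c. rep a c" if "a:prime_field" for a
  using that unfolding prime_field_def
 proof (induction rule: generate_field.induct)
  case one show ?case using rep1 by blast
 next
  case (a_inv a)
  then obtain m n where 1: "n ~= 0" "e n \<otimes> a = e m" unfolding rep_def by blast
  moreover have "a:carrier R" using C a_inv unfolding prime_field_def by blast
  ultimately have "e n \<otimes> \<ominus> a = e (- m)" unfolding e_neg by (simp add: r_minus)
  thus ?case unfolding rep_def using 1 by blast
 next
  case (m_inv a)
  then obtain m n where 1: "n ~= 0" "e n \<otimes> a = e m" unfolding rep_def by blast
  have a: "a:carrier R" "a:Units R" using C m_inv field_Units unfolding prime_field_def by auto
  have "m ~= 0" using 1 e0 a m_inv integral[of "e n" a] by auto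
  moreover have "e m \<otimes> inv a = e n" unfolding 1(2)[symmetric] using a by (simp add: m_assoc)
  ultimately show ?case unfolding rep_def by blast
 qed (use rep_add rep_mult C in \<open>auto simp: prime_field_def\<close>, blast+)
 have fn: "c = d" if r: "rep a c" "rep a d" "a:carrier R" for a c d
 proof -
  obtain m n where "n ~= 0" "e n \<otimes> a = e m" "c = of_int m / of_int n"
  using r(1) unfolding rep_def by blast
  moreover obtain m' n' where "n' ~= 0" "e n' \<otimes> a = e m'" "d = of_int m' / of_int n'"
  using r(2) unfolding rep_def by blast
  ultimately have 1: "n ~= 0" "e n \<otimes> a = e m" "c = of_int m / of_int n"
  "n' ~= 0" "e n' \<otimes> a = e m'" "d = of_int m' / of_int n'" .
  have "e (m * n') = e (m' * n)"
  unfolding e_mult 1(2)[symmetric] 1(5)[symmetric] using that(3) by (simp add: m_ac)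
  hence "e (m * n' - m' * n) = \<zero>" using e_add[of "m * n'" "- (m' * n)"] e_neg by (simp add: r_neg)
  hence "m * n' = m' * n" using e0 by simp
  hence "(of_int (m * n') :: complex) = of_int (m' * n)" by simp
  thus ?thesis unfolding 1(3,6) using 1(1,4) by (simp add: frac_eq_eq)
 qed
 define tu where "tu a = (SOME c. rep a c)" for a
 have tu: "rep a (tu a)" if "a:prime_field" for a
  using someI_ex[OF ex[OF that]] unfolding tu_def .
 note P = subringE[OF subfieldE(1)[OF subfield_prime_field]]
 have "complex_hom (R\<lparr>carrier := prime_field\<rparr>) tu"
  unfolding complex_hom_def
 proof (intro conjI ballI)
  show "tu \<one>\<^bsub>R\<lparr>carrier := prime_field\<rparr>\<^esub> = 1" using fn[OF tu rep1] P(3) by simp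
  fix a b assume "a:carrier (R\<lparr>carrier := prime_field\<rparr>)" "b:carrier (R\<lparr>carrier := prime_field\<rparr>)"
  hence ab: "a:prime_field" "b:prime_field" by auto
  show "tu (a \<otimes>\<^bsub>R\<lparr>carrier := prime_field\<rparr>\<^esub> b) = tu a * tu b"
  using fn[OF tu rep_mult[OF tu tu]] ab P(6) C by simp
  show "tu (a \<oplus>\<^bsub>R\<lparr>carrier := prime_field\<rparr>\<^esub> b) = tu a + tu b"
  using fn[OF tu rep_add[OF tu tu]] ab P(7) C by simp
 qed
 thus ?thesis by blast
qed

end

text \<open>Over \<open>L\<close> the polynomial splits, so the images of its roots account for all
  complex roots. The induction removes one linear factor at a time.\<close>

lemma (in algebraically_closed) hom_poly_root_in_image:
 assumes ph: "complex_hom L ph" and "q:carrier (poly_ring L)" "q ~= []" "poly (hom_poly ph q) z = 0"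
 shows "z:ph ` carrier L"
 using assms(2-4)
proof (induction "length q" arbitrary: q rule: less_induct)
 case (less q)
 note q = less.prems
 have qC: "set q <= carrier L" "hd q ~= \<zero>"
  using q unfolding univ_poly_carrier[symmetric] polynomial_def by auto
 have ne: "ph (hd p) ~= 0" if "p:carrier (poly_ring L)" "p ~= []" for p
  using that complex_hom_inj[OF ph, of "hd p" \<zero>] complex_hom_simps(2)[OF ph]
  unfolding univ_poly_carrier[symmetric] polynomial_def by (auto simp: subset_iff)
 show ?case
 proof (cases "length q <= 1")
  case True
  then obtain a where "q = [a]" using q(2) by (cases q) auto
  thus ?thesis using q ne[OF q(1,2)] by (simp add: poly_monom)
 next
  case False
  have "size (roots q) = length q - 1"
  using roots_over_carrier[OF q(1)] unfolding splitted_def .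
  hence "roots q ~= {#}" using False by auto
  then obtain a where "a :# roots q" by blast
  hence ra: "is_root q a" using roots_mem_iff_is_root[OF q(1)] by blast
  hence aL: "a:carrier L" unfolding is_root_def by blast
  have p1: "[\<one>, \<ominus> a]:carrier (poly_ring L)"
  using aL unfolding univ_poly_carrier[symmetric] polynomial_def by auto
  obtain r where r: "r:carrier (poly_ring L)" "q = [\<one>, \<ominus> a] \<otimes>\<^bsub>poly_ring L\<^esub> r"
  using is_root_imp_pdivides[OF q(1) ra] unfolding pdivides_def factor_def by blast
  have rC: "set r <= carrier L" using r(1) unfolding univ_poly_carrier[symmetric] polynomial_def by auto
  have mult: "hom_poly ph q = hom_poly ph [\<one>, \<ominus> a] * hom_poly ph r"
  using hom_poly_mult[OF ph, of "[\<one>, \<ominus> a]" r] r rC aL unfolding univ_poly_mult by simp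
  have q0: "hom_poly ph q ~= 0" using degree_hom_poly(2)[of q ph] ne[OF q(1,2)] q(2) by auto
  have "r ~= []" using mult q0 by auto
  have "degree (hom_poly ph q) = 1 + degree (hom_poly ph r)"
  using mult q0 degree_hom_poly(1)[of "[\<one>, \<ominus> a]" ph] ne[OF p1] by (subst mult, subst degree_mult_eq) auto
  hence "length r < length q"
  unfolding degree_hom_poly(1)[of q ph, OF q(2) ne[OF q(1,2)]]
  degree_hom_poly(1)[of r ph, OF \<open>r ~= []\<close> ne[OF r(1) \<open>r ~= []\<close>]]
  by linarith
  consider "poly (hom_poly ph [\<one>, \<ominus> a]) z = 0" | "poly (hom_poly ph r) z = 0"
  using mult q(3) by auto
  thus ?thesis
  proof cases
  case 1
  hence "z = ph a" using complex_hom_simps[OF ph] aL by (simp add: poly_monom)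
  thus ?thesis using aL by blast
  next
  case 2
  thus ?thesis using less.hyps[OF \<open>length r < length q\<close> r(1) \<open>r ~= []\<close>] by blast
  qed
 qed
qed

section \<open>Automorphisms of the field of algebraic numbers\<close>

lemma carrier_galois_group:
 "al:carrier (galois_group M K) <-> al:Bij (carrier M) & al:ring_hom M M & (ALL x:K. al x = x)"
 unfolding galois_group_def by simp

lemma galois_group_closed: "al:carrier (galois_group M K) ==> x:carrier M ==> al x:carrier M"
 unfolding carrier_galois_group using Bij_imp_funcset by blast

lemma galois_group_mono: "K <= K' ==> carrier (galois_group M K') <= carrier (galois_group M K)"
 unfolding carrier_galois_group subset_iff by blast

lemma galois_group_mult:
 "al:carrier (galois_group M K) ==> tu:carrier (galois_group M K)
  ==> al \<otimes>\<^bsub>galois_group M K\<^esub> tu = compose (carrier M) al tu"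
 unfolding carrier_galois_group unfolding galois_group_def BijGroup_def by simp

lemma galois_group_one: "\<one>\<^bsub>galois_group M K\<^esub> = (\<lambda>x\<in>carrier M. x)"
 unfolding galois_group_def BijGroup_def by simp

lemma (in field) group_galois_group:
 assumes "K <= carrier R"
 shows "group (galois_group R K)"
proof -
 interpret B: group "BijGroup (carrier R)" by (rule group_BijGroup)
 have "subgroup (carrier (galois_group R K)) (BijGroup (carrier R))"
 proof (rule B.subgroupI)
  show "carrier (galois_group R K) <= carrier (BijGroup (carrier R))"
  unfolding carrier_galois_group subset_iff by (simp add: BijGroup_def)
  have "(\<lambda>x\<in>carrier R. x):carrier (galois_group R K)"
  unfolding carrier_galois_group using id_Bij assms by (auto intro!: ring_hom_memI)
  thus "carrier (galois_group R K) ~= {}" by blast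
 next
  fix al assume al: "al:carrier (galois_group R K)"
  hence B: "al:Bij (carrier R)" and hom: "al:ring_hom R R" and fix_K: "ALL x:K. al x = x"
  unfolding carrier_galois_group by auto
  have eq: "inv\<^bsub>BijGroup (carrier R)\<^esub> al = (\<lambda>x\<in>carrier R. inv_into (carrier R) al x)"
  using inv_BijGroup[OF B] .
  note bij = B[unfolded Bij_def, simplified]
  have i: "inv_into (carrier R) al (al x) = x" if "x:carrier R" for x
  using bij that by (simp add: bij_betw_def inv_into_f_f)
  have j: "inv_into (carrier R) al x:carrier R" "al (inv_into (carrier R) al x) = x" if "x:carrier R" for x
  using bij that by (auto simp: bij_betw_def inv_into_into f_inv_into_f)
  have inv_hom: "(\<lambda>x\<in>carrier R. inv_into (carrier R) al x):ring_hom R R"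
  proof (rule ring_hom_memI)
  fix x y assume xy: "x:carrier R" "y:carrier R"
  have mult: "x \<otimes> y = al (inv_into (carrier R) al x \<otimes> inv_into (carrier R) al y)"
  using ring_hom_mult[OF hom j(1)[OF xy(1)] j(1)[OF xy(2)]] j(2) xy by simp
  have "inv_into (carrier R) al (x \<otimes> y) = inv_into (carrier R) al x \<otimes> inv_into (carrier R) al y"
  by (subst mult, rule i) (use j(1) xy in simp)
  thus "(\<lambda>x\<in>carrier R. inv_into (carrier R) al x) (x \<otimes> y)
  = (\<lambda>x\<in>carrier R. inv_into (carrier R) al x) x \<otimes> (\<lambda>x\<in>carrier R. inv_into (carrier R) al x) y"
  using xy by simp
  have add: "x \<oplus> y = al (inv_into (carrier R) al x \<oplus> inv_into (carrier R) al y)"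
  using ring_hom_add[OF hom j(1)[OF xy(1)] j(1)[OF xy(2)]] j(2) xy by simp
  have "inv_into (carrier R) al (x \<oplus> y) = inv_into (carrier R) al x \<oplus> inv_into (carrier R) al y"
  by (subst add, rule i) (use j(1) xy in simp)
  thus "(\<lambda>x\<in>carrier R. inv_into (carrier R) al x) (x \<oplus> y)
  = (\<lambda>x\<in>carrier R. inv_into (carrier R) al x) x \<oplus> (\<lambda>x\<in>carrier R. inv_into (carrier R) al x) y"
  using xy by simp
  next
  fix x assume "x:carrier R"
  thus "(\<lambda>x\<in>carrier R. inv_into (carrier R) al x) x:carrier R" using j(1) by simp
  next
  show "(\<lambda>x\<in>carrier R. inv_into (carrier R) al x) \<one> = \<one>"
  using i[of \<one>] ring_hom_one[OF hom] by simp
  qed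
  show "inv\<^bsub>BijGroup (carrier R)\<^esub> al:carrier (galois_group R K)"
  unfolding eq carrier_galois_group
  proof (intro conjI ballI restrict_inv_into_Bij[OF B] inv_hom)
  fix x assume "x:K"
  thus "(\<lambda>x\<in>carrier R. inv_into (carrier R) al x) x = x"
  using i[of x] assms fix_K by auto
  qed
 next
  fix al tu assume altu: "al:carrier (galois_group R K)" "tu:carrier (galois_group R K)"
  hence h: "al:ring_hom R R" "tu:ring_hom R R" and B: "al:Bij (carrier R)" "tu:Bij (carrier R)"
  unfolding carrier_galois_group by auto
  have "al \<otimes>\<^bsub>BijGroup (carrier R)\<^esub> tu = compose (carrier R) al tu"
  using B by (simp add: BijGroup_def)
  moreover have "compose (carrier R) al tu:ring_hom R R"
  using ring_hom_mult[OF h(1)] ring_hom_add[OF h(1)] ring_hom_one[OF h(1)] ring_hom_closed[OF h(1)]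
  ring_hom_mult[OF h(2)] ring_hom_add[OF h(2)] ring_hom_one[OF h(2)] ring_hom_closed[OF h(2)]
  by (intro ring_hom_memI) (auto simp: compose_eq)
  moreover have "compose (carrier R) al tu x = x" if "x:K" for x
  using altu assms that unfolding carrier_galois_group by (auto simp: compose_eq subset_iff)
  ultimately show "al \<otimes>\<^bsub>BijGroup (carrier R)\<^esub> tu:carrier (galois_group R K)"
  unfolding carrier_galois_group using compose_Bij[OF B] by auto
 qed
 thus ?thesis
  using subgroup.subgroup_is_group[OF _ B.is_group] unfolding galois_group_def by fastforce
qed

text \<open>In effect \<open>L\<close> is an algebraic closure of the rational numbers. The field F
  is left out because conjugates and sizes of algebraic numbers are taken over the
  rationals.\<close>

locale algebraic_numbers = algebraically_closed L for L (structure) +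
 assumes char_0: "n > (0::nat) ==> add_pow L n \<one> ~= \<zero>"
  and algebraic_prime: "x:carrier L ==> (algebraic over prime_field) x"
begin

text \<open>One embedding is fixed. By \<open>complex_hom_galois\<close> every other one is
  \<open>ph\<close> composed with an automorphism, so the archimedean absolute values of a number
  are those of \<open>ph\<close> on its conjugates.\<close>

definition ph :: "'a => complex" where "ph = (SOME ph. complex_hom L ph)"

abbreviation Aut where "Aut \<equiv> carrier (galois_group L prime_field)"

lemma ph_hom: "complex_hom L ph"
proof -
 obtain tu where "complex_hom (L\<lparr>carrier := prime_field\<rparr>) tu"
  using exists_complex_hom_prime_field char_0 by blast
 then obtain h where "complex_hom L h"
  using complex_hom_extension[OF subfield_prime_field algebraic_prime
  subfieldE(1)[OF subfield_prime_field] order_refl] by blast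
 thus ?thesis unfolding ph_def by (rule someI[of "complex_hom L"])
qed

lemmas ph_simps = complex_hom_simps[OF ph_hom]
lemmas ph_inj = complex_hom_inj[OF ph_hom]

lemma prime_field_carrier: "prime_field <= carrier L"
 using subfieldE(3)[OF subfield_prime_field] .

lemma poly_ring_prime:
 assumes "p:carrier (prime_field [X])"
 shows "p:carrier (poly_ring L)" "set p <= prime_field"
 using assms prime_field_carrier unfolding univ_poly_carrier[symmetric] polynomial_def by auto

lemma Irr_prime:
 assumes "x:carrier L"
 shows "Irr prime_field x:carrier (prime_field [X])" "Irr prime_field x ~= []"
  "eval (Irr prime_field x) x = \<zero>" "hd (Irr prime_field x) = \<one>" "length (Irr prime_field x) >= 2"
proof -
 note I = IrrE[OF subfield_prime_field assms algebraic_prime[OF assms]]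
 show "Irr prime_field x:carrier (prime_field [X])" "eval (Irr prime_field x) x = \<zero>"
  "hd (Irr prime_field x) = \<one>" using I by auto
 have "length (Irr prime_field x) - 1 >= 1" using pirreducible_degree[OF subfield_prime_field I(1,2)] .
 thus "Irr prime_field x ~= []" "length (Irr prime_field x) >= 2" by auto
qed

text \<open>The number \<open>h x\<close> is a root of the minimal polynomial of \<open>x\<close>
  over the rationals. Both embeddings agree on its coefficients, and the image of \<open>g\<close>
  contains all its roots.\<close>

lemma complex_hom_range:
 assumes "complex_hom L h" "complex_hom L g"
 shows "h ` carrier L <= g ` carrier L"
proof
 fix z assume "z:h ` carrier L"
 then obtain x where x: "x:carrier L" "z = h x" by blast
 define p where "p = Irr prime_field x"
 note p = Irr_prime[OF x(1), folded p_def]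
 have pC: "set p <= carrier L" using poly_ring_prime[OF p(1)] prime_field_carrier by blast
 have "hom_poly h p = hom_poly g p"
  using poly_ring_prime(2)[OF p(1)] complex_hom_prime_field(1)[OF assms]
  by (intro hom_poly_cong) blast
 hence "poly (hom_poly g p) z = 0"
  using poly_hom_poly[OF assms(1) pC x(1)] p(3) x(2) complex_hom_simps(2)[OF assms(1)] by simp
 thus "z:g ` carrier L"
  using hom_poly_root_in_image[OF assms(2) poly_ring_prime(1)[OF p(1)] p(2)] by blast
qed

lemma complex_hom_galois:
 assumes "complex_hom L h"
 shows "EX al:Aut. ALL x:carrier L. ph (al x) = h x"
proof -
 have eq: "h ` carrier L = ph ` carrier L"
  using complex_hom_range[OF assms ph_hom] complex_hom_range[OF ph_hom assms] by blast
 define al where "al = (\<lambda>x\<in>carrier L. inv_into (carrier L) ph (h x))"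
 have al: "al x:carrier L" "ph (al x) = h x" if "x:carrier L" for x
  using that eq inv_into_into[of "h x" ph "carrier L"] f_inv_into_f[of "h x" ph "carrier L"]
  unfolding al_def by auto
 note h = complex_hom_simps[OF assms]
 have hom: "al:ring_hom L L"
 proof (rule ring_hom_memI)
  fix x y assume "x:carrier L" "y:carrier L"
  thus "al (x \<otimes> y) = al x \<otimes> al y" "al (x \<oplus> y) = al x \<oplus> al y"
  by (auto intro!: ph_inj simp: al ph_simps h)
 next
  show "al \<one> = \<one>" by (rule ph_inj) (auto simp: al ph_simps h)
 qed (rule al(1))
 have "bij_betw al (carrier L) (carrier L)"
 proof (rule bij_betw_imageI)
  show "inj_on al (carrier L)"
  using al(2) complex_hom_inj[OF assms] by (metis inj_onI)
  show "al ` carrier L = carrier L"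
  proof
  show "carrier L <= al ` carrier L"
  proof
  fix y assume y: "y:carrier L"
  then obtain x where "x:carrier L" "ph y = h x" using eq by blast
  thus "y:al ` carrier L" using al ph_inj y by (intro image_eqI[of _ _ x]) auto
  qed
  qed (use al in blast)
 qed
 hence "al:Bij (carrier L)" unfolding Bij_def al_def by simp
 moreover have "al a = a" if "a:prime_field" for a
  using that prime_field_carrier complex_hom_prime_field(1)[OF assms ph_hom that]
  by (intro ph_inj al(1)) (auto simp: al)
 ultimately have "al:Aut" unfolding carrier_galois_group using hom by blast
 thus ?thesis using al(2) by blast
qed

lemma Aut_hom:
 assumes "al:Aut"
 shows "al:ring_hom L L" "complex_hom L (%x. ph (al x))"
proof -
 show h: "al:ring_hom L L" using assms unfolding carrier_galois_group by blast
 show "complex_hom L (%x. ph (al x))" unfolding complex_hom_def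
  using ring_hom_mult[OF h] ring_hom_add[OF h] ring_hom_one[OF h] ring_hom_closed[OF h] ph_simps by simp
qed

text \<open>The extension is made inside the complex numbers, after composing with
  \<open>ph\<close>, and is brought back to \<open>L\<close> by \<open>complex_hom_galois\<close>.
  No second use of Zorn's lemma is required.\<close>

lemma automorphism_extension:
 assumes E0: "subring E0 L" "prime_field <= E0" and tu: "tu:ring_hom (L\<lparr>carrier := E0\<rparr>) L"
 shows "EX al:Aut. ALL a:E0. al a = tu a"
proof -
 have cl: "tu a:carrier L" if "a:E0" for a using ring_hom_closed[OF tu] that by simp
 have "complex_hom (L\<lparr>carrier := E0\<rparr>) (%x. ph (tu x))"
  unfolding complex_hom_def
  using ring_hom_mult[OF tu] ring_hom_add[OF tu] ring_hom_one[OF tu] cl ph_simps by simp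
 then obtain h where h: "complex_hom L h" "!!a. a:E0 ==> h a = ph (tu a)"
  using complex_hom_extension[OF subfield_prime_field algebraic_prime E0] by metis
 obtain al where al: "al:Aut" "!!x. x:carrier L ==> ph (al x) = h x"
  using complex_hom_galois[OF h(1)] by blast
 have "al a = tu a" if "a:E0" for a
  using subringE(1)[OF E0(1)] al(2)[of a] h(2)[OF that] that cl galois_group_closed[OF al(1)]
  by (intro ph_inj) auto
 thus ?thesis using al(1) by blast
qed

lemma finite_roots:
 assumes "p:carrier (poly_ring L)" "p ~= []"
 shows "finite {x:carrier L. eval p x = \<zero>}"
proof -
 have p: "set p <= carrier L" "hd p ~= \<zero>"
  using assms unfolding univ_poly_carrier[symmetric] polynomial_def by auto
 hence "ph (hd p) ~= 0" using ph_inj[of "hd p" \<zero>] ph_simps(2) assms(2) by (auto simp: subset_iff)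
 hence "hom_poly ph p ~= 0" using degree_hom_poly(2)[OF assms(2), of ph] by auto
 hence "finite {z. poly (hom_poly ph p) z = 0}" by (rule poly_roots_finite)
 moreover have "ph ` {x:carrier L. eval p x = \<zero>} <= {z. poly (hom_poly ph p) z = 0}"
  using poly_hom_poly[OF ph_hom p(1)] ph_simps(2) by auto
 moreover have "inj_on ph {x:carrier L. eval p x = \<zero>}" by (auto intro!: inj_onI ph_inj)
 ultimately show ?thesis using finite_subset finite_imageD by blast
qed

lemma Aut_eval:
 assumes "al:Aut" "p:carrier (prime_field [X])" "x:carrier L" "eval p x = \<zero>"
 shows "eval p (al x) = \<zero>"
proof -
 have p: "set p <= carrier L" using poly_ring_prime(2)[OF assms(2)] prime_field_carrier by blast
 have alx: "al x:carrier L" using galois_group_closed[OF assms(1,3)] .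
 have "hom_poly (%x. ph (al x)) p = hom_poly ph p"
  using poly_ring_prime(2)[OF assms(2)] assms(1) unfolding carrier_galois_group
  by (intro hom_poly_cong) auto
 hence "ph (eval p (al x)) = ph (al (eval p x))"
  using poly_hom_poly[OF Aut_hom(2)[OF assms(1)] p assms(3)] poly_hom_poly[OF ph_hom p alx] by simp
 also have "\<dots> = 0" using assms(4) complex_hom_simps(2)[OF Aut_hom(2)[OF assms(1)]] by simp
 finally show ?thesis using ph_inj[of "eval p (al x)" \<zero>] ph_simps(2) eval_in_carrier[OF p alx] by simp
qed

lemma finite_orbit:
 assumes "x:carrier L"
 shows "finite {al x | al. al:Aut}"
proof (rule finite_subset)
 show "{al x | al. al:Aut} <= {y:carrier L. eval (Irr prime_field x) y = \<zero>}"
  using Aut_eval[OF _ Irr_prime(1)[OF assms] assms Irr_prime(3)[OF assms]] galois_group_closed[OF _ assms]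
  by auto
 show "finite {y:carrier L. eval (Irr prime_field x) y = \<zero>}"
  using finite_roots[OF poly_ring_prime(1)[OF Irr_prime(1)[OF assms]] Irr_prime(2)[OF assms]] .
qed

lemma countable_carrier: "countable (carrier L)"
proof -
 have "countable (ph ` prime_field)"
 proof (rule countable_subset)
  show "ph ` prime_field <= \<rat>" using complex_hom_prime_field(2)[OF ph_hom ph_hom] by blast
  show "countable (\<rat> :: complex set)" by (rule countable_rat)
 qed
 moreover have "inj_on ph prime_field" using prime_field_carrier by (auto intro!: inj_onI ph_inj)
 ultimately have "countable prime_field" using countable_image_inj_on by blast
 hence c: "countable (lists prime_field)" by (rule countable_lists)
 have "carrier L <= (\<Union>p\<in>{p:lists prime_field. p:carrier (poly_ring L) & p ~= []}. {x:carrier L. eval p x = \<zero>})"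
 proof
  fix x assume "x:carrier L"
  thus "x:(\<Union>p\<in>{p:lists prime_field. p:carrier (poly_ring L) & p ~= []}. {x:carrier L. eval p x = \<zero>})"
  using Irr_prime[of x] poly_ring_prime by (intro UN_I[of "Irr prime_field x"]) auto
 qed
 moreover have "countable (\<Union>p\<in>{p:lists prime_field. p:carrier (poly_ring L) & p ~= []}. {x:carrier L. eval p x = \<zero>})"
 proof (rule countable_UN)
  show "countable {p:lists prime_field. p:carrier (poly_ring L) & p ~= []}"
  by (rule countable_subset[OF _ c]) blast
 qed (use finite_roots countable_finite in blast)
 ultimately show ?thesis using countable_subset by blast
qed

text \<open>A number which is fixed by all automorphisms has no other conjugate, so its minimal
 polynomial is \<open>(X - a) ^ d\<close>, and \<open>d a\<close> is one of its coefficients.\<close>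

lemma Aut_fixed_rational:
 assumes c: "c:carrier L" and fixed: "!!al. al:Aut ==> al c = c"
 shows "ph c:\<rat>"
proof -
 define p where "p = Irr prime_field c"
 note p = Irr_prime[OF c, folded p_def]
 have pC: "set p <= carrier L" using poly_ring_prime(2)[OF p(1)] prime_field_carrier by blast
 define f where "f = hom_poly ph p"
 have deg: "degree f = length p - 1" "lead_coeff f = 1"
  using degree_hom_poly[OF p(2), of ph] p(4) ph_simps(1) unfolding f_def by auto
 have root: "poly f (ph c) = 0" using poly_hom_poly[OF ph_hom pC c] p(3) ph_simps(2) unfolding f_def by simp
 \<comment> \<open>A root \<open>z\<close> defines an embedding of the field generated by
   \<open>c\<close>. It extends to \<open>L\<close> and comes from an automorphism, which fixes
   \<open>c\<close> by assumption.\<close>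
 have "z = ph c" if z: "poly f z = 0" for z
 proof -
  have hp: "complex_hom (L\<lparr>carrier := prime_field\<rparr>) ph"
  unfolding complex_hom_def using ph_simps prime_field_carrier by (auto simp: subset_iff)
  have sub: "subring (simple_extension prime_field c) L" "prime_field <= simple_extension prime_field c"
  using simple_extension_is_subring[OF subfieldE(1)[OF subfield_prime_field] c]
  simple_extension_incl[OF prime_field_carrier c] by auto
  obtain tu where tu: "complex_hom (L\<lparr>carrier := simple_extension prime_field c\<rparr>) tu" "tu c = z"
  using simple_extension_complex_hom[OF subfield_prime_field hp c algebraic_prime[OF c]] z
  unfolding f_def p_def by metis
  obtain h where h: "complex_hom L h" "!!a. a:simple_extension prime_field c ==> h a = tu a"
  using complex_hom_extension[OF subfield_prime_field algebraic_prime sub tu(1)] by metis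
  obtain al where al: "al:Aut" "ph (al c) = h c" using complex_hom_galois[OF h(1)] c by blast
  thus ?thesis
  using fixed[OF al(1)] al(2) h(2)[OF simple_extension_mem[OF subfieldE(1)[OF subfield_prime_field] c]] tu(2) by simp
 qed
 hence "{z. poly f z = 0} = {ph c}" using root by blast
 hence f: "f = [:- ph c, 1:] ^ order (ph c) f"
  using complex_poly_decompose[of f] deg(2) by simp
 define d where "d = length p - 1"
 have "order (ph c) f = d" using deg(1) arg_cong[OF f, of degree] unfolding d_def
  by (simp add: degree_power_eq)
 hence f: "f = [:- ph c, 1:] ^ d" using f by simp
 have d: "d >= 1" using p(5) unfolding d_def by simp
 have "Polynomial.coeff f (d - 1) = of_nat (d choose (d - 1)) * (- ph c)"
  unfolding f using coeff_linear_poly_power[of "d - 1" d "- ph c" 1] d by simp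
 also have "d choose (d - 1) = d" using binomial_symmetric[of 1 d] d by simp
 finally have "ph c = - Polynomial.coeff f (d - 1) / of_nat d" using d by (simp add: field_simps)
 moreover have "Polynomial.coeff f (d - 1):\<rat>"
 proof -
  have "ph ` set p <= \<rat>"
  using poly_ring_prime(2)[OF p(1)] complex_hom_prime_field(2)[OF ph_hom ph_hom] by blast
  thus ?thesis using coeff_hom_poly_image[of ph p "d - 1"] unfolding f_def by auto
 qed
 ultimately show ?thesis by (simp add: Rats_divide)
qed

end

section \<open>Lifting homomorphisms into the circle\<close>

definition add_hom :: "('g, 'm) monoid_scheme => 'g set => ('g => real) => bool" where
 "add_hom H B f <-> (ALL x:B. ALL y:B. f (x \<otimes>\<^bsub>H\<^esub> y) = f x + f y)"

text \<open>The isolator, or pure closure, of the subgroup generated by \<open>B\<close>: for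
  abelian groups the smallest subgroup containing \<open>B\<close> with torsion-free
  quotient.\<close>

definition sat :: "('g, 'm) monoid_scheme => 'g set => 'g set" where
 "sat H B = {x:carrier H. EX j::int. j > 0 & x [^]\<^bsub>H\<^esub> j:generate H B}"

context comm_group
begin

lemma add_hom_int_pow:
 assumes B: "subgroup B G" and f: "add_hom G B f" and x: "x:B"
 shows "f \<one> = 0" "f (inv x) = - f x" "f (x [^] (k::int)) = of_int k * f x"
proof -
 note sg = subgroup.one_closed[OF B] subgroup.m_closed[OF B] subgroup.m_inv_closed[OF B]
 have xC: "x:carrier G" using subgroup.mem_carrier[OF B x] .
 have "f (\<one> \<otimes> \<one>) = f \<one> + f \<one>" using f sg(1) unfolding add_hom_def by blast
 thus one: "f \<one> = 0" by simp
 have inv: "f (inv y) = - f y" if "y:B" for y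
 proof -
  have "f (y \<otimes> inv y) = f y + f (inv y)" using f[unfolded add_hom_def, rule_format, OF that sg(3)[OF that]] .
  thus ?thesis using one subgroup.mem_carrier[OF B that] by simp
 qed
 show "f (inv x) = - f x" using inv x by blast
 have npow: "x [^] (n::nat):B & f (x [^] n) = of_nat n * f x" for n
  using f x sg one unfolding add_hom_def by (induction n) (auto simp: algebra_simps)
 show "f (x [^] (k::int)) = of_int k * f x"
 proof (cases k)
  case (nonneg n)
  thus ?thesis using npow[of n] by (simp add: int_pow_int)
 next
  case (neg n)
  have "x [^] k = inv (x [^] Suc n)" unfolding neg int_pow_neg[OF xC] int_pow_int ..
  hence "f (x [^] k) = - f (x [^] Suc n)" using inv npow[of "Suc n"] by simp
  also have "\<dots> = - (of_nat (Suc n) * f x)" using npow[of "Suc n"] by simp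
  also have "\<dots> = of_int k * f x" unfolding neg by (simp add: algebra_simps)
  finally show ?thesis .
 qed
qed

lemma subgroup_int_pow: "subgroup B G ==> x:B ==> x [^] (k::int):B"
 using subgroup_int_pow_closed .

lemma generate_insert:
 assumes "B <= carrier G" "a:carrier G"
 shows "generate G (insert a B) = {d \<otimes> a [^] (m::int) | d m. d:generate G B}"
proof
 note gB = generate_is_subgroup[OF assms(1)]
 note c = subgroup.mem_carrier[OF gB]
 show "generate G (insert a B) <= {d \<otimes> a [^] (m::int) | d m. d:generate G B}"
 proof
  fix x assume "x:generate G (insert a B)"
  thus "x:{d \<otimes> a [^] (m::int) | d m. d:generate G B}"
  proof induction
  case one
  show ?case using subgroup.one_closed[OF gB] by (auto intro!: exI[of _ \<one>] exI[of _ "0::int"])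
  next
  case (incl h)
  thus ?case
  proof
  assume "h = a" thus ?thesis using subgroup.one_closed[OF gB] assms(2)
  by (auto intro!: exI[of _ \<one>] exI[of _ "1::int"] simp: int_pow_1)
  next
  assume "h:B" thus ?thesis using generate.incl[of h B G] assms(1)
  by (auto intro!: exI[of _ h] exI[of _ "0::int"])
  qed
  next
  case (inv h)
  thus ?case
  proof
  assume "h = a" thus ?thesis using subgroup.one_closed[OF gB] assms(2)
  by (auto intro!: exI[of _ \<one>] exI[of _ "-1::int"] simp: int_pow_neg int_pow_1)
  next
  assume "h:B" thus ?thesis using generate.inv[of h B G] assms(1)
  by (auto intro!: exI[of _ "inv h"] exI[of _ "0::int"])
  qed
  next
  case (eng h1 h2)
  then obtain d1 m1 d2 m2 where 1: "d1:generate G B" "h1 = d1 \<otimes> a [^] (m1::int)"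
  "d2:generate G B" "h2 = d2 \<otimes> a [^] (m2::int)" by blast
  have "h1 \<otimes> h2 = (d1 \<otimes> d2) \<otimes> a [^] (m1 + m2)"
  using 1 c assms(2) by (simp add: int_pow_mult m_ac)
  thus ?case using subgroup.m_closed[OF gB 1(1,3)] by blast
  qed
 qed
 have aB: "insert a B <= carrier G" using assms by blast
 note g = generate_is_subgroup[OF aB]
 have "a:generate G (insert a B)" by (rule generate.incl) simp
 moreover have "generate G B <= generate G (insert a B)" by (rule mono_generate) blast
 ultimately show "{d \<otimes> a [^] (m::int) | d m. d:generate G B} <= generate G (insert a B)"
  using subgroup.m_closed[OF g] subgroup_int_pow[OF g] by blast
qed

lemma saturation_subgroup:
 assumes "B <= carrier G"
 shows "subgroup (sat G B) G"
proof (rule subgroupI)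
 note gB = generate_is_subgroup[OF assms]
 show "sat G B <= carrier G" unfolding sat_def by blast
 have "\<one>:sat G B" unfolding sat_def
  using subgroup.one_closed[OF gB] by (auto intro!: exI[of _ "1::int"])
 thus "sat G B ~= {}" by blast
next
 note gB = generate_is_subgroup[OF assms]
 fix x assume "x:sat G B"
 then obtain j :: int where j: "x:carrier G" "j > 0" "x [^] j:generate G B" unfolding sat_def by blast
 have "(inv x) [^] j = inv (x [^] j)" using j(1) by (simp add: int_pow_inv)
 thus "inv x:sat G B" unfolding sat_def
  using j subgroup.m_inv_closed[OF gB j(3)] by auto
next
 note gB = generate_is_subgroup[OF assms]
 fix x y assume "x:sat G B" "y:sat G B"
 then obtain j k :: int where j: "x:carrier G" "j > 0" "x [^] j:generate G B"
  and k: "y:carrier G" "k > 0" "y [^] k:generate G B" unfolding sat_def by blast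
 have "(x \<otimes> y) [^] (j * k) = (x [^] j) [^] k \<otimes> (y [^] k) [^] j"
  using j(1) k(1) by (simp add: int_pow_distrib int_pow_pow mult.commute)
 hence "(x \<otimes> y) [^] (j * k):generate G B"
  using subgroup.m_closed[OF gB] subgroup_int_pow[OF gB j(3)] subgroup_int_pow[OF gB k(3)] by simp
 thus "x \<otimes> y:sat G B" unfolding sat_def using j k
  by (auto intro!: exI[of _ "j * k"])
qed

lemma saturation_incl: "B <= carrier G ==> generate G B <= sat G B"
 unfolding sat_def using generate_in_carrier[of B]
 by (auto intro!: exI[of _ "1::int"] simp: int_pow_1)

lemma saturation_mono: "B <= C ==> sat G B <= sat G C"
 unfolding sat_def using mono_generate[of B C] by blast

lemma saturation_pure:
 assumes "x:carrier G" "j > (0::int)" "x [^] j:sat G B"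
 shows "x:sat G B"
proof -
 obtain k :: int where k: "k > 0" "(x [^] j) [^] k:generate G B"
  using assms(3) unfolding sat_def by blast
 hence "x [^] (j * k):generate G B" using assms(1) by (simp add: int_pow_pow)
 thus ?thesis unfolding sat_def using assms(1,2) k(1)
  by (auto intro!: exI[of _ "j * k"])
qed

lemma saturation_insert:
 assumes B: "B <= carrier G" "a:carrier G" and x: "x:sat G (insert a B)"
 obtains j m :: int and d where "j > 0" "d:generate G B" "x [^] j = d \<otimes> a [^] m"
 using x unfolding sat_def generate_insert[OF B] by blast

text \<open>Independence of a new element from a saturated subgroup. It makes the exponent in a
  relation x^j = d a^m unique once j is fixed.\<close>

lemma int_pow_mem_saturation:
 assumes "a:carrier G" "a \<notin> sat G B" "B <= carrier G" "a [^] (m::int):sat G B"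
 shows "m = 0"
proof (rule ccontr)
 assume "m ~= 0"
 then consider "m > 0" | "- m > 0" by linarith
 thus False
 proof cases
  case 2
  have "a [^] (- m):sat G B"
  using subgroup.m_inv_closed[OF saturation_subgroup[OF assms(3)] assms(4)] assms(1)
  by (simp add: int_pow_neg)
  thus False using saturation_pure[OF assms(1) 2] assms(2) by blast
 qed (use saturation_pure[OF assms(1) _ assms(4)] assms(2) in blast)
qed

text \<open>The common frame of two extension problems: the elements of the group are adjoined one
  at a time, by dependent choice along an enumeration. The predicate \<open>Q\<close> is trivial for
  real-valued extension and expresses a prescribed character when a logarithm is wanted.\<close>

lemma add_hom_extend_countable:
 fixes Q :: "'a => real => bool"
 assumes cnt: "countable (carrier G)" and B: "B <= carrier G"
  and f0: "add_hom G (sat G B) f0" "!!x. x:sat G B ==> Q x (f0 x)"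
  and step: "!!S a f. finite S ==> S <= carrier G ==> a:carrier G ==> a \<notin> sat G (B Un S) ==>
  add_hom G (sat G (B Un S)) f ==> (!!x. x:sat G (B Un S) ==> Q x (f x)) ==>
  EX f'. add_hom G (sat G (insert a (B Un S))) f' & (ALL x:sat G (B Un S). f' x = f x)
  & (ALL x:sat G (insert a (B Un S)). Q x (f' x))"
 shows "EX f. add_hom G (carrier G) f & (ALL x:sat G B. f x = f0 x) & (ALL x:carrier G. Q x (f x))"
proof -
 define a where "a = from_nat_into (carrier G)"
 have a: "a i:carrier G" for i unfolding a_def by (rule from_nat_into) auto
 have a_surj: "EX i. a i = x" if "x:carrier G" for x
  unfolding a_def using from_nat_into_surj[OF cnt that] .
 define S where "S i = a ` {..<i}" for i :: nat
 have S: "finite (S i)" "S i <= carrier G" "S (Suc i) = insert (a i) (S i)" for i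
  unfolding S_def using a by (auto simp: lessThan_Suc)
 define D where "D i = sat G (B Un S i)" for i
 define ok where "ok i f <-> add_hom G (D i) f & (ALL x:D i. Q x (f x))" for i f
 have "EX f. ALL i. (ok i (f i) & (ALL x:sat G B. f i x = f0 x)) & (ALL x:D i. f (Suc i) x = f i x)"
 proof (rule dependent_nat_choice)
  show "EX f. ok 0 f & (ALL x:sat G B. f x = f0 x)"
  using f0 unfolding ok_def D_def S_def by (intro exI[of _ f0]) simp
 next
  fix f i assume f: "ok i f & (ALL x:sat G B. f x = f0 x)"
  have sub: "sat G B <= D i" unfolding D_def by (rule saturation_mono) blast
  show "EX f'. (ok (Suc i) f' & (ALL x:sat G B. f' x = f0 x)) & (ALL x:D i. f' x = f x)"
  proof (cases "a i:D i")
  case True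
  have "D (Suc i) <= D i"
  proof
  fix x assume x: "x:D (Suc i)"
  hence xC: "x:carrier G" unfolding D_def sat_def by blast
  have BS: "B Un S i <= carrier G" using B S(2)[of i] by blast
  have x': "x:sat G (insert (a i) (B Un S i))" using x unfolding D_def S(3) by simp
  obtain j m :: int and d where j: "j > 0" "d:generate G (B Un S i)" "x [^] j = d \<otimes> a i [^] m"
  using saturation_insert[OF BS a x'] .
  note sg = saturation_subgroup[OF BS]
  have "d:D i" using saturation_incl[OF BS] j(2) unfolding D_def by blast
  hence "x [^] j:D i" unfolding j(3) using subgroup.m_closed[OF sg] subgroup_int_pow[OF sg] True
  unfolding D_def by blast
  thus "x:D i" using saturation_pure[OF xC j(1)] unfolding D_def by blast
  qed
  hence "ok (Suc i) f" using f unfolding ok_def add_hom_def by blast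
  thus ?thesis using f by blast
  next
  case False
  then obtain f' where "add_hom G (sat G (insert (a i) (B Un S i))) f'"
  "ALL x:sat G (B Un S i). f' x = f x" "ALL x:sat G (insert (a i) (B Un S i)). Q x (f' x)"
  using step[OF S(1,2)[of i] a, of i f] f unfolding ok_def D_def by blast
  thus ?thesis using f sub unfolding ok_def D_def S(3) by (intro exI[of _ f']) auto
  qed
 qed
 then obtain f where f: "!!i. ok i (f i)" "!!i x. x:sat G B ==> f i x = f0 x"
  "!!i x. x:D i ==> f (Suc i) x = f i x" by blast
 have Dmono: "D i <= D j" if "i <= j" for i j
  unfolding D_def S_def by (rule saturation_mono) (use that in fastforce)
 have fmono: "f j x = f i x" if "i <= j" "x:D i" for i j x
  using that
 proof (induction j rule: dec_induct)
  case (step n)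
  thus ?case using f(3)[of x n] Dmono[of i n] by auto
 qed simp
 have ex: "EX i. x:D i" if xC: "x:carrier G" for x
 proof -
  obtain i where "a i = x" using a_surj[OF xC] by blast
  hence "x:generate G (B Un S (Suc i))" by (intro generate.incl) (auto simp: S_def)
  thus ?thesis using saturation_incl[of "B Un S (Suc i)"] B S(2)[of "Suc i"] unfolding D_def by blast
 qed
 define g where "g x = f (LEAST i. x:D i) x" for x
 have g: "g x = f i x" if "x:D i" for i x
  unfolding g_def using fmono[of "LEAST i. x:D i" i x] that LeastI[of "%i. x:D i"] Least_le[of "%i. x:D i"]
  by metis
 have sgD: "subgroup (D i) G" for i
  unfolding D_def using B S(2)[of i] by (intro saturation_subgroup) blast
 have "add_hom G (carrier G) g" unfolding add_hom_def
 proof (intro ballI)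
  fix x y assume "x:carrier G" "y:carrier G"
  then obtain i j where "x:D i" "y:D j" using ex by blast
  hence xy: "x:D (max i j)" "y:D (max i j)" using Dmono[of i "max i j"] Dmono[of j "max i j"] by auto
  hence "x \<otimes> y:D (max i j)" using subgroup.m_closed[OF sgD] by blast
  thus "g (x \<otimes> y) = g x + g y" using g xy f(1)[of "max i j"] unfolding ok_def add_hom_def by simp
 qed
 moreover have "g x = f0 x" if "x:sat G B" for x
 proof -
  have "x:D 0" using that unfolding D_def S_def by simp
  thus ?thesis using g f(2) that by simp
 qed
 moreover have "Q x (g x)" if "x:carrier G" for x
 proof -
  obtain i where "x:D i" using ex \<open>x : carrier G\<close> by blast
  thus ?thesis using g f(1)[of i] unfolding ok_def by simp
 qed
 ultimately show ?thesis by blast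
qed

text \<open>The reals are divisible and torsion-free, so values can always be transported along
  power relations. The auxiliary fact \<open>ext\<close> serves twice: with \<open>a = 1\<close> to
  reach the saturation, and with an independent \<open>a\<close>, to which it gives the value
  0.\<close>

lemma add_hom_extend:
 assumes cnt: "countable (carrier G)" and B: "subgroup B G" and f0: "add_hom G B f0"
 shows "EX f. add_hom G (carrier G) f & (ALL x:B. f x = f0 x)"
proof -
 have BC: "B <= carrier G" using subgroup.subset[OF B] .
 have genB: "generate G B = B"
  using generate_subgroup_incl[OF order_refl B] by (auto intro: generate.incl)
 text \<open>Both for the saturation and for adjoining an element, the value at \<open>x\<close> is forced by
  (or chosen along) a relation \<open>x ^ j = d a ^ m\<close>.\<close>
 have ext: "EX f'. add_hom G C' f' & (ALL x:C. f' x = f x)"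
  if C: "subgroup C G" "subgroup C' G" "C <= C'" and f: "add_hom G C f" and a: "a:carrier G"
  and indep: "!!m::int. a [^] m:C ==> a [^] m = \<one>"
  and rel: "!!x. x:C' ==> EX (j::int) (m::int). j > 0 & (EX d:C. x [^] j = d \<otimes> a [^] m)" for C C' f a
 proof -
  note cC = subgroup.mem_carrier[OF C(1)] and cC' = subgroup.mem_carrier[OF C(2)]
  note fC = add_hom_int_pow[OF C(1) f]
  define P where "P x r <-> (EX (j::int) (m::int). EX d:C. j > 0 & x [^] j = d \<otimes> a [^] m & r = f d / of_int j)" for x r
  have uniq: "r = s" if h: "P x r" "P x s" "x:C'" for x r s
  proof -
  obtain j m d where 1: "d:C" "(j::int) > 0" "x [^] j = d \<otimes> a [^] (m::int)" "r = f d / of_int j"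
  using h(1) unfolding P_def by blast
  obtain j' m' d' where 2: "d':C" "(j'::int) > 0" "x [^] j' = d' \<otimes> a [^] (m'::int)" "s = f d' / of_int j'"
  using h(2) unfolding P_def by blast
  have x: "x:carrier G" using cC' h(3) by blast
  have d: "d:carrier G" "d':carrier G" using cC 1 2 by auto
  have "d [^] j' \<otimes> a [^] (m * j') = (x [^] j) [^] j'"
  unfolding 1(3) using d a by (simp add: int_pow_distrib int_pow_pow)
  also have "\<dots> = (x [^] j') [^] j" using x by (simp add: int_pow_pow mult.commute)
  also have "\<dots> = d' [^] j \<otimes> a [^] (m' * j)"
  unfolding 2(3) using d a by (simp add: int_pow_distrib int_pow_pow)
  finally have e: "d [^] j' \<otimes> a [^] (m * j') = d' [^] j \<otimes> a [^] (m' * j)" .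
  have "a [^] (m * j' - m' * j) = inv (d [^] j') \<otimes> (d [^] j' \<otimes> a [^] (m * j')) \<otimes> inv (a [^] (m' * j))"
  using d a by (simp add: int_pow_diff m_assoc[symmetric])
  also have "\<dots> = inv (d [^] j') \<otimes> d' [^] j"
  unfolding e using d a by (simp add: m_assoc)
  finally have aa: "a [^] (m * j' - m' * j) = inv (d [^] j') \<otimes> d' [^] j" .
  also have "\<dots>:C" using subgroup.m_closed[OF C(1) subgroup.m_inv_closed[OF C(1)]]
  subgroup_int_pow[OF C(1)] 1(1) 2(1) by blast
  finally have "inv (d [^] j') \<otimes> d' [^] j = \<one>" using indep aa by metis
  hence "d [^] j' = d' [^] j" using d by (metis int_pow_closed inv_closed inv_equality inv_inv)
  hence "of_int j' * f d = of_int j * f d'" using fC(3)[OF 1(1), of j'] fC(3)[OF 2(1), of j] by simp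
  thus ?thesis unfolding 1 2 using 1(2) 2(2) by (simp add: field_simps)
  qed
  have ex: "EX r. P x r" if x: "x:C'" for x
  proof -
  obtain j m d where "(j::int) > 0" "d:C" "x [^] j = d \<otimes> a [^] (m::int)" using rel[OF x] by blast
  hence "P x (f d / of_int j)" unfolding P_def by blast
  thus ?thesis by blast
  qed
  define f' where "f' x = (SOME r. P x r)" for x
  have f': "P x (f' x)" if "x:C'" for x unfolding f'_def using someI_ex[OF ex[OF that]] .
  have add: "P (x \<otimes> y) (r + s)" if h: "P x r" "P y s" "x:C'" "y:C'" for x y r s
  proof -
  obtain j m d where 1: "d:C" "(j::int) > 0" "x [^] j = d \<otimes> a [^] (m::int)" "r = f d / of_int j"
  using h(1) unfolding P_def by blast
  obtain j' m' d' where 2: "d':C" "(j'::int) > 0" "y [^] j' = d' \<otimes> a [^] (m'::int)" "s = f d' / of_int j'"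
  using h(2) unfolding P_def by blast
  have x: "x:carrier G" "y:carrier G" using cC' h by auto
  have d: "d:carrier G" "d':carrier G" using cC 1 2 by auto
  have "(x \<otimes> y) [^] (j * j') = (x [^] j) [^] j' \<otimes> (y [^] j') [^] j"
  using x by (simp add: int_pow_distrib int_pow_pow mult.commute)
  also have "\<dots> = (d [^] j' \<otimes> d' [^] j) \<otimes> a [^] (m * j' + m' * j)"
  unfolding 1 2 using d a by (simp add: int_pow_distrib int_pow_pow int_pow_mult m_ac)
  finally have e: "(x \<otimes> y) [^] (j * j') = (d [^] j' \<otimes> d' [^] j) \<otimes> a [^] (m * j' + m' * j)" .
  have dC: "d [^] j':C" "d' [^] j:C" using subgroup_int_pow[OF C(1)] 1 2 by auto
  have "f (d [^] j' \<otimes> d' [^] j) = of_int j' * f d + of_int j * f d'"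
  using f dC fC(3)[OF 1(1), of j'] fC(3)[OF 2(1), of j] unfolding add_hom_def by simp
  hence "r + s = f (d [^] j' \<otimes> d' [^] j) / of_int (j * j')"
  unfolding 1 2 using 1(2) 2(2) by (simp add: field_simps)
  thus ?thesis unfolding P_def using e 1(2) 2(2) subgroup.m_closed[OF C(1) dC]
  by (intro exI[of _ "j * j'"] exI[of _ "m * j' + m' * j"] bexI[of _ "d [^] j' \<otimes> d' [^] j"]) auto
  qed
  have "add_hom G C' f'" unfolding add_hom_def
  proof (intro ballI)
  fix x y assume xy: "x:C'" "y:C'"
  hence "P (x \<otimes> y) (f' (x \<otimes> y))" using f' subgroup.m_closed[OF C(2)] by blast
  thus "f' (x \<otimes> y) = f' x + f' y"
  using uniq add[OF f' f'] xy subgroup.m_closed[OF C(2)] by blast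
  qed
  moreover have "f' x = f x" if x: "x:C" for x
  proof -
  have "P x (f x)" unfolding P_def using x cC[OF x]
  by (intro exI[of _ "1::int"] exI[of _ "0::int"] bexI[of _ x]) (auto simp: int_pow_1)
  thus ?thesis using uniq f' C(3) x by blast
  qed
  ultimately show ?thesis by blast
 qed
 have "EX f1. add_hom G (sat G B) f1 & (ALL x:B. f1 x = f0 x)"
 proof (rule ext[OF B saturation_subgroup[OF BC] _ f0 one_closed])
  show "B <= sat G B" using saturation_incl[OF BC] genB by simp
  fix x assume "x:sat G B"
  then obtain j :: int where "j > 0" "x [^] j:B" unfolding sat_def genB by blast
  thus "EX (j::int) (m::int). j > 0 & (EX d:B. x [^] j = d \<otimes> \<one> [^] m)"
  using BC by (intro exI[of _ j] exI[of _ 0] conjI bexI[of _ "x [^] j"]) auto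
 qed (simp add: int_pow_one)
 then obtain f1 where f1: "add_hom G (sat G B) f1" "!!x. x:B ==> f1 x = f0 x" by blast
 have "EX f. add_hom G (carrier G) f & (ALL x:sat G B. f x = f1 x) & (ALL x:carrier G. True)"
 proof (rule add_hom_extend_countable[OF cnt BC f1(1)])
  fix S a f
  assume S: "finite S" "S <= carrier G" and a: "a:carrier G" "a \<notin> sat G (B Un S)"
  and f: "add_hom G (sat G (B Un S)) f"
  have BS: "B Un S <= carrier G" using BC S by blast
  have aBS: "insert a (B Un S) <= carrier G" using BS a by blast
  have "EX f'. add_hom G (sat G (insert a (B Un S))) f' & (ALL x:sat G (B Un S). f' x = f x)"
  proof (rule ext[OF saturation_subgroup[OF BS] saturation_subgroup[OF aBS] _ f a(1)])
  show "sat G (B Un S) <= sat G (insert a (B Un S))" by (rule saturation_mono) blast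
  show "a [^] m = \<one>" if "a [^] m:sat G (B Un S)" for m :: int
  using int_pow_mem_saturation[OF a BS that] by simp
  fix x assume "x:sat G (insert a (B Un S))"
  then obtain j m :: int and d where "j > 0" "d:generate G (B Un S)" "x [^] j = d \<otimes> a [^] m"
  using saturation_insert[OF BS a(1)] by blast
  thus "EX (j::int) (m::int). j > 0 & (EX d:sat G (B Un S). x [^] j = d \<otimes> a [^] m)"
  using saturation_incl[OF BS] by blast
  qed
  thus "EX f'. add_hom G (sat G (insert a (B Un S))) f' & (ALL x:sat G (B Un S). f' x = f x)
  & (ALL x:sat G (insert a (B Un S)). True)" by blast
 qed simp
 then obtain f where f: "add_hom G (carrier G) f" "!!x. x:sat G B ==> f x = f1 x" by blast
 have "f x = f0 x" if "x:B" for x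
  using f(2)[of x] f1(2)[OF that] saturation_incl[OF BC] genB that by auto
 thus ?thesis using f(1) by blast
qed

text \<open>When \<open>a\<close> is adjoined, the new quotient \<open>D'\<close> / \<open>D\<close>
  is torsion-free of rank one. The exponent \<open>M\<close> embeds it into the integers, so it is
  cyclic, and a logarithm is chosen freely on a generator. If the quotient were the group of
  rationals, a character could fail to lift; this is why boundedness is assumed.\<close>

lemma lift_circle_hom:
 assumes cnt: "countable (carrier G)" and B: "subgroup B G"
  and bounded: "!!S. finite S ==> S <= carrier G ==>
  EX M>0. ALL x:sat G (B Un S). x [^] (M::int):generate G (B Un S)"
  and u: "!!x y. x:carrier G ==> y:carrier G ==> u (x \<otimes> y) = u x * u y"
  "!!x. x:carrier G ==> cmod (u x) = 1"
  and f0: "add_hom G (sat G B) f0" "!!x. x:sat G B ==> cis (2 * pi * f0 x) = u x"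
 shows "EX f. add_hom G (carrier G) f & (ALL x:sat G B. f x = f0 x)
  & (ALL x:carrier G. cis (2 * pi * f x) = u x)"
proof (rule add_hom_extend_countable[where Q = "%x r. cis (2 * pi * r) = u x", OF cnt subgroup.subset[OF B] f0])
 have BC: "B <= carrier G" using subgroup.subset[OF B] .
 fix S a f
 assume S: "finite S" "S <= carrier G" and a: "a:carrier G" "a \<notin> sat G (B Un S)"
  and f: "add_hom G (sat G (B Un S)) f" "!!x. x:sat G (B Un S) ==> cis (2 * pi * f x) = u x"
 define D where "D = sat G (B Un S)"
 define D' where "D' = sat G (insert a (B Un S))"
 have BS: "B Un S <= carrier G" using BC S by blast
 have aBS: "insert a (B Un S) <= carrier G" using BS a by blast
 have sgD: "subgroup D G" and sgD': "subgroup D' G"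
  unfolding D_def D'_def using saturation_subgroup[OF BS] saturation_subgroup[OF aBS] .
 note mD = subgroup.m_closed[OF sgD] and cD = subgroup.mem_carrier[OF sgD]
 note mD' = subgroup.m_closed[OF sgD'] and cD' = subgroup.mem_carrier[OF sgD']
 have DD': "D <= D'" unfolding D_def D'_def by (rule saturation_mono) blast
 have aD': "a:D'" unfolding D'_def using saturation_incl[OF aBS] by (auto intro: generate.incl)
 obtain M :: int where M: "M > 0" "!!x. x:D' ==> x [^] M:generate G (insert a (B Un S))"
  using bounded[of "insert a S"] S a unfolding D'_def by auto
 \<comment> \<open>\<open>M\<close> times the coordinate of \<open>x\<close> in the direction of
   \<open>a\<close>: an integer-valued homomorphism on \<open>D'\<close> with kernel
   \<open>D\<close>.\<close>
 define k where "k x = (THE m. EX d:D. x [^] M = d \<otimes> a [^] (m::int))" for x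
 have k_eq: "k x = m" if "d:D" "x [^] M = d \<otimes> a [^] m" for x d and m :: int
  unfolding k_def
 proof (rule the_equality)
  show "EX d:D. x [^] M = d \<otimes> a [^] m" using that by blast
  fix m' :: int assume "EX d:D. x [^] M = d \<otimes> a [^] (m'::int)"
  then obtain d' where d': "d':D" "x [^] M = d' \<otimes> a [^] m'" by blast
  have e: "d \<otimes> a [^] m = d' \<otimes> a [^] m'" using that(2) d'(2) by simp
  have dC: "d:carrier G" "d':carrier G" using cD that(1) d'(1) by auto
  have "a [^] (m' - m) = inv d' \<otimes> (d' \<otimes> a [^] m') \<otimes> inv (a [^] m)"
  using dC a(1) by (simp add: int_pow_diff m_assoc[symmetric])
  also have "\<dots> = inv d' \<otimes> d" unfolding e[symmetric] using dC a(1) by (simp add: m_assoc)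
  finally have "a [^] (m' - m) = inv d' \<otimes> d" .
  hence "a [^] (m' - m):sat G (B Un S)"
  using mD[OF subgroup.m_inv_closed[OF sgD d'(1)] that(1)] unfolding D_def by simp
  thus "m' = m" using int_pow_mem_saturation[OF a BS] by fastforce
 qed
 have k_ex: "EX d:D. x [^] M = d \<otimes> a [^] k x" if x: "x:D'" for x
 proof -
  obtain d m where d: "d:generate G (B Un S)" "x [^] M = d \<otimes> a [^] (m::int)"
  using M(2)[OF x] unfolding generate_insert[OF BS a(1)] by blast
  hence "d:D" using saturation_incl[OF BS] unfolding D_def by blast
  thus ?thesis using k_eq d(2) by metis
 qed
 have k_add: "k (x \<otimes> y) = k x + k y" if xy: "x:D'" "y:D'" for x y
 proof -
  obtain d where d: "d:D" "x [^] M = d \<otimes> a [^] k x" using k_ex[OF xy(1)] by blast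
  obtain d' where d': "d':D" "y [^] M = d' \<otimes> a [^] k y" using k_ex[OF xy(2)] by blast
  have c: "x:carrier G" "y:carrier G" "d:carrier G" "d':carrier G" using cD cD' xy d d' by auto
  have "(x \<otimes> y) [^] M = (d \<otimes> d') \<otimes> a [^] (k x + k y)"
  using c a(1) by (simp add: int_pow_distrib d(2) d'(2) int_pow_mult m_ac)
  thus ?thesis using k_eq mD[OF d(1) d'(1)] by blast
 qed
 have k_pow: "k (x [^] (t::int)) = t * k x" if x: "x:D'" for x t
 proof -
  have "add_hom G D' (%x. of_int (k x))" unfolding add_hom_def using k_add by simp
  from add_hom_int_pow(3)[OF sgD' this x] show ?thesis by (metis of_int_eq_iff of_int_mult)
 qed
 have k0: "x:D" if h: "x:D'" "k x = 0" for x
 proof -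
  obtain d where "d:D" "x [^] M = d \<otimes> a [^] k x" using k_ex[OF h(1)] by blast
  hence "x [^] M:D" using h(2) cD by simp
  thus ?thesis using saturation_pure[OF cD'[OF h(1)] M(1)] unfolding D_def by blast
 qed
 have kD: "k x = 0" if "x:D" for x
  using k_eq[of "x [^] M" x 0] subgroup_int_pow[OF sgD that] cD[OF that] by simp
 have "k a = M" using k_eq[of \<one> a M] subgroup.one_closed[OF sgD] a(1) by simp
 hence ex: "EX n. n > 0 & (EX x:D'. k x = int n)" using M(1) aD' by (intro exI[of _ "nat M"]) auto
 \<comment> \<open>The values of \<open>k\<close> are the multiples of g, so \<open>D'\<close> is
   generated by \<open>D\<close> and an element \<open>b\<close> of value g. Any argument of
   \<open>u b\<close> may serve as the value of the logarithm at \<open>b\<close>.\<close>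
 define g where "g = (LEAST n. n > 0 & (EX x:D'. k x = int n))"
 obtain b where b: "g > 0" "b:D'" "k b = int g" using LeastI_ex[OF ex] unfolding g_def by blast
 have gmin: "n >= g" if "n > 0" "x:D'" "k x = int n" for n x
  unfolding g_def using that by (intro Least_le) blast
 have kdvd: "int g dvd k x" if x: "x:D'" for x
 proof -
  define q where "q = k x div int g"
  have y: "x \<otimes> b [^] (- q):D'" using mD'[OF x subgroup_int_pow[OF sgD' b(2)]] .
  have "k (x \<otimes> b [^] (- q)) = k x mod int g"
  using k_add[OF x subgroup_int_pow[OF sgD' b(2)]] k_pow[OF b(2)] b(3)
  by (simp add: q_def minus_div_mult_eq_mod[symmetric])
  moreover have "k x mod int g < int g" "k x mod int g >= 0" using b(1) by auto
  ultimately have "k x mod int g = 0"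
  using gmin[OF _ y, of "nat (k x mod int g)"] by (cases "k x mod int g = 0") auto
  thus ?thesis by (rule mod_0_imp_dvd)
 qed
 have bC: "b:carrier G" using cD' b(2) .
 obtain r where r: "cis (2 * pi * r) = u b"
 proof -
  have "u b ~= 0" using u(2)[OF bC] by auto
  hence "u b = cis (Arg (u b))" using u(2)[OF bC] cis_Arg[of "u b"] by (simp add: sgn_eq)
  hence "cis (2 * pi * (Arg (u b) / (2 * pi))) = u b" by simp
  thus ?thesis using that by blast
 qed
 define t where "t x = k x div int g" for x
 have t_add: "t (x \<otimes> y) = t x + t y" if "x:D'" "y:D'" for x y
  unfolding t_def k_add[OF that] using kdvd[OF that(1)] by (simp add: div_plus_div_distrib_dvd_left)
 define p where "p x = x \<otimes> b [^] (- t x)" for x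
 have pD: "p x:D" if x: "x:D'" for x
 proof (rule k0)
  show "p x:D'" unfolding p_def using mD'[OF x subgroup_int_pow[OF sgD' b(2)]] .
  show "k (p x) = 0" unfolding p_def
  using k_add[OF x subgroup_int_pow[OF sgD' b(2)]] k_pow[OF b(2)] b(3) kdvd[OF x] by (simp add: t_def)
 qed
 have p_mult: "p (x \<otimes> y) = p x \<otimes> p y" if "x:D'" "y:D'" for x y
 proof -
  have "b [^] (- (t x + t y)) = b [^] (- t x) \<otimes> b [^] (- t y)"
  using int_pow_mult[OF bC, of "- t x" "- t y"] by simp
  thus ?thesis unfolding p_def t_add[OF that] using cD'[OF that(1)] cD'[OF that(2)] bC
  by (simp add: m_ac)
 qed
 have p_inv: "x = p x \<otimes> b [^] t x" if "x:D'" for x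
  unfolding p_def using cD'[OF that] bC by (simp add: m_assoc int_pow_mult[symmetric])
 define f' where "f' x = f (p x) + of_int (t x) * r" for x
 have upow: "u (b [^] (m::int)) = cis (2 * pi * (of_int m * r))" for m
 proof -
  have u1: "u \<one> = 1" using u(1)[of \<one> \<one>] u(2)[of \<one>] by auto
  have nat: "u (b [^] (n::nat)) = cis (2 * pi * (of_nat n * r))" for n
  proof (induction n)
  case (Suc n)
  thus ?case using u(1)[of "b [^] n" b] bC r by (simp add: cis_mult algebra_simps flip: r)
  qed (simp add: u1)
  show ?thesis
  proof (cases m)
  case (nonneg n)
  thus ?thesis using nat[of n] by (simp add: int_pow_int)
  next
  case (neg n)
  have "b [^] m = inv (b [^] Suc n)" unfolding neg int_pow_neg[OF bC] int_pow_int ..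
  hence "u (b [^] m) * u (b [^] Suc n) = 1"
  using u(1)[of "inv (b [^] Suc n)" "b [^] Suc n"] bC u1 by simp
  hence "u (b [^] m) = inverse (cis (2 * pi * (of_nat (Suc n) * r)))"
  unfolding nat by (metis inverse_unique mult.commute)
  also have "\<dots> = cis (2 * pi * (of_int m * r))"
  unfolding cis_inverse neg by (rule arg_cong[of _ _ cis]) (simp add: algebra_simps)
  finally show ?thesis .
  qed
 qed
 have "add_hom G D' f'" unfolding add_hom_def
 proof (intro ballI)
  fix x y assume xy: "x:D'" "y:D'"
  have "f (p x \<otimes> p y) = f (p x) + f (p y)" using f(1) pD[OF xy(1)] pD[OF xy(2)] unfolding add_hom_def D_def by blast
  thus "f' (x \<otimes> y) = f' x + f' y" unfolding f'_def p_mult[OF xy] t_add[OF xy] by (simp add: distrib_right)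
 qed
 moreover have "f' x = f x" if x: "x:D" for x
  unfolding f'_def p_def t_def kD[OF x] using cD[OF x] by simp
 moreover have "cis (2 * pi * f' x) = u x" if x: "x:D'" for x
 proof -
  have "u x = u (p x) * u (b [^] t x)"
  using u(1)[of "p x" "b [^] t x"] cD[OF pD[OF x]] bC p_inv[OF x] by simp
  also have "\<dots> = cis (2 * pi * f' x)"
  unfolding upow f(2)[OF pD[OF x, unfolded D_def], symmetric] f'_def by (simp add: cis_mult distrib_left)
  finally show ?thesis ..
 qed
 ultimately show "EX f'. add_hom G (sat G (insert a (B Un S))) f' & (ALL x:sat G (B Un S). f' x = f x)
  & (ALL x:sat G (insert a (B Un S)). cis (2 * pi * f' x) = u x)"
  unfolding D_def D'_def by (intro exI[of _ f']) blast
qed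

text \<open>The multiplicities \<open>k\<close> of an element in the first direction give an integer valued
 homomorphism, which extends because it is a lift of the trivial homomorphism.\<close>

lemma exists_integer_hom:
 assumes cnt: "countable (carrier G)" and B: "subgroup B G" "sat G B = B"
  and bounded: "!!S. finite S ==> S <= carrier G ==>
  EX M>0. ALL x:sat G (B Un S). x [^] (M::int):generate G (B Un S)"
  and a: "a:carrier G" "a \<notin> B"
 shows "EX h. add_hom G (carrier G) h & (ALL x:carrier G. h x:\<int>) & h a ~= 0"
proof -
 have BC: "B <= carrier G" using subgroup.subset[OF B(1)] .
 have aB: "insert a B <= carrier G" using BC a by blast
 define D where "D = sat G (insert a B)"
 have sgD: "subgroup D G" unfolding D_def by (rule saturation_subgroup[OF aB])
 note mD = subgroup.m_closed[OF sgD] and cD = subgroup.mem_carrier[OF sgD]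
 have genB: "generate G B = B"
  using generate_subgroup_incl[OF order_refl B(1)] by (auto intro: generate.incl)
 obtain M :: int where M: "M > 0" "!!x. x:D ==> x [^] M:generate G (insert a B)"
  using bounded[of "{a}"] a unfolding D_def by auto
 define k where "k x = (THE m. EX d:B. x [^] M = d \<otimes> a [^] (m::int))" for x
 have k_eq: "k x = m" if "d:B" "x [^] M = d \<otimes> a [^] m" for x d and m :: int
  unfolding k_def
 proof (rule the_equality)
  show "EX d:B. x [^] M = d \<otimes> a [^] m" using that by blast
  fix m' :: int assume "EX d:B. x [^] M = d \<otimes> a [^] (m'::int)"
  then obtain d' where d': "d':B" "x [^] M = d' \<otimes> a [^] m'" by blast
  have e: "d \<otimes> a [^] m = d' \<otimes> a [^] m'" using that(2) d'(2) by simp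
  have dC: "d:carrier G" "d':carrier G" using BC that(1) d'(1) by auto
  have "a [^] (m' - m) = inv d' \<otimes> (d' \<otimes> a [^] m') \<otimes> inv (a [^] m)"
  using dC a(1) by (simp add: int_pow_diff m_assoc[symmetric])
  also have "\<dots> = inv d' \<otimes> d" unfolding e[symmetric] using dC a(1) by (simp add: m_assoc)
  finally have "a [^] (m' - m):B"
  using subgroup.m_closed[OF B(1) subgroup.m_inv_closed[OF B(1) d'(1)] that(1)] by simp
  thus "m' = m" using int_pow_mem_saturation[OF a(1) _ BC] a(2) B(2) by fastforce
 qed
 have k_ex: "EX d:B. x [^] M = d \<otimes> a [^] k x" if x: "x:D" for x
 proof -
  obtain d m where d: "d:B" "x [^] M = d \<otimes> a [^] (m::int)"
  using M(2)[OF x] unfolding generate_insert[OF BC a(1)] genB by blast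
  thus ?thesis using k_eq by metis
 qed
 have k_add: "k (x \<otimes> y) = k x + k y" if xy: "x:D" "y:D" for x y
 proof -
  obtain d where d: "d:B" "x [^] M = d \<otimes> a [^] k x" using k_ex[OF xy(1)] by blast
  obtain d' where d': "d':B" "y [^] M = d' \<otimes> a [^] k y" using k_ex[OF xy(2)] by blast
  have c: "x:carrier G" "y:carrier G" "d:carrier G" "d':carrier G" using cD xy BC d d' by auto
  have "(x \<otimes> y) [^] M = (d \<otimes> d') \<otimes> a [^] (k x + k y)"
  using c a(1) by (simp add: int_pow_distrib d(2) d'(2) int_pow_mult m_ac)
  thus ?thesis using k_eq subgroup.m_closed[OF B(1) d(1) d'(1)] by blast
 qed
 have aD: "a:D" unfolding D_def using saturation_incl[OF aB] by (auto intro: generate.incl)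
 have ka: "k a = M" using k_eq[of \<one> a M] subgroup.one_closed[OF B(1)] a(1) by simp
 have satD: "sat G D = D"
 proof
  show "sat G D <= D"
  proof
  fix x assume "x:sat G D"
  then obtain j :: int where j: "x:carrier G" "j > 0" "x [^] j:generate G D" unfolding sat_def by blast
  moreover have "generate G D = D"
  using generate_subgroup_incl[OF order_refl sgD] by (auto intro: generate.incl)
  ultimately show "x:D" using saturation_pure unfolding D_def by blast
  qed
  show "D <= sat G D" using saturation_incl[of D] subgroup.subset[OF sgD] by (auto intro: generate.incl)
 qed
 have "EX f. add_hom G (carrier G) f & (ALL x:sat G D. f x = of_int (k x))
  & (ALL x:carrier G. cis (2 * pi * f x) = (%_. 1) x)"
 proof (rule lift_circle_hom[OF cnt sgD])
  fix S assume S: "finite S" "S <= carrier G"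
  \<comment> \<open>The bound is given only for \<open>B\<close> with a finite set adjoined, so
    \<open>D\<close> is replaced by \<open>B\<close> with \<open>a\<close>, which has the same
    saturation.\<close>
  obtain N :: int where N: "N > 0" "!!x. x:sat G (B Un insert a S) ==> x [^] N:generate G (B Un insert a S)"
  using bounded[of "insert a S"] S a by auto
  have sub: "B Un insert a S <= D Un S"
  using aD saturation_incl[OF aB] generate.incl[of _ "insert a B" G] unfolding D_def by auto
  have BS: "B Un insert a S <= carrier G" using BC S a by blast
  have DS: "D <= sat G (B Un insert a S)" unfolding D_def by (rule saturation_mono) blast
  have SS: "S <= sat G (B Un insert a S)" using saturation_incl[OF BS] generate.incl[of _ "B Un insert a S" G] by auto
  have gDS: "generate G (D Un S) <= sat G (B Un insert a S)"
  by (rule generate_subgroup_incl[OF _ saturation_subgroup[OF BS]]) (use DS SS in blast)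
  have "x [^] N:generate G (D Un S)" if x: "x:sat G (D Un S)" for x
  proof -
  obtain j :: int where j: "x:carrier G" "j > 0" "x [^] j:generate G (D Un S)"
  using x unfolding sat_def by blast
  hence "x:sat G (B Un insert a S)" using saturation_pure gDS by blast
  thus ?thesis using N(2) mono_generate[OF sub] by blast
  qed
  thus "EX M>0. ALL x:sat G (D Un S). x [^] (M::int):generate G (D Un S)" using N(1) by blast
 next
  show "add_hom G (sat G D) (%x. of_int (k x))" unfolding satD add_hom_def using k_add by simp
  show "cis (2 * pi * of_int (k x)) = 1" for x by (rule cis_multiple_2pi) simp
 qed auto
 then obtain h where h: "add_hom G (carrier G) h" "!!x. x:D ==> h x = of_int (k x)"
  "!!x. x:carrier G ==> cis (2 * pi * h x) = 1" unfolding satD by auto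
 have "h x:\<int>" if "x:carrier G" for x
 proof -
  have "cos (2 * pi * h x) = 1" using h(3)[OF that] by (metis cis.simps(1) one_complex.simps(1))
  then obtain n :: int where "2 * pi * h x = of_int n * 2 * pi" using cos_one_2pi_int by blast
  hence "h x = of_int n" by simp
  thus ?thesis by simp
 qed
 moreover have "h a ~= 0" using h(2)[OF aD] ka M(1) by simp
 ultimately show ?thesis using h(1) by blast
qed

end

section \<open>Multiplicative groups of abelian extensions\<close>

context algebraic_numbers
begin

abbreviation MM where "MM \<equiv> mult_of L"

sublocale mg: comm_group "mult_of L"
proof -
 have "mult_of L = units_of L" unfolding mult_of_def units_of_def field_Units by simp
 thus "comm_group (mult_of L)" using units_comm_group by simp
qed

abbreviation mmult (infixl "*M" 70) where "x *M y == x \<otimes>\<^bsub>MM\<^esub> y"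
abbreviation minv ("minv _" [81] 80) where "minv x == inv\<^bsub>MM\<^esub> x"
abbreviation mpow (infixr "[^M]" 75) where "x [^M] k == x [^]\<^bsub>MM\<^esub> k"

lemma galois_inverse:
 assumes "K <= carrier L" "al:carrier (galois_group L K)"
 defines "bt \<equiv> inv\<^bsub>galois_group L K\<^esub> al"
 shows "bt:carrier (galois_group L K)" "!!x. x:carrier L ==> bt (al x) = x"
  "!!x. x:carrier L ==> al (bt x) = x"
proof -
 interpret g: group "galois_group L K" using group_galois_group[OF assms(1)] .
 show bt: "bt:carrier (galois_group L K)" unfolding bt_def using assms(2) by simp
 fix x assume x: "x:carrier L"
 have "(bt \<otimes>\<^bsub>galois_group L K\<^esub> al) x = x" "(al \<otimes>\<^bsub>galois_group L K\<^esub> bt) x = x"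
  using assms(2) x unfolding bt_def by (auto simp: galois_group_one)
 thus "bt (al x) = x" "al (bt x) = x"
  using galois_group_mult[OF bt assms(2)] galois_group_mult[OF assms(2) bt] x by (auto simp: compose_eq)
qed

lemma galois_compose:
 assumes "K <= carrier L" "al:carrier (galois_group L K)" "bt:carrier (galois_group L K)"
 shows "compose (carrier L) al bt:carrier (galois_group L K)"
proof -
 interpret g: group "galois_group L K" using group_galois_group[OF assms(1)] .
 show ?thesis using g.m_closed[OF assms(2,3)] galois_group_mult[OF assms(2,3)] by simp
qed

lemma Aut_closed [simp]: "al:Aut ==> x:carrier L ==> al x:carrier L"
 by (rule galois_group_closed)

lemma Aut_simps:
 assumes "al:Aut"
 shows "al \<one> = \<one>" "al \<zero> = \<zero>"
  "!!x y. x:carrier L ==> y:carrier L ==> al (x \<otimes> y) = al x \<otimes> al y"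
  "!!x y. x:carrier L ==> y:carrier L ==> al (x \<oplus> y) = al x \<oplus> al y"
  "!!x. x:carrier L ==> al x = \<zero> <-> x = \<zero>"
  "!!x n. x:carrier L ==> al (x [^] (n::nat)) = al x [^] n"
  "inj_on al (carrier L)"
proof -
 note h = Aut_hom(1)[OF assms]
 show one: "al \<one> = \<one>" using ring_hom_one[OF h] .
 show zero: "al \<zero> = \<zero>" using ring_hom_zero[OF h ring_axioms ring_axioms] .
 show mult: "!!x y. x:carrier L ==> y:carrier L ==> al (x \<otimes> y) = al x \<otimes> al y"
  using ring_hom_mult[OF h] .
 show "!!x y. x:carrier L ==> y:carrier L ==> al (x \<oplus> y) = al x \<oplus> al y"
  using ring_hom_add[OF h] .
 show inj: "inj_on al (carrier L)"
  using assms unfolding carrier_galois_group Bij_def bij_betw_def by blast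
 show "al x = \<zero> <-> x = \<zero>" if "x:carrier L" for x
  using inj_onD[OF inj, of x \<zero>] zero that by auto
 show "al (x [^] n) = al x [^] n" if "x:carrier L" for x and n :: nat
  by (induction n) (auto simp: one mult that assms)
qed

lemma Aut_mult_hom: "al:Aut ==> al:hom MM MM"
 by (intro homI) (auto simp: Aut_simps)

lemma Aut_int_pow:
 assumes "al:Aut" "x:carrier L - {\<zero>}"
 shows "al (x [^M] (k::int)) = al x [^M] k"
 using hom_int_pow[OF Aut_mult_hom[OF assms(1)] _ mg.is_group mg.is_group] assms(2) by simp

definition enum where "enum = from_nat_into (carrier L)"

text \<open>Finite sets of nonzero numbers, stable under all automorphisms, that exhaust the nonzero
  elements of \<open>L\<close>. They stand for the finite normal extensions Q(R n) of the rationals;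
  \<open>Gm n\<close> is the absolute Galois group of Q(R n).\<close>

definition R :: "nat => 'a set" where "R n = {al (enum k) | k al. k < n & al:Aut} - {\<zero>}"

definition Gm :: "nat => ('a => 'a) set" where "Gm n = {al:Aut. ALL x:R n. al x = x}"

lemma enum: "enum k:carrier L"
 unfolding enum_def by (rule from_nat_into) auto

lemma R_finite: "finite (R n)"
proof -
 have "{al (enum k) | k al. k < n & al:Aut} = (\<Union>k<n. {al (enum k) | al. al:Aut})" by blast
 thus ?thesis unfolding R_def using finite_orbit[OF enum] by simp
qed

lemma R_carrier: "x:R n ==> x:carrier L" "x:R n ==> x ~= \<zero>"
 unfolding R_def using Aut_closed[OF _ enum] by auto

lemma R_mono: "m <= n ==> R m <= R n"
 unfolding R_def using less_le_trans by blast

lemma id_Aut: "(\<lambda>x\<in>carrier L. x):Aut"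
proof -
 interpret g: group "galois_group L prime_field" using group_galois_group[OF prime_field_carrier] .
 show ?thesis using g.one_closed unfolding galois_group_one .
qed

lemma R_exhaust: "x:carrier L ==> x ~= \<zero> ==> EX n. x:R n"
proof -
 assume x: "x:carrier L" "x ~= \<zero>"
 obtain k where "enum k = x" unfolding enum_def using from_nat_into_surj[OF countable_carrier x(1)] by blast
 hence "(\<lambda>x\<in>carrier L. x) (enum k) = x" using x by simp
 hence "x:R (Suc k)" unfolding R_def using x id_Aut by fastforce
 thus ?thesis by blast
qed

lemma R_exhaust_finite:
 assumes "finite S" "S <= carrier L - {\<zero>}"
 shows "EX m>=n. S <= R m"
 using assms
proof (induction S)
 case (insert x S)
 then obtain m where m: "m >= n" "S <= R m" by auto
 obtain k where "x:R k" using R_exhaust insert.prems by blast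
 hence "insert x S <= R (max m k)" using m R_mono[of m "max m k"] R_mono[of k "max m k"] by auto
 thus ?case using m(1) by (intro exI[of _ "max m k"]) auto
qed auto

lemma R_stable: "al:Aut ==> x:R n ==> al x:R n"
proof -
 assume a: "al:Aut" "x:R n"
 then obtain k bt where b: "x = bt (enum k)" "k < n" "bt:Aut" unfolding R_def by blast
 have "al x = compose (carrier L) al bt (enum k)" unfolding b(1) by (simp add: compose_eq enum)
 moreover have "compose (carrier L) al bt:Aut" using galois_compose[OF prime_field_carrier a(1) b(3)] .
 moreover have "al x ~= \<zero>" using Aut_simps(5)[OF a(1)] R_carrier[OF a(2)] by simp
 ultimately show ?thesis unfolding R_def using b(2) by auto
qed

lemma R_image: "al:Aut ==> al ` R n = R n"
proof (rule endo_inj_surj[OF R_finite])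
 assume al: "al:Aut"
 show "al ` R n <= R n" using R_stable[OF al] by blast
 show "inj_on al (R n)" using Aut_simps(7)[OF al] R_carrier(1) by (auto intro: inj_on_subset)
qed

lemma GmD: "al:Gm n ==> al:Aut" "al:Gm n ==> x:R n ==> al x = x"
 unfolding Gm_def by auto

text \<open>The coefficients are formed from the roots by ring operations, so they lie in
  \<open>A\<close> and commute with every homomorphism on \<open>A\<close>. The subring is kept
  general: \<open>A\<close> is all of \<open>L\<close> for rationality over Q, and it is F when only
  automorphisms of F over K are at hand.\<close>

lemma exists_coeffs:
 assumes A: "subring A L" and Y: "finite Y" "Y <= A"
 shows "EX c. ALL i. c i:A & Polynomial.coeff (\<Prod>x\<in>Y. [:- ph x, 1:]) i = ph (c i)
  & (ALL tu. tu:ring_hom (L\<lparr>carrier := A\<rparr>) L -->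
  Polynomial.coeff (\<Prod>x\<in>Y. [:- ph (tu x), 1:]) i = ph (tu (c i)))"
 using Y
proof (induction Y)
 case empty
 note Az = subringE(2,3)[OF A]
 have ta: "tu \<one> = \<one>" "tu \<zero> = \<zero>" if "tu:ring_hom (L\<lparr>carrier := A\<rparr>) L" for tu
  using ring_hom_one[OF that] ring_hom_zero[OF that subring_is_ring[OF A] ring_axioms] by auto
 show ?case
  using Az ta by (intro exI[of _ "%i. if i = 0 then \<one> else \<zero>"]) (auto simp: ph_simps(1,2) coeff_1 ta simp del: One_nat_def)
next
 case (insert y Y)
 hence "Y <= A" by blast
 from insert.IH[OF this] obtain c where c0: "ALL i. c i:A & Polynomial.coeff (\<Prod>x\<in>Y. [:- ph x, 1:]) i = ph (c i)
  & (ALL tu. tu:ring_hom (L\<lparr>carrier := A\<rparr>) L -->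
  Polynomial.coeff (\<Prod>x\<in>Y. [:- ph (tu x), 1:]) i = ph (tu (c i)))" ..
 hence c: "!!i. c i:A" "!!i. Polynomial.coeff (\<Prod>x\<in>Y. [:- ph x, 1:]) i = ph (c i)"
  "!!i tu. tu:ring_hom (L\<lparr>carrier := A\<rparr>) L ==> Polynomial.coeff (\<Prod>x\<in>Y. [:- ph (tu x), 1:]) i = ph (tu (c i))"
  by auto
 note Ar = subringE[OF A]
 have AL: "a:A ==> a:carrier L" for a using Ar(1) by blast
 have y: "y:A" using insert.prems by blast
 define c' where "c' i = \<ominus> y \<otimes> c i \<oplus> (if i = 0 then \<zero> else c (i - 1))" for i
 have t: "\<ominus> y \<otimes> c i:A" "(if i = 0 then \<zero> else c (i - 1)):A" for i
  using Ar(2,5,6) c(1) y by auto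
 have cA: "c' i:A" for i unfolding c'_def using Ar(7)[OF t] .
 have cL: "ph (c' i) = - ph y * ph (c i) + (if i = 0 then 0 else ph (c (i - 1)))" for i
  unfolding c'_def using t[of i] AL c(1) y by (auto simp: ph_simps)
 have coeff_insert: "Polynomial.coeff (\<Prod>x\<in>insert y Y. [:- f x, 1:]) i
  = - f y * Polynomial.coeff (\<Prod>x\<in>Y. [:- f x, 1:]) i
  + (if i = 0 then 0 else Polynomial.coeff (\<Prod>x\<in>Y. [:- f x, 1:]) (i - 1))" for f :: "'a => complex" and i
  using insert.hyps by (simp add: mult_pCons_left coeff_pCons split: nat.split)
 have "Polynomial.coeff (\<Prod>x\<in>insert y Y. [:- ph (tu x), 1:]) i = ph (tu (c' i))"
  if tu: "tu:ring_hom (L\<lparr>carrier := A\<rparr>) L" for tu i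
 proof -
  note h = ring_hom_mult[OF tu] ring_hom_add[OF tu] ring_hom_zero[OF tu subring_is_ring[OF A] ring_axioms]
  have cl: "tu a:carrier L" if "a:A" for a using ring_hom_closed[OF tu] that by simp
  have "tu y \<oplus> tu (\<ominus> y) = \<zero>" using h(2)[of y "\<ominus> y"] h(3) y Ar(5) AL by (simp add: r_neg)
  hence neg: "ph (tu (\<ominus> y)) = - ph (tu y)"
  using ph_simps(4)[of "tu y" "tu (\<ominus> y)"] cl y Ar(5) ph_simps(2) by (simp add: eq_neg_iff_add_eq_0 add.commute)
  have "tu (c' i) = tu (\<ominus> y) \<otimes> tu (c i) \<oplus> (if i = 0 then \<zero> else tu (c (i - 1)))"
  unfolding c'_def using h(1)[of "\<ominus> y" "c i"] h(2)[of "\<ominus> y \<otimes> c i" "if i = 0 then \<zero> else c (i - 1)"] h(3) t[of i] c(1) y Ar(5)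
  by (auto split: if_splits)
  hence "ph (tu (c' i)) = - ph (tu y) * ph (tu (c i)) + (if i = 0 then 0 else ph (tu (c (i - 1))))"
  using cl c(1) y Ar(5) neg by (simp add: ph_simps)
  thus ?thesis unfolding coeff_insert[of "%x. ph (tu x)"] c(3)[OF tu] by simp
 qed
 thus ?case
  using cA cL coeff_insert[of ph] c(2) by (intro exI[of _ c']) auto
qed

lemma Aut_ring_hom_carrier: "al:Aut ==> al:ring_hom (L\<lparr>carrier := carrier L\<rparr>) L"
 using Aut_hom(1) by (simp add: ring_hom_def)

text \<open>Every automorphism permutes the finite set \<open>Y\<close>, so it fixes the
  coefficients; elements fixed by all automorphisms are rational.\<close>

lemma coeff_stable_rational:
 assumes Y: "finite Y" "Y <= carrier L" and stable: "!!al x. al:Aut ==> x:Y ==> al x:Y"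
 shows "Polynomial.coeff (\<Prod>x\<in>Y. [:- ph x, 1:]) i:\<rat>"
proof -
 obtain c where c: "!!i. c i:carrier L" "!!i. Polynomial.coeff (\<Prod>x\<in>Y. [:- ph x, 1:]) i = ph (c i)"
  "!!al i. al:Aut ==> Polynomial.coeff (\<Prod>x\<in>Y. [:- ph (al x), 1:]) i = ph (al (c i))"
  using exists_coeffs[OF carrier_is_subring Y] Aut_ring_hom_carrier by metis
 have "al (c i) = c i" if al: "al:Aut" for al
 proof -
  have inj: "inj_on al Y" using Aut_simps(7)[OF al] Y(2) by (rule inj_on_subset)
  hence "al ` Y = Y" using stable[OF al] Y(1) by (intro endo_inj_surj) auto
  hence "(\<Prod>x\<in>Y. [:- ph x, 1:]) = (\<Prod>x\<in>Y. [:- ph (al x), 1:])"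
  using prod.reindex[OF inj, of "%x. [:- ph x, 1:]"] by simp
  hence "ph (al (c i)) = ph (c i)" using c(2)[of i] c(3)[OF al, of i] by simp
  thus ?thesis using ph_inj c(1) al by simp
 qed
 thus ?thesis using Aut_fixed_rational[OF c(1)] c(2) by simp
qed

lemma root_of_unity_in_image:
 assumes "z ^ N = 1" "N > 0"
 shows "EX x:carrier L. ph x = z"
proof -
 define q where "q = \<one> # replicate (N - 1) \<zero> @ [\<ominus> \<one>]"
 have q: "q:carrier (poly_ring L)" "q ~= []"
  unfolding q_def univ_poly_carrier[symmetric] polynomial_def by (auto simp: set_replicate_conv_if)
 have "hom_poly ph q = Polynomial.monom 1 N - 1"
  unfolding q_def using hom_poly_replicate[OF ph_hom, of "N - 1" "[\<ominus> \<one>]"] assms(2)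
  by (simp add: ph_simps one_pCons monom_0 minus_pCons)
 hence "poly (hom_poly ph q) z = 0" using assms(1) by (simp add: poly_monom)
 thus ?thesis using hom_poly_root_in_image[OF ph_hom q] by blast
qed

text \<open>If the orbit of a primitive root \<open>ze\<close> missed \<open>ze [^] p\<close>, the
  roots of unity outside the orbit would form a stable set with integral polynomial containing
  \<open>ze [^] p\<close> but not \<open>ze\<close>. By \<open>cyclotomic_prime_dvd\<close>, p would
  divide N.\<close>

lemma exists_frobenius:
 fixes N :: nat
 assumes p: "prime p" "\<not> p dvd N" and N: "N > 0"
 shows "EX al:Aut. ALL z:carrier L. z [^] N = \<one> --> al z = z [^] p"
proof -
 have "cis (2 * pi / real N) ^ N = 1" using N by (simp add: Complex.DeMoivre)
 then obtain ze where ze: "ze:carrier L" "ph ze = cis (2 * pi / real N)"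
  using root_of_unity_in_image N by blast
 have phN: "x [^] N = \<one> <-> ph x ^ N = 1" if "x:carrier L" for x
  using ph_inj[of "x [^] N" \<one>] that ph_simps by (metis nat_pow_closed one_closed)
 have gen: "EX k::nat. z = ze [^] k" if z: "z:carrier L" "z [^] N = \<one>" for z
 proof -
  have "ph z:{z. z ^ N = 1}" using phN z by simp
  then obtain k where "ph z = cis (2 * pi * real k / real N)"
  using bij_betw_imp_surj_on[OF Complex.bij_betw_roots_unity[OF N]] by blast
  also have "\<dots> = ph ze ^ k" unfolding ze(2) by (simp add: Complex.DeMoivre mult.commute)
  also have "\<dots> = ph (ze [^] k)" using ph_simps(6)[OF ze(1)] by simp
  finally show ?thesis using ph_inj z(1) ze(1) by (metis nat_pow_closed)
 qed
 have zeN: "ze [^] N = \<one>" using phN[OF ze(1)] ze(2) \<open>cis (2 * pi / real N) ^ N = 1\<close> by simp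
 have "EX al:Aut. al ze = ze [^] p"
 proof (rule ccontr)
  assume contr: "\<not> ?thesis"
  define U where "U = {z:carrier L. z [^] N = \<one>}"
  define \<Omega> where "\<Omega> = {al ze | al. al:Aut}"
  have ze\<Omega>: "ze:\<Omega>" unfolding \<Omega>_def using id_Aut ze(1) by (auto intro!: exI[of _ "\<lambda>x\<in>carrier L. x"])
  have "ph ` U <= {z. z ^ N = 1}" unfolding U_def using phN by auto
  moreover have injU: "inj_on ph A" if "A <= carrier L" for A using that by (auto intro!: inj_onI ph_inj)
  moreover have "finite {z::complex. z ^ N = 1}" using finite_roots_unity[of N] N by simp
  ultimately have "finite (ph ` U)" using finite_subset by blast
  moreover have "inj_on ph U" by (rule injU) (auto simp: U_def)
  ultimately have finU: "finite U" by (rule finite_imageD)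
  have stU: "al x:U" if "al:Aut" "x:U" for al x
  proof -
  have x: "x:carrier L" "x [^] N = \<one>" using that(2) unfolding U_def by auto
  hence "al x [^] N = \<one>" using Aut_simps(6)[OF that(1) x(1), of N] Aut_simps(1)[OF that(1)] by simp
  thus ?thesis unfolding U_def using Aut_closed[OF that(1) x(1)] by simp
  qed
  have st: "al x:U - \<Omega>" if al: "al:Aut" and x: "x:U - \<Omega>" for al x
  proof -
  have "al x \<notin> \<Omega>"
  proof
  assume "al x:\<Omega>"
  then obtain bt where bt: "bt:Aut" "al x = bt ze" unfolding \<Omega>_def by blast
  note ia = galois_inverse[OF prime_field_carrier al]
  have "x = compose (carrier L) (inv\<^bsub>galois_group L prime_field\<^esub> al) bt ze"
  using ia(2)[of x] x bt(2) ze(1) by (simp add: compose_eq U_def)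
  thus False using x galois_compose[OF prime_field_carrier ia(1) bt(1)] unfolding \<Omega>_def by blast
  qed
  thus ?thesis using stU al x by blast
  qed
  have finD: "finite (U - \<Omega>)" "U - \<Omega> <= carrier L" using finU unfolding U_def by auto
  define B where "B = ph ` (U - \<Omega>)"
  have PB: "(\<Prod>w\<in>B. [:- w, 1:]) = (\<Prod>x\<in>U - \<Omega>. [:- ph x, 1:])"
  unfolding B_def using prod.reindex[OF injU[OF finD(2)], of "%w. [:- w, 1:]"] by simp
  have algB: "algebraic_int (ph x)" if "x:U" for x
  using algebraic_int_nth_root[of "ph x" N] phN that N unfolding U_def by auto
  have "p dvd N"
  proof (rule cyclotomic_prime_dvd[OF p(1) N, of "ph ze" B])
  show "ph ze ^ N = 1" using phN[OF ze(1)] zeN by simp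
  show "ph ze \<notin> B"
  proof
  assume "ph ze:B"
  then obtain x where "x:U - \<Omega>" "ph ze = ph x" unfolding B_def by blast
  thus False using ph_inj[of ze x] ze(1) ze\<Omega> unfolding U_def by auto
  qed
  show "B <= {w. w ^ N = 1}" unfolding B_def U_def using phN by auto
  have "ze [^] p:U" unfolding U_def using ze(1) zeN by (simp add: nat_pow_pow) (metis mult.commute nat_pow_one nat_pow_pow)
  moreover have "ze [^] p \<notin> \<Omega>"
  proof
  assume "ze [^] p:\<Omega>"
  then obtain al where "al:Aut" "ze [^] p = al ze" unfolding \<Omega>_def by auto
  thus False using contr by auto
  qed
  ultimately show "ph ze ^ p:B" unfolding B_def using ph_simps(6)[OF ze(1)] by (metis DiffI imageI)
  show "Polynomial.coeff (\<Prod>w\<in>B. [:- w, 1:]) i:\<int>" for i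
  proof -
  have "algebraic_int (Polynomial.coeff (\<Prod>w\<in>B. [:- w, 1:]) i)"
  unfolding PB using algB by (intro algebraic_int_coeff_prod) blast
  moreover have "Polynomial.coeff (\<Prod>w\<in>B. [:- w, 1:]) i:\<rat>"
  unfolding PB by (rule coeff_stable_rational[OF finD]) (rule st)
  ultimately show ?thesis by (rule rational_algebraic_int_is_int)
  qed
  qed
  thus False using p(2) by blast
 qed
 then obtain al where al: "al:Aut" "al ze = ze [^] p" by blast
 have "al z = z [^] p" if z: "z:carrier L" "z [^] N = \<one>" for z
 proof -
  obtain k :: nat where "z = ze [^] k" using gen[OF z] by blast
  thus ?thesis using Aut_simps(6)[OF al(1) ze(1)] al(2) ze(1) by (simp add: nat_pow_pow mult.commute)
 qed
 thus ?thesis using al(1) by blast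
qed

end

lemma (in comm_group) int_pow_combine:
 assumes "x:carrier G" "w:carrier G" "v:carrier G"
 shows "(x [^] (a::int) \<otimes> w) [^] (k::int) \<otimes> (x [^] (b::int) \<otimes> v) [^] (l::int)
  = x [^] (a * k + b * l) \<otimes> (w [^] k \<otimes> v [^] l)"
 using assms by (simp add: int_pow_distrib int_pow_pow int_pow_mult m_ac)

section \<open>Kummer exponents and Frobenius automorphisms\<close>

context algebraic_numbers
begin

definition mu :: "'a set" where "mu = {z:carrier L. EX n>0. z [^] (n::nat) = \<one>}"

lemma pow_nonzero: "x:carrier L ==> x ~= \<zero> ==> x [^] (n::nat) ~= \<zero>"
 by (induction n) (auto simp: integral_iff)

lemma Aut_funpow:
 assumes "al:Aut"
 shows "(\<lambda>x\<in>carrier L. (al ^^ n) x):Aut" "x:carrier L ==> (al ^^ n) x:carrier L"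
proof -
 show c: "(al ^^ n) x:carrier L" if "x:carrier L" for x
  using that assms by (induction n) auto
 show "(\<lambda>x\<in>carrier L. (al ^^ n) x):Aut"
 proof (induction n)
  case 0
  thus ?case using id_Aut by (simp add: restrict_def)
 next
  case (Suc n)
  have "(\<lambda>x\<in>carrier L. (al ^^ Suc n) x) = compose (carrier L) al (\<lambda>x\<in>carrier L. (al ^^ n) x)"
  by (auto simp: compose_def fun_eq_iff)
  thus ?case using galois_compose[OF prime_field_carrier assms Suc] by (simp only:)
 qed
qed

text \<open>Every point has a period of at most \<open>card A\<close>, and all these periods divide
  the factorial. So the exponent depends on the size of the set alone, not on
  \<open>f\<close>.\<close>

lemma funpow_fact_fixed:
 assumes A: "finite A" "f ` A <= A" "inj_on f A" and x: "x:A"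
 shows "(f ^^ fact (card A)) x = x"
proof -
 have mem: "(f ^^ n) y:A" if "y:A" for n y using that A(2) by (induction n) auto
 have "\<not> inj_on (%n. (f ^^ n) x) {..card A}"
 proof
  assume "inj_on (%n. (f ^^ n) x) {..card A}"
  hence "card {..card A} <= card A"
  using mem[OF x] by (intro card_inj_on_le[OF _ _ A(1)]) auto
  thus False by simp
 qed
 then obtain i j where ij: "i < j" "j <= card A" "(f ^^ i) x = (f ^^ j) x"
  unfolding inj_on_def by (metis atMost_iff linorder_neqE_nat)
 have injn: "inj_on (f ^^ n) A" for n
 proof (induction n)
  case (Suc n)
  have "inj_on (f \<circ> (f ^^ n)) A"
  using Suc mem A(3) by (intro comp_inj_on) (auto intro: inj_on_subset)
  thus ?case by (simp add: comp_def)
 qed simp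
 have "(f ^^ i) ((f ^^ (j - i)) x) = (f ^^ i) x"
  using ij funpow_add[of i "j - i" f] by simp
 hence *: "(f ^^ (j - i)) x = x" using injn mem[OF x] x by (meson inj_onD)
 have "(j - i) dvd fact (card A)" using ij by (intro dvd_fact) auto
 then obtain k where "fact (card A) = (j - i) * k" by (rule dvdE)
 moreover have "(f ^^ ((j - i) * k)) x = x"
 proof (induction k)
  case (Suc k)
  have "(f ^^ ((j - i) * Suc k)) x = (f ^^ ((j - i) * k)) ((f ^^ (j - i)) x)"
  using funpow_add[of "(j - i) * k" "j - i" f] by (simp add: add.commute)
  thus ?case using Suc * by simp
 qed simp
 ultimately show ?thesis by simp
qed

text \<open>A single exponent moves every automorphism into \<open>Gm m\<close>. Since it is the
  same for all Frobenius automorphisms, the final Kummer exponent does not depend on the order of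
  the roots of unity involved.\<close>

lemma fact_power_in_Gm:
 assumes "al:Aut"
 shows "(\<lambda>x\<in>carrier L. (al ^^ fact (card (R m))) x):Gm m"
proof -
 have "inj_on al (R m)" using Aut_simps(7)[OF assms] R_carrier(1) by (auto intro: inj_on_subset)
 hence "(al ^^ fact (card (R m))) x = x" if "x:R m" for x
  using funpow_fact_fixed[OF R_finite _ _ that] R_image[OF assms] by blast
 thus ?thesis unfolding Gm_def using Aut_funpow(1)[OF assms] R_carrier by simp
qed

lemma field_cancel:
 assumes "a:carrier L" "b:carrier L" "c:carrier L" "c ~= \<zero>" "a \<otimes> c = b \<otimes> c"
 shows "a = b"
 using assms m_rcancel by blast

text \<open>A Frobenius power \<open>et\<close> in \<open>Gm m\<close> acts on the relevant roots of unity by \<open>q\<close>-th powers. Comparing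
 \<open>et tu y\<close> with \<open>tu et y\<close> shows that \<open>tu\<close> changes \<open>y ^ (q - 1)\<close> and \<open>om = et y / y\<close> by the same factor.\<close>

lemma kummer_power_prime:
 fixes N :: nat
 assumes p: "prime p" "\<not> p dvd N" and N: "N > 0"
  and y: "y:carrier L" "y ~= \<zero>" and fixed: "!!tu. tu:Gm m ==> tu (y [^] N) = y [^] N"
  and comm: "!!et tu. et:Gm m ==> tu:Gm m ==> et (tu y) = tu (et y)"
 shows "EX om:mu. ALL tu:Gm m. tu (y [^] (p ^ fact (card (R m)) - 1) \<otimes> om) = y [^] (p ^ fact (card (R m)) - 1) \<otimes> om"
proof -
 define D where "D = (fact (card (R m)) :: nat)"
 define q where "q = p ^ D"
 have q1: "q >= 1" unfolding q_def using prime_gt_0_nat[OF p(1)] by (simp add: Suc_leI)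
 obtain al where al: "al:Aut" "!!z. z:carrier L ==> z [^] N = \<one> ==> al z = z [^] p"
  using exists_frobenius[OF p N] by blast
 define et where "et = (\<lambda>x\<in>carrier L. (al ^^ D) x)"
 have etGm: "et:Gm m" unfolding et_def D_def using fact_power_in_Gm[OF al(1)] .
 have powN: "(z [^] (k::nat)) [^] N = \<one>" if "z:carrier L" "z [^] N = \<one>" for z k
  using that by (metis mult.commute nat_pow_one nat_pow_pow)
 have etz: "et z = z [^] q" if z: "z:carrier L" "z [^] N = \<one>" for z
 proof -
  have "(al ^^ n) z = z [^] (p ^ n)" for n
  proof (induction n)
  case (Suc n)
  thus ?case using al(2)[of "z [^] (p ^ n)"] powN[OF z] z by (simp add: nat_pow_pow mult.commute)
  qed (use z in simp)
  thus ?thesis unfolding et_def q_def using z by simp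
 qed
 \<comment> \<open>The Kummer cocycle of \<open>y\<close>. Its values are \<open>N\<close>-th roots
   of unity, so \<open>et\<close> acts on them as the q-th power.\<close>
 define c where "c tu = tu y \<otimes> inv y" for tu
 have iy: "inv y:carrier L" "inv y ~= \<zero>" "y \<otimes> inv y = \<one>" using y field_Units by auto
 have c: "c tu:carrier L" "c tu ~= \<zero>" "tu y = c tu \<otimes> y" "c tu [^] N = \<one>" if tu: "tu:Gm m" for tu
 proof -
  note A = GmD(1)[OF tu]
  have ty: "tu y:carrier L" "tu y ~= \<zero>" using A y Aut_simps(5)[OF A] by auto
  show "c tu:carrier L" unfolding c_def using ty iy by simp
  show "c tu ~= \<zero>" unfolding c_def using ty iy by (simp add: integral_iff)
  show e: "tu y = c tu \<otimes> y" unfolding c_def using ty iy y by (simp add: m_assoc m_comm[of "inv y"])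
  have "c tu [^] N \<otimes> y [^] N = \<one> \<otimes> y [^] N"
  using fixed[OF tu] Aut_simps(6)[OF A y(1), of N] e y \<open>c tu : carrier L\<close> by (simp add: nat_pow_distrib)
  thus "c tu [^] N = \<one>"
  using field_cancel[of "c tu [^] N" \<one> "y [^] N"] y \<open>c tu : carrier L\<close> pow_nonzero[OF y] by simp
 qed
 define om where "om = c et"
 note om = c[OF etGm, folded om_def]
 have iom: "inv om:carrier L" "inv om ~= \<zero>" "om \<otimes> inv om = \<one>" "inv om \<otimes> om = \<one>" using om field_Units by auto
 have iomN: "inv om [^] N = \<one>"
 proof -
  have "(inv om \<otimes> om) [^] N = inv om [^] N \<otimes> om [^] N" using iom(1) om(1) by (rule nat_pow_distrib)
  thus ?thesis using iom om(4) by simp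
 qed
 \<comment> \<open>As \<open>tu\<close> multiplies y^(q-1) and \<open>om\<close> by the same factor,
   their quotient is fixed; hence the inverse of \<open>om\<close> is the witness.\<close>
 have "inv om:mu" unfolding mu_def using iom(1) iomN N by blast
 moreover have "tu (y [^] (q - 1) \<otimes> inv om) = y [^] (q - 1) \<otimes> inv om" if tu: "tu:Gm m" for tu
 proof -
  note A = GmD(1)[OF tu] and ctu = c[OF tu] and As = Aut_simps[OF GmD(1)[OF etGm]]
  have tom: "tu om:carrier L" "tu (inv om):carrier L" using A om(1) iom(1) by auto
  have tomi: "tu om \<otimes> tu (inv om) = \<one>" using Aut_simps(1,3)[OF A] om(1) iom by metis
  have "et (tu y) = (c tu [^] q \<otimes> om) \<otimes> y"
  using ctu As(3)[OF ctu(1) y(1)] etz[OF ctu(1,4)] om(1,3) y by (simp add: m_assoc)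
  moreover have "tu (et y) = (tu om \<otimes> c tu) \<otimes> y"
  using om(1,3) Aut_simps(3)[OF A om(1) y(1)] ctu tom y by (simp add: m_assoc)
  ultimately have "c tu [^] q \<otimes> om = tu om \<otimes> c tu"
  using comm[OF etGm tu] field_cancel[of "c tu [^] q \<otimes> om" "tu om \<otimes> c tu" y] ctu(1) om(1) tom y by simp
  moreover have "c tu [^] q = c tu [^] (q - 1) \<otimes> c tu" using q1 ctu(1) by (metis Suc_diff_1 Suc_le_lessD One_nat_def nat_pow_Suc)
  ultimately have "(c tu [^] (q - 1) \<otimes> om) \<otimes> c tu = tu om \<otimes> c tu"
  using ctu(1) om(1) by (simp add: m_ac)
  hence e: "c tu [^] (q - 1) \<otimes> om = tu om"
  using field_cancel[of "c tu [^] (q - 1) \<otimes> om" "tu om" "c tu"] ctu(1,2) om(1) tom by simp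
  have "c tu [^] (q - 1) \<otimes> tu (inv om) = c tu [^] (q - 1) \<otimes> (om \<otimes> inv om) \<otimes> tu (inv om)"
  using iom ctu(1) by simp
  also have "\<dots> = inv om \<otimes> ((c tu [^] (q - 1) \<otimes> om) \<otimes> tu (inv om))"
  using iom(1) om(1) ctu(1) tom by (simp add: m_ac)
  also have "\<dots> = inv om" unfolding e tomi using iom(1) by simp
  finally have f: "c tu [^] (q - 1) \<otimes> tu (inv om) = inv om" .
  have "tu (y [^] (q - 1) \<otimes> inv om) = (c tu \<otimes> y) [^] (q - 1) \<otimes> tu (inv om)"
  using Aut_simps(3)[OF A _ iom(1)] Aut_simps(6)[OF A y(1)] y(1) ctu(3) by simp
  also have "\<dots> = y [^] (q - 1) \<otimes> (c tu [^] (q - 1) \<otimes> tu (inv om))"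
  using ctu(1) y(1) tom by (simp add: nat_pow_distrib m_ac)
  finally show ?thesis unfolding f .
 qed
 ultimately show ?thesis unfolding q_def D_def by blast
qed

lemma mu_subgroup: "subgroup mu MM"
proof (rule mg.subgroupI)
 show "mu <= carrier MM"
 proof
  fix z assume "z:mu"
  then obtain n :: nat where z: "z:carrier L" "n > 0" "z [^] n = \<one>" unfolding mu_def by blast
  hence "z ~= \<zero>" using nat_pow_zero[of n] by auto
  thus "z:carrier MM" using z by simp
 qed
 have "\<one>:mu" unfolding mu_def by (auto intro!: exI[of _ 1])
 thus "mu ~= {}" by blast
next
 fix z assume "z:mu"
 then obtain n :: nat where z: "z:carrier L" "n > 0" "z [^] n = \<one>" unfolding mu_def by blast
 hence z0: "z:carrier MM" using nat_pow_zero[of n] by auto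
 have "(minv z) [^M] n = \<one>\<^bsub>MM\<^esub>"
  using mg.nat_pow_inv[OF z0, of n] z(3) unfolding nat_pow_mult_of by simp
 thus "minv z:mu" unfolding mu_def using z mg.inv_closed[OF z0] unfolding nat_pow_mult_of by auto
next
 fix a b assume "a:mu" "b:mu"
 then obtain n k :: nat where a: "a:carrier L" "n > 0" "a [^] n = \<one>" and b: "b:carrier L" "k > 0" "b [^] k = \<one>"
  unfolding mu_def by blast
 have "(a \<otimes> b) [^] (n * k) = (a [^] n) [^] k \<otimes> (b [^] k) [^] n"
  using a(1) b(1) by (simp add: nat_pow_distrib nat_pow_pow mult.commute)
 hence "(a \<otimes> b) [^] (n * k) = \<one>" by (simp only: a(3) b(3) nat_pow_one r_one one_closed)
 thus "a *M b:mu" unfolding mu_def using a b by (auto intro!: exI[of _ "n * k"])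
qed

text \<open>By Galois theory this is the multiplicative group of the number field Q(R m).\<close>

definition fixed_units :: "nat => 'a set" where
 "fixed_units m = {y:carrier L - {\<zero>}. ALL tu:Gm m. tu y = y}"

lemma fixed_units_subgroup: "subgroup (fixed_units m) MM"
proof (rule mg.subgroupI)
 show "fixed_units m <= carrier MM" unfolding fixed_units_def by auto
 have "\<one>:fixed_units m" unfolding fixed_units_def using Aut_simps(1) GmD(1) by auto
 thus "fixed_units m ~= {}" by blast
next
 fix y assume y: "y:fixed_units m"
 hence yM: "y:carrier MM" unfolding fixed_units_def by simp
 have "tu (minv y) = minv y" if "tu:Gm m" for tu
 proof -
  have "tu (y [^M] (-1::int)) = tu y [^M] (-1::int)"
  using Aut_int_pow[OF GmD(1)[OF that]] yM by simp
  moreover have "tu y = y" using y that unfolding fixed_units_def by blast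
  moreover have "y [^M] (-1::int) = minv y" using mg.int_pow_neg[OF yM, of 1] mg.int_pow_1[OF yM] by simp
  ultimately show ?thesis by simp
 qed
 thus "minv y:fixed_units m" unfolding fixed_units_def using mg.inv_closed[OF yM] by simp
next
 fix a b assume ab: "a:fixed_units m" "b:fixed_units m"
 hence "tu (a \<otimes> b) = a \<otimes> b" if "tu:Gm m" for tu
 proof -
  have "tu a = a" "tu b = b" "a:carrier L" "b:carrier L" using ab that unfolding fixed_units_def by auto
  thus ?thesis using Aut_simps(3)[OF GmD(1)[OF that], of a b] by simp
 qed
 thus "a *M b:fixed_units m" using ab unfolding fixed_units_def
  by (auto simp: integral_iff)
qed

lemma R_fixed_units: "R m <= fixed_units m"
 unfolding fixed_units_def using GmD(2) R_carrier by blast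

text \<open>Write N = 2^a N' with N' odd. The N'-th power of x^(2^a) is fixed, and 2 does not divide
  N'; the 2^a-th power of x^N' is fixed, and 3 does not divide 2^a. So
  \<open>kummer_power_prime\<close> applies to these two powers with p = 2 and p = 3, and Bezout's
  identity for 2^a and N' combines the results. The exponent obtained does not depend on N or
  x.\<close>

lemma kummer_power:
 fixes N :: nat
 assumes N: "N > 0" and x: "x:carrier L - {\<zero>}" and fixed: "x [^] N:fixed_units m"
  and comm: "!!et tu. et:Gm m ==> tu:Gm m ==> et (tu x) = tu (et x)"
 defines "D \<equiv> fact (card (R m)) :: nat"
 shows "EX om:mu. x [^] ((2 ^ D - 1) * (3 ^ D - 1) :: nat) \<otimes> om:fixed_units m"
proof -
 have "N ~= 0" "\<not> is_unit (2::nat)" using N by simp_all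
 then obtain N' where N': "N = 2 ^ multiplicity 2 N * N'" "odd N'" by (rule multiplicity_decompose')
 define a where "a = multiplicity 2 N"
 have aN: "N = 2 ^ a * N'" "odd N'" using N' unfolding a_def by auto
 have xL: "x:carrier L" "x ~= \<zero>" using x by auto
 have fx: "tu (x [^] N) = x [^] N" if "tu:Gm m" for tu using fixed that unfolding fixed_units_def by blast
 have comm_pow: "et (tu (x [^] k)) = tu (et (x [^] k))" if h: "et:Gm m" "tu:Gm m" for et tu and k :: nat
  using comm[OF h] Aut_simps(6)[OF GmD(1)[OF h(1)]] Aut_simps(6)[OF GmD(1)[OF h(2)]] xL
  Aut_closed[OF GmD(1)[OF h(1)] xL(1)] Aut_closed[OF GmD(1)[OF h(2)] xL(1)] by simp
 have nz: "x [^] k ~= \<zero>" for k :: nat using pow_nonzero[OF xL] .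
 have fu: "y \<otimes> om:fixed_units m"
  if "om:mu" "y:carrier L" "y ~= \<zero>" "ALL tu:Gm m. tu (y \<otimes> om) = y \<otimes> om" for y om
  using that subgroup.mem_carrier[OF mu_subgroup that(1)] unfolding fixed_units_def
  by (simp add: integral_iff)
 have "EX om:mu. ALL tu:Gm m. tu ((x [^] (2 ^ a :: nat)) [^] (2 ^ D - 1 :: nat) \<otimes> om) = (x [^] (2 ^ a :: nat)) [^] (2 ^ D - 1 :: nat) \<otimes> om"
  unfolding D_def
 proof (rule kummer_power_prime)
  show "prime (2::nat)" "\<not> 2 dvd N'" using aN(2) by auto
  show "N' > 0" using aN N by (cases N') auto
  show "x [^] (2 ^ a :: nat):carrier L" "x [^] (2 ^ a :: nat) ~= \<zero>" using xL nz by auto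
  show "tu ((x [^] (2 ^ a :: nat)) [^] N') = (x [^] (2 ^ a :: nat)) [^] N'" if "tu:Gm m" for tu
  using fx[OF that] xL unfolding aN(1) by (simp add: nat_pow_pow)
  show "et (tu (x [^] (2 ^ a :: nat))) = tu (et (x [^] (2 ^ a :: nat)))" if "et:Gm m" "tu:Gm m" for et tu
  using comm_pow[OF that] .
 qed
 then obtain om1 where om1: "om1:mu" "(x [^] (2 ^ a :: nat)) [^] (2 ^ D - 1 :: nat) \<otimes> om1:fixed_units m"
  using fu nat_pow_closed xL(1) nz pow_nonzero by blast
 have "\<not> 3 dvd (2 ^ a :: nat)" using prime_dvd_power[of "3::nat" 2 a] by (auto dest: dvd_imp_le)
 hence "EX om:mu. ALL tu:Gm m. tu ((x [^] N') [^] (3 ^ D - 1 :: nat) \<otimes> om) = (x [^] N') [^] (3 ^ D - 1 :: nat) \<otimes> om"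
  unfolding D_def
 proof (intro kummer_power_prime[of 3 "2 ^ a"])
  show "prime (3::nat)" "(0::nat) < 2 ^ a" by auto
  show "x [^] N':carrier L" "x [^] N' ~= \<zero>" using xL nz by auto
  show "tu ((x [^] N') [^] (2 ^ a :: nat)) = (x [^] N') [^] (2 ^ a :: nat)" if "tu:Gm m" for tu
  using fx[OF that] xL unfolding aN(1) by (simp add: nat_pow_pow mult.commute)
  show "et (tu (x [^] N')) = tu (et (x [^] N'))" if "et:Gm m" "tu:Gm m" for et tu
  using comm_pow[OF that] .
 qed
 then obtain om2 where om2: "om2:mu" "(x [^] N') [^] (3 ^ D - 1 :: nat) \<otimes> om2:fixed_units m"
  using fu nat_pow_closed xL(1) nz pow_nonzero by blast
 define q where "q = (2 ^ D - 1 :: nat)"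
 define r where "r = (3 ^ D - 1 :: nat)"
 have "coprime (2 ^ a) N'" using aN(2) by simp
 hence "coprime (int (2 ^ a)) (int N')" by (metis coprime_int_iff)
 then obtain s t :: int where st: "s * int (2 ^ a) + t * int N' = 1"
  using bezout_int[of "int (2 ^ a)" "int N'"] by auto
 define u1 where "u1 = (x [^] (2 ^ a :: nat)) [^] q \<otimes> om1"
 define u2 where "u2 = (x [^] N') [^] r \<otimes> om2"
 have omM: "om1:carrier MM" "om2:carrier MM" using om1 om2 subgroup.mem_carrier[OF mu_subgroup] by auto
 have xM: "x:carrier MM" using x by simp
 have u1: "u1 = x [^M] int (2 ^ a * q) *M om1"
  unfolding u1_def using xL by (simp only: int_pow_int nat_pow_mult_of mult_mult_of nat_pow_pow)
 have u2: "u2 = x [^M] int (N' * r) *M om2"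
  unfolding u2_def using xL by (simp only: int_pow_int nat_pow_mult_of mult_mult_of nat_pow_pow)
 \<comment> \<open>Raising \<open>u1\<close> to s r and \<open>u2\<close> to t q gives
   \<open>x\<close> the exponent (s 2^a + t N') q r = q r; the same powers of \<open>om1\<close> and
   \<open>om2\<close> are collected here.\<close>
 define om where "om = om1 [^M] (s * int r) *M om2 [^M] (t * int q)"
 have ommu: "om:mu" unfolding om_def
  using subgroup.m_closed[OF mu_subgroup] mg.subgroup_int_pow[OF mu_subgroup] om1(1) om2(1) by blast
 have "u1 [^M] (s * int r) *M u2 [^M] (t * int q):fixed_units m"
  using subgroup.m_closed[OF fixed_units_subgroup] mg.subgroup_int_pow[OF fixed_units_subgroup] om1(2) om2(2)
  unfolding u1_def u2_def q_def r_def by blast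
 also have "u1 [^M] (s * int r) *M u2 [^M] (t * int q)
  = x [^M] (int (2 ^ a * q) * (s * int r) + int (N' * r) * (t * int q)) *M om"
  unfolding u1 u2 om_def using mg.int_pow_combine[OF xM omM] .
 also have "int (2 ^ a * q) * (s * int r) + int (N' * r) * (t * int q) = (s * int (2 ^ a) + t * int N') * int (q * r)"
  by (simp add: algebra_simps)
 also have "\<dots> = int (q * r)" unfolding st by simp
 finally have "x [^] (q * r) \<otimes> om:fixed_units m"
  by (simp only: int_pow_int nat_pow_mult_of mult_mult_of)
 thus ?thesis using ommu unfolding q_def r_def by blast
qed

end

section \<open>Finiteness from bounds on conjugates and denominators\<close>

lemma algebraic_int_multiple:
 fixes z :: complex
 assumes "algebraic z"
 shows "EX d::nat. d > 0 & algebraic_int (of_nat d * z)"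
proof -
 obtain p where p: "!!i. coeff p i:\<int>" "p ~= 0" "poly p z = 0"
  using assms unfolding algebraic_def by blast
 hence "ALL i. EX k. coeff p i = of_int k" by (metis Ints_cases)
 then obtain e :: "nat => int" where e: "!!i. coeff p i = of_int (e i)" by metis
 define n where "n = degree p"
 define c where "c = e n"
 have c0: "c ~= 0" using p(2) e[of n] unfolding c_def n_def by auto
 have "n > 0"
 proof (rule ccontr)
  assume "\<not> n > 0"
  then obtain k where "p = [:k:]" unfolding n_def by (metis gr0I degree_eq_zeroE)
  thus False using p by simp
 qed
 have "0 = (\<Sum>j\<le>n. of_int (e j) * z ^ j)"
  using p(3) by (simp add: poly_altdef n_def e)
 also have "\<dots> = of_int c * z ^ n + (\<Sum>j<n. of_int (e j) * z ^ j)"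
  by (simp add: c_def lessThan_Suc_atMost[symmetric])
 finally have zn: "of_int c * z ^ n = (\<Sum>j<n. of_int (- e j) * z ^ j)"
  by (simp add: sum_negf eq_neg_iff_add_eq_0)
 \<comment> \<open>The companion matrix scaled by the leading coefficient c. Only c z, and not z
   itself, acts on the powers of z with integer entries.\<close>
 define a where "a = (%i j. if Suc i < n then (if j = Suc i then c else 0) else - e j)"
 have "of_int c * z * z ^ i = (\<Sum>j<n. of_int (a i j) * z ^ j)" if "i < n" for i
 proof (cases "Suc i < n")
  case True
  hence "(\<Sum>j<n. of_int (a i j) * z ^ j) = (\<Sum>j<n. if j = Suc i then of_int c * z ^ j else 0)"
  by (intro sum.cong) (auto simp: a_def)
  thus ?thesis using True by simp
 next
  case False
  hence "n = Suc i" using that by simp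
  thus ?thesis using zn by (simp add: a_def mult.assoc)
 qed
 hence "algebraic_int (of_int c * z)"
  using algebraic_int_if_int_eigenvalue[of "{..<n}" "%i. z ^ i" "of_int c * z" a] \<open>n > 0\<close>
  by (auto intro!: bexI[of _ 0])
 hence "algebraic_int (of_nat (nat \<bar>c\<bar>) * z)"
  using algebraic_int_minus[of "of_int c * z"] by (cases "c >= 0") auto
 thus ?thesis using c0 by (intro exI[of _ "nat \<bar>c\<bar>"]) auto
qed

context algebraic_numbers
begin

lemma algebraic_ph: "x:carrier L ==> Polynomial.algebraic (ph x)"
proof -
 assume x: "x:carrier L"
 define p where "p = Irr prime_field x"
 note p = Irr_prime[OF x, folded p_def]
 have pC: "set p <= carrier L" using poly_ring_prime(2)[OF p(1)] prime_field_carrier by blast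
 have "hom_poly ph p ~= 0" using degree_hom_poly(2)[OF p(2), of ph] p(4) ph_simps(1) by auto
 moreover have "poly (hom_poly ph p) (ph x) = 0" using poly_hom_poly[OF ph_hom pC x] p(3) ph_simps(2) by simp
 moreover have "Polynomial.coeff (hom_poly ph p) i:\<rat>" for i
 proof -
  have "ph ` set p <= \<rat>"
  using poly_ring_prime(2)[OF p(1)] complex_hom_prime_field(2)[OF ph_hom ph_hom] by blast
  thus ?thesis using coeff_hom_poly_image[of ph p i] by auto
 qed
 ultimately show ?thesis unfolding algebraic_altdef by blast
qed

lemma conjugate_bounds:
 assumes a: "a:carrier L"
 shows "EX C>=1. EX d::nat. d > 0 & (ALL al:Aut. cmod (ph (al a)) <= C & algebraic_int (of_nat d * ph (al a)))"
proof -
 define Y where "Y = {al a | al. al:Aut}"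
 have fin: "finite Y" unfolding Y_def by (rule finite_orbit[OF a])
 have YL: "Y <= carrier L" unfolding Y_def using a by auto
 have "ALL y:Y. EX d::nat. d > 0 & algebraic_int (of_nat d * ph y)"
  using algebraic_int_multiple algebraic_ph YL by blast
 then obtain e :: "'a => nat" where e: "!!y. y:Y ==> e y > 0 & algebraic_int (of_nat (e y) * ph y)"
  by metis
 define d where "d = (\<Prod>y\<in>Y. e y)"
 define C where "C = 1 + (\<Sum>y\<in>Y. cmod (ph y))"
 have "C >= 1" unfolding C_def by (simp add: sum_nonneg)
 moreover have "d > 0" unfolding d_def using e by (simp add: prod_pos)
 moreover have "cmod (ph y) <= C" if "y:Y" for y
  using member_le_sum[OF that _ fin, of "%y. cmod (ph y)"] unfolding C_def by simp
 moreover have "algebraic_int (of_nat d * ph y)" if "y:Y" for y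
 proof -
  have "d = (\<Prod>y\<in>Y - {y}. e y) * e y" unfolding d_def using fin that by (simp add: prod.remove mult.commute)
  hence eq: "of_nat d * ph y = of_nat (\<Prod>y\<in>Y - {y}. e y) * (of_nat (e y) * ph y)" by simp
  show ?thesis unfolding eq by (rule algebraic_int_times[OF algebraic_int_of_nat]) (use e that in blast)
 qed
 ultimately show ?thesis unfolding Y_def by blast
qed

text \<open>Exponents of the generators are divided by j with remainder: the quotients give
  \<open>h\<close>, and the remainders, between 0 and j - 1, give \<open>g'\<close>. The point is
  that C and d do not depend on j, so taking j-th roots later yields bounds independent of
  j.\<close>

lemma generate_reduce:
 assumes "finite S" "S <= carrier MM"
 shows "EX C>=1. EX d::nat. d > 0 & (ALL j::nat. j > 0 --> (ALL g:generate MM S. EX h:generate MM S. EX g':carrier MM.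
  g = h [^] j \<otimes> g' & (ALL al:Aut. cmod (ph (al g')) <= C ^ j & algebraic_int (of_nat d ^ j * ph (al g')))))"
 using assms
proof (induction S)
 case empty
 have "generate MM {} = {\<one>}" using mg.generate_empty by simp
 thus ?case
  by (intro exI[of _ "1::real"] exI[of _ "1::nat"] conjI allI impI ballI bexI[of _ \<one>])
  (auto simp: Aut_simps(1) ph_simps(1))
next
 case (insert a S)
 have S: "S <= carrier MM" and aM: "a:carrier MM" and aL: "a:carrier L" using insert.prems by auto
 obtain C d where C: "C >= 1" "d > (0::nat)" and IH: "!!j g. j > (0::nat) ==> g:generate MM S ==>
  EX h:generate MM S. EX g':carrier MM. g = h [^] j \<otimes> g'
  & (ALL al:Aut. cmod (ph (al g')) <= C ^ j & algebraic_int (of_nat d ^ j * ph (al g')))"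
  using insert.IH[OF S] by auto
 obtain C' d' where C': "C' >= 1" "d' > (0::nat)"
  "!!al. al:Aut ==> cmod (ph (al a)) <= C'" "!!al. al:Aut ==> algebraic_int (of_nat d' * ph (al a))"
  using conjugate_bounds[OF aL] by blast
 have main: "EX h:generate MM (insert a S). EX g':carrier MM. g = h [^] j \<otimes> g'
  & (ALL al:Aut. cmod (ph (al g')) <= (C * C') ^ j & algebraic_int (of_nat (d * d') ^ j * ph (al g')))"
  if j: "j > (0::nat)" and g: "g:generate MM (insert a S)" for j g
 proof -
  obtain g0 and k :: int where g0: "g0:generate MM S" "g = g0 \<otimes> a [^M] k"
  using g unfolding mg.generate_insert[OF S aM] by auto
  obtain h0 g0' where h0: "h0:generate MM S" "g0':carrier MM" "g0 = h0 [^] j \<otimes> g0'"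
  and b0: "!!al. al:Aut ==> cmod (ph (al g0')) <= C ^ j"
  "!!al. al:Aut ==> algebraic_int (of_nat d ^ j * ph (al g0'))"
  using IH[OF j g0(1)] by blast
  \<comment> \<open>The remainder is nonnegative for negative \<open>k\<close> as well, so
    \<open>g'\<close> involves no inverse of \<open>a\<close> and its denominators stay under
    control.\<close>
  define r where "r = nat (k mod int j)"
  have r: "r < j" "k = (k div int j) * int j + int r" using j unfolding r_def by (auto simp: nat_less_iff)
  define h where "h = h0 *M a [^M] (k div int j)"
  define g' where "g' = g0' *M a [^M] r"
  have h0M: "h0:carrier MM" using mg.generate_in_carrier[OF S h0(1)] .
  have hg: "h:generate MM (insert a S)" unfolding h_def mg.generate_insert[OF S aM] using h0(1) by blast
  have g'M: "g':carrier MM" unfolding g'_def using h0(2) aM pow_nonzero[of a r]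
  by (auto simp: nat_pow_mult_of integral_iff)
  have ak: "a [^M] k = (a [^M] (k div int j)) [^M] int j *M a [^M] int r"
  by (subst r(2)) (simp only: mg.int_pow_mult[OF aM] mg.int_pow_pow[OF aM])
  have "h [^M] int j = h0 [^M] int j *M (a [^M] (k div int j)) [^M] int j"
  unfolding h_def by (rule mg.int_pow_distrib[OF h0M mg.int_pow_closed[OF aM]])
  moreover have "a [^M] (k div int j):carrier L" "h0:carrier L" "g0':carrier L" "a [^M] r:carrier L"
  using mg.int_pow_closed[OF aM, of "k div int j"] h0M h0(2) aL by (auto simp: nat_pow_mult_of)
  ultimately have eq: "g = h [^] j \<otimes> g'"
  using g0(2) h0(3) ak unfolding g'_def int_pow_int nat_pow_mult_of mult_mult_of
  by (simp add: m_ac)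
  have "cmod (ph (al g')) <= (C * C') ^ j & algebraic_int (of_nat (d * d') ^ j * ph (al g'))" if al: "al:Aut" for al
  proof -
  have e: "ph (al g') = ph (al g0') * ph (al a) ^ r"
  unfolding g'_def nat_pow_mult_of mult_mult_of using h0(2) aL al by (simp add: Aut_simps ph_simps)
  have "cmod (ph (al a)) ^ r <= C' ^ r" using C'(3)[OF al] by (intro power_mono) auto
  also have "\<dots> <= C' ^ j" using C'(1) r(1) by (intro power_increasing) auto
  finally have 1: "cmod (ph (al g')) <= (C * C') ^ j"
  unfolding e norm_mult norm_power power_mult_distrib using b0(1)[OF al] C(1) by (intro mult_mono) auto
  have "of_nat (d * d') ^ j * ph (al g')
  = (of_nat d ^ j * ph (al g0')) * (of_nat d' ^ (j - r) * (of_nat d' * ph (al a)) ^ r)"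
  unfolding e power_mult_distrib using r(1) by (simp add: power_mult_distrib flip: power_add)
  also have "algebraic_int \<dots>"
  using b0(2)[OF al] C'(4)[OF al] algebraic_int_times algebraic_int_power algebraic_int_of_nat by metis
  finally show ?thesis using 1 by blast
  qed
  thus ?thesis using hg g'M eq by blast
 qed
 have "C * C' >= 1" using C(1) C'(1) by (metis mult_mono' mult_1 zero_le_one)
 moreover have "d * d' > 0" using C(2) C'(2) by simp
 ultimately show ?case using main by blast
qed

text \<open>Automorphisms that agree on \<open>R m\<close> agree on elements of
  \<open>fixed_units m\<close>, so the number of conjugates is bounded by the number of restrictions
  to \<open>R m\<close>. After multiplication by the denominator,
  \<open>finite_algebraic_int_bounded\<close> applies to the orbits.\<close>

lemma finite_fixed_units_bounded:
 "finite {w:fixed_units m. ALL al:Aut. cmod (ph (al w)) <= C & algebraic_int (of_nat d * ph (al w))}" (is "finite ?W")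
 if d: "d > (0::nat)"
proof -
 define e where "e = add_pow L d \<one>"
 have eL: "e:carrier L" unfolding e_def by simp
 have phn: "ph (add_pow L n \<one>) = of_nat n" for n :: nat
  by (induction n) (auto simp: ph_simps)
 have phe: "ph e = of_nat d" unfolding e_def by (rule phn)
 have e0: "e ~= \<zero>" unfolding e_def using char_0[OF d] .
 have ale: "al e = e" if "al:Aut" for al
 proof -
  have "al (add_pow L n \<one>) = add_pow L n \<one>" for n :: nat
  by (induction n) (auto simp: Aut_simps[OF that])
  thus ?thesis unfolding e_def .
 qed
 define orb where "orb w = {al (e \<otimes> w) | al. al:Aut}" for w
 define \<A> where "\<A> = (%w. ph ` orb w) ` ?W"
 define T where "T = (%al. restrict al (R m)) ` Aut"
 have finT: "finite T"
 proof (rule finite_subset)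
  show "T <= R m \<rightarrow>\<^sub>E R m" unfolding T_def using R_stable by auto
  show "finite (R m \<rightarrow>\<^sub>E R m)" using R_finite by (intro finite_PiE) auto
 qed
 have WL: "w:carrier L" if "w : ?W" for w using that unfolding fixed_units_def by simp
 have card_orb: "finite (orb w) & card (orb w) <= card T" if w: "w : ?W" for w
 proof -
  have "al (e \<otimes> w) = bt (e \<otimes> w)" if h: "al:Aut" "bt:Aut" "restrict al (R m) = restrict bt (R m)" for al bt
  proof -
  note ib = galois_inverse[OF prime_field_carrier h(2)]
  let ?ga = "compose (carrier L) (inv\<^bsub>galois_group L prime_field\<^esub> bt) al"
  have "?ga x = x" if "x:R m" for x
  using fun_cong[OF h(3), of x] that ib(2) R_carrier by (simp add: compose_eq)
  hence "?ga:Gm m" unfolding Gm_def using galois_compose[OF prime_field_carrier ib(1) h(1)] by blast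
  hence "?ga w = w" using w unfolding fixed_units_def by blast
  hence "al w = bt w" using ib(3)[of "al w"] h(1) WL[OF w] by (simp add: compose_eq)
  thus ?thesis using ale[OF h(1)] ale[OF h(2)] eL WL[OF w] Aut_simps(3)[OF h(1)] Aut_simps(3)[OF h(2)] by simp
  qed
  note eqw = this
  define F where "F t = (SOME al. al:Aut & restrict al (R m) = t) (e \<otimes> w)" for t
  have F: "F (restrict al (R m)) = al (e \<otimes> w)" if h: "al:Aut" for al
  proof -
  define bt where "bt = (SOME bt. bt:Aut & restrict bt (R m) = restrict al (R m))"
  have "bt:Aut & restrict bt (R m) = restrict al (R m)"
  unfolding bt_def by (rule someI[of _ al]) (use h in simp)
  hence "bt (e \<otimes> w) = al (e \<otimes> w)" using eqw[of bt al] h by blast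
  thus ?thesis unfolding F_def bt_def .
  qed
  have "orb w = F ` T" unfolding orb_def T_def image_image using F by (auto simp: image_iff)
  thus ?thesis using card_image_le[OF finT] finT by simp
 qed
 have "finite (\<Union> \<A>)"
 proof (rule finite_algebraic_int_bounded[where B = "card T" and C = "of_nat d * C"])
  fix Y assume "Y:\<A>"
  then obtain w where w: "w : ?W" "Y = ph ` orb w" unfolding \<A>_def by blast
  have oL: "orb w <= carrier L" unfolding orb_def using eL WL[OF w(1)] by auto
  have inj: "inj_on ph (orb w)" using oL by (auto intro!: inj_onI ph_inj)
  have st: "al x:orb w" if h: "al:Aut" "x:orb w" for al x
  proof -
  obtain bt where b: "x = bt (e \<otimes> w)" "bt:Aut" using h(2) unfolding orb_def by blast
  have "al x = compose (carrier L) al bt (e \<otimes> w)" unfolding b(1) using eL WL[OF w(1)] by (simp add: compose_eq)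
  thus ?thesis unfolding orb_def using galois_compose[OF prime_field_carrier h(1) b(2)] by blast
  qed
  have "ALL y:Y. algebraic_int y & cmod y <= of_nat d * C"
  proof
  fix y assume "y:Y"
  then obtain al where al: "al:Aut" "y = ph (al (e \<otimes> w))" unfolding w(2) orb_def by blast
  hence "y = of_nat d * ph (al w)" using ale[OF al(1)] eL WL[OF w(1)] Aut_simps(3)[OF al(1)] by (simp add: ph_simps phe)
  thus "algebraic_int y & cmod y <= of_nat d * C" using w(1) al(1) by (auto simp: norm_mult intro!: mult_left_mono)
  qed
  moreover have "ALL i. Polynomial.coeff (\<Prod>y\<in>Y. [:- y, 1:]) i:\<rat>"
  unfolding w(2) prod.reindex[OF inj] using coeff_stable_rational[of "orb w"] card_orb[OF w(1)] oL st by simp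
  moreover have "finite Y & card Y <= card T"
  unfolding w(2) using card_orb[OF w(1)] card_image[OF inj] by simp
  ultimately show "finite Y & card Y <= card T & (ALL y:Y. algebraic_int y & cmod y <= of_nat d * C)
  & (ALL i. Polynomial.coeff (\<Prod>y\<in>Y. [:- y, 1:]) i:\<rat>)" by blast
 qed
 moreover have "(%w. ph (e \<otimes> w)) ` ?W <= \<Union> \<A>"
 proof
  fix z assume "z:(%w. ph (e \<otimes> w)) ` ?W"
  then obtain w where w: "w : ?W" "z = ph (e \<otimes> w)" by blast
  have "e \<otimes> w:orb w" unfolding orb_def using id_Aut eL WL[OF w(1)]
  by (auto intro!: exI[of _ "\<lambda>x\<in>carrier L. x"])
  thus "z:\<Union> \<A>" unfolding \<A>_def using w by blast
 qed
 moreover have "inj_on (%w. ph (e \<otimes> w)) ?W"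
 proof (rule inj_onI)
  fix w v assume h: "w : ?W" "v : ?W" "ph (e \<otimes> w) = ph (e \<otimes> v)"
  hence "e \<otimes> w = e \<otimes> v" using ph_inj eL WL by simp
  hence "w \<otimes> e = v \<otimes> e" using m_comm[OF eL WL[OF h(1)]] m_comm[OF eL WL[OF h(2)]] by simp
  thus "w = v" using field_cancel[OF WL[OF h(1)] WL[OF h(2)] eL e0] by blast
 qed
 ultimately show ?thesis using finite_subset finite_imageD by blast
qed

text \<open>If y^j lies in the group generated by \<open>S\<close>, write it as h^j g' by
  \<open>generate_reduce\<close> and put w = y / h. Then w^j = g', so w and its conjugates satisfy
  bounds that no longer involve j, and only finitely many w occur. \<open>M\<close> is the product
  of exponents that return these w to the group.\<close>

lemma saturation_fixed_units_bounded:
 assumes S: "finite S" "S <= R m"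
 shows "EX M::int. M > 0 & (ALL y:fixed_units m. y:sat MM S --> y [^M] M:generate MM S)"
proof -
 have "x:carrier MM" if "x:S" for x using R_carrier[of x m] S(2) that by auto
 hence SM: "S <= carrier MM" by blast
 have gS: "generate MM S <= fixed_units m"
  using mg.generate_subgroup_incl[OF _ fixed_units_subgroup] S(2) R_fixed_units by blast
 note sg = mg.generate_is_subgroup[OF SM]
 obtain C d where C: "C >= 1" "d > (0::nat)" and red: "!!j g. j > (0::nat) ==> g:generate MM S ==>
  EX h:generate MM S. EX g':carrier MM. g = h [^] j \<otimes> g'
  & (ALL al:Aut. cmod (ph (al g')) <= C ^ j & algebraic_int (of_nat d ^ j * ph (al g')))"
  using generate_reduce[OF S(1) SM] by auto
 define W where "W = {w:fixed_units m. ALL al:Aut. cmod (ph (al w)) <= C & algebraic_int (of_nat d * ph (al w))}"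
 define W' where "W' = W Int sat MM S"
 have finW: "finite W'" unfolding W'_def W_def using finite_fixed_units_bounded[OF C(2)] by blast
 have "ALL w:W'. EX j::int. j > 0 & w [^M] j:generate MM S"
  unfolding W'_def sat_def by blast
 then obtain k :: "'a => int" where k: "!!w. w:W' ==> k w > 0 & w [^M] k w:generate MM S" by metis
 define M where "M = (\<Prod>w\<in>W'. k w)"
 have "M > 0" unfolding M_def using k by (simp add: prod_pos)
 moreover have "y [^M] M:generate MM S" if y: "y:fixed_units m" "y:sat MM S" for y
 proof -
  have yM: "y:carrier MM" using y(1) subgroup.mem_carrier[OF fixed_units_subgroup] by blast
  obtain i :: int where i: "i > 0" "y [^M] i:generate MM S" using y(2) unfolding sat_def by blast
  define j where "j = nat i"
  have j: "j > 0" "y [^M] int j:generate MM S" using i unfolding j_def by auto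
  obtain h g' where h: "h:generate MM S" "g':carrier MM" "y [^M] int j = h [^] j \<otimes> g'"
  and b: "!!al. al:Aut ==> cmod (ph (al g')) <= C ^ j" "!!al. al:Aut ==> algebraic_int (of_nat d ^ j * ph (al g'))"
  using red[OF j] by blast
  have hM: "h:carrier MM" using mg.generate_in_carrier[OF SM h(1)] .
  define w where "w = minv h *M y"
  have wf: "w:fixed_units m" unfolding w_def
  using subgroup.m_closed[OF fixed_units_subgroup subgroup.m_inv_closed[OF fixed_units_subgroup] y(1)] gS h(1) by blast
  have wM: "w:carrier MM" using wf subgroup.mem_carrier[OF fixed_units_subgroup] by blast
  have yhw: "y = h *M w" unfolding w_def using mg.inv_solve_left' hM yM by (metis mg.inv_closed mg.inv_solve_left mg.is_group group.is_monoid monoid.m_closed)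
  have "w:sat MM S" unfolding w_def
  using subgroup.m_closed[OF mg.saturation_subgroup[OF SM] subgroup.m_inv_closed[OF mg.saturation_subgroup[OF SM]] y(2)]
  mg.saturation_incl[OF SM] h(1) by blast
  moreover have "w:W"
  proof -
  have hL: "h:carrier L" "h ~= \<zero>" "w:carrier L" "g':carrier L" using hM wM h(2) by auto
  have "h [^] j \<otimes> w [^] j = h [^] j \<otimes> g'"
  using h(3) unfolding yhw int_pow_int nat_pow_mult_of mult_mult_of using hL by (simp add: nat_pow_distrib)
  hence wj: "w [^] j = g'"
  using field_cancel[of "w [^] j" g' "h [^] j"] hL pow_nonzero[OF hL(1,2)] m_comm by (metis nat_pow_closed)
  have "cmod (ph (al w)) <= C & algebraic_int (of_nat d * ph (al w))" if al: "al:Aut" for al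
  proof -
  have e: "ph (al g') = ph (al w) ^ j" unfolding wj[symmetric] using hL al by (simp add: Aut_simps ph_simps)
  have "cmod (ph (al w)) <= C"
  proof (rule power_le_imp_le_base[of _ "j - 1"])
  show "cmod (ph (al w)) ^ Suc (j - 1) <= C ^ Suc (j - 1)" using b(1)[OF al] j(1) unfolding e by (simp add: norm_power)
  qed (use C in simp)
  moreover have "algebraic_int (of_nat d * ph (al w))"
  using algebraic_int_nth_root[of "of_nat d * ph (al w)" j] b(2)[OF al] j(1) unfolding e by (simp add: power_mult_distrib)
  ultimately show ?thesis by blast
  qed
  thus ?thesis unfolding W_def using wf by blast
  qed
  ultimately have wW: "w:W'" unfolding W'_def by blast
  have "M = k w * (\<Prod>w\<in>W' - {w}. k w)" unfolding M_def using finW wW by (rule prod.remove)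
  hence "w [^M] M = (w [^M] k w) [^M] (\<Prod>w\<in>W' - {w}. k w)"
  using mg.int_pow_pow[OF wM] by simp
  hence "w [^M] M:generate MM S" using mg.subgroup_int_pow[OF sg] k[OF wW] by simp
  moreover have "y [^M] M = h [^M] M *M w [^M] M"
  unfolding yhw using mg.int_pow_distrib[OF hM wM] .
  ultimately show ?thesis using subgroup.m_closed[OF sg mg.subgroup_int_pow[OF sg h(1)]] by simp
 qed
 ultimately show ?thesis by blast
qed

text \<open>May's theorem in the form used below. The uniform exponent of
  \<open>kummer_power\<close> moves \<open>x\<close>, up to a root of unity, into the number field
  Q(R m), where \<open>saturation_fixed_units_bounded\<close> supplies the second exponent. The
  level m is chosen beyond n so that commutativity holds, and large enough for \<open>R m\<close> to
  contain \<open>S\<close>.\<close>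

theorem saturation_bounded:
 assumes comm: "!!m et tu x. n <= m ==> et:Gm m ==> tu:Gm m ==> x:E ==> et (tu x) = tu (et x)"
  and S: "finite S" "S <= carrier MM"
 shows "EX M::int. M > 0 & (ALL x:E. x:sat MM (mu Un S) --> x [^M] M:generate MM (mu Un S))"
proof -
 obtain m where m: "m >= n" "S <= R m" using R_exhaust_finite[OF S(1), of n] S(2) by auto
 obtain M1 :: int where M1: "M1 > 0" "!!y. y:fixed_units m ==> y:sat MM S ==> y [^M] M1:generate MM S"
  using saturation_fixed_units_bounded[OF S(1) m(2)] by blast
 define D where "D = (fact (card (R m)) :: nat)"
 define m0 where "m0 = ((2 ^ D - 1) * (3 ^ D - 1) :: nat)"
 have "D > 0" unfolding D_def by simp
 hence "1 < (2::nat) ^ D" "1 < (3::nat) ^ D" by (rule one_less_power[rotated], simp)+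
 hence m00: "m0 > 0" unfolding m0_def by simp
 note sS = mg.saturation_subgroup[OF S(2)]
 have muM: "mu <= carrier MM" using subgroup.subset[OF mu_subgroup] .
 have muS: "mu Un S <= carrier MM" using muM S(2) by blast
 note g = mg.generate_is_subgroup[OF muS]
 have mu_sat: "mu <= sat MM S"
 proof
  fix z assume z: "z:mu"
  then obtain k :: nat where k: "k > 0" "z [^] k = \<one>" unfolding mu_def by blast
  hence "z [^M] int k:generate MM S" using generate.one[of MM S] by (simp add: int_pow_int nat_pow_mult_of)
  thus "z:sat MM S" unfolding sat_def using z muM k(1) by (auto intro!: exI[of _ "int k"])
 qed
 have S_sat: "S <= sat MM S" using mg.saturation_incl[OF S(2)] generate.incl[of _ S MM] by blast
 have sub: "generate MM (mu Un S) <= sat MM S"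
  by (rule mg.generate_subgroup_incl[OF _ sS]) (use mu_sat S_sat in blast)
 have "x [^M] (int m0 * M1):generate MM (mu Un S)" if x: "x:E" "x:sat MM (mu Un S)" for x
 proof -
  obtain i :: int where i: "x:carrier MM" "i > 0" "x [^M] i:generate MM (mu Un S)"
  using x(2) unfolding sat_def by blast
  hence xS: "x:sat MM S" using mg.saturation_pure sub by blast
  then obtain j :: int where j: "j > 0" "x [^M] j:generate MM S" unfolding sat_def by blast
  define N where "N = nat j"
  have N: "N > 0" "x [^] N:generate MM S" using j unfolding N_def by (auto simp: int_pow_int nat_pow_mult_of dest!: zero_less_imp_eq_int)
  have "generate MM S <= fixed_units m"
  using mg.generate_subgroup_incl[OF _ fixed_units_subgroup] m(2) R_fixed_units by blast
  then obtain om where om: "om:mu" "x [^] m0 \<otimes> om:fixed_units m"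
  using kummer_power[OF N(1), of x m] i(1) N(2) comm[OF m(1) _ _ x(1)] unfolding m0_def D_def by auto
  have omM: "om:carrier MM" using om(1) muM by blast
  define y where "y = x [^M] int m0 *M om"
  have y: "y:fixed_units m" using om(2) unfolding y_def int_pow_int nat_pow_mult_of mult_mult_of .
  have "y:sat MM S" unfolding y_def
  using subgroup.m_closed[OF sS mg.subgroup_int_pow[OF sS xS]] om(1) mu_sat by blast
  hence "y [^M] M1:generate MM S" using M1(2) y by blast
  hence y': "y [^M] M1:generate MM (mu Un S)" using mg.mono_generate[of S "mu Un S"] by blast
  have omg: "om [^M] (- M1):generate MM (mu Un S)"
  using mg.subgroup_int_pow[OF g generate.incl] om(1) by blast
  \<comment> \<open>Writing \<open>om\<close> as x^0 times \<open>om\<close> lets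
    \<open>int_pow_combine\<close> collect the exponents of \<open>x\<close>.\<close>
  have "y [^M] M1 *M om [^M] (- M1) = (x [^M] int m0 *M om) [^M] M1 *M (x [^M] (0::int) *M om) [^M] (- M1)"
  unfolding y_def using omM by simp
  also have "\<dots> = x [^M] (int m0 * M1) *M (om [^M] M1 *M om [^M] (- M1))"
  using mg.int_pow_combine[OF i(1) omM omM, of "int m0" M1 0 "- M1"] by simp
  also have "om [^M] M1 *M om [^M] (- M1) = \<one>\<^bsub>MM\<^esub>" using mg.int_pow_mult[OF omM, of M1 "- M1"] by simp
  finally have "x [^M] (int m0 * M1) = y [^M] M1 *M om [^M] (- M1)"
  using mg.int_pow_closed[OF i(1), of "int m0 * M1"] by simp
  thus ?thesis using subgroup.m_closed[OF g y' omg] by simp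
 qed
 thus ?thesis using m00 M1(1) by (intro exI[of _ "int m0 * M1"]) auto
qed

end

section \<open>The tower of fields over F and its Galois groups\<close>

lemma (in field) algebraic_trans:
 assumes K: "subfield K R" and F: "subfield F R" "K <= F"
  and alg: "!!a. a:F ==> (algebraic over K) a" and x: "x:carrier R" "(algebraic over F) x"
 shows "(algebraic over K) x"
proof -
 define p where "p = Irr F x"
 note p = IrrE[OF F(1) x, folded p_def]
 have pF: "set p <= F" and lc: "p ~= [] ==> hd p ~= \<zero>"
  using p(1) unfolding univ_poly_carrier[symmetric] polynomial_def by auto
 have p0: "p ~= []" using pirreducible_degree[OF F(1) p(1,2)] by auto
 have pC: "set p <= carrier R" using pF subfieldE(3)[OF F(1)] by blast
 \<comment> \<open>The finitely many coefficients of the minimal polynomial generate a finite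
   extension of \<open>K\<close> over which \<open>x\<close> is already algebraic.\<close>
 define E where "E = finite_extension K p"
 have algp: "(algebraic over K) y" if "y:set p" for y using alg pF that by blast
 have E: "subfield E R" unfolding E_def by (rule finite_extension_is_subfield[OF K pC algp])
 have finE: "finite_dimension K E" unfolding E_def by (rule finite_extension_finite_dimension(1)[OF K pC algp])
 have "set p <= E" unfolding E_def using finite_extension_mem[OF subfieldE(1)[OF K] pC] .
 hence "p:carrier (E [X])" using lc p0 unfolding univ_poly_carrier[symmetric] polynomial_def by auto
 hence xE: "(algebraic over E) x" using algebraicI p0 p(4) by blast
 have "finite_dimension E (simple_extension E x)" using finite_dimension_simple_extension[OF E x(1)] xE by blast
 hence "finite_dimension K (simple_extension E x)" using telescopic_base_dim(1)[OF K E finE] by blast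
 thus ?thesis
  using finite_dimension_imp_algebraic[OF K simple_extension_is_subring[OF subfieldE(1)[OF E] x(1)]]
  simple_extension_mem[OF subfieldE(1)[OF E] x(1)] by blast
qed

locale abelian_closure = field L for L :: "('a, 'b) ring_scheme" (structure) +
 fixes F K :: "'a set" and \<iota> :: "rat set => 'a"
 assumes closure: "algebraic_closure L F"
  and char_zero: "!!n::nat. n > 0 ==> add_pow L n \<one>\<^bsub>L\<^esub> ~= \<zero>\<^bsub>L\<^esub>"
  and roots_of_unity:
  "!!z n::nat. z:carrier L ==> n > 0 ==> z [^]\<^bsub>L\<^esub> n = \<one>\<^bsub>L\<^esub> ==> z:F"
  and embedding: "\<iota>:mon rat_mod_int (mult_of (L\<lparr>carrier := F\<rparr>))"
  and K_subfield: "subfield K L"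
  and K_number_field: "ring.finite_dimension L (generate_field L {}) K"
  and F_abelian: "abelian_extension (L\<lparr>carrier := F\<rparr>) K"
begin

lemma F_subfield: "subfield F L"
 using closure unfolding algebraic_closure_def by blast

lemma F_carrier: "F <= carrier L" using subfieldE(3)[OF F_subfield] .

lemma F_galois: "field (L\<lparr>carrier := F\<rparr>)" "K <= F" "x:F ==> (algebraic over K) x"
 "x:F ==> (!!tu. tu:carrier (galois_group (L\<lparr>carrier := F\<rparr>) K) ==> tu x = x) ==> x:K"
 "comm_group (galois_group (L\<lparr>carrier := F\<rparr>) K)"
proof -
 have g: "galois_extension (L\<lparr>carrier := F\<rparr>) K" and c: "comm_group (galois_group (L\<lparr>carrier := F\<rparr>) K)"
  using F_abelian unfolding abelian_extension_def by auto
 show "comm_group (galois_group (L\<lparr>carrier := F\<rparr>) K)" by (rule c)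
 show "field (L\<lparr>carrier := F\<rparr>)" using g unfolding galois_extension_def by blast
 have "subfield K (L\<lparr>carrier := F\<rparr>)" using g unfolding galois_extension_def by blast
 thus "K <= F" using subfieldE(3) by fastforce
 show "(algebraic over K) x" if "x:F"
  using g that algebraic_consistent[OF subfieldE(1)[OF F_subfield]] unfolding galois_extension_def by simp
 show "x:K" if "x:F" "!!tu. tu:carrier (galois_group (L\<lparr>carrier := F\<rparr>) K) ==> tu x = x"
  using g that unfolding galois_extension_def by auto
qed

lemma prime_field_K: "prime_field <= K"
 unfolding prime_field_def by (rule generate_field_min_subfield1[OF _ K_subfield]) auto

sublocale algebraic_numbers L
proof -
 interpret ac: algebraic_closure L F by (rule closure)
 show "algebraic_numbers L"
 proof (unfold_locales)
  show "add_pow L n \<one> ~= \<zero>" if "n > 0" for n :: nat using char_zero that by blast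
  fix x assume x: "x:carrier L"
  have KP: "(algebraic over prime_field) y" if "y:K" for y
  using finite_dimension_imp_algebraic[OF subfield_prime_field subfieldE(1)[OF K_subfield]] K_number_field that
  unfolding prime_field_def by blast
  have FP: "(algebraic over prime_field) y" if "y:F" for y
  using algebraic_trans[OF subfield_prime_field K_subfield prime_field_K KP] F_galois(3)[OF that] that F_carrier by blast
  show "(algebraic over prime_field) x"
  using algebraic_trans[OF subfield_prime_field F_subfield _ FP x] ac.algebraic_extension[OF x] prime_field_K F_galois(2) by blast
 qed
qed

abbreviation GG where "GG \<equiv> galois_group L F"

lemma prime_field_F: "prime_field <= F" using prime_field_K F_galois(2) by blast

lemma G_Aut: "al:carrier GG ==> al:Aut" using galois_group_mono[OF prime_field_F] by blast

lemma G_iff: "al:carrier GG <-> al:Aut & (ALL x:F. al x = x)"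
 using prime_field_F unfolding carrier_galois_group by blast

sublocale G: group GG by (rule group_galois_group[OF F_carrier])

abbreviation gmult (infixl "*G" 70) where "x *G y == x \<otimes>\<^bsub>GG\<^esub> y"
abbreviation ginv ("ginv _" [81] 80) where "ginv x == inv\<^bsub>GG\<^esub> x"

definition G_n :: "nat => ('a => 'a) set" where "G_n n = carrier GG Int Gm n"

text \<open>By Galois theory this is the finite Galois extension F(R n) of F. These fields form the
  tower along which automorphisms, characters and lifts are built.\<close>

definition E :: "nat => 'a set" where "E n = {x:carrier L. ALL al:G_n n. al x = x}"

lemma G_nD: "al:G_n n ==> al:Aut" "al:G_n n ==> al:carrier GG" "al:G_n n ==> x:R n ==> al x = x"
 "al:G_n n ==> x:E n ==> al x = x"
 unfolding G_n_def E_def using GmD by auto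

lemma G_nI: "al:carrier GG ==> (!!x. x:R n ==> al x = x) ==> al:G_n n"
 unfolding G_n_def Gm_def using G_Aut by blast

lemma G_mult: "al:carrier GG ==> bt:carrier GG ==> x:carrier L ==> (al *G bt) x = al (bt x)"
 by (subst galois_group_mult) (auto simp: compose_eq)

lemma G_inv: "al:carrier GG ==> x:carrier L ==> (ginv al) (al x) = x"
 "al:carrier GG ==> x:carrier L ==> al ((ginv al) x) = x"
 using galois_inverse[OF F_carrier] by auto

lemma G_closed [simp]: "al:carrier GG ==> x:carrier L ==> al x:carrier L"
 by (rule galois_group_closed)

lemma G_eqI:
 assumes "al:carrier GG" "bt:carrier GG" "!!x. x:carrier L ==> al x = bt x"
 shows "al = bt"
 using assms unfolding carrier_galois_group Bij_def by (auto intro: extensionalityI)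

lemma E_carrier: "E n <= carrier L" unfolding E_def by blast

lemma F_E: "F <= E n" unfolding E_def using G_nD(2) G_iff F_carrier by blast

lemma R_E: "R n <= E n" unfolding E_def using G_nD(3) R_carrier by blast

lemma G_n_antimono: "m <= n ==> G_n n <= G_n m"
 using R_mono[of m n] unfolding G_n_def Gm_def by blast

lemma E_mono: "m <= n ==> E m <= E n" using G_n_antimono[of m n] unfolding E_def by blast

lemma E_subfield: "subfield (E n) L"
proof (rule subfieldI')
 show "subring (E n) L"
 proof (rule subringI)
  show "E n <= carrier L" by (rule E_carrier)
  show "\<one>:E n" unfolding E_def using Aut_simps(1)[OF G_nD(1)] by simp
  show "\<ominus> h:E n" if "h:E n" for h
  proof -
  have "al (\<ominus> h) = \<ominus> h" if al: "al:G_n n" for al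
  proof -
  have hL: "h:carrier L" and ah: "al h = h" using \<open>h : E n\<close> al unfolding E_def by auto
  have "al (\<ominus> h) \<oplus> h = al (\<ominus> h \<oplus> h)" using Aut_simps(4)[OF G_nD(1)[OF al], of "\<ominus> h" h] hL ah by simp
  also have "\<dots> = \<zero>" using hL Aut_simps(2)[OF G_nD(1)[OF al]] by (simp add: l_neg)
  finally show ?thesis using hL minus_equality[of "al (\<ominus> h)" h] G_nD(1)[OF al] by simp
  qed
  thus ?thesis using that unfolding E_def by simp
  qed
  show "h1 \<otimes> h2:E n" "h1 \<oplus> h2:E n" if "h1:E n" "h2:E n" for h1 h2
  proof -
  have h: "h1:carrier L" "h2:carrier L" using that E_carrier by auto
  have "al (h1 \<otimes> h2) = h1 \<otimes> h2 & al (h1 \<oplus> h2) = h1 \<oplus> h2" if al: "al:G_n n" for al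
  using Aut_simps(3,4)[OF G_nD(1)[OF al] h] G_nD(4)[OF al \<open>h1 : E n\<close>] G_nD(4)[OF al \<open>h2 : E n\<close>] by simp
  thus "h1 \<otimes> h2:E n" "h1 \<oplus> h2:E n" using h unfolding E_def by simp_all
  qed
 qed
 show "inv k:E n" if k: "k:E n - {\<zero>}" for k
 proof -
  have kL: "k:carrier L" "k ~= \<zero>" using k E_carrier by auto
  have ik: "inv k:carrier L" "inv k \<otimes> k = \<one>" using kL field_Units by auto
  have "al (inv k) = inv k" if al: "al:G_n n" for al
  proof -
  have "al (inv k) \<otimes> k = inv k \<otimes> k"
  using Aut_simps(1,3)[OF G_nD(1)[OF al]] ik kL k G_nD(4)[OF al, of k] by (metis DiffD1)
  thus ?thesis using field_cancel[of "al (inv k)" "inv k" k] ik kL G_nD(1)[OF al] by simp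
  qed
  thus ?thesis unfolding E_def using ik by simp
 qed
qed

lemma E_units_subgroup: "subgroup (E n - {\<zero>}) MM"
proof (rule mg.subgroupI)
 note E = subringE[OF subfieldE(1)[OF E_subfield[of n]]]
 show "E n - {\<zero>} <= carrier MM" using E_carrier by auto
 show "E n - {\<zero>} ~= {}" using E(3) by auto
 fix a assume a: "a:E n - {\<zero>}"
 hence aM: "a:carrier MM" using E_carrier by auto
 have "al (minv a) = minv a" if "al:G_n n" for al
 proof -
  have "al (a [^M] (-1::int)) = al a [^M] (-1::int)"
  using Aut_int_pow[OF G_nD(1)[OF that]] aM by simp
  moreover have "al a = a" using G_nD(4)[OF that] a by blast
  moreover have "a [^M] (-1::int) = minv a" using mg.int_pow_neg[OF aM, of 1] mg.int_pow_1[OF aM] by simp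
  ultimately show ?thesis by simp
 qed
 thus "minv a:E n - {\<zero>}" unfolding E_def using mg.inv_closed[OF aM] by simp
next
 note E = subringE[OF subfieldE(1)[OF E_subfield[of n]]]
 fix a b assume ab: "a:E n - {\<zero>}" "b:E n - {\<zero>}"
 hence "a:carrier L" "b:carrier L" using E_carrier by auto
 thus "a *M b:E n - {\<zero>}" using E(6)[of a b] ab integral_iff[of a b] by simp
qed

lemma E_exhaust: "x:carrier L ==> EX n. x:E n"
 using R_exhaust R_E F_E subringE(2)[OF subfieldE(1)[OF F_subfield]] by (cases "x = \<zero>") blast+

lemma mu_F: "mu <= F" unfolding mu_def using roots_of_unity by blast

lemma F_ring_hom_Aut:
 assumes "tu:carrier (galois_group (L\<lparr>carrier := F\<rparr>) K)"
 shows "tu:ring_hom (L\<lparr>carrier := F\<rparr>) L" "x:F ==> tu x:F" "EX al:Aut. ALL a:F. al a = tu a" "inj_on tu F"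
proof -
 have h: "tu:ring_hom (L\<lparr>carrier := F\<rparr>) (L\<lparr>carrier := F\<rparr>)" and B: "tu:Bij F"
  using assms unfolding carrier_galois_group by auto
 show c: "x:F ==> tu x:F" for x using ring_hom_closed[OF h] by simp
 show h': "tu:ring_hom (L\<lparr>carrier := F\<rparr>) L"
  using ring_hom_mult[OF h] ring_hom_add[OF h] ring_hom_one[OF h] c F_carrier by (intro ring_hom_memI) auto
 show "EX al:Aut. ALL a:F. al a = tu a"
  by (rule automorphism_extension[OF subfieldE(1)[OF F_subfield] prime_field_F h'])
 show "inj_on tu F" using B unfolding Bij_def bij_betw_def by blast
qed

text \<open>Normality of F over K inside \<open>L\<close>, derived from the fixed-field form of the
  Galois property: the polynomial whose roots are the conjugates of \<open>x\<close> under Gal(F/K)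
  has coefficients in K, so \<open>al x\<close> is again one of its roots.\<close>

lemma Aut_F_stable:
 assumes al: "al:Aut" "!!a. a:K ==> al a = a" and x: "x:F"
 shows "al x:F"
proof -
 let ?GK = "galois_group (L\<lparr>carrier := F\<rparr>) K"
 interpret g: comm_group ?GK by (rule F_galois(5))
 define Y where "Y = {tu x | tu. tu:carrier ?GK}"
 have xL: "x:carrier L" using x F_carrier by blast
 have YF: "Y <= F" unfolding Y_def using F_ring_hom_Aut(2) x by blast
 have "Y <= {bt x | bt. bt:Aut}"
 proof
  fix y assume "y:Y"
  then obtain tu where tu: "tu:carrier ?GK" "y = tu x" unfolding Y_def by blast
  obtain bt where "bt:Aut" "ALL a:F. bt a = tu a" using F_ring_hom_Aut(3)[OF tu(1)] by blast
  hence "y = bt x & bt:Aut" using tu(2) x by simp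
  thus "y:{bt x | bt. bt:Aut}" by (intro CollectI exI[of _ bt])
 qed
 hence fin: "finite Y" using finite_orbit[OF xL] finite_subset by blast
 have xY: "x:Y"
 proof -
  have "\<one>\<^bsub>?GK\<^esub> x = x" using x by (simp add: galois_group_one)
  thus ?thesis unfolding Y_def by (intro CollectI exI[of _ "\<one>\<^bsub>?GK\<^esub>"]) (use g.one_closed in simp)
 qed
 obtain c where c: "!!i. c i:F" "!!i. Polynomial.coeff (\<Prod>x\<in>Y. [:- ph x, 1:]) i = ph (c i)"
  "!!i tu. tu:ring_hom (L\<lparr>carrier := F\<rparr>) L ==> Polynomial.coeff (\<Prod>x\<in>Y. [:- ph (tu x), 1:]) i = ph (tu (c i))"
  using exists_coeffs[OF subfieldE(1)[OF F_subfield] fin YF] by auto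
 have cK: "c i:K" for i
 proof (rule F_galois(4)[OF c(1)])
  fix tu assume tu: "tu:carrier ?GK"
  have inj: "inj_on tu Y" using F_ring_hom_Aut(4)[OF tu] YF by (rule inj_on_subset)
  have "tu ` Y <= Y"
  proof
  fix z assume "z:tu ` Y"
  then obtain rh where rh: "rh:carrier ?GK" "z = tu (rh x)" unfolding Y_def by blast
  have "(tu \<otimes>\<^bsub>?GK\<^esub> rh) x = z" using galois_group_mult[OF tu rh(1)] rh(2) x by (simp add: compose_eq)
  thus "z:Y" unfolding Y_def using g.m_closed[OF tu rh(1)] by blast
  qed
  hence "tu ` Y = Y" using inj fin by (intro endo_inj_surj) auto
  hence "(\<Prod>x\<in>Y. [:- ph x, 1:]) = (\<Prod>x\<in>Y. [:- ph (tu x), 1:])"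
  using prod.reindex[OF inj, of "%x. [:- ph x, 1:]"] by simp
  hence "ph (tu (c i)) = ph (c i)" using c(2)[of i] c(3)[OF F_ring_hom_Aut(1)[OF tu], of i] by simp
  thus "tu (c i) = c i" using ph_inj F_ring_hom_Aut(2)[OF tu] c(1) F_carrier by blast
 qed
 have "al:ring_hom (L\<lparr>carrier := F\<rparr>) L"
  using Aut_simps[OF al(1)] al(1) F_carrier by (intro ring_hom_memI) (auto simp: subset_iff)
 hence "(\<Prod>x\<in>Y. [:- ph (al x), 1:]) = (\<Prod>x\<in>Y. [:- ph x, 1:])"
  using c(2,3) al(2)[OF cK] by (intro poly_eqI) simp
 moreover have "poly (\<Prod>x\<in>Y. [:- ph (al x), 1:]) (ph (al x)) = 0" using xY fin by (auto simp: poly_prod)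
 ultimately have "poly (\<Prod>x\<in>Y. [:- ph x, 1:]) (ph (al x)) = 0" by simp
 then obtain y where y: "y:Y" "ph (al x) = ph y" using fin by (auto simp: poly_prod)
 hence "al x = y" using ph_inj al(1) xL YF F_carrier by (metis Aut_closed subsetD)
 thus ?thesis using y(1) YF by blast
qed

text \<open>Restrictions to F lie in Gal(F/K). Here its commutativity enters the argument.\<close>

lemma Aut_K_commute:
 assumes al: "al:Aut" "!!a. a:K ==> al a = a" and bt: "bt:Aut" "!!a. a:K ==> bt a = a"
  and x: "x:F"
 shows "al (bt x) = bt (al x)"
proof -
 let ?GK = "galois_group (L\<lparr>carrier := F\<rparr>) K"
 interpret g: comm_group ?GK by (rule F_galois(5))
 have res: "restrict al F:carrier ?GK" if al: "al:Aut" "!!a. a:K ==> al a = a" for al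
 proof -
  note st = Aut_F_stable[OF al]
  note ia = galois_inverse[OF prime_field_carrier al(1)]
  have "(inv\<^bsub>galois_group L prime_field\<^esub> al) a = a" if "a:K" for a
  using ia(2)[of a] al(2)[OF that] that F_galois(2) F_carrier by auto
  hence st': "(inv\<^bsub>galois_group L prime_field\<^esub> al) x:F" if "x:F" for x
  using Aut_F_stable[OF ia(1)] that by blast
  have "bij_betw al F F"
  proof (rule bij_betw_imageI)
  show "inj_on al F" using Aut_simps(7)[OF al(1)] F_carrier by (rule inj_on_subset)
  have "x:al ` F" if "x:F" for x using ia(3)[of x] st'[OF that] that F_carrier by (metis imageI subsetD)
  thus "al ` F = F" using st by blast
  qed
  hence "restrict al F:Bij F" unfolding Bij_def by (simp add: bij_betw_restrict_eq)
  moreover have "restrict al F:ring_hom (L\<lparr>carrier := F\<rparr>) (L\<lparr>carrier := F\<rparr>)"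
  using Aut_simps[OF al(1)] st F_carrier subringE[OF subfieldE(1)[OF F_subfield]]
  by (intro ring_hom_memI) (auto simp: subset_iff)
  ultimately show ?thesis unfolding carrier_galois_group using al(2) F_galois(2) by auto
 qed
 have "restrict al F \<otimes>\<^bsub>?GK\<^esub> restrict bt F = restrict bt F \<otimes>\<^bsub>?GK\<^esub> restrict al F"
  using g.m_comm[OF res[OF al] res[OF bt]] .
 hence "compose F (restrict al F) (restrict bt F) = compose F (restrict bt F) (restrict al F)"
  using galois_group_mult[OF res[OF al] res[OF bt]] galois_group_mult[OF res[OF bt] res[OF al]] by simp
 from fun_cong[OF this, of x] show ?thesis
  using x Aut_F_stable[OF al x] Aut_F_stable[OF bt x] by (simp add: compose_eq)
qed

text \<open>A finite spanning set of \<open>K\<close> over the prime field lies in some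
  \<open>R k\<close>, up to zero, and linear combinations with rational coefficients of fixed
  elements are fixed.\<close>

lemma exists_Gm_K: "EX k. ALL m>=k. ALL al:Gm m. ALL a:K. al a = a"
proof -
 obtain n where "dimension n prime_field K" using K_number_field unfolding finite_dimension_def prime_field_def by blast
 then obtain Us where Us: "set Us <= carrier L" "Span prime_field Us = K"
  using exists_base[OF subfield_prime_field] by blast
 obtain k where k: "set Us - {\<zero>} <= R k" using R_exhaust_finite[of "set Us - {\<zero>}" 0] Us(1) by auto
 have "al a = a" if m: "m >= k" and al: "al:Gm m" and a: "a:K" for m al a
 proof -
  note A = GmD(1)[OF al]
  have fu: "al u = u" if "u:set Us" for u
  using that k R_mono[OF m] GmD(2)[OF al] Aut_simps(2)[OF A] by (cases "u = \<zero>") auto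
  obtain Ks where Ks: "set Ks <= prime_field" "a = combine Ks Us"
  using a unfolding Us(2)[symmetric] Span_eq_combine_set[OF subfield_prime_field Us(1)] by blast
  have "al (combine Ks Vs) = combine Ks Vs" if "set Ks <= prime_field" "set Vs <= set Us" for Ks Vs
  using that
  proof (induction Ks Vs rule: combine.induct)
  case (1 k Ks u Vs)
  have fk: "al k = k" using 1(2) A unfolding carrier_galois_group by auto
  have c: "k:carrier L" "u:carrier L" "combine Ks Vs:carrier L"
  using 1(2,3) prime_field_carrier Us(1) combine_in_carrier[of Ks Vs] by auto
  thus ?case using 1 Aut_simps(3,4)[OF A] fk fu[of u] by simp
  qed (auto simp: Aut_simps(2)[OF A])
  thus ?thesis using Ks by simp
 qed
 thus ?thesis by blast
qed

text \<open>The commutator \<open>dl\<close> is trivial on F because Gal(F/K) is abelian, and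
  trivial on \<open>R m\<close> because both automorphisms are. So it lies in \<open>G_n n\<close>
  and fixes \<open>E n\<close>.\<close>

lemma E_commute: "EX k. ALL m>=k. ALL al:Gm m. ALL bt:Gm m. ALL x:E n. al (bt x) = bt (al x)"
proof -
 obtain k where k: "!!m al a. m >= k ==> al:Gm m ==> a:K ==> al a = a" using exists_Gm_K by blast
 have "al (bt x) = bt (al x)" if m: "m >= max k n" and h: "al:Gm m" "bt:Gm m" "x:E n" for m al bt x
 proof -
  note A = GmD(1)[OF h(1)] and B = GmD(1)[OF h(2)]
  define ga where "ga = compose (carrier L) bt al"
  have ga: "ga:Aut" unfolding ga_def using galois_compose[OF prime_field_carrier B A] .
  note ig = galois_inverse[OF prime_field_carrier ga]
  define dl where "dl = compose (carrier L) (inv\<^bsub>galois_group L prime_field\<^esub> ga) (compose (carrier L) al bt)"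
  have dl: "dl:Aut" unfolding dl_def
  using galois_compose[OF prime_field_carrier ig(1) galois_compose[OF prime_field_carrier A B]] .
  have dlx: "dl y = y" if "y:carrier L" "al (bt y) = bt (al y)" for y
  using ig(2)[of y] that A B unfolding dl_def ga_def by (simp add: compose_eq)
  have "dl y = y" if "y:F" for y
  using dlx[of y] Aut_K_commute[OF A _ B _ that] k[of m] m h that F_carrier by auto
  moreover have "dl y = y" if "y:R m" for y
  using dlx[of y] GmD(2)[OF h(1) that] GmD(2)[OF h(2) that] R_carrier that by simp
  ultimately have "dl:G_n n"
  using dl R_mono[of n m] m by (intro G_nI) (auto simp: G_iff)
  hence "dl x = x" using G_nD(4) h(3) by blast
  hence "ga (dl x) = ga x" by simp
  thus ?thesis using ig(3)[of "al (bt x)"] h(3) E_carrier A B unfolding dl_def ga_def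
  by (auto simp: compose_eq subset_iff)
 qed
 thus ?thesis by blast
qed

lemma E_saturation_bounded:
 assumes "finite S" "S <= carrier MM"
 shows "EX M::int. M > 0 & (ALL x:E n. x:sat MM (mu Un S) --> x [^M] M:generate MM (mu Un S))"
proof -
 obtain k where k: "!!m al bt x. m >= k ==> al:Gm m ==> bt:Gm m ==> x:E n ==> al (bt x) = bt (al x)"
  using E_commute by blast
 show ?thesis
 proof (rule saturation_bounded[of k "E n" S])
  show "et (tu x) = tu (et x)" if "k <= m" "et:Gm m" "tu:Gm m" "x:E n" for m et tu x
  using k that by blast
 qed (rule assms)+
qed

end

section \<open>Kummer extensions and linear relations between radicals\<close>

context ring
begin

text \<open>Relations are lists: they may repeat a summand, can be concatenated, and are transformed
  entry by entry.\<close>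

definition lsum :: "'a list => 'a" where "lsum l = foldr (add R) l \<zero>"

lemma list_sum_simps: "lsum [] = \<zero>" "lsum (x # l) = x \<oplus> lsum l"
 unfolding lsum_def by auto

lemma list_sum_closed: "set l <= carrier R ==> lsum l:carrier R"
 by (induction l) (auto simp: list_sum_simps)

lemma list_sum_append:
 "set l <= carrier R ==> set k <= carrier R ==> lsum (l @ k) = lsum l \<oplus> lsum k"
 by (induction l) (auto simp: list_sum_simps list_sum_closed a_assoc)

lemma list_sum_mult:
 "a:carrier R ==> set l <= carrier R ==> lsum (map (%x. a \<otimes> x) l) = a \<otimes> lsum l"
 by (induction l) (auto simp: list_sum_simps list_sum_closed r_distr)

lemma list_sum_minus:
 assumes "!!x. x:set l ==> f x:carrier R" "!!x. x:set l ==> g x:carrier R"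
 shows "lsum (map (%x. f x \<ominus> g x) l) = lsum (map f l) \<ominus> lsum (map g l)"
 using assms
proof (induction l)
 case Nil
 thus ?case by (simp add: list_sum_simps minus_eq)
next
 case (Cons x l)
 have c: "lsum (map f l):carrier R" "lsum (map g l):carrier R" "f x:carrier R" "g x:carrier R"
  using Cons.prems by (auto intro!: list_sum_closed)
 have "(f x \<ominus> g x) \<oplus> (lsum (map f l) \<ominus> lsum (map g l))
  = (f x \<oplus> lsum (map f l)) \<ominus> (g x \<oplus> lsum (map g l))"
  using c by (simp add: minus_eq minus_add a_ac)
 thus ?case using Cons by (simp add: list_sum_simps)
qed

lemma list_sum_products:
 assumes "set l <= carrier R" "set k <= carrier R"
 shows "lsum (concat (map (%a. map (%b. a \<otimes> b) k) l)) = lsum l \<otimes> lsum k"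
 using assms(1)
proof (induction l)
 case (Cons a l)
 have "set (concat (map (%a. map (%b. a \<otimes> b) k) l)) <= carrier R" "set (map (%b. a \<otimes> b) k) <= carrier R"
  using Cons.prems assms(2) by auto
 thus ?case using Cons assms(2) by (simp add: list_sum_simps list_sum_append list_sum_mult l_distr list_sum_closed)
qed (simp add: list_sum_simps list_sum_closed assms)

end

text \<open>The number of nonzero entries measures the length of a relation; a map that keeps zero
  and kills a nonzero entry shortens it.\<close>

lemma length_filter_map_less:
 assumes "!!x. x = z ==> f x = z" "d:set l" "d ~= z" "f d = z"
 shows "length (filter (%x. x ~= z) (map f l)) < length (filter (%x. x ~= z) l)"
proof -
 have le: "length (filter (%x. x ~= z) (map f k)) <= length (filter (%x. x ~= z) k)" for k
  by (induction k) (use assms(1) in auto)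
 obtain k1 k2 where "l = k1 @ d # k2" using assms(2) by (meson split_list)
 thus ?thesis using le[of k1] le[of k2] assms(3,4) by simp
qed

context abelian_closure
begin

lemma Aut_list_sum:
 "al:Aut ==> set l <= carrier L ==> al (lsum l) = lsum (map al l)"
 by (induction l) (auto simp: list_sum_simps Aut_simps(2,4) list_sum_closed)

lemma int_pow_mu:
 assumes "x:carrier MM" "j > (0::int)" "x [^M] j = \<one>"
 shows "x:mu"
proof -
 have "x [^] (nat j) = \<one>" using assms int_pow_int[of MM x "nat j"] by (simp add: nat_pow_mult_of)
 moreover have "nat j > 0" "x:carrier L" using assms by auto
 ultimately show ?thesis unfolding mu_def by blast
qed

lemma mu_int_pow:
 assumes "x:mu"
 shows "EX j>0::int. x [^M] j = \<one>"
proof -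
 obtain n :: nat where "n > 0" "x [^] n = \<one>" using assms unfolding mu_def by blast
 hence "x [^M] int n = \<one>" by (simp add: int_pow_int nat_pow_mult_of)
 thus ?thesis using \<open>n > 0\<close> by (intro exI[of _ "int n"]) simp
qed

lemma mu_E: "mu <= E n - {\<zero>}" using mu_F F_E subgroup.subset[OF mu_subgroup] by fastforce


text \<open>The radicals over \<open>E n\<close>. As F contains all roots of unity, they generate
  Kummer extensions of \<open>E n\<close>.\<close>

definition D :: "nat => 'a set" where "D n = sat MM (E n - {\<zero>})"

lemma generate_E: "generate MM (E n - {\<zero>}) = E n - {\<zero>}"
 using mg.generate_subgroup_incl[OF subset_refl E_units_subgroup] by (auto intro: generate.incl)

lemma D_iff: "x:D n <-> x:carrier L & x ~= \<zero> & (EX j>0::int. x [^M] j:E n - {\<zero>})"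
 unfolding D_def sat_def generate_E by auto

lemma E_units_sub: "E n - {\<zero>} <= carrier MM" using E_carrier by auto

lemma D_subgroup: "subgroup (D n) MM"
 unfolding D_def by (rule mg.saturation_subgroup[OF E_units_sub])

lemma E_D: "E n - {\<zero>} <= D n"
 unfolding D_def using mg.saturation_incl[OF E_units_sub] generate_E by blast

lemma D_carrier: "x:D n ==> x:carrier L" "x:D n ==> x ~= \<zero>" unfolding D_iff by auto

lemma D_pure: "x:carrier MM ==> j > (0::int) ==> x [^M] j:D n ==> x:D n"
 unfolding D_def by (rule mg.saturation_pure)

lemma D_mult: "x:D n ==> y:D n ==> x \<otimes> y:D n"
 using subgroup.m_closed[OF D_subgroup] by simp

lemma G_n_D:
 assumes et: "et:G_n n" and d: "d:D n"
 obtains ze where "ze:mu" "et d = ze \<otimes> d"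
proof -
 note A = G_nD(1)[OF et]
 have dM: "d:carrier MM" using D_carrier[OF d] by simp
 have eM: "et d:carrier MM" using hom_in_carrier[OF Aut_mult_hom[OF A] dM] .
 obtain j :: int where j: "j > 0" "d [^M] j:E n - {\<zero>}" using d unfolding D_iff by blast
 define ze where "ze = et d *M minv d"
 have zeM: "ze:carrier MM" unfolding ze_def by (rule subgroup.m_closed[OF mg.subgroup_self eM mg.inv_closed[OF dM]])
 have pM: "d [^M] j:carrier MM" using dM mg.int_pow_closed by blast
 have "et d [^M] j = d [^M] j" using Aut_int_pow[OF A, of d j] dM G_nD(4)[OF et] j(2) by simp
 hence "ze [^M] j = \<one>\<^bsub>MM\<^esub>"
  unfolding ze_def using mg.int_pow_distrib[OF eM mg.inv_closed[OF dM]] mg.int_pow_inv[OF dM] mg.r_inv[OF pM] by simp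
 hence "ze:mu" using int_pow_mu[OF zeM j(1)] by simp
 moreover have "ze *M d = et d" unfolding ze_def
  using mult_of.m_assoc[OF eM mg.inv_closed[OF dM] dM] mg.l_inv[OF dM] mult_of.r_one[OF eM] by simp
 ultimately show ?thesis using that by simp
qed

context
 fixes n :: nat and c :: "'a => 'a"
 assumes c_mu: "!!x. x:D n ==> c x:mu"
  and c_mult: "!!x y. x:D n ==> y:D n ==> c (x \<otimes> y) = c x \<otimes> c y"
  and c_E: "!!x. x:E n - {\<zero>} ==> c x = \<one>"
begin

private definition "D0 = insert \<zero> (D n)"

private definition "t d = (if d = \<zero> then \<zero> else c d \<otimes> d)"

private lemma D0_carrier: "d:D0 ==> d:carrier L" unfolding D0_def using D_carrier by auto

private lemma E_D0: "E n <= D0" unfolding D0_def using E_D by blast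

private lemma mu_carrier: "ze:mu ==> ze:carrier L" unfolding mu_def by blast

private lemma D0_mult: "x:D0 ==> y:D0 ==> x \<otimes> y:D0"
 using D_mult D_carrier unfolding D0_def by auto

private lemma t_D0: "d:D0 ==> t d:D0"
 unfolding t_def using D0_mult[of "c d" d] c_mu[of d] mu_E[of n] E_D0 by (auto simp: D0_def)

private lemma t_carrier: "d:D0 ==> t d:carrier L" using t_D0 D0_carrier by blast

private lemma t_mult: "x:D0 ==> y:D0 ==> t (x \<otimes> y) = t x \<otimes> t y"
proof -
 assume h: "x:D0" "y:D0"
 show ?thesis
 proof (cases "x = \<zero> \<or> y = \<zero>")
  case True
  thus ?thesis using h D0_carrier[of x] D0_carrier[of y] t_carrier[of x] t_carrier[of y] by (auto simp: t_def[of \<zero>])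
 next
  case False
  hence D: "x:D n" "y:D n" using h unfolding D0_def by auto
  have C: "x:carrier L" "y:carrier L" "c x:carrier L" "c y:carrier L"
  using D_carrier D c_mu mu_carrier by auto
  have "x \<otimes> y ~= \<zero>" using D_carrier(2)[OF D_mult[OF D]] .
  thus ?thesis unfolding t_def c_mult[OF D] using False C by (simp add: m_ac)
 qed
qed

private lemma t_E: "x:E n ==> t x = x"
 unfolding t_def using c_E[of x] E_carrier[of n] by auto

private lemma minus_D0: "d:D0 ==> \<ominus> d:D0 & t (\<ominus> d) = \<ominus> t d"
proof -
 assume d: "d:D0"
 have m: "\<ominus> \<one>:E n" using subringE(3,5)[OF subfieldE(1)[OF E_subfield]] by blast
 have "\<ominus> d = \<ominus> \<one> \<otimes> d" using D0_carrier[OF d] by (simp add: l_minus)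
 moreover have "t (\<ominus> \<one> \<otimes> d) = \<ominus> \<one> \<otimes> t d" using t_mult[of "\<ominus> \<one>" d] t_E[OF m] d m E_D0 by auto
 ultimately show ?thesis using D0_mult[of "\<ominus> \<one>" d] d m E_D0 t_carrier[OF d] by (auto simp: l_minus)
qed

text \<open>If two entries have a ratio outside \<open>E n\<close>, some \<open>et : G_n n\<close> acts on them with different
 factors \<open>ze\<close>; applying \<open>et - ze\<close> shortens the relation.\<close>

private lemma relation_shorten:
 assumes et: "et:G_n n" and l: "set l <= D0" "lsum l = \<zero>" and d: "d:set l" "d ~= \<zero>"
  and ze: "ze:mu" "et d = ze \<otimes> d"
  and IH: "!!k. length (filter (%x. x ~= \<zero>) k) < length (filter (%x. x ~= \<zero>) l) ==> set k <= D0 ==>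
  lsum k = \<zero> ==> lsum (map t k) = \<zero>"
 shows "et (lsum (map t l)) = ze \<otimes> lsum (map t l)"
proof -
 note A = G_nD(1)[OF et]
 have zeL: "ze:carrier L" "ze:E n" using ze(1) mu_carrier mu_E[of n] by auto
 \<comment> \<open>The operator \<open>et - ze\<close> kills \<open>d\<close> and multiplies every
   other entry by an element of \<open>E n\<close>, so it shortens the relation without leaving
   \<open>D0\<close>; moreover it commutes with \<open>t\<close>.\<close>
 define f where "f x = et x \<ominus> ze \<otimes> x" for x
 have lL: "set l <= carrier L" using l(1) D0_carrier by blast
 have fx: "f x:D0 & t (f x) = et (t x) \<ominus> ze \<otimes> t x" if x: "x:D0" for x
 proof (cases "x = \<zero>")
  case True
  thus ?thesis unfolding f_def t_def using zeL Aut_simps(2)[OF A] by (simp add: D0_def minus_eq)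
 next
  case False
  hence xD: "x:D n" using x unfolding D0_def by simp
  obtain xi where xi: "xi:mu" "et x = xi \<otimes> x" using G_n_D[OF et xD] .
  have C: "xi:carrier L" "x:carrier L" "t x:carrier L" using xi(1) mu_carrier x D0_carrier t_carrier by auto
  have e: "xi \<ominus> ze:E n" unfolding minus_eq
  using zeL(2) xi(1) mu_E[of n] subringE(5,7)[OF subfieldE(1)[OF E_subfield[of n]]] by blast
  have fe: "f x = (xi \<ominus> ze) \<otimes> x" unfolding f_def xi(2) using C zeL by (simp add: minus_eq l_distr l_minus)
  have cx: "c x:mu" "c x:carrier L" using c_mu[OF xD] mu_carrier by auto
  have "et (t x) = c x \<otimes> (xi \<otimes> x)"
  using Aut_simps(3)[OF A cx(2) C(2)] G_nD(4)[OF et, of "c x"] cx(1) mu_E[of n] xi(2) False unfolding t_def by auto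
  also have "\<dots> = xi \<otimes> t x" unfolding t_def using False cx(2) C by (simp add: m_ac)
  finally have "et (t x) \<ominus> ze \<otimes> t x = (xi \<ominus> ze) \<otimes> t x" using C zeL by (simp add: minus_eq l_distr l_minus)
  thus ?thesis unfolding fe using D0_mult[OF _ x, of "xi \<ominus> ze"] t_mult[OF _ x, of "xi \<ominus> ze"] t_E[OF e] e E_D0 by auto
 qed
 have f0: "f \<zero> = \<zero>" unfolding f_def using zeL Aut_simps(2)[OF A] by (simp add: minus_eq)
 have fd: "f d = \<zero>" unfolding f_def ze(2) using zeL d lL by (auto simp: minus_eq r_neg)
 have "lsum (map f l) = lsum (map et l) \<ominus> lsum (map (%x. ze \<otimes> x) l)"
  unfolding f_def by (rule list_sum_minus) (use lL A zeL in auto)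
 also have "\<dots> = et (lsum l) \<ominus> ze \<otimes> lsum l" using Aut_list_sum[OF A lL] list_sum_mult[OF zeL(1) lL] by simp
 finally have "lsum (map f l) = \<zero>" using l(2) zeL Aut_simps(2)[OF A] by (simp add: minus_eq)
 moreover have "length (filter (%x. x ~= \<zero>) (map f l)) < length (filter (%x. x ~= \<zero>) l)"
  using length_filter_map_less[of \<zero> f d l] f0 fd d by auto
 ultimately have z: "lsum (map t (map f l)) = \<zero>" using IH[of "map f l"] fx l(1) by auto
 have tL: "set (map t l) <= carrier L" using l(1) t_carrier by auto
 have mt: "map t (map f l) = map (%y. et y \<ominus> ze \<otimes> y) (map t l)" using fx l(1) by auto
 have "lsum (map t (map f l)) = lsum (map et (map t l)) \<ominus> lsum (map (%x. ze \<otimes> x) (map t l))"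
  unfolding mt by (rule list_sum_minus) (use tL A zeL in auto)
 hence "et (lsum (map t l)) \<ominus> ze \<otimes> lsum (map t l) = \<zero>"
  using z Aut_list_sum[OF A tL] list_sum_mult[OF zeL(1) tL] by simp
 thus ?thesis using r_right_minus_eq list_sum_closed[OF tL] A zeL by simp
qed

text \<open>If all ratios of entries to \<open>d\<close> lie in \<open>E n\<close>, then
  \<open>t\<close> multiplies the whole relation by the ratio of \<open>t d\<close> to
  \<open>d\<close>. Otherwise some \<open>et\<close> acts on two entries by different factors, and
  \<open>relation_shorten\<close> makes both factors describe \<open>et\<close> on the transformed
  sum, which must therefore vanish.\<close>

private lemma relation:
 assumes "set l <= D0" "lsum l = \<zero>"
 shows "lsum (map t l) = \<zero>"
 using assms
proof (induction "length (filter (%x. x ~= \<zero>) l)" arbitrary: l rule: less_induct)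
 case less
 have lL: "set l <= carrier L" and tL: "set (map t l) <= carrier L" using less.prems(1) D0_carrier t_carrier by auto
 note TL = list_sum_closed[OF tL]
 have IH: "lsum (map t k) = \<zero>" if "length (filter (%x. x ~= \<zero>) k) < length (filter (%x. x ~= \<zero>) l)"
  "set k <= D0" "lsum k = \<zero>" for k using less.hyps that by blast
 show ?case
 proof (cases "set l <= {\<zero>}")
  case True
  thus ?thesis by (induction l) (auto simp: list_sum_simps t_def)
 next
  case False
  then obtain d where d: "d:set l" "d ~= \<zero>" by blast
  hence dD: "d:D n" and dL: "d:carrier L" using less.prems(1) lL unfolding D0_def by auto
  have id: "minv d:D n" using subgroup.m_inv_closed[OF D_subgroup dD] .
  hence idL: "minv d:carrier L" and idd: "minv d \<otimes> d = \<one>"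
  using D_carrier mg.l_inv[of d] dL d(2) by auto
  define r where "r x = minv d \<otimes> x" for x
  have rx: "x = r x \<otimes> d" if "x:carrier L" for x
  proof -
  have "r x \<otimes> d = (minv d \<otimes> d) \<otimes> x" unfolding r_def using that idL dL by (simp add: m_ac)
  thus ?thesis using idd that by simp
  qed
  have rL: "r x:carrier L" if "x:carrier L" for x unfolding r_def using that idL by simp
  show ?thesis
  proof (cases "ALL x:set l. r x:E n")
  case True
  have tx: "t x = t d \<otimes> r x" if "x:set l" for x
  proof -
  have "t x = t (r x \<otimes> d)" using rx[of x] lL that by auto
  also have "\<dots> = r x \<otimes> t d"
  using t_mult[of "r x" d] t_E[of "r x"] True that subsetD[OF E_D0, of "r x"] dD by (simp add: D0_def)
  finally show ?thesis using m_comm[of "r x" "t d"] t_carrier[of d] rL[of x] lL that dD unfolding D0_def by auto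
  qed
  have tdL: "t d:carrier L" using t_carrier dD unfolding D0_def by blast
  have rl: "set (map r l) <= carrier L" using rL lL by auto
  have "lsum (map t l) = lsum (map (%x. t d \<otimes> x) (map r l))" using tx by (intro arg_cong[of _ _ lsum]) auto
  also have "\<dots> = t d \<otimes> lsum (map r l)" by (rule list_sum_mult[OF tdL rl])
  also have "lsum (map r l) = minv d \<otimes> lsum l" unfolding r_def by (rule list_sum_mult[OF idL lL])
  finally show ?thesis using less.prems(2) tdL idL by simp
  next
  case False
  then obtain x where x: "x:set l" "r x \<notin> E n" by blast
  have xL: "x:carrier L" using x lL by blast
  obtain et where et: "et:G_n n" "et (r x) ~= r x" using x(2) rL[OF xL] unfolding E_def by blast
  note A = G_nD(1)[OF et(1)]
  have "x ~= \<zero>" using x(2) idL subringE(2)[OF subfieldE(1)[OF E_subfield]] unfolding r_def by auto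
  hence xD: "x:D n" using x less.prems(1) unfolding D0_def by auto
  obtain ze where ze: "ze:mu" "et d = ze \<otimes> d" using G_n_D[OF et(1) dD] .
  obtain xi where xi: "xi:mu" "et x = xi \<otimes> x" using G_n_D[OF et(1) xD] .
  have C: "ze:carrier L" "xi:carrier L" using ze xi mu_carrier by auto
  have e1: "et (lsum (map t l)) = ze \<otimes> lsum (map t l)"
  by (rule relation_shorten[OF et(1) less.prems d ze IH])
  have e2: "et (lsum (map t l)) = xi \<otimes> lsum (map t l)"
  by (rule relation_shorten[OF et(1) less.prems x(1) \<open>x ~= \<zero>\<close> xi IH])
  have "ze ~= xi"
  proof
  assume "ze = xi"
  have "et (r x) \<otimes> et d = et x" using Aut_simps(3)[OF A rL[OF xL] dL] rx[OF xL] by simp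
  also have "\<dots> = r x \<otimes> et d" unfolding xi(2) ze(2) \<open>ze = xi\<close> using rx[OF xL] rL[OF xL] C dL by (metis m_lcomm)
  finally have "et (r x) = r x"
  using field_cancel[of "et (r x)" "r x" "et d"] rL[OF xL] dL d(2) A Aut_simps(5)[OF A dL] by simp
  thus False using et(2) by blast
  qed
  thus ?thesis using field_cancel[OF C TL] e1 e2 by auto
  qed
 qed
qed

text \<open>Kummer duality: a character \<open>c\<close> of \<open>D n\<close> modulo
  \<open>Eu n\<close> with values in the roots of unity comes from an automorphism. By
  \<open>relation\<close>, the map \<open>t\<close> extends additively to the ring \<open>A\<close>
  of sums of elements of \<open>D0\<close>; there it is a ring homomorphism over \<open>E n\<close>,
  and \<open>automorphism_extension\<close> carries it to \<open>L\<close>.\<close>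

theorem kummer_extension: "EX al:G_n n. ALL x:D n. al x = c x \<otimes> x"
proof -
 define A where "A = {lsum l | l. set l <= D0}"
 define tu where "tu a = lsum (map t (SOME l. set l <= D0 & lsum l = a))" for a
 have wd: "lsum (map t l) = lsum (map t k)"
  if h: "set l <= D0" "set k <= D0" "lsum l = lsum k" for l k
 proof -
  have kl: "lsum (map (%x. \<ominus> x) m) = \<ominus> lsum m" if "set m <= carrier L" for m
  using that by (induction m) (auto simp: list_sum_simps list_sum_closed minus_add)
  have C: "set l <= carrier L" "set k <= carrier L" "set (map t l) <= carrier L" "set (map t k) <= carrier L"
  using h D0_carrier t_carrier by auto
  have s: "set (l @ map (%x. \<ominus> x) k) <= D0" using h minus_D0 by auto
  have "lsum (l @ map (%x. \<ominus> x) k) = \<zero>"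
  using C h(3) kl[OF C(2)] list_sum_append[of l "map (%x. \<ominus> x) k"] list_sum_closed[OF C(2)] by (auto simp: r_neg)
  from relation[OF s this] have "lsum (map t l @ map t (map (%x. \<ominus> x) k)) = \<zero>" by simp
  moreover have mt: "map t (map (%x. \<ominus> x) k) = map (%x. \<ominus> x) (map t k)" using h(2) minus_D0 by auto
  moreover have "set (map (%x. \<ominus> x) (map t k)) <= carrier L" using C(4) by auto
  ultimately have "lsum (map t l) \<oplus> \<ominus> lsum (map t k) = \<zero>"
  using kl[OF C(4)] list_sum_append[OF C(3), of "map (%x. \<ominus> x) (map t k)"] by (simp only:)
  thus ?thesis using r_right_minus_eq[of "lsum (map t l)" "lsum (map t k)"] list_sum_closed C(3,4)
  unfolding minus_eq by blast
 qed
 have tu: "tu (lsum l) = lsum (map t l)" if l: "set l <= D0" for l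
 proof -
  have "set (SOME k. set k <= D0 & lsum k = lsum l) <= D0
  & lsum (SOME k. set k <= D0 & lsum k = lsum l) = lsum l"
  by (rule someI[of _ l]) (use l in simp)
  thus ?thesis unfolding tu_def using wd[OF _ l] by blast
 qed
 have sing: "x:A & tu x = t x" if "x:D0" for x
 proof -
  have "lsum [x] = x" "lsum (map t [x]) = t x" using that D0_carrier t_carrier by (auto simp: list_sum_simps)
  thus ?thesis using tu[of "[x]"] that unfolding A_def by (auto intro: exI[of _ "[x]"])
 qed
 have AL: "A <= carrier L" unfolding A_def using list_sum_closed D0_carrier by blast
 have ops: "a \<oplus> b:A & a \<otimes> b:A & tu (a \<oplus> b) = tu a \<oplus> tu b & tu (a \<otimes> b) = tu a \<otimes> tu b"
  if ab: "a:A" "b:A" for a b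
 proof -
  obtain l k where lk: "a = lsum l" "set l <= D0" "b = lsum k" "set k <= D0" using ab unfolding A_def by blast
  have C: "set l <= carrier L" "set k <= carrier L" "set (map t l) <= carrier L" "set (map t k) <= carrier L"
  using lk D0_carrier t_carrier by auto
  have p: "a \<oplus> b = lsum (l @ k)" using list_sum_append[OF C(1,2)] lk by simp
  define m where "m = concat (map (%a. map (%b. a \<otimes> b) k) l)"
  have q: "a \<otimes> b = lsum m" unfolding m_def using list_sum_products[OF C(1,2)] lk by simp
  have m: "set m <= D0" unfolding m_def using lk D0_mult by auto
  have "map t m = concat (map (%a. map (%b. a \<otimes> b) (map t k)) (map t l))"
  unfolding m_def map_concat map_map using lk t_mult by (intro arg_cong[of _ _ concat] map_cong) auto
  hence "tu (a \<otimes> b) = tu a \<otimes> tu b"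
  unfolding q tu[OF m] using list_sum_products[OF C(3,4)] lk tu by simp
  moreover have "tu (a \<oplus> b) = tu a \<oplus> tu b"
  unfolding p using tu[of "l @ k"] list_sum_append[OF C(3,4)] lk tu by simp
  moreover have "a \<oplus> b:A" unfolding p A_def using lk by (intro CollectI exI[of _ "l @ k"]) auto
  moreover have "a \<otimes> b:A" unfolding q A_def using m by blast
  ultimately show ?thesis by blast
 qed
 have EA: "E n <= A" using E_D0 sing by blast
 have oneE: "\<one>:E n" using subringE(3)[OF subfieldE(1)[OF E_subfield]] .
 have "subring A L"
 proof (rule subringI)
  show "A <= carrier L" by (rule AL)
  show "\<one>:A" using oneE EA by blast
  fix a assume a: "a:A"
  have "\<ominus> \<one>:A" using subringE(3,5)[OF subfieldE(1)[OF E_subfield]] EA by blast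
  hence "\<ominus> \<one> \<otimes> a:A" using ops a by blast
  thus "\<ominus> a:A" using a AL by (auto simp: l_minus subset_iff)
 qed (use ops in blast)+
 moreover have "tu:ring_hom (L\<lparr>carrier := A\<rparr>) L"
 proof (rule ring_hom_memI)
  show "tu x:carrier L" if "x:carrier (L\<lparr>carrier := A\<rparr>)" for x
  proof -
  have "x:A" using that by simp
  then obtain l where "x = lsum l" "set l <= D0" unfolding A_def by blast
  thus ?thesis using tu[of l] t_carrier list_sum_closed[of "map t l"] by auto
  qed
  show "tu \<one>\<^bsub>L\<lparr>carrier := A\<rparr>\<^esub> = \<one>" using sing[of \<one>] t_E[OF oneE] oneE E_D0 by auto
 qed (use ops in auto)
 moreover have "prime_field <= A" using prime_field_F F_E EA by blast
 ultimately obtain al where al: "al:Aut" "ALL a:A. al a = tu a" using automorphism_extension by blast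
 have fE: "al x = x" if "x:E n" for x using al(2) EA sing[of x] t_E[OF that] that E_D0 by auto
 have "al:carrier GG" unfolding G_iff using al(1) fE F_E by blast
 hence "al:G_n n" by (rule G_nI) (use fE R_E in blast)
 moreover have "al x = c x \<otimes> x" if "x:D n" for x
  using al(2) sing[of x] that D_carrier[OF that] unfolding D0_def t_def by simp
 ultimately show ?thesis by blast
qed

end

end

section \<open>Characters of the multiplicative group\<close>

lemma cis_2pi_eq_1_iff: "cis (2 * pi * x) = 1 <-> x:\<int>"
proof
 assume "cis (2 * pi * x) = 1"
 hence "cos (2 * pi * x) = 1" by (metis Re_complex_of_real cis.sel(1) of_real_1)
 then obtain n :: int where "2 * pi * x = of_int n * 2 * pi" unfolding cos_one_2pi_int by blast
 hence "x = of_int n" by simp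
 thus "x:\<int>" by simp
qed (rule cis_multiple_2pi)

lemma of_real_of_rat: "complex_of_real (of_rat r) = of_rat r"
 by (cases r) (simp add: of_rat_rat)

lemma rat_group: "comm_group rat_group" "subgroup \<int> rat_group" "normal \<int> rat_group"
proof -
 show c: "comm_group rat_group"
 proof (rule comm_groupI)
  show "EX y:carrier rat_group. y \<otimes>\<^bsub>rat_group\<^esub> x = \<one>\<^bsub>rat_group\<^esub>" for x
  unfolding rat_group_def by (auto intro: exI[of _ "- x"])
 qed (auto simp: rat_group_def)
 interpret comm_group rat_group by (rule c)
 have inv: "inv\<^bsub>rat_group\<^esub> x = - x" for x
  by (rule inv_equality) (auto simp: rat_group_def)
 show s: "subgroup \<int> rat_group"
  by (rule subgroupI) (auto simp: rat_group_def inv[unfolded rat_group_def] Ints_add)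
 show "normal \<int> rat_group" by (rule subgroup_imp_normal[OF s])
qed

lemma rat_coset: "\<int> #>\<^bsub>rat_group\<^esub> r = {k + r | k. k:\<int>}"
 unfolding r_coset_def rat_group_def by auto

context abelian_closure
begin

definition z :: "rat => 'a" where "z r = \<iota> (\<int> #>\<^bsub>rat_group\<^esub> r)"

lemma z_simps: "z r:F - {\<zero>}" "z (r + s) = z r \<otimes> z s" "z r = \<one> <-> r:\<int>"
proof -
 interpret N: normal \<int> rat_group by (rule rat_group)
 have h: "\<iota>:hom rat_mod_int (mult_of (L\<lparr>carrier := F\<rparr>))" and inj: "inj_on \<iota> (carrier rat_mod_int)"
  using embedding unfolding mon_def by auto
 have car: "\<int> #>\<^bsub>rat_group\<^esub> r:carrier rat_mod_int" for r
  unfolding rat_mod_int_def FactGroup_def RCOSETS_def by (auto simp: rat_group_def)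
 show zF: "z r:F - {\<zero>}" for r unfolding z_def using hom_in_carrier[OF h car[of r]] by auto
 show zm: "z (r + s) = z r \<otimes> z s" for r s
 proof -
  have "(\<int> #>\<^bsub>rat_group\<^esub> r) \<otimes>\<^bsub>rat_mod_int\<^esub> (\<int> #>\<^bsub>rat_group\<^esub> s) = \<int> #>\<^bsub>rat_group\<^esub> (r + s)"
  unfolding rat_mod_int_def FactGroup_def using N.rcos_sum[of r s] by (simp add: rat_group_def)
  thus ?thesis unfolding z_def using hom_mult[OF h car[of r] car[of s]] by simp
 qed
 have zL: "z r:carrier L" "z r ~= \<zero>" for r using zF F_carrier by auto
 have "z 0 = z 0 \<otimes> z 0" using zm[of 0 0] by simp
 hence z0: "z 0 = \<one>" using field_cancel[of \<one> "z 0" "z 0"] zL by simp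
 have mem: "r:\<int> #>\<^bsub>rat_group\<^esub> r" for r unfolding rat_coset by force
 have int: "\<int> #>\<^bsub>rat_group\<^esub> r = \<int>" if "r:\<int>" for r
 proof -
  have "EX k:\<int>. x = k + r" if "x:\<int>" for x using \<open>r : \<int>\<close> that by (intro bexI[of _ "x - r"]) auto
  thus ?thesis unfolding rat_coset using that by (auto intro: Ints_add)
 qed
 show "z r = \<one> <-> r:\<int>"
 proof
  assume "z r = \<one>"
  hence "\<int> #>\<^bsub>rat_group\<^esub> r = \<int> #>\<^bsub>rat_group\<^esub> 0"
  using inj_onD[OF inj _ car[of r] car[of 0]] z0 unfolding z_def by simp
  thus "r:\<int>" using mem[of r] int[of 0] by simp
 next
  assume "r:\<int>"
  hence "z r = z 0" unfolding z_def using int[of r] int[of 0] by simp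
  thus "z r = \<one>" using z0 by simp
 qed
qed

lemma z_carrier: "z r:carrier L" "z r ~= \<zero>" using z_simps(1) F_carrier by auto

lemma z_pow: "z r [^] (n::nat) = z (of_nat n * r)"
proof (induction n)
 case 0
 thus ?case using z_simps(3)[of 0] by simp
next
 case (Suc n)
 have "z (of_nat (Suc n) * r) = z (of_nat n * r + r)" by (simp add: algebra_simps)
 thus ?case using Suc z_simps(2) by simp
qed

lemma z_mu: "z r:mu"
proof -
 obtain a b where ab: "r = Rat.Fract a b" "b > 0" by (cases r) auto
 have "of_int b * r = of_int a" using ab by (simp add: Fract_of_int_quotient)
 hence "of_nat (nat b) * r = of_int a" using ab(2) by simp
 hence "z r [^] nat b = \<one>" unfolding z_pow using z_simps(3) by simp
 thus ?thesis unfolding mu_def using z_carrier ab(2) by (auto intro!: exI[of _ "nat b"])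
qed

text \<open>The n elements z(k/n) have distinct images among the n complex n-th roots of unity, so
  they exhaust them. Thus the given embedding of Q/Z is onto the torsion.\<close>

lemma mu_z: assumes "x:mu" obtains r where "x = z r"
proof -
 obtain n :: nat where n: "x:carrier L" "n > 0" "x [^] n = \<one>" using assms unfolding mu_def by blast
 let ?f = "%k::nat. ph (z (of_nat k / of_nat n))"
 have sub: "?f ` {..<n} <= {w. w ^ n = 1}"
 proof clarify
  fix k
  have "z (of_nat k / of_nat n) [^] n = \<one>" unfolding z_pow using n(2) z_simps(3) by simp
  thus "?f k ^ n = 1" using ph_simps(1,6) z_carrier(1) by metis
 qed
 have inj: "inj_on ?f {..<n}"
 proof (rule inj_onI)
  fix i j assume ij: "i:{..<n}" "j:{..<n}" "?f i = ?f j"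
  hence "z (of_nat i / of_nat n) = z (of_nat j / of_nat n)" using ph_inj z_carrier by blast
  moreover have "z (of_nat i / of_nat n) = z (of_nat i / of_nat n - of_nat j / of_nat n) \<otimes> z (of_nat j / of_nat n)"
  using z_simps(2)[symmetric] by simp
  ultimately have "z (of_nat i / of_nat n - of_nat j / of_nat n) = \<one>"
  using field_cancel[of _ \<one> "z (of_nat j / of_nat n)"] z_carrier by (metis l_one one_closed)
  hence "(of_nat i - of_nat j) / of_nat n:(\<int> :: rat set)" using z_simps(3) by (simp add: diff_divide_distrib)
  then obtain m :: int where "(of_nat i - of_nat j) / of_nat n = (of_int m :: rat)" by (auto elim: Ints_cases)
  hence "(of_int (int i - int j) :: rat) = of_int (m * int n)" using n(2) by (simp add: field_simps)
  hence e: "int i - int j = m * int n" by (simp only: of_int_eq_iff)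
  have "\<bar>m * int n\<bar> < int n" unfolding e[symmetric] using ij by auto
  hence "m = 0" using n(2) by (simp add: abs_mult)
  thus "i = j" using e by simp
 qed
 have "finite {w::complex. w ^ n = 1}" using finite_nth_roots[of n 1] n(2) by simp
 hence "?f ` {..<n} = {w. w ^ n = 1}"
  using sub inj card_roots_unity_eq[OF n(2)] by (intro card_subset_eq) (auto simp: card_image)
 moreover have "ph x:{w. w ^ n = 1}" using n ph_simps(1) ph_simps(6)[OF n(1), of n] by simp
 ultimately obtain k where "ph x = ?f k" by blast
 hence "x = z (of_nat k / of_nat n)" using ph_inj n(1) z_carrier by blast
 thus ?thesis using that by blast
qed

abbreviation U where "U \<equiv> carrier L - {\<zero>}"

definition Chars :: "('a => complex) set" where "Chars = topspace (X_closure L \<iota>)"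

lemma X_iff: "kp:Chars <-> kp:extensional U & (ALL x:U. cmod (kp x) = 1)
 & (ALL x:U. ALL y:U. kp (x \<otimes> y) = kp x * kp y) & (ALL r. kp (z r) = cis (2 * pi * of_rat r))"
proof -
 have "exp (2 * of_real pi * \<i> * of_rat r) = cis (2 * pi * of_rat r)" for r
  unfolding cis_conv_exp by (simp add: of_real_of_rat mult_ac)
 thus ?thesis
  unfolding Chars_def X_closure_def topspace_subtopology topspace_product_topology z_def hom_def circle_group_def PiE_def
  by (auto simp: Pi_iff)
qed

lemma X_D: assumes "kp:Chars"
 shows "kp:extensional U" "!!x. x:U ==> cmod (kp x) = 1"
  "!!x y. x:U ==> y:U ==> kp (x \<otimes> y) = kp x * kp y" "!!r. kp (z r) = cis (2 * pi * of_rat r)"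
  "!!x. x:U ==> kp x ~= 0" "kp \<one> = 1"
proof -
 note h = assms[unfolded X_iff]
 show "kp:extensional U" using h by blast
 show c: "!!x. x:U ==> cmod (kp x) = 1" using h by blast
 show "!!x y. x:U ==> y:U ==> kp (x \<otimes> y) = kp x * kp y" using h by blast
 show z: "!!r. kp (z r) = cis (2 * pi * of_rat r)" using h by blast
 show "!!x. x:U ==> kp x ~= 0" using c by force
 show "kp \<one> = 1" using z[of 0] z_simps(3)[of 0] by simp
qed

lemma X_pow: "kp:Chars ==> x:U ==> kp (x [^] (n::nat)) = kp x ^ n"
 by (induction n) (auto simp: X_D(3,6) pow_nonzero)

lemma X_int_pow:
 assumes "kp:Chars" "x:U" "j > (0::int)"
 shows "kp (x [^M] j) = kp x ^ nat j"
 using X_pow[OF assms(1,2), of "nat j"] assms(3) int_pow_int[of MM x "nat j"] by (simp add: nat_pow_mult_of)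

lemma mu_U: "x:mu ==> x:U" using subgroup.subset[OF mu_subgroup] by auto

lemma X_mu: "kp:Chars ==> kp':Chars ==> x:mu ==> kp x = kp' x"
 by (erule mu_z) (simp add: X_D(4))

lemma X_mu_inj: "kp:Chars ==> x:mu ==> kp x = 1 ==> x = \<one>"
proof (erule mu_z)
 fix r assume h: "kp:Chars" "kp x = 1" "x = z r"
 hence "real_of_rat r:\<int>" using X_D(4)[of kp r] cis_2pi_eq_1_iff by simp
 then obtain k where "real_of_rat r = of_int k" by (auto elim: Ints_cases)
 hence "real_of_rat r = real_of_rat (of_int k)" by simp
 hence "r = of_int k" by (simp only: of_rat_eq_iff)
 thus "x = \<one>" using h(3) z_simps(3) by simp
qed

lemma X_mu_root: assumes "u ^ n = (1::complex)" "n > 0" obtains ze where "ze:mu" "!!kp. kp:Chars ==> kp ze = u"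
proof -
 have "u:{z. z ^ n = 1}" using assms(1) by simp
 then obtain k where k: "u = cis (2 * pi * real k / real n)"
  using bij_betw_imp_surj_on[OF Complex.bij_betw_roots_unity[OF assms(2)]] by blast
 show ?thesis
 proof (rule that[of "z (of_nat k / of_nat n)"])
  show "kp (z (of_nat k / of_nat n)) = u" if "kp:Chars" for kp using X_D(4)[OF that] k by (simp add: of_rat_divide)
 qed (rule z_mu)
qed

text \<open>Precomposition gives a right action, without the inverse in
  \<open>galois_action\<close>; the orbits are the same by \<open>q_iff\<close>.\<close>

definition act :: "('a => complex) => ('a => 'a) => 'a => complex" where
 "act kp tu = (\<lambda>x\<in>U. kp (tu x))"

definition twist :: "('a => complex) => ('a => real) => 'a => complex" where
 "twist kp f = (\<lambda>x\<in>U. kp x * cis (2 * pi * f x))"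

abbreviation additive where "additive f \<equiv> add_hom MM U f"

lemma additiveD: "additive f ==> x:U ==> y:U ==> f (x \<otimes> y) = f x + f y"
 unfolding add_hom_def by simp

lemma additive_mu: "additive f ==> x:mu ==> f x = 0"
proof -
 assume f: "additive f" and x: "x:mu"
 have s: "subgroup U MM" using mg.subgroup_self by simp
 obtain j :: int where j: "j > 0" "x [^M] j = \<one>" using mu_int_pow[OF x] by blast
 have "f \<one> = of_int j * f x" using mg.add_hom_int_pow(3)[OF s f mu_U[OF x], of j] j(2) by simp
 moreover have "f \<one> = 0" using mg.add_hom_int_pow(1)[OF s f] x mu_U by auto
 ultimately show ?thesis using j(1) by simp
qed

lemma G_U: "tu:carrier GG ==> x:U ==> tu x:U"
 using Aut_simps(5)[OF G_Aut] by auto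

lemma act_X: "kp:Chars ==> tu:carrier GG ==> act kp tu:Chars"
proof -
 assume kp: "kp:Chars" and tu: "tu:carrier GG"
 have "tu (z r) = z r" for r using tu z_simps(1) unfolding G_iff by blast
 moreover have "tu (x \<otimes> y) = tu x \<otimes> tu y" if "x:U" "y:U" for x y
  using Aut_simps(3)[OF G_Aut[OF tu]] that by simp
 ultimately show ?thesis unfolding X_iff act_def using X_D[OF kp] G_U[OF tu] z_carrier by (auto simp: integral_iff)
qed

lemma twist_X: "kp:Chars ==> additive f ==> twist kp f:Chars"
proof -
 assume kp: "kp:Chars" and f: "additive f"
 have "f (z r) = 0" for r by (rule additive_mu[OF f z_mu])
 thus ?thesis unfolding X_iff twist_def using X_D[OF kp] additiveD[OF f] z_carrier
  by (auto simp: integral_iff norm_mult cis_mult[symmetric] algebra_simps)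
qed

text \<open>On \<open>D n\<close> the ratio of the characters has values in roots of unity and is
  trivial on \<open>Eu n\<close>. Both characters embed \<open>mu\<close> into the circle in the
  same way, so the ratio comes from a unique \<open>c\<close> with values in \<open>mu\<close>, and
  \<open>kummer_extension\<close> realises \<open>c\<close>.\<close>

lemma kummer_match:
 assumes kp: "kp:Chars" "kp':Chars" and eq: "!!x. x:E n - {\<zero>} ==> kp x = kp' x"
 shows "EX \<sigma>:G_n n. ALL x:D n. kp' (\<sigma> x) = kp x"
proof -
 have DU: "x:U" if "x:D n" for x using D_carrier[OF that] by simp
 have ex: "EX ze:mu. kp' ze = kp x / kp' x" if x: "x:D n" for x
 proof -
  obtain j :: int where j: "j > 0" "x [^M] j:E n - {\<zero>}" using x unfolding D_iff by blast
  have "(kp x / kp' x) ^ nat j = 1"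
  using eq[OF j(2)] X_int_pow[OF kp(1) DU[OF x] j(1)] X_int_pow[OF kp(2) DU[OF x] j(1)] X_D(5)[OF kp(2) DU[OF x]]
  by (simp add: power_divide)
  then obtain ze where "ze:mu" "!!rh. rh:Chars ==> rh ze = kp x / kp' x"
  by (rule X_mu_root) (use j(1) in auto)
  thus ?thesis using kp(2) by blast
 qed
 define c where "c x = (SOME ze. ze:mu & kp' ze = kp x / kp' x)" for x
 have c: "c x:mu & kp' (c x) = kp x / kp' x" if "x:D n" for x
  unfolding c_def by (rule someI_ex) (use ex[OF that] in blast)
 have uniq: "a = b" if ab: "a:mu" "b:mu" "kp' a = kp' b" for a b
 proof -
  have i: "minv b:mu" using subgroup.m_inv_closed[OF mu_subgroup ab(2)] .
  have bU: "b:carrier MM" using mu_U[OF ab(2)] by simp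
  have e: "minv b \<otimes> b = \<one>" using mg.l_inv[OF bU] by simp
  have m: "minv b \<otimes> a:mu" using subgroup.m_closed[OF mu_subgroup i ab(1)] by simp
  have "kp' (minv b \<otimes> a) = kp' (minv b \<otimes> b)" using X_D(3)[OF kp(2) mu_U[OF i]] mu_U ab by simp
  hence "minv b \<otimes> a = \<one>" using X_mu_inj[OF kp(2) m] e X_D(6)[OF kp(2)] by simp
  hence "minv b \<otimes> a = minv b \<otimes> b" using e by simp
  thus ?thesis using m_lcancel[of "minv b" a b] mu_U[OF i] mu_U[OF ab(1)] mu_U[OF ab(2)] by simp
 qed
 have "EX \<sigma>:G_n n. ALL x:D n. \<sigma> x = c x \<otimes> x"
 proof (rule kummer_extension)
  show "c x:mu" if "x:D n" for x using c[OF that] by blast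
  show "c (x \<otimes> y) = c x \<otimes> c y" if h: "x:D n" "y:D n" for x y
  proof (rule uniq)
  show m: "c x \<otimes> c y:mu" using subgroup.m_closed[OF mu_subgroup] c h by auto
  show "c (x \<otimes> y):mu" using c D_mult h by blast
  show "kp' (c (x \<otimes> y)) = kp' (c x \<otimes> c y)"
  using c[OF h(1)] c[OF h(2)] c[OF D_mult[OF h]] X_D(3)[OF kp(2) mu_U mu_U, of "c x" "c y"]
  X_D(3)[OF kp(1) DU[OF h(1)] DU[OF h(2)]] X_D(3)[OF kp(2) DU[OF h(1)] DU[OF h(2)]] by simp
  qed
  show "c x = \<one>" if x: "x:E n - {\<zero>}" for x
  proof -
  have xD: "x:D n" using x E_D by blast
  have "kp' (c x) = 1" using c[OF xD] eq[OF x] X_D(5)[OF kp(2) DU[OF xD]] by simp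
  thus ?thesis using X_mu_inj[OF kp(2)] c[OF xD] by blast
  qed
 qed
 then obtain \<sigma> where \<sigma>: "\<sigma>:G_n n" "!!x. x:D n ==> \<sigma> x = c x \<otimes> x" by blast
 have "kp' (\<sigma> x) = kp x" if x: "x:D n" for x
  unfolding \<sigma>(2)[OF x] using c[OF x] X_D(3)[OF kp(2) mu_U DU[OF x], of "c x"] X_D(5)[OF kp(2) DU[OF x]] by simp
 thus ?thesis using \<sigma>(1) by blast
qed

abbreviation Eu where "Eu n \<equiv> E n - {\<zero>}"

abbreviation \<E> where "\<E> n \<equiv> MM\<lparr>carrier := Eu n\<rparr>"

lemma \<E>_group: "comm_group (\<E> n)"
proof -
 interpret e: group "\<E> n" by (rule subgroup.subgroup_is_group[OF E_units_subgroup mg.is_group])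
 show ?thesis by (rule e.group_comm_groupI) (use E_carrier in \<open>auto simp: m_comm subset_iff\<close>)
qed

lemma \<E>_saturation:
 assumes "B <= Eu n"
 shows "sat (\<E> n) B = sat MM B Int Eu n" "generate (\<E> n) B = generate MM B"
proof -
 show g: "generate (\<E> n) B = generate MM B" by (rule mg.generate_consistent[OF assms E_units_subgroup])
 show "sat (\<E> n) B = sat MM B Int Eu n"
  unfolding sat_def g using mg.int_pow_consistent[OF E_units_subgroup, of _ n] E_carrier by auto
qed

lemma countable_Eu: "countable (Eu n)" using countable_subset[OF _ countable_carrier] E_carrier by blast

lemma additive_extend:
 assumes "add_hom MM (Eu n) f"
 shows "EX g. additive g & (ALL x:Eu n. g x = f x)"
 using mg.add_hom_extend[OF _ E_units_subgroup assms] countable_subset[OF _ countable_carrier, of U] by auto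

text \<open>The circle-valued homomorphism \<open>kp' / kp\<close> on \<open>Eu n\<close> is lifted,
  starting from 0 on the saturated subgroup \<open>B\<close>. The values of the logarithm outside
  \<open>Eu n\<close> come from an arbitrary real extension, so nothing is claimed there about
  \<open>kp'\<close>.\<close>

lemma lift_on_Eu:
 assumes kp: "kp:Chars" "kp':Chars" and B: "subgroup B MM" "B <= Eu n" "sat MM B Int Eu n <= B"
  and bounded: "!!S. finite S ==> S <= Eu n ==>
  EX M>0::int. ALL x:Eu n. x:sat MM (B Un S) --> x [^M] M:generate MM (B Un S)"
  and eq: "!!x. x:B ==> kp x = kp' x"
 shows "EX f. additive f & (ALL x:B. f x = 0) & (ALL x:Eu n. kp' x = kp x * cis (2 * pi * f x))"
proof -
 interpret e: comm_group "\<E> n" by (rule \<E>_group)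
 have sB: "subgroup B (\<E> n)" using mg.subgroup_incl[OF B(1) E_units_subgroup B(2)] .
 have EU: "x:U" if "x:Eu n" for x using that E_carrier by auto
 have satB: "sat (\<E> n) B <= B" using \<E>_saturation(1)[OF B(2)] B(3) by simp
 have "EX f. add_hom (\<E> n) (carrier (\<E> n)) f & (ALL x:sat (\<E> n) B. f x = 0)
  & (ALL x:carrier (\<E> n). cis (2 * pi * f x) = kp' x / kp x)"
 proof (rule e.lift_circle_hom[OF _ sB])
  show "countable (carrier (\<E> n))" using countable_Eu by simp
  show "EX M>0. ALL x:sat (\<E> n) (B Un S). x [^]\<^bsub>\<E> n\<^esub> (M::int):generate (\<E> n) (B Un S)"
  if S: "finite S" "S <= carrier (\<E> n)" for S
  proof -
  have BS: "B Un S <= Eu n" using B(2) S(2) by auto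
  obtain M :: int where "M > 0" "ALL x:Eu n. x:sat MM (B Un S) --> x [^M] M:generate MM (B Un S)"
  using bounded[OF S(1)] S(2) by auto
  thus ?thesis unfolding \<E>_saturation[OF BS] using mg.int_pow_consistent[OF E_units_subgroup, of _ n M]
  by (intro exI[of _ M]) auto
  qed
  show "kp' (x \<otimes>\<^bsub>\<E> n\<^esub> y) / kp (x \<otimes>\<^bsub>\<E> n\<^esub> y) = kp' x / kp x * (kp' y / kp y)"
  if "x:carrier (\<E> n)" "y:carrier (\<E> n)" for x y
  using X_D(3)[OF kp(1) EU EU, of x y] X_D(3)[OF kp(2) EU EU, of x y] that by simp
  show "cmod (kp' x / kp x) = 1" if "x:carrier (\<E> n)" for x
  using X_D(2)[OF kp(1) EU, of x] X_D(2)[OF kp(2) EU, of x] that by (simp add: norm_divide)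
  show "add_hom (\<E> n) (sat (\<E> n) B) (%x. 0)" unfolding add_hom_def by simp
  show "cis (2 * pi * 0) = kp' x / kp x" if "x:sat (\<E> n) B" for x
  proof -
  have "x:B" using that satB by blast
  thus ?thesis using eq[of x] X_D(5)[OF kp(2) EU, of x] B(2) by auto
  qed
 qed
 then obtain f where f: "add_hom (\<E> n) (Eu n) f" "!!x. x:sat (\<E> n) B ==> f x = 0"
  "!!x. x:Eu n ==> cis (2 * pi * f x) = kp' x / kp x" by auto
 have "add_hom MM (Eu n) f" using f(1) unfolding add_hom_def by simp
 then obtain g where g: "additive g" "!!x. x:Eu n ==> g x = f x" using additive_extend by blast
 have "g x = 0" if "x:B" for x
 proof -
  have "x:sat (\<E> n) B" using e.saturation_incl[of B] that B(2) generate.incl[OF that] by auto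
  thus ?thesis using f(2)[of x] g(2)[of x] that B(2) by auto
 qed
 moreover have "kp' x = kp x * cis (2 * pi * g x)" if "x:Eu n" for x
  unfolding g(2)[OF that] f(3)[OF that] using X_D(5)[OF kp(1) EU[OF that]] by simp
 ultimately show ?thesis using g(1) by blast
qed

lemma mu_saturated: "sat MM mu <= mu"
proof
 fix x assume "x:sat MM mu"
 then obtain j :: int where j: "x:carrier MM" "j > 0" "x [^M] j:mu"
  unfolding sat_def using mg.generate_subgroup_incl[OF subset_refl mu_subgroup] by blast
 obtain k :: int where k: "k > 0" "(x [^M] j) [^M] k = \<one>" using mu_int_pow[OF j(3)] by blast
 hence "x [^M] (j * k) = \<one>" using mg.int_pow_pow[OF j(1)] by simp
 thus "x:mu" using int_pow_mu[OF j(1) mult_pos_pos[OF j(2) k(1)]] by blast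
qed

lemma E_bounded_mu:
 assumes "finite S" "S <= Eu n"
 shows "EX M>0::int. ALL x:Eu n. x:sat MM (mu Un S) --> x [^M] M:generate MM (mu Un S)"
proof -
 have "S <= carrier MM" using assms(2) E_carrier by auto
 thus ?thesis using E_saturation_bounded[OF assms(1), of n] by blast
qed

lemma character_lift_Eu:
 assumes "kp:Chars" "kp':Chars"
 shows "EX f. additive f & (ALL x:Eu n. kp' x = kp x * cis (2 * pi * f x))"
 using lift_on_Eu[OF assms mu_subgroup mu_E, of n] mu_saturated E_bounded_mu X_mu[OF assms] by blast

text \<open>The number 2 is a concrete element of infinite order in every \<open>Eu n\<close>. It
  serves as the test element on which winding numbers are shown to be nonzero.\<close>

lemma two_not_mu: "\<one> \<oplus> \<one>:Eu n" "\<one> \<oplus> \<one> \<notin> mu"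
proof -
 have c: "ph (\<one> \<oplus> \<one>) = 2" using ph_simps(1) ph_simps(4)[of \<one> \<one>] by simp
 hence "\<one> \<oplus> \<one> ~= \<zero>" using ph_simps(2) by auto
 thus "\<one> \<oplus> \<one>:Eu n" using subringE(3,7)[OF subfieldE(1)[OF E_subfield]] by blast
 show "\<one> \<oplus> \<one> \<notin> mu"
 proof
  assume "\<one> \<oplus> \<one>:mu"
  then obtain k :: nat where "k > 0" "(\<one> \<oplus> \<one>) [^] k = \<one>" unfolding mu_def by blast
  hence "(2::complex) ^ k = 1" using ph_simps(6)[of "\<one> \<oplus> \<one>" k] c ph_simps(1) by simp
  hence "cmod (2 ^ k) = 1" by simp
  hence "(2::real) ^ k = 1" by (simp add: norm_power)
  thus False using \<open>k > 0\<close> one_less_power[of "2::real" k] by simp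
 qed
qed

text \<open>Twisting by an integer-valued \<open>h\<close> leaves a character unchanged on
  \<open>Eu n\<close> but has a nontrivial winding number there. This is the source of elements of
  \<open>W\<close> near 1 with nonzero winding.\<close>

lemma integer_hom_Eu: "EX h. additive h & (ALL x:Eu n. h x:\<int>) & h (\<one> \<oplus> \<one>) ~= 0"
proof -
 interpret e: comm_group "\<E> n" by (rule \<E>_group)
 have "EX h. add_hom (\<E> n) (carrier (\<E> n)) h & (ALL x:carrier (\<E> n). h x:\<int>) & h (\<one> \<oplus> \<one>) ~= 0"
 proof (rule e.exists_integer_hom)
  show "countable (carrier (\<E> n))" using countable_Eu by simp
  show s: "subgroup mu (\<E> n)" using mg.subgroup_incl[OF mu_subgroup E_units_subgroup mu_E] .
  show "sat (\<E> n) mu = mu"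
  using e.saturation_incl[of mu] mu_E[of n] generate.incl[of _ mu "\<E> n"] mu_saturated \<E>_saturation(1)[OF mu_E[of n]] by auto
  show "EX M>0. ALL x:sat (\<E> n) (mu Un S). x [^]\<^bsub>\<E> n\<^esub> (M::int):generate (\<E> n) (mu Un S)"
  if S: "finite S" "S <= carrier (\<E> n)" for S
  proof -
  have BS: "mu Un S <= Eu n" using mu_E[of n] S(2) by auto
  obtain M :: int where "M > 0" "ALL x:Eu n. x:sat MM (mu Un S) --> x [^M] M:generate MM (mu Un S)"
  using E_bounded_mu[OF S(1), of n] S(2) by auto
  thus ?thesis unfolding \<E>_saturation[OF BS] using mg.int_pow_consistent[OF E_units_subgroup, of _ n M]
  by (intro exI[of _ M]) auto
  qed
 qed (use two_not_mu in auto)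
 then obtain f where f: "add_hom (\<E> n) (Eu n) f" "!!x. x:Eu n ==> f x:\<int>" "f (\<one> \<oplus> \<one>) ~= 0" by auto
 have "add_hom MM (Eu n) f" using f(1) unfolding add_hom_def by simp
 then obtain g where "additive g" "!!x. x:Eu n ==> g x = f x" using additive_extend by blast
 thus ?thesis using f two_not_mu(1)[of n] by (intro exI[of _ g]) auto
qed

lemma nth_root:
 assumes x: "x:U" and n: "n > (0::nat)"
 shows "EX y:U. y [^] n = x"
proof -
 have "EX w. w ^ n = ph x"
 proof -
  have "(if ph x = 0 then 0 else exp (Ln (ph x) / of_nat n)) ^ n = ph x"
  using n by (auto simp flip: exp_of_nat_mult)
  thus ?thesis by blast
 qed
 then obtain w where w: "w ^ n = ph x" by blast
 define q where "q = \<one> # replicate (n - 1) \<zero> @ [\<ominus> x]"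
 have q: "q:carrier (poly_ring L)" "q ~= []"
  unfolding q_def univ_poly_carrier[symmetric] polynomial_def using x by (auto simp: set_replicate_conv_if)
 have "hom_poly ph q = Polynomial.monom 1 n - [:ph x:]"
  unfolding q_def using hom_poly_replicate[OF ph_hom, of "n - 1" "[\<ominus> x]"] n x
  by (simp add: ph_simps one_pCons monom_0 minus_pCons)
 hence "poly (hom_poly ph q) w = 0" using w by (simp add: poly_monom)
 then obtain y where y: "y:carrier L" "ph y = w" using hom_poly_root_in_image[OF ph_hom q] by blast
 hence "ph (y [^] n) = ph x" using ph_simps(6)[OF y(1)] w by simp
 hence e: "y [^] n = x" using ph_inj y(1) x by blast
 hence "y ~= \<zero>" using x n nat_pow_zero[of n] by auto
 thus ?thesis using y(1) e by blast
qed

lemma additive_pow: "additive f ==> x:U ==> f (x [^] (n::nat)) = of_nat n * f x"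
proof (induction n)
 case 0
 have "\<one>:mu" using subgroup.one_closed[OF mu_subgroup] by simp
 thus ?case using additive_mu[OF 0(1)] by simp
next
 case (Suc n)
 thus ?case using additiveD[OF Suc.prems(1), of "x [^] n" x] pow_nonzero by (simp add: algebra_simps)
qed

text \<open>The group is divisible: with |f x| < n and x = y^n, the integer \<open>f y\<close> has
  absolute value below 1. This makes additive logarithms of a character ratio unique, and with them
  winding numbers.\<close>

lemma additive_integer_zero:
 assumes f: "additive f" "!!x. x:U ==> f x:\<int>" and x: "x:U"
 shows "f x = 0"
proof -
 obtain n :: nat where n: "\<bar>f x\<bar> < of_nat n" using reals_Archimedean2 by blast
 hence n0: "n > 0" by (cases n) auto
 obtain y where y: "y:U" "y [^] n = x" using nth_root[OF x n0] by blast
 have e: "f x = of_nat n * f y" using additive_pow[OF f(1) y(1), of n] y(2) by simp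
 hence "\<bar>f y\<bar> < 1" using n n0 by (simp add: abs_mult)
 hence "f y = 0" using f(2)[OF y(1)] by (auto elim!: Ints_cases)
 thus ?thesis using e by simp
qed

end

lemma (in comm_group) finprod_subgroup:
 assumes "subgroup H G" "!!x. x:A ==> f x:H"
 shows "finprod G f A:H"
 using assms(2)
proof (induction A rule: infinite_finite_induct)
 case (insert x A)
 have "f:A \<rightarrow> carrier G" "f x:carrier G" using insert.prems subgroup.mem_carrier[OF assms(1)] by auto
 thus ?case using insert subgroup.m_closed[OF assms(1)] by simp
qed (auto simp: subgroup.one_closed[OF assms(1)])

section \<open>Comparison of characters along the tower\<close>

context abelian_closure
begin

lemma Eu_U: "x:Eu n ==> x:U" using E_carrier by auto

lemma Eu_mono: "m <= n ==> Eu m <= Eu n" using E_mono[of m n] by blast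

lemma Eu_exhaust: "x:U ==> EX n. x:Eu n" using E_exhaust by blast

lemma R_U: "x:R n ==> x:U" using R_carrier by blast

lemma G_n_subgroup: "subgroup (G_n n) GG"
proof (rule G.subgroupI)
 show "G_n n <= carrier GG" using G_nD(2) by blast
 have "\<one>\<^bsub>GG\<^esub>:G_n n" by (rule G_nI[OF G.one_closed]) (simp add: galois_group_one R_carrier)
 thus "G_n n ~= {}" by blast
 show "ginv a:G_n n" if a: "a:G_n n" for a
 proof (rule G_nI)
  show "ginv a:carrier GG" using G_nD(2)[OF a] by simp
  show "(ginv a) x = x" if "x:R n" for x
  using G_inv(1)[OF G_nD(2)[OF a], of x] G_nD(3)[OF a that] R_carrier(1)[OF that] by simp
 qed
 show "a *G b:G_n n" if ab: "a:G_n n" "b:G_n n" for a b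
 proof (rule G_nI)
  show "a *G b:carrier GG" using G_nD(2) ab by simp
  show "(a *G b) x = x" if x: "x:R n" for x
  using G_mult[OF G_nD(2)[OF ab(1)] G_nD(2)[OF ab(2)] R_carrier(1)[OF x]] G_nD(3)[OF ab(1) x] G_nD(3)[OF ab(2) x] by simp
 qed
qed

lemma R_image_G: "al:carrier GG ==> x:R n ==> al x:R n" using R_stable G_Aut by blast

lemma G_n_iff:
 assumes "al:carrier GG" "bt:carrier GG"
 shows "ginv al *G bt:G_n n <-> (ALL x:R n. al x = bt x)"
proof
 assume h: "ginv al *G bt:G_n n"
 show "ALL x:R n. al x = bt x"
 proof
  fix x assume x: "x:R n"
  have "(ginv al) (bt x) = x" using G_nD(3)[OF h x] G_mult[of "ginv al" bt x] assms R_carrier[OF x] by simp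
  hence "al ((ginv al) (bt x)) = al x" by simp
  thus "al x = bt x" using G_inv(2)[OF assms(1), of "bt x"] assms(2) R_carrier[OF x] by simp
 qed
next
 assume h: "ALL x:R n. al x = bt x"
 show "ginv al *G bt:G_n n"
 proof (rule G_nI)
  show "(ginv al *G bt) x = x" if x: "x:R n" for x
  using G_mult[of "ginv al" bt x] assms R_carrier[OF x] bspec[OF h x, symmetric] G_inv(1)[OF assms(1), of x] by simp
 qed (use assms in simp)
qed

text \<open>\<open>R n\<close> is stable under the Galois group, so conjugation preserves
  \<open>G_n n\<close> and hence its fixed field.\<close>

lemma E_stable:
 assumes al: "al:carrier GG" and x: "x:E n"
 shows "al x:E n"
proof -
 have xL: "x:carrier L" using x E_carrier by blast
 have "bt (al x) = al x" if bt: "bt:G_n n" for bt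
 proof -
  note B = G_nD(2)[OF bt]
  have "ginv al *G (bt *G al):G_n n"
  by (subst G_n_iff) (use al B G_mult[OF B al] R_carrier G_nD(3)[OF bt] R_image_G[OF al] in auto)
  hence "(ginv al *G (bt *G al)) x = x" using G_nD(4) x by blast
  hence "(ginv al) (bt (al x)) = x"
  using G_mult[of "ginv al" "bt *G al" x] G_mult[OF B al xL] al B xL by simp
  hence "al ((ginv al) (bt (al x))) = al x" by simp
  thus ?thesis using G_inv(2)[OF al, of "bt (al x)"] al B xL by simp
 qed
 thus ?thesis unfolding E_def using al xL by simp
qed

lemma Eu_stable: "al:carrier GG ==> x:Eu n ==> al x:Eu n"
 using E_stable G_U[of al x] E_carrier by blast

lemma G_mult_hom: "al:carrier GG ==> x:U ==> y:U ==> al (x \<otimes> y) = al x \<otimes> al y"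
 using Aut_simps(3)[OF G_Aut] by blast

lemma G_eq_on_E:
 assumes "al:carrier GG" "bt:carrier GG" "!!x. x:R n ==> al x = bt x" and x: "x:E n"
 shows "al x = bt x"
proof -
 have xL: "x:carrier L" using x E_carrier by blast
 have "ginv al *G bt:G_n n" using G_n_iff[OF assms(1,2)] assms(3) by blast
 note G_nD(4)[OF this x]
 hence "(ginv al) (bt x) = x"
  using G_mult[of "ginv al" bt x] assms(1,2) xL by simp
 hence "al ((ginv al) (bt x)) = al x" by simp
 thus ?thesis using G_inv(2)[OF assms(1), of "bt x"] assms(2) xL by simp
qed

text \<open>Since \<open>Q\<close> is finite, \<open>th x = \<Prod>q\<in>Q. x / q x\<close> differs from a power of \<open>x\<close> by a norm, which lies in
 \<open>E n\<close>. So \<open>th\<close> reduces statements modulo \<open>D n\<close> to statements modulo the roots of unity.\<close>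

lemma E_bounded_D:
 assumes S: "finite S" "S <= Eu m"
 shows "EX M>0::int. ALL x:Eu m. x:sat MM (D n Int Eu m Un S) --> x [^M] M:generate MM (D n Int Eu m Un S)"
proof -
 \<comment> \<open>The Galois group of \<open>E m\<close> over the part of it fixed by
   \<open>G_n n\<close>, as a set of restrictions. It is finite since a restriction is determined by
   its values on \<open>R m\<close>.\<close>
 define Q where "Q = (%g. restrict g (E m)) ` G_n n"
 define th where "th x = finprod MM (%q. x *M minv (q x)) Q" for x
 have sE: "subgroup (Eu m) MM" by (rule E_units_subgroup)
 have mgc: "comm_monoid MM" using mg.comm_group_axioms by (rule comm_group.axioms(1))
 have QE: "q:Q ==> x:Eu m ==> q x:Eu m" for q x
  unfolding Q_def using Eu_stable[OF G_nD(2)] by auto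
 have Qmult: "q:Q ==> x:Eu m ==> y:Eu m ==> q (x \<otimes> y) = q x \<otimes> q y" for q x y
  unfolding Q_def using G_mult_hom[OF G_nD(2)] Eu_U subgroup.m_closed[OF sE] by auto
 have EM: "x:Eu m ==> x:carrier MM" for x using Eu_U by simp
 have invE: "x:Eu m ==> minv x:Eu m" for x using subgroup.m_inv_closed[OF sE] .
 have finQ: "finite Q"
 proof (rule finite_imageD)
  show "finite ((%q. restrict q (R m)) ` Q)"
  proof (rule finite_subset)
  show "(%q. restrict q (R m)) ` Q <= PiE (R m) (%_. R m)"
  unfolding Q_def using R_image_G[OF G_nD(2)] R_E by (fastforce simp: subset_iff)
  show "finite (PiE (R m) (%_. R m))" using R_finite by (intro finite_PiE) auto
  qed
  show "inj_on (%q. restrict q (R m)) Q"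
  proof (rule inj_onI)
  fix q q' assume h: "q:Q" "q':Q" "restrict q (R m) = restrict q' (R m)"
  then obtain g g' where g: "g:G_n n" "q = restrict g (E m)" "g':G_n n" "q' = restrict g' (E m)"
  unfolding Q_def by blast
  have "g x = g' x" if "x:R m" for x using fun_cong[OF h(3), of x] that g subsetD[OF R_E that] by auto
  hence "g x = g' x" if "x:E m" for x using G_eq_on_E[OF G_nD(2)[OF g(1)] G_nD(2)[OF g(3)] _ that] by blast
  thus "q = q'" unfolding g by (auto simp: restrict_def)
  qed
 qed
 have idQ: "restrict (\<one>\<^bsub>GG\<^esub>) (E m):Q" unfolding Q_def using subgroup.one_closed[OF G_n_subgroup] by blast
 have cQ: "card Q > 0" using finQ idQ card_gt_0_iff by blast
 have thE: "th x:Eu m" if "x:Eu m" for x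
  unfolding th_def by (rule mg.finprod_subgroup[OF sE]) (use that QE invE subgroup.m_closed[OF sE] in simp)
 have fac: "(%q. x *M minv (q x)):Q \<rightarrow> carrier MM" if x: "x:Eu m" for x
  by (rule Pi_I, rule EM, rule subgroup.m_closed[OF sE x], rule invE, erule QE, rule x)
 have thmu: "th (x \<otimes> y) = th x \<otimes> th y" if x: "x:Eu m" and y: "y:Eu m" for x y
 proof -
  have xyE: "x *M y:Eu m" by (rule subgroup.m_closed[OF sE x y])
  have "th x *M th y = finprod MM (%q. (x *M minv (q x)) *M (y *M minv (q y))) Q"
  unfolding th_def
  by (rule comm_monoid.finprod_multf[OF mgc fac[OF x] fac[OF y], symmetric])
  also have "\<dots> = finprod MM (%q. (x *M y) *M minv (q (x *M y))) Q"
  proof (rule comm_monoid.finprod_cong'[OF mgc refl])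
  show "(%q. (x *M y) *M minv (q (x *M y))):Q \<rightarrow> carrier MM"
  by (rule Pi_I, rule EM, rule subgroup.m_closed[OF sE xyE], rule invE, erule QE, rule xyE)
  fix q assume q: "q:Q"
  have c: "x:carrier MM" "y:carrier MM" "q x:carrier MM" "q y:carrier MM" using x y QE[OF q] EM by blast+
  have "q (x *M y) = q x *M q y" using Qmult[OF q x y] by simp
  moreover have "minv (q x *M q y) = minv (q x) *M minv (q y)" by (rule mg.inv_mult[OF c(3,4)])
  moreover have ic: "minv (q x):carrier MM" "minv (q y):carrier MM" using mg.inv_closed c by blast+
  ultimately show "(x *M minv (q x)) *M (y *M minv (q y)) = (x *M y) *M minv (q (x *M y))"
  using c ic by (simp add: m_ac)
  qed
  finally show ?thesis unfolding th_def by simp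
 qed
 have thD: "th x:mu" if x: "x:D n Int Eu m" for x
 proof -
  have "x *M minv (q x):mu" if q: "q:Q" for q
  proof -
  obtain g where g: "g:G_n n" "q = restrict g (E m)" using q unfolding Q_def by blast
  obtain ze where ze: "ze:mu" "g x = ze \<otimes> x" using G_n_D[OF g(1)] x by blast
  have c: "ze:carrier MM" "x:carrier MM" using mu_U[OF ze(1)] x EM by auto
  have "q x = ze *M x" using g(2) ze(2) x by simp
  hence "x *M minv (q x) = x *M (minv ze *M minv x)" using mg.inv_mult[OF c] by simp
  also have "\<dots> = minv ze *M (x *M minv x)"
  using c mg.inv_closed[OF c(1)] mg.inv_closed[OF c(2)] by (simp add: m_lcomm)
  also have "\<dots> = minv ze" using mg.r_inv[OF c(2)] mg.inv_closed[OF c(1)] by simp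
  finally show ?thesis using subgroup.m_inv_closed[OF mu_subgroup ze(1)] by simp
  qed
  thus ?thesis unfolding th_def by (rule mg.finprod_subgroup[OF mu_subgroup])
 qed
 have thD': "x:D n" if x: "x:Eu m" "th x:mu" for x
 proof -
  \<comment> \<open>The norm of \<open>x\<close>. Translation by \<open>g\<close> permutes
    \<open>Q\<close>, so the norm lies in \<open>E n\<close>; since \<open>th x\<close> is a root of
    unity, x^card Q = th x N shows that a power of \<open>x\<close> lies in
    \<open>D n\<close>.\<close>
  define N where "N = finprod MM (%q. q x) Q"
  have NE: "N:Eu m" unfolding N_def by (rule mg.finprod_subgroup[OF sE]) (use QE x in blast)
  have qx: "(%q. q x):Q \<rightarrow> carrier MM" using QE x EM by blast
  have "N:E n"
  proof -
  have "g N = N" if g: "g:G_n n" for g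
  proof -
  define s where "s q = restrict (%y. g (q y)) (E m)" for q
  have sQ: "s q:Q" if "q:Q" for q
  proof -
  obtain h where h: "h:G_n n" "q = restrict h (E m)" using \<open>q : Q\<close> unfolding Q_def by blast
  have "s q = restrict (g *G h) (E m)"
  unfolding s_def h(2) by (rule restrict_ext)
  (use G_mult[OF G_nD(2)[OF g] G_nD(2)[OF h(1)] subsetD[OF E_carrier]] in auto)
  thus ?thesis unfolding Q_def using subgroup.m_closed[OF G_n_subgroup g h(1)] by blast
  qed
  have "inj_on s Q"
  proof (rule inj_onI)
  fix q q' assume h: "q:Q" "q':Q" "s q = s q'"
  have "q y = q' y" if y: "y:E m" for y
  proof -
  have "g (q y) = g (q' y)" using fun_cong[OF h(3), of y] y unfolding s_def by simp
  moreover have "q y:carrier L" "q' y:carrier L"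
  using h(1,2) y G_closed[OF G_nD(2) subsetD[OF E_carrier y]] unfolding Q_def by auto
  ultimately show ?thesis using inj_onD[OF Aut_simps(7)[OF G_nD(1)[OF g]]] by blast
  qed
  moreover have "q:extensional (E m)" "q':extensional (E m)" using h unfolding Q_def by auto
  ultimately show "q = q'" by (rule extensionalityI[rotated 2])
  qed
  hence bij: "inj_on s Q" "s ` Q = Q" using endo_inj_surj[OF finQ, of s] sQ by auto
  have "g N = finprod MM (g \<circ> (%q. q x)) Q"
  proof -
  have hm: "g:hom MM MM" using Aut_mult_hom[OF G_nD(1)[OF g]] .
  have "g (finprod MM (%q. q x) P) = finprod MM (g \<circ> (%q. q x)) P" if "finite P" "P <= Q" for P
  using that
  proof (induction P)
  case empty
  thus ?case using Aut_simps(1)[OF G_nD(1)[OF g]] by simp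
  next
  case (insert q P)
  have c: "q x:carrier MM" "(%q. q x):P \<rightarrow> carrier MM" using qx insert.prems by blast+
  have c': "(g \<circ> (%q. q x)) q:carrier MM" "(g \<circ> (%q. q x)):P \<rightarrow> carrier MM"
  using c hom_in_carrier[OF hm] by (auto simp del: carrier_mult_of simp: Pi_iff)
  show ?case using insert comm_monoid.finprod_insert[OF mgc insert.hyps, where f = "%q. q x", OF c(2,1)]
  comm_monoid.finprod_insert[OF mgc insert.hyps, where f = "g \<circ> (%q. q x)", OF c'(2,1)]
  hom_mult[OF hm c(1) comm_monoid.finprod_closed[OF mgc c(2)]] by (simp add: o_def)
  qed
  thus ?thesis unfolding N_def using finQ by blast
  qed
  also have "\<dots> = finprod MM (%q. q x) (s ` Q)"
  proof (subst comm_monoid.finprod_reindex[OF mgc])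
  show "(%q. q x):s ` Q \<rightarrow> carrier MM" using qx bij(2) by simp
  show "finprod MM (g \<circ> (%q. q x)) Q = finprod MM (%q. s q x) Q"
  proof (rule comm_monoid.finprod_cong'[OF mgc refl])
  show "(%q. s q x):Q \<rightarrow> carrier MM" using qx sQ by blast
  qed (use x in \<open>auto simp: s_def\<close>)
  qed (rule bij)
  also have "\<dots> = N" unfolding bij(2) N_def ..
  finally show ?thesis .
  qed
  thus ?thesis unfolding E_def using NE Eu_U by blast
  qed
  hence Nn: "N:D n" using NE E_D by blast
  have xM: "x:carrier MM" using x EM by blast
  have "th x *M N = finprod MM (%q. (x *M minv (q x)) *M q x) Q"
  unfolding th_def N_def
  by (rule comm_monoid.finprod_multf[OF mgc fac[OF x(1)] qx, symmetric])
  also have "\<dots> = finprod MM (%q. x) Q"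
  proof (rule comm_monoid.finprod_cong'[OF mgc refl])
  fix q assume q: "q:Q"
  have c: "q x:carrier MM" using qx q by blast
  show "(x *M minv (q x)) *M q x = x"
  using xM c mg.inv_closed[OF c] mg.l_inv[OF c] by (simp add: m_assoc)
  qed (use xM in blast)
  also have "\<dots> = x [^M] card Q" by (rule comm_monoid.finprod_const[OF mgc xM])
  also have "\<dots> = x [^M] int (card Q)" by (simp add: int_pow_int)
  finally have "x [^M] int (card Q) = th x \<otimes> N" by simp
  hence "x [^M] int (card Q):D n" using D_mult[OF subsetD[OF E_D subsetD[OF mu_E x(2)]] Nn] by simp
  thus ?thesis using D_pure[OF xM, of "int (card Q)" n] cQ by simp
 qed
 interpret e: comm_group "\<E> m" by (rule \<E>_group)
 interpret th: group_hom "\<E> m" MM th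
  by (unfold_locales, rule homI) (use thE thmu EM in \<open>auto simp del: carrier_mult_of\<close>)
 have gimg: "th ` generate MM A = generate MM (th ` A)" if "A <= Eu m" for A
  using th.generate_img[of A] that \<E>_saturation(2)[OF that] by simp
 define B where "B = D n Int Eu m"
 have BS: "B Un S <= Eu m" unfolding B_def using S(2) by auto
 have "th ` S <= carrier MM" using thE S(2) EM by blast
 then obtain M :: int where M: "M > 0"
  "!!y. y:E m ==> y:sat MM (mu Un th ` S) ==> y [^M] M:generate MM (mu Un th ` S)"
  using E_saturation_bounded[of "th ` S" m] S(1) by blast
 have pow: "x [^M] k:Eu m & th (x [^M] k) = th x [^M] k" if x: "x:Eu m" for x and k :: int
  using th.hom_int_pow[of x k] x e.int_pow_closed[of x k] mg.int_pow_consistent[OF sE x, of k] by simp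
 have "x [^M] M:generate MM (B Un S)" if x: "x:Eu m" "x:sat MM (B Un S)" for x
 proof -
  obtain j :: int where j: "j > 0" "x [^M] j:generate MM (B Un S)" using x(2) unfolding sat_def by blast
  have "th (x [^M] j):generate MM (th ` (B Un S))" using gimg[OF BS] j(2) by blast
  moreover have "th ` (B Un S) <= mu Un th ` S" using thD unfolding B_def by auto
  ultimately have "th (x [^M] j):generate MM (mu Un th ` S)" using mg.mono_generate by blast
  hence "th x [^M] j:generate MM (mu Un th ` S)" using pow[OF x(1), of j] by simp
  hence "th x:sat MM (mu Un th ` S)" unfolding sat_def using j(1) EM[OF thE[OF x(1)]] by blast
  hence g: "th x [^M] M:generate MM (mu Un th ` S)" using M(2)[of "th x"] thE[OF x(1)] by blast
  have gS: "generate MM S <= Eu m" using mg.generate_subgroup_incl[OF S(2) sE] .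
  have sub: "subgroup (mu <#>\<^bsub>MM\<^esub> generate MM (th ` S)) MM"
  by (rule mg.mult_subgroups[OF mu_subgroup]) (rule mg.generate_is_subgroup, use thE S(2) EM in blast)
  have one: "\<one>\<^bsub>MM\<^esub>:mu" "\<one>\<^bsub>MM\<^esub>:generate MM (th ` S)"
  by (rule subgroup.one_closed[OF mu_subgroup], rule generate.one)
  have "mu Un th ` S <= mu <#>\<^bsub>MM\<^esub> generate MM (th ` S)"
  proof
  fix w assume w: "w:mu Un th ` S"
  hence wM: "w:carrier MM" using mu_U thE S(2) EM by auto
  show "w:mu <#>\<^bsub>MM\<^esub> generate MM (th ` S)"
  proof (cases "w:mu")
  case True
  have "w = w *M \<one>\<^bsub>MM\<^esub>" using wM by simp
  thus ?thesis unfolding set_mult_def using True one(2) by blast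
  next
  case False
  hence "w:generate MM (th ` S)" using w by (blast intro: generate.incl)
  moreover have "w = \<one>\<^bsub>MM\<^esub> *M w" using wM by simp
  ultimately show ?thesis unfolding set_mult_def using one(1) by blast
  qed
  qed
  from subsetD[OF mg.generate_subgroup_incl[OF this sub] g]
  have "th x [^M] M:mu <#>\<^bsub>MM\<^esub> th ` generate MM S" unfolding gimg[OF S(2)] .
  then obtain ze s where ze: "ze:mu" "s:generate MM S" "th x [^M] M = ze *M th s"
  unfolding set_mult_def by blast
  have sEu: "s:Eu m" using ze(2) gS by blast
  define p where "p = x [^M] M"
  have pE: "p:Eu m" "th p = ze \<otimes> th s" using pow[OF x(1), of M] ze(3) unfolding p_def by auto
  define y where "y = p \<otimes> minv s"
  have yE: "y:Eu m" unfolding y_def using subgroup.m_closed[OF sE pE(1) invE[OF sEu]] by simp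
  have ys: "y \<otimes> s = p" unfolding y_def
  using mg.l_inv[OF EM[OF sEu]] EM[OF pE(1)] EM[OF sEu] mg.inv_closed[OF EM[OF sEu]] by (simp add: m_assoc)
  have "th y \<otimes> th s = ze \<otimes> th s" using thmu[OF yE sEu] ys pE(2) by simp
  hence "th y = ze" using field_cancel[of "th y" ze "th s"] Eu_U[OF thE[OF yE]] Eu_U[OF thE[OF sEu]] mu_U[OF ze(1)] by simp
  hence "y:B" unfolding B_def using thD'[OF yE] ze(1) yE by blast
  hence "y:generate MM (B Un S)" by (blast intro: generate.incl)
  moreover have "s:generate MM (B Un S)" using ze(2) mg.mono_generate[of S "B Un S"] by blast
  ultimately have "y *M s:generate MM (B Un S)" by (rule generate.eng)
  thus ?thesis using ys unfolding p_def by simp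
 qed
 thus ?thesis unfolding B_def[symmetric] using M(1) by blast
qed

text \<open>Moving \<open>kp'\<close> by the automorphism of \<open>kummer_match\<close> makes both
  characters agree on all of \<open>D n\<close>, which contains every element that is torsion modulo
  \<open>Eu n\<close>. The rest of \<open>Eu (Suc n)\<close> can be handled by a logarithm, since
  \<open>D n\<close> meets it in a saturated subgroup.\<close>

lemma character_step:
 assumes kp: "kp:Chars" "kp':Chars" and eq: "!!x. x:Eu n ==> kp x = kp' x"
 shows "EX \<sigma>:G_n n. EX f. additive f & (ALL x:Eu n. f x = 0)
  & (ALL x:Eu (Suc n). kp' (\<sigma> x) = kp x * cis (2 * pi * f x))"
proof -
 obtain \<sigma> where \<sigma>: "\<sigma>:G_n n" "!!x. x:D n ==> kp' (\<sigma> x) = kp x" using kummer_match[OF kp eq] by blast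
 let ?B = "D n Int Eu (Suc n)"
 have "EX f. additive f & (ALL x:?B. f x = 0) & (ALL x:Eu (Suc n). act kp' \<sigma> x = kp x * cis (2 * pi * f x))"
 proof (rule lift_on_Eu[OF kp(1) act_X[OF kp(2) G_nD(2)[OF \<sigma>(1)]]])
  show "subgroup ?B MM" by (rule mg.subgroups_Inter_pair[OF D_subgroup E_units_subgroup])
  show "sat MM ?B Int Eu (Suc n) <= ?B"
  proof
  fix x assume x: "x:sat MM ?B Int Eu (Suc n)"
  then obtain j :: int where "j > 0" "x [^M] j:generate MM ?B" "x:carrier MM" unfolding sat_def by blast
  moreover have "generate MM ?B <= D n" by (rule mg.generate_subgroup_incl[OF _ D_subgroup]) blast
  ultimately show "x : ?B" using D_pure x by blast
  qed
  show "kp x = act kp' \<sigma> x" if "x : ?B" for x using \<sigma>(2)[of x] that Eu_U unfolding act_def by auto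
 qed (use E_bounded_D in auto)
 then obtain f where f: "additive f" "!!x. x : ?B ==> f x = 0" "!!x. x:Eu (Suc n) ==> act kp' \<sigma> x = kp x * cis (2 * pi * f x)"
  by blast
 have "f x = 0" if "x:Eu n" for x using f(2)[of x] that E_D[of n] Eu_mono[of n "Suc n"] by auto
 moreover have "kp' (\<sigma> x) = kp x * cis (2 * pi * f x)" if "x:Eu (Suc n)" for x
  using f(3)[OF that] Eu_U[OF that] unfolding act_def by simp
 ultimately show ?thesis using \<sigma>(1) f(1) by blast
qed

text \<open>Completeness of the Galois group along the tower. The limit is surjective because
  \<open>tu m\<close> permutes the finite set \<open>R m\<close>, so an element of
  \<open>R m\<close> already has its preimage at stage m.\<close>

lemma G_limit:
 assumes tu: "!!k::nat. tu k:carrier GG" and coh: "!!k x. x:E (n + k) ==> tu (Suc k) x = tu k x"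
 shows "EX rh:carrier GG. ALL k. ALL x:E (n + k). rh x = tu k x"
proof -
 have coh': "tu j x = tu k x" if "k <= j" "x:E (n + k)" for j k x
  using that(1)
 proof (induction j rule: dec_induct)
  case (step i)
  thus ?case using coh[of x i] E_mono[of "n + k" "n + i"] that(2) by auto
 qed simp
 define kx where "kx x = (SOME k. x:E (n + k))" for x
 have kx: "x:E (n + kx x)" if xL: "x:carrier L" for x
 proof -
  obtain m where "x:E m" using E_exhaust[OF xL] by blast
  hence "x:E (n + m)" using E_mono[of m "n + m"] by auto
  thus ?thesis unfolding kx_def by (rule someI)
 qed
 define rh where "rh = (\<lambda>x\<in>carrier L. tu (kx x) x)"
 have rh: "rh x = tu k x" if x: "x:E (n + k)" for x k
 proof -
  have xL: "x:carrier L" using x E_carrier by blast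
  have "tu (kx x) x = tu (max k (kx x)) x" using coh'[of "kx x" "max k (kx x)" x] kx[OF xL] by simp
  also have "\<dots> = tu k x" using coh'[of k "max k (kx x)" x] x by simp
  finally show ?thesis unfolding rh_def using xL by simp
 qed
 have common: "EX k. x:E (n + k) & y:E (n + k)" if "x:carrier L" "y:carrier L" for x y
  using kx[OF that(1)] kx[OF that(2)] E_mono[of "n + kx x" "n + max (kx x) (kx y)"] E_mono[of "n + kx y" "n + max (kx x) (kx y)"]
  by (intro exI[of _ "max (kx x) (kx y)"]) auto
 have A: "tu k:Aut" for k using tu G_Aut by blast
 have cl: "rh x:carrier L" if "x:carrier L" for x using rh[OF kx[OF that]] A that by simp
 have hom: "rh (x \<otimes> y) = rh x \<otimes> rh y & rh (x \<oplus> y) = rh x \<oplus> rh y" if xy: "x:carrier L" "y:carrier L" for x y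
 proof -
  obtain k where k: "x:E (n + k)" "y:E (n + k)" using common[OF xy] by blast
  have "x \<otimes> y:E (n + k)" "x \<oplus> y:E (n + k)" using subringE(6,7)[OF subfieldE(1)[OF E_subfield]] k by blast+
  thus ?thesis using rh k Aut_simps(3,4)[OF A xy] by simp
 qed
 have inj: "inj_on rh (carrier L)"
 proof (rule inj_onI)
  fix x y assume xy: "x:carrier L" "y:carrier L" "rh x = rh y"
  obtain k where k: "x:E (n + k)" "y:E (n + k)" using common[OF xy(1,2)] by blast
  hence "tu k x = tu k y" using rh xy(3) by simp
  thus "x = y" using inj_onD[OF Aut_simps(7)[OF A]] xy by blast
 qed
 have Frh: "rh x = x" if "x:F" for x
  using rh[of x 0] F_E that tu[of 0] unfolding G_iff by auto
 have "y:rh ` carrier L" if y: "y:carrier L" for y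
 proof (cases "y = \<zero>")
  case True
  hence "rh y = y" using Frh subringE(2)[OF subfieldE(1)[OF F_subfield]] by blast
  thus ?thesis using y by (metis imageI)
 next
  case False
  then obtain m where m: "y:R m" using R_exhaust y by blast
  hence "y:tu m ` R m" using R_image[OF A] by blast
  then obtain x where x: "x:R m" "y = tu m x" by blast
  have "x:E (n + m)" using x(1) R_E E_mono[of m "n + m"] by auto
  hence "rh x = y" using rh x(2) by simp
  thus ?thesis using R_carrier(1)[OF x(1)] by blast
 qed
 hence "rh:Bij (carrier L)" unfolding Bij_def using inj cl by (auto simp: bij_betw_def rh_def)
 moreover have "rh:ring_hom L L"
  by (rule ring_hom_memI) (use cl hom Frh[OF subringE(3)[OF subfieldE(1)[OF F_subfield]]] in auto)
 ultimately have "rh:carrier GG" unfolding carrier_galois_group using Frh by blast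
 thus ?thesis using rh by blast
qed

text \<open>\<open>character_step\<close> is iterated. At stage k the new automorphism lies in
  \<open>G_n (n + k)\<close> and the new logarithm vanishes on \<open>Eu (n + k)\<close>, so
  products and sums become stationary on every element and pass to the limit.\<close>

theorem character_core:
 assumes kp: "kp:Chars" "kp':Chars" and eq: "!!x. x:Eu n ==> kp x = kp' x"
 shows "EX tu:G_n n. EX f. additive f & (ALL x:Eu n. f x = 0) & act kp' tu = twist kp f"
proof -
 define P where "P k p <-> fst p:G_n n & additive (snd p) & (ALL x:Eu n. snd p x = 0)
  & (ALL x:Eu (n + k). kp' (fst p x) = kp x * cis (2 * pi * snd p x))" for k :: nat and p :: "('a => 'a) \<times> ('a => real)"
 define Q where "Q k p p' <-> (ALL x:E (n + k). fst p' x = fst p x) & (ALL x:Eu (n + k). snd p' x = snd p x)"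
  for k :: nat and p p' :: "('a => 'a) \<times> ('a => real)"
 have "EX s. ALL k. P k (s k) & Q k (s k) (s (Suc k))"
 proof (rule dependent_nat_choice)
  have "kp' (\<one>\<^bsub>GG\<^esub> x) = kp x" if "x:Eu n" for x
  using eq[OF that] Eu_U[OF that] by (simp add: galois_group_one)
  hence "P 0 (\<one>\<^bsub>GG\<^esub>, %x. 0)"
  unfolding P_def add_hom_def using subgroup.one_closed[OF G_n_subgroup] by simp
  thus "EX x. P 0 x" by blast
 next
  fix p k assume p: "P k p"
  obtain tu g where pg: "p = (tu, g)" by (cases p)
  have tu: "tu:G_n n" and g: "additive g" "!!x. x:Eu n ==> g x = 0"
  "!!x. x:Eu (n + k) ==> kp' (tu x) = kp x * cis (2 * pi * g x)"
  using p unfolding P_def pg by auto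
  have "twist kp g x = act kp' tu x" if "x:Eu (n + k)" for x
  using g(3)[OF that] Eu_U[OF that] unfolding twist_def act_def by simp
  then obtain \<sigma> f where \<sigma>: "\<sigma>:G_n (n + k)" and f: "additive f" "!!x. x:Eu (n + k) ==> f x = 0"
  "!!x. x:Eu (Suc (n + k)) ==> act kp' tu (\<sigma> x) = twist kp g x * cis (2 * pi * f x)"
  using character_step[OF twist_X[OF kp(1) g(1)] act_X[OF kp(2) G_nD(2)[OF tu]], of "n + k"] by blast
  have \<sigma>n: "\<sigma>:G_n n" using \<sigma> G_n_antimono[of n "n + k"] by auto
  have m: "(tu *G \<sigma>) x = tu (\<sigma> x)" if "x:carrier L" for x using G_mult[OF G_nD(2)[OF tu] G_nD(2)[OF \<sigma>] that] .
  have "P (Suc k) (tu *G \<sigma>, %x. g x + f x)"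
  unfolding P_def fst_conv snd_conv
  proof (intro conjI ballI)
  show "tu *G \<sigma>:G_n n" by (rule subgroup.m_closed[OF G_n_subgroup tu \<sigma>n])
  show "additive (%x. g x + f x)" using g(1) f(1) unfolding add_hom_def by simp
  show "g x + f x = 0" if "x:Eu n" for x using g(2)[OF that] f(2)[of x] that Eu_mono[of n "n + k"] by auto
  show "kp' ((tu *G \<sigma>) x) = kp x * cis (2 * pi * (g x + f x))" if x: "x:Eu (n + Suc k)" for x
  using f(3)[of x] x Eu_U[OF x] G_U[OF G_nD(2)[OF \<sigma>] Eu_U[OF x]] m[of x] unfolding act_def twist_def
  by (simp add: cis_mult[symmetric] distrib_left)
  qed
  moreover have "Q k p (tu *G \<sigma>, %x. g x + f x)"
  unfolding Q_def pg fst_conv snd_conv using m[OF subsetD[OF E_carrier]] G_nD(4)[OF \<sigma>] f(2) by auto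
  ultimately show "EX y. P (Suc k) y & Q k p y" by blast
 qed
 then obtain s where s: "!!k. P k (s k)" "!!k. Q k (s k) (s (Suc k))" by blast
 define tu g where "tu k = fst (s k)" and "g k = snd (s k)" for k
 have tu: "tu k:G_n n" "x:E (n + k) ==> tu (Suc k) x = tu k x" for k x
  using s(1)[of k] s(2)[of k] unfolding P_def Q_def tu_def by auto
 have g: "additive (g k)" "x:Eu n ==> g k x = 0" "x:Eu (n + k) ==> g (Suc k) x = g k x"
  "x:Eu (n + k) ==> kp' (tu k x) = kp x * cis (2 * pi * g k x)" for k x
  using s(1)[of k] s(2)[of k] unfolding P_def Q_def tu_def g_def by auto
 obtain rh where rh: "rh:carrier GG" "!!k x. x:E (n + k) ==> rh x = tu k x"
  using G_limit[of tu n] tu G_nD(2) by blast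
 have gc: "g j x = g k x" if "k <= j" "x:Eu (n + k)" for j k x
  using that(1)
 proof (induction j rule: dec_induct)
  case (step i)
  thus ?case using g(3)[of x i] Eu_mono[of "n + k" "n + i"] that(2) by auto
 qed simp
 define kx where "kx x = (SOME k. x:Eu (n + k))" for x
 have kx: "x:Eu (n + kx x)" if x: "x:U" for x
 proof -
  obtain m where "x:Eu m" using Eu_exhaust[OF x] by blast
  hence "x:Eu (n + m)" using Eu_mono[of m "n + m"] by auto
  thus ?thesis unfolding kx_def by (rule someI)
 qed
 define f where "f x = g (kx x) x" for x
 have fg: "f x = g k x" if x: "x:Eu (n + k)" for k x
 proof -
  have "g (kx x) x = g (max k (kx x)) x" using gc[of "kx x" "max k (kx x)" x] kx[OF Eu_U[OF x]] by simp
  also have "\<dots> = g k x" using gc[of k "max k (kx x)" x] x by simp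
  finally show ?thesis unfolding f_def .
 qed
 have "additive f"
  unfolding add_hom_def
 proof (intro ballI)
  fix x y assume xy: "x:U" "y:U"
  define k where "k = max (kx x) (kx y)"
  have k: "x:Eu (n + k)" "y:Eu (n + k)"
  using kx[OF xy(1)] kx[OF xy(2)] Eu_mono[of "n + kx x" "n + k"] Eu_mono[of "n + kx y" "n + k"] unfolding k_def by auto
  hence "x \<otimes> y:Eu (n + k)" using subgroup.m_closed[OF E_units_subgroup k] by simp
  thus "f (x *M y) = f x + f y" using fg[OF k(1)] fg[OF k(2)] fg[of "x \<otimes> y" k] additiveD[OF g(1) xy, of k] by simp
 qed
 moreover have "f x = 0" if "x:Eu n" for x using fg[of x 0] g(2)[of x 0] that by simp
 moreover have "act kp' rh = twist kp f"
  unfolding act_def twist_def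
 proof (rule restrict_ext)
  fix x assume x: "x:U"
  show "kp' (rh x) = kp x * cis (2 * pi * f x)"
  using kx[OF x] rh(2)[of x "kx x"] g(4)[of x "kx x"] fg[of x "kx x"] by auto
 qed
 moreover have "rh:G_n n"
 proof (rule G_nI[OF rh(1)])
  show "rh x = x" if x: "x:R n" for x using rh(2)[of x 0] G_nD(3)[OF tu(1) x, of 0] subsetD[OF R_E x] by simp
 qed
 ultimately show ?thesis by blast
qed

text \<open>\<open>character_lift_Eu\<close> first twists \<open>kp\<close> so that it agrees with
  \<open>kp'\<close> on \<open>Eu n\<close>, then \<open>character_core\<close> applies. A twist is
  joined to \<open>kp\<close> by a path, so any single n gives path-connectedness of X_F; letting n
  vary gives the density of the image of monodromy.\<close>

theorem character_dense:
 assumes kp: "kp:Chars" "kp':Chars"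
 shows "EX tu:G_n n. EX f. additive f & act kp' tu = twist kp f"
proof -
 obtain f where f: "additive f" "!!x. x:Eu n ==> kp' x = kp x * cis (2 * pi * f x)"
  using character_lift_Eu[OF kp] by blast
 have "twist kp f x = kp' x" if "x:Eu n" for x using f(2)[OF that] Eu_U[OF that] unfolding twist_def by simp
 then obtain tu g where g: "tu:G_n n" "additive g" "act kp' tu = twist (twist kp f) g"
  using character_core[OF twist_X[OF kp(1) f(1)] kp(2), of n] by blast
 have "twist (twist kp f) g = twist kp (%x. f x + g x)"
  unfolding twist_def by (auto simp: restrict_def cis_mult[symmetric] distrib_left)
 moreover have "additive (%x. f x + g x)" using f(1) g(2) unfolding add_hom_def by simp
 ultimately show ?thesis using g by auto
qed

end

section \<open>Lifting of paths\<close>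

lemma interval_locally_constant:
 fixes P :: "real => bool"
 assumes loc: "!!t. t:{0..1} ==> EX d>0. ALL s:{0..1}. \<bar>s - t\<bar> < d --> (P s <-> P t)"
  and "P 0" "t:{0..1}"
 shows "P t"
proof -
 have "0 <= (0::real) & t <= 1 --> (P 0 <-> P t)"
 proof (rule Bolzano[of 0 t "%a b. 0 <= a & b <= 1 --> (P a <-> P b)"])
  fix x assume x: "0 <= x" "x <= t"
  hence "x:{0..1}" using assms(3) by simp
  then obtain d where d: "d > 0" "!!s. s:{0..1} ==> \<bar>s - x\<bar> < d ==> P s <-> P x"
  using loc[of x] by blast
  have "P a <-> P b" if "a <= x" "x <= b" "b - a < d" "0 <= a" "b <= 1" for a b
  using d(2)[of a] d(2)[of b] that by auto
  thus "EX d>0. ALL a b. a <= x & x <= b & b - a < d --> 0 <= a & b <= 1 --> (P a <-> P b)"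
  using d(1) by blast
 qed (use assms(3) in auto)
 thus ?thesis using assms by auto
qed

lemma sum_roots_of_unity:
 fixes w :: complex
 assumes "w ^ N = 1" "w ~= 1"
 shows "(\<Sum>j<N. w ^ j) = 0"
 using geometric_sum[OF assms(2), of N] assms(1) by simp

lemma finite_positive_bound:
 fixes f :: "'c => real"
 assumes "finite A" "!!x. x:A ==> f x > 0"
 shows "EX e>0. ALL x:A. e <= f x"
 using assms
proof (induction A)
 case (insert a A)
 then obtain e where "e > 0" "ALL x:A. e <= f x" by auto
 thus ?case using insert.prems by (intro exI[of _ "min e (f a)"]) auto
qed (auto intro: exI[of _ 1])

locale pointed_abelian_closure = abelian_closure +
 fixes ps :: "'a => complex"
 assumes base_point: "ps:topspace (X_closure L \<iota>)"
begin

lemma ps: "ps:Chars" using base_point unfolding Chars_def .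

text \<open>A base of the uniformity of X. Because \<open>R m\<close> is stable under the Galois
  group, these entourages are invariant (\<open>near_act\<close>).\<close>

definition near :: "nat => real => ('a => complex) => ('a => complex) => bool" where
 "near m dl kp kp' <-> (ALL x:R m. cmod (kp x - kp' x) < dl)"

lemma near_sym: "near m dl kp kp' ==> near m dl kp' kp" unfolding near_def by (simp add: norm_minus_commute)

lemma near_trans: "near m a kp kp' ==> near m b kp' kp'' ==> a + b <= c ==> near m c kp kp''"
 unfolding near_def
proof
 fix x assume h: "ALL x:R m. cmod (kp x - kp' x) < a" "ALL x:R m. cmod (kp' x - kp'' x) < b" "a + b <= c" "x:R m"
 have "cmod (kp x - kp'' x) <= cmod (kp x - kp' x) + cmod (kp' x - kp'' x)"
  using norm_triangle_ineq[of "kp x - kp' x" "kp' x - kp'' x"] by simp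
 moreover have "cmod (kp x - kp' x) < a" "cmod (kp' x - kp'' x) < b" using h by auto
 ultimately show "cmod (kp x - kp'' x) < c" using h(3) by linarith
qed

lemma near_mono: "near m a kp kp' ==> m' <= m ==> a <= b ==> near m' b kp kp'"
 unfolding near_def using R_mono[of m' m] by (meson less_le_trans subsetD)

lemma near_refl: "dl > 0 ==> near m dl kp kp" unfolding near_def by simp

lemma near_act: "near m dl kp kp' ==> tu:carrier GG ==> near m dl (act kp tu) (act kp' tu)"
 unfolding near_def act_def using R_image_G[of tu _ m] R_U by auto

lemma near_slack: "near m a kp kp' ==> EX dl>0. near m (a - dl) kp kp'"
proof -
 assume h: "near m a kp kp'"
 have "EX e>0. ALL x:R m. e <= a - cmod (kp x - kp' x)"
  by (rule finite_positive_bound[OF R_finite]) (use h in \<open>auto simp: near_def\<close>)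
 then obtain e where e: "e > 0" "!!x. x:R m ==> e <= a - cmod (kp x - kp' x)" by blast
 have "cmod (kp x - kp' x) < a - e / 2" if "x:R m" for x using e(1) e(2)[OF that] by linarith
 thus ?thesis unfolding near_def using e(1) by (intro exI[of _ "e / 2"]) auto
qed

lemma act_act: "tu:carrier GG ==> ups:carrier GG ==> act (act kp tu) ups = act kp (tu *G ups)"
 unfolding act_def by (rule restrict_ext) (use G_U G_mult in auto)

lemma act_one: "kp:Chars ==> act kp \<one>\<^bsub>GG\<^esub> = kp"
proof (rule extensionalityI[OF _ X_D(1)])
 show "act kp \<one>\<^bsub>GG\<^esub> x = kp x" if "x:U" for x unfolding act_def using that by (simp add: galois_group_one)
qed (auto simp: act_def)

lemma act_G_n: "g:G_n m ==> x:R m ==> act kp g x = kp x"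
 unfolding act_def using G_nD(3)[of g m x] R_U[of x m] by simp

lemma act_inv: "kp:Chars ==> tu:carrier GG ==> act (act kp tu) (ginv tu) = kp"
 "kp:Chars ==> tu:carrier GG ==> act (act kp (ginv tu)) tu = kp"
 by (auto simp: act_act act_one)

text \<open>If \<open>tu x ~= x\<close>, one of the Lagrange resolvents \<open>y = \<Sum>i<N. om\<^bsup>ij\<^esup> \<otimes> tu\<^sup>i x\<close> is nonzero and multiplied
 by a nontrivial root of unity by \<open>tu\<close>.\<close>

lemma resolvent:
 fixes N :: nat
 assumes tu: "tu:carrier GG" and x: "x:carrier L" "tu x ~= x" and N: "N > 0" "(tu ^^ N) x = x"
 defines "om \<equiv> z (1 / of_nat N)"
 shows "EX j. 0 < j & j < N & (let y = lsum (map (%i. om [^] (i * j) \<otimes> (tu ^^ i) x) [0..<N]) in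
  y ~= \<zero> & tu y \<otimes> om [^] j = y)"
proof -
 define y where "y j = lsum (map (%i. om [^] (i * j) \<otimes> (tu ^^ i) x) [0..<N])" for j
 note A = G_Aut[OF tu]
 have omL: "om:carrier L" unfolding om_def by (rule z_carrier)
 have f: "(tu ^^ i) x:carrier L" for i using x(1) A by (induction i) auto
 have lL: "set (map (%i. om [^] (i * j) \<otimes> (tu ^^ i) x) [0..<N]) <= carrier L" for j using omL f by auto
 have yL: "y j:carrier L" for j unfolding y_def by (rule list_sum_closed[OF lL])
 have tuom: "tu om = om" using tu z_simps(1) unfolding G_iff om_def by blast
 have hsum: "h (lsum l) = sum_list (map h l)" if "complex_hom L h" "set l <= carrier L" for h l
  using that(2) by (induction l) (auto simp: list_sum_simps list_sum_closed complex_hom_simps[OF that(1)])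
 have hy: "h (y j) = (\<Sum>i<N. h om ^ (i * j) * h ((tu ^^ i) x))" if h: "complex_hom L h" for h j
  unfolding y_def hsum[OF h lL]
  by (simp add: complex_hom_simps[OF h] omL f o_def interv_sum_list_conv_sum_set_nat atLeast0LessThan)
 have ompow: "om [^] i = \<one> <-> N dvd i" for i :: nat
 proof -
  have "om [^] i = \<one> <-> (of_nat i / of_nat N :: rat):\<int>" unfolding om_def z_pow z_simps(3) by simp
  also have "\<dots> <-> N dvd i"
  using of_int_div_of_int_in_Ints_iff[of "int i" "int N", where ?'a = rat] N(1) by simp
  finally show ?thesis .
 qed
 have prim: "h om ^ i = 1 <-> N dvd i" if h: "complex_hom L h" for h i
 proof -
  have "h om ^ i = 1 <-> h (om [^] i) = h \<one>" by (simp add: complex_hom_simps(1,6)[OF h] omL)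
  also have "\<dots> <-> om [^] i = \<one>" using complex_hom_inj[OF h _ one_closed, of "om [^] i"] omL by auto
  finally show ?thesis unfolding ompow .
 qed
 have tuy: "tu (y j) \<otimes> om [^] j = y j" for j
 proof -
  define g where "g i = ph om ^ (i * j) * ph ((tu ^^ i) x)" for i
  have "ph (tu (y j)) = (\<Sum>i<N. ph om ^ (i * j) * ph ((tu ^^ Suc i) x))"
  using hy[OF Aut_hom(2)[OF A], of j] tuom by simp
  hence "ph (tu (y j) \<otimes> om [^] j) = (\<Sum>i<N. g (Suc i))"
  using yL A omL unfolding g_def by (simp add: ph_simps sum_distrib_left power_add mult_ac)
  also have "\<dots> = (\<Sum>i<N. g i)"
  \<comment> \<open>The summand is periodic in i: both the powers of \<open>om\<close> and the
    iterates of \<open>tu\<close> at \<open>x\<close> return after N steps.\<close>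
  proof -
  have "g N = g 0" unfolding g_def using N(2) prim[OF ph_hom, of "N * j"] by simp
  thus ?thesis using sum.lessThan_Suc_shift[of g N] sum.lessThan_Suc[of g N] by simp
  qed
  also have "\<dots> = ph (y j)" unfolding hy[OF ph_hom] g_def ..
  finally show ?thesis using ph_inj yL A omL by simp
 qed
 \<comment> \<open>Fourier inversion at index 0: all resolvents together give N x. If those with j >
   0 vanished, N x would be the resolvent with j = 0, which \<open>tu\<close> fixes.\<close>
 have total: "(\<Sum>j<N. h (y j)) = of_nat N * h x" if h: "complex_hom L h" for h
 proof -
  have inner: "(\<Sum>j<N. h om ^ (i * j)) = (if i = 0 then of_nat N else 0)" if i: "i < N" for i
  proof (cases "i = 0")
  case False
  have "h om ^ i ~= 1" using prim[OF h, of i] False i by (auto dest: dvd_imp_le)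
  moreover have "(h om ^ i) ^ N = 1" using prim[OF h, of "i * N"] by (simp add: power_mult)
  ultimately show ?thesis using sum_roots_of_unity[of "h om ^ i" N] False by (simp add: power_mult)
  qed simp
  have "(\<Sum>j<N. h (y j)) = (\<Sum>i<N. (\<Sum>j<N. h om ^ (i * j)) * h ((tu ^^ i) x))"
  unfolding hy[OF h] sum_distrib_right by (rule sum.swap)
  also have "\<dots> = (\<Sum>i<N. if i = 0 then of_nat N * h x else 0)" by (rule sum.cong) (auto simp: inner)
  also have "\<dots> = of_nat N * h x" using N(1) by (simp add: sum.delta)
  finally show ?thesis .
 qed
 have "EX j. 0 < j & j < N & y j ~= \<zero>"
 proof (rule ccontr)
  assume "\<not> ?thesis"
  hence z0: "y j = \<zero>" if "0 < j" "j < N" for j using that by blast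
  have only: "of_nat N * h x = h (y 0)" if h: "complex_hom L h" for h
  proof -
  have "(\<Sum>j<N. h (y j)) = (\<Sum>j<N. if j = 0 then h (y 0) else 0)"
  by (rule sum.cong) (auto simp: z0 complex_hom_simps(2)[OF h])
  thus ?thesis using total[OF h] N(1) by (simp add: sum.delta)
  qed
  have "tu (y 0) = y 0" using tuy[of 0] yL A by simp
  hence "of_nat N * ph (tu x) = of_nat N * ph x" using only[OF ph_hom] only[OF Aut_hom(2)[OF A]] by simp
  hence "ph (tu x) = ph x" using N(1) by simp
  thus False using ph_inj x A by (metis Aut_closed)
 qed
 thus ?thesis using tuy unfolding y_def Let_def by blast
qed

text \<open>If \<open>tu\<close> moves an element of \<open>R n\<close>, it multiplies some
  resolvent \<open>y\<close> by a nontrivial root of unity of order dividing N. Then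
  \<open>act kp tu\<close> and \<open>kp\<close> differ at \<open>y\<close> by at least the least
  distance from 1 to such roots. Resolvents of all possible \<open>tu\<close> range over a finite
  set, so m and ep serve for all \<open>kp\<close> and \<open>tu\<close>: freeness of the action is
  uniform.\<close>

lemma separation:
 "EX m>=n. EX ep>0. ALL kp:Chars. ALL tu:carrier GG. near m ep (act kp tu) kp --> tu:G_n n"
proof -
 \<comment> \<open>An exponent that annihilates every permutation of \<open>R n\<close>, so that one
   N suits all \<open>tu\<close>.\<close>
 define N where "N = (fact (card (R n)) :: nat)"
 have N: "N > 0" unfolding N_def by simp
 define om where "om = z (1 / of_nat N)"
 have omL: "om:carrier L" "om ~= \<zero>" unfolding om_def using z_carrier by auto
 \<comment> \<open>All sums of N terms of the shape occurring in resolvents; the exponents i j stay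
   below N N.\<close>
 define Y where "Y = lsum ` {l. set l <= (%(i, x). om [^] i \<otimes> x) ` ({..<N * N} \<times> R n) & length l = N}"
 have "finite Y" unfolding Y_def using R_finite by (intro finite_imageI finite_lists_length_eq finite_cartesian_product) auto
 moreover have "Y <= carrier L"
 proof
  fix y assume "y:Y"
  then obtain l where l: "y = lsum l" "set l <= (%(i, x). om [^] i \<otimes> x) ` ({..<N * N} \<times> R n)" unfolding Y_def by blast
  have "(%(i, x). om [^] i \<otimes> x) ` ({..<N * N} \<times> R n) <= carrier L" using omL R_carrier(1) by auto
  thus "y:carrier L" unfolding l(1) by (rule list_sum_closed[OF subset_trans[OF l(2)]])
 qed
 ultimately obtain m where m: "m >= n" "Y - {\<zero>} <= R m" using R_exhaust_finite[of "Y - {\<zero>}" n] by blast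
 define w where "w = cis (2 * pi / of_nat N)"
 have omw: "kp om = w" if "kp:Chars" for kp
  unfolding om_def w_def X_D(4)[OF that] by (simp add: of_rat_divide)
 have wj: "w ^ j ~= 1" if "0 < j" "j < N" for j
 proof
  assume "w ^ j = 1"
  hence "ps (om [^] j) = 1" using X_pow[OF ps, of om j] omw[OF ps] omL by simp
  moreover have "om [^] j:mu" unfolding om_def z_pow by (rule z_mu)
  ultimately have "om [^] j = \<one>" using X_mu_inj[OF ps] by blast
  hence "(of_nat j / of_nat N :: rat):\<int>" unfolding om_def z_pow z_simps(3) by simp
  hence "N dvd j" using of_int_div_of_int_in_Ints_iff[of "int j" "int N", where ?'a = rat] N by simp
  thus False using that by (auto dest: dvd_imp_le)
 qed
 obtain ep where ep: "ep > 0" "!!j. j:{1..<N} ==> ep <= cmod (1 - w ^ j)"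
  using finite_positive_bound[of "{1..<N}" "%j. cmod (1 - w ^ j)"] wj by auto
 have "tu:G_n n" if kp: "kp:Chars" and tu: "tu:carrier GG" and nr: "near m ep (act kp tu) kp" for kp tu
 proof (rule ccontr)
  assume "tu \<notin> G_n n"
  then obtain x where x: "x:R n" "tu x ~= x" using G_nI[OF tu] by blast
  have inj: "inj_on tu (R n)" using Aut_simps(7)[OF G_Aut[OF tu]] R_carrier(1) by (auto intro: inj_on_subset)
  have fx: "(tu ^^ i) x:R n" for i using x(1) R_image_G[OF tu] by (induction i) auto
  have "(tu ^^ N) x = x"
  unfolding N_def by (rule funpow_fact_fixed[OF R_finite _ inj x(1)]) (use R_image_G[OF tu] in blast)
  then obtain j y where j: "0 < j" "j < N" and y: "y = lsum (map (%i. om [^] (i * j) \<otimes> (tu ^^ i) x) [0..<N])"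
  "y ~= \<zero>" "tu y \<otimes> om [^] j = y"
  using resolvent[OF tu R_carrier(1)[OF x(1)] x(2) N] unfolding om_def[symmetric] Let_def by blast
  have "i * j < N * N" if "i < N" for i using that j by (simp add: mult_strict_mono)
  hence "y:Y" unfolding Y_def y(1) using fx by (intro imageI CollectI) auto
  hence yR: "y:R m" using m(2) y(2) by blast
  have yU: "y:U" "tu y:U" using R_U[OF yR] G_U[OF tu] by auto
  have pU: "om [^] j:U" using omL pow_nonzero by simp
  have "kp y = kp (tu y \<otimes> om [^] j)" using y(3) by simp
  also have "\<dots> = kp (tu y) * w ^ j"
  using X_D(3)[OF kp yU(2) pU] X_pow[OF kp, of om j] omL omw[OF kp] by simp
  finally have e: "kp (tu y) - kp y = kp (tu y) * (1 - w ^ j)" by (simp add: algebra_simps)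
  have "cmod (kp (tu y) - kp y) = cmod (1 - w ^ j)" unfolding e norm_mult using X_D(2)[OF kp yU(2)] by simp
  hence "cmod (kp (tu y) - kp y) >= ep" using ep(2)[of j] j by simp
  moreover have "cmod (act kp tu y - kp y) < ep" using nr yR unfolding near_def by blast
  ultimately show False unfolding act_def using yU(1) by simp
 qed
 thus ?thesis using m(1) ep(1) by blast
qed

abbreviation T where "T \<equiv> X_closure L \<iota>"
abbreviation Y where "Y \<equiv> X_field L F \<iota>"
abbreviation q where "q \<equiv> X_proj L F"

lemma T_open_near: "openin T {kp':Chars. near m dl kp' kp}"
proof -
 let ?A = "%x. if x:R m then ball (kp x) dl Int sphere 0 1 else sphere 0 (1::real)"
 have "openin (product_topology (%_. unit_circle) (carrier (mult_of L))) (PiE (carrier (mult_of L)) ?A)"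
 proof (rule product_topology_basis)
  show "openin unit_circle (?A i)" for i by (auto simp: openin_open)
  show "finite {i. ?A i ~= topspace unit_circle}" by (rule finite_subset[OF _ R_finite[of m]]) auto
 qed
 moreover have "{kp':Chars. near m dl kp' kp} = PiE (carrier (mult_of L)) ?A \<inter>
  {ps:hom (mult_of L) circle_group. ALL x::rat. ps (\<iota> (\<int> #>\<^bsub>rat_group\<^esub> x)) = exp (2 * of_real pi * \<i> * of_rat x)}"
 proof -
  have "kp':PiE U ?A" if "kp':Chars" "near m dl kp' kp" for kp'
  using X_D(1,2)[OF that(1)] that(2) unfolding near_def by (auto simp: PiE_def dist_norm norm_minus_commute)
  moreover have "near m dl kp' kp & kp':PiE U (%_. sphere 0 1)" if "kp':PiE U ?A" for kp'
  proof
  show "near m dl kp' kp"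
  unfolding near_def
  proof
  fix x assume x: "x:R m"
  hence "kp' x : ?A x" using that R_U[OF x] by blast
  thus "cmod (kp' x - kp x) < dl" using x by (simp add: dist_norm norm_minus_commute)
  qed
  have "PiE U ?A <= PiE U (%_. sphere 0 1)" by (rule PiE_mono) auto
  thus "kp':PiE U (%_. sphere 0 1)" using that by (rule subsetD)
  qed
  ultimately show ?thesis
  unfolding Chars_def X_closure_def topspace_subtopology topspace_product_topology carrier_mult_of by auto
 qed
 ultimately show ?thesis unfolding X_closure_def openin_subtopology by blast
qed

lemma T_open_iff:
 "openin T V <-> V <= Chars & (ALL kp:V. EX m. EX dl>0. ALL kp':Chars. near m dl kp' kp --> kp':V)"
proof (intro iffI conjI ballI)
 assume V: "openin T V"
 show "V <= Chars" using openin_subset[OF V] unfolding Chars_def .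
 fix kp assume kpV: "kp:V"
 hence kp: "kp:Chars" using \<open>V <= Chars\<close> by blast
 let ?P = "product_topology (%_. unit_circle) (carrier (mult_of L))"
 obtain W where W: "openin ?P W" "kp:W" "W Int topspace T <= V"
  using V kpV unfolding X_closure_def openin_subtopology by auto
 obtain A where A: "kp:PiE (carrier (mult_of L)) A" "!!i. openin unit_circle (A i)"
  "finite {i. A i ~= topspace unit_circle}" "PiE (carrier (mult_of L)) A <= W"
  using product_topology_open_contains_basis[OF W(1,2)] by blast
 define I where "I = {i. A i ~= sphere 0 1} Int U"
 have fI: "finite I" unfolding I_def using A(3) by simp
 obtain m where m: "I <= R m" using R_exhaust_finite[OF fI, of 0] unfolding I_def by blast
 have "EX e>0. ball (kp i) e Int sphere 0 1 <= A i" if "i:U" for i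
  using A(2)[of i] A(1) that unfolding openin_contains_ball by (auto simp: PiE_def Pi_def)
 then obtain e where e: "!!i. i:U ==> e i > 0 & ball (kp i) (e i) Int sphere 0 1 <= A i" by metis
 obtain dl where dl: "dl > 0" "!!i. i:I ==> dl <= e i"
  using finite_positive_bound[OF fI, of e] e unfolding I_def by blast
 have "kp':V" if k: "kp':Chars" "near m dl kp' kp" for kp'
 proof -
  have "kp' i:A i" if i: "i:U" for i
  proof (cases "i:I")
  case True
  hence "cmod (kp' i - kp i) < e i" using k(2) m dl(2)[OF True] unfolding near_def by force
  thus ?thesis using e[OF i] X_D(2)[OF k(1) i] by (auto simp: dist_norm norm_minus_commute subset_iff)
  next
  case False
  hence "A i = sphere 0 1" using i unfolding I_def by blast
  thus ?thesis using X_D(2)[OF k(1) i] by simp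
  qed
  hence "kp':PiE (carrier (mult_of L)) A" using X_D(1)[OF k(1)] by (auto simp: PiE_def)
  thus ?thesis using A(4) W(3) k(1) unfolding Chars_def by blast
 qed
 thus "EX m. EX dl>0. ALL kp':Chars. near m dl kp' kp --> kp':V" using dl(1) by blast
next
 assume h: "V <= Chars & (ALL kp:V. EX m. EX dl>0. ALL kp':Chars. near m dl kp' kp --> kp':V)"
 show "openin T V"
 proof (subst openin_subopen, intro ballI)
  fix kp assume kp: "kp:V"
  then obtain m dl where "dl > 0" "ALL kp':Chars. near m dl kp' kp --> kp':V" using h by blast
  thus "EX W. openin T W & kp:W & W <= V"
  using T_open_near[of m dl kp] near_refl[of dl m kp] kp h by (intro exI[of _ "{kp':Chars. near m dl kp' kp}"]) blast
 qed
qed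

lemma q_iff: "kp':q kp <-> (EX tu:carrier GG. kp' = act kp tu)"
proof -
 have e: "galois_action L F tu kp = act kp (ginv tu)" for tu
  unfolding galois_action_def act_def compose_def by simp
 show ?thesis unfolding X_proj_def orbit_def e mem_Collect_eq
 proof
  assume "EX tu:carrier GG. kp' = act kp tu"
  then obtain tu where "tu:carrier GG" "kp' = act kp tu" by blast
  thus "EX tu. kp' = act kp (ginv tu) & tu:carrier GG" by (intro exI[of _ "ginv tu"]) simp
 qed (use G.inv_closed in blast)
qed

lemma q_eq_iff:
 assumes "kp:Chars" "kp':Chars"
 shows "q kp = q kp' <-> (EX tu:carrier GG. kp' = act kp tu)"
proof
 assume "q kp = q kp'"
 moreover have "kp':q kp'" unfolding q_iff using act_one[OF assms(2)] by (metis G.one_closed)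
 ultimately show "EX tu:carrier GG. kp' = act kp tu" using q_iff by blast
next
 assume "EX tu:carrier GG. kp' = act kp tu"
 then obtain tu where tu: "tu:carrier GG" "kp' = act kp tu" by blast
 show "q kp = q kp'"
 proof (rule Set.set_eqI)
  fix rh
  have "EX ups:carrier GG. rh = act kp' ups" if "ups:carrier GG" "rh = act kp ups" for ups
  proof (intro bexI)
  show "rh = act kp' (ginv tu *G ups)"
  unfolding tu(2) that(2) using tu(1) that(1) by (simp add: act_act G.inv_solve_left' flip: G.m_assoc)
  qed (use tu that in simp)
  moreover have "EX ups:carrier GG. rh = act kp ups" if "ups:carrier GG" "rh = act kp' ups" for ups
  using that tu act_act[OF tu(1) that(1)] by (intro bexI[of _ "tu *G ups"]) auto
  ultimately show "rh:q kp <-> rh:q kp'" unfolding q_iff by blast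
 qed
qed

lemma q_act: "kp:Chars ==> tu:carrier GG ==> q (act kp tu) = q kp"
 using q_eq_iff[of kp "act kp tu"] act_X by blast

lemma Y_topspace: "topspace Y = q ` Chars" unfolding X_field_def Chars_def by simp

lemma q_quotient: "quotient_map T Y q" unfolding X_field_def by (rule quotient_map_quotient_topology)

lemma q_continuous: "continuous_map T Y q" by (rule quotient_imp_continuous_map[OF q_quotient])

lemma q_open:
 assumes V: "openin T V"
 shows "openin Y (q ` V)"
 unfolding X_field_def openin_quotient_topology
proof
 note h = V[unfolded T_open_iff]
 show "q ` V <= q ` topspace T" using h unfolding Chars_def by blast
 show "openin T {x:topspace T. q x:q ` V}"
  unfolding T_open_iff
 proof (intro conjI ballI)
  show "{x:topspace T. q x:q ` V} <= Chars" unfolding Chars_def by blast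
  fix kp assume "kp:{x:topspace T. q x:q ` V}"
  then obtain rh where rh: "kp:Chars" "rh:V" "q kp = q rh" unfolding Chars_def by auto
  then obtain tu where tu: "tu:carrier GG" "rh = act kp tu" using q_eq_iff h by blast
  obtain m dl where m: "dl > 0" "!!kp'. kp':Chars ==> near m dl kp' rh ==> kp':V" using h rh(2) by blast
  have "kp':{x:topspace T. q x:q ` V}" if k: "kp':Chars" "near m dl kp' kp" for kp'
  using m(2)[OF act_X[OF k(1) tu(1)]] near_act[OF k(2) tu(1)] q_act[OF k(1) tu(1)] k(1) tu(2) unfolding Chars_def
  by (metis (mono_tags, lifting) imageI mem_Collect_eq)
  thus "EX m. EX dl>0. ALL kp':Chars. near m dl kp' kp --> kp':{x:topspace T. q x:q ` V}"
  using m(1) by blast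
 qed
qed

lemma T_continuous_iff:
 "continuous_map S T f <-> f ` topspace S <= Chars & (ALL x:U. continuous_map S euclidean (%s. f s x))"
proof
 assume h: "continuous_map S T f"
 have "continuous_map S unit_circle (%s. f s x)" if "x:U" for x
 proof -
  have "continuous_map S (product_topology (%_. unit_circle) (carrier (mult_of L))) f"
  using h unfolding X_closure_def continuous_map_in_subtopology by blast
  thus ?thesis unfolding continuous_map_componentwise using that by simp
 qed
 thus "f ` topspace S <= Chars & (ALL x:U. continuous_map S euclidean (%s. f s x))"
  using continuous_map_image_subset_topspace[OF h] unfolding Chars_def by (simp add: continuous_map_in_subtopology)
next
 assume h: "f ` topspace S <= Chars & (ALL x:U. continuous_map S euclidean (%s. f s x))"
 hence c: "f s:topspace T" if "s:topspace S" for s using that unfolding Chars_def by blast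
 have "continuous_map S unit_circle (%s. f s x)" if "x:U" for x
  using h that X_D(2) by (auto simp: continuous_map_in_subtopology)
 thus "continuous_map S T f"
  unfolding X_closure_def continuous_map_in_subtopology continuous_map_componentwise
  using c unfolding X_closure_def by (auto simp: PiE_def)
qed

lemma pathin_T_iff:
 "pathin T xi <-> (ALL t:{0..1}. xi t:Chars) & (ALL x:U. continuous_on {0..1} (%t. xi t x))"
 unfolding pathin_def T_continuous_iff by (auto simp: continuous_map_iff_continuous)

lemma pathin_near:
 assumes "pathin T xi" "t:{0..1}" "dl > 0"
 shows "EX d>0. ALL s:{0..1}. \<bar>s - t\<bar> < d --> near m dl (xi s) (xi t)"
proof -
 have "EX d>0. ALL s:{0..1}. \<bar>s - t\<bar> < d --> cmod (xi s x - xi t x) < dl" if "x:U" for x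
  using assms(1) that assms(2,3) unfolding pathin_T_iff continuous_on_iff by (simp add: dist_norm)
 then obtain d where d: "!!x. x:U ==> d x > 0 & (ALL s:{0..1}. \<bar>s - t\<bar> < d x --> cmod (xi s x - xi t x) < dl)"
  by metis
 obtain e where "e > 0" "!!x. x:R m ==> e <= d x" using finite_positive_bound[OF R_finite, of m d] d R_U by blast
 thus ?thesis using d R_U unfolding near_def by (intro exI[of _ e]) force
qed

lemma path_open:
 assumes "pathin S ga" "openin S V" "t:{0..1}" "ga t:V"
 shows "EX d>0. ALL s:{0..1}. \<bar>s - t\<bar> < d --> ga s:V"
proof -
 have "openin (top_of_set {0..1}) {s:{0..1}. ga s:V}"
  using openin_continuous_map_preimage[OF assms(1)[unfolded pathin_def] assms(2)] by simp
 then obtain d where d: "d > 0" "ball t d Int {0..1} <= {s:{0..1}. ga s:V}"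
  using assms(3,4) unfolding openin_contains_ball by blast
 thus ?thesis by (intro exI[of _ d]) (auto simp: dist_real_def abs_minus_commute subset_iff)
qed

end

section \<open>Lifting of paths modulo open subgroups and in the limit\<close>

context pointed_abelian_closure
begin

lemma Chars_eqI:
 assumes "kp:Chars" "kp':Chars" "!!n x. x:R n ==> kp x = kp' x"
 shows "kp = kp'"
proof (rule extensionalityI[OF X_D(1)[OF assms(1)] X_D(1)[OF assms(2)]])
 fix x assume "x:U"
 then obtain n where "x:R n" using R_exhaust by blast
 thus "kp x = kp' x" by (rule assms(3))
qed

lemma G_n_mem: "tu:carrier GG ==> tu:G_n n <-> (ALL x:R n. tu x = x)"
 using G_nI[of tu n] G_nD(3)[of tu n] by blast

lemma G_n_coset:
 assumes "ups:G_n n" "tu:carrier GG" "ginv ups *G tu:G_n n"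
 shows "tu:G_n n"
 using assms(3) G_nD(3)[OF assms(1)] unfolding G_n_iff[OF G_nD(2)[OF assms(1)] assms(2)] G_n_mem[OF assms(2)] by simp

lemma G_n_sandwich:
 assumes "g:G_n n" "g':G_n n" "tu:carrier GG"
 shows "g' *G (tu *G ginv g):G_n n <-> tu:G_n n"
proof -
 have i: "ginv g:G_n n" using subgroup.m_inv_closed[OF G_n_subgroup assms(1)] .
 note C = G_nD(2)[OF assms(2)] G_nD(2)[OF i] assms(3)
 have "(g' *G (tu *G ginv g)) x = tu x" if x: "x:R n" for x
  using G_mult[OF C(1) G.m_closed[OF C(3,2)] R_carrier(1)[OF x]] G_mult[OF C(3,2) R_carrier(1)[OF x]]
  G_nD(3)[OF i x] G_nD(3)[OF assms(2) R_image_G[OF C(3) x]] by simp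
 thus ?thesis using C by (simp add: G_n_mem)
qed

lemma G_n_conj:
 assumes "g:G_n n" "tu:carrier GG"
 shows "ginv tu *G (g *G tu):G_n n"
proof -
 note C = G_nD(2)[OF assms(1)] assms(2)
 have "(g *G tu) x = tu x" if x: "x:R n" for x
  using G_mult[OF C R_carrier(1)[OF x]] G_nD(3)[OF assms(1) R_image_G[OF C(2) x]] by simp
 thus ?thesis unfolding G_n_iff[OF C(2) G.m_closed[OF C]] by simp
qed

text \<open>The bound \<open>ep <= 1\<close> is for \<open>close_endpt\<close>: it keeps characters
  at distance below 1, where winding numbers cannot change unnoticed.\<close>

definition separates :: "nat => nat => real => bool" where
 "separates n m ep <-> n <= m & ep > 0 & ep <= 1 &
  (ALL kp:Chars. ALL tu:carrier GG. near m ep (act kp tu) kp --> tu:G_n n)"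

lemma separatesD: "separates n m ep ==> kp:Chars ==> tu:carrier GG ==> near m ep (act kp tu) kp ==> tu:G_n n"
 unfolding separates_def by blast

lemma exists_separates: "EX m ep. separates n m ep"
proof -
 obtain m ep where h: "n <= m" "ep > 0"
  "!!kp tu. kp:Chars ==> tu:carrier GG ==> near m ep (act kp tu) kp ==> tu:G_n n"
  using separation[of n] by blast
 hence "separates n m (min ep 1)" unfolding separates_def using near_mono[of m "min ep 1" _ _ m ep] by auto
 thus ?thesis by blast
qed

lemma same_coset:
 assumes s: "separates n m ep" and kp: "kp:Chars" and tu: "tu:carrier GG" "ups:carrier GG"
  and near: "near m (ep / 2) (act kp tu) rh" "near m (ep / 2) (act kp ups) rh"
 shows "ginv tu *G ups:G_n n"
proof (rule separatesD[OF s act_X[OF kp tu(1)]])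
 have "act (act kp tu) (ginv tu *G ups) = act kp ups"
  using tu by (simp add: act_act flip: G.m_assoc)
 thus "near m ep (act (act kp tu) (ginv tu *G ups)) (act kp tu)"
  using near_trans[OF near(2) near_sym[OF near(1)], of ep] by simp
qed (use tu in simp)

text \<open>Paths modulo \<open>G_n n\<close>: lifts to \<open>X\<close> of paths in the quotient by \<open>G_n n\<close>, not assumed continuous.\<close>

definition npath :: "nat => real => real => (real => 'a => complex) => bool" where
 "npath n a b xi <-> (ALL t:{a..b}. xi t:Chars) & (ALL t:{a..b}. ALL m. ALL dl>0. EX d>0. ALL s:{a..b}. \<bar>s - t\<bar> < d -->
  (EX g:G_n n. near m dl (act (xi s) g) (xi t)))"

lemma npathD: "npath n a b xi ==> t:{a..b} ==> xi t:Chars"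
 "npath n a b xi ==> t:{a..b} ==> dl > 0 ==> EX d>0. ALL s:{a..b}. \<bar>s - t\<bar> < d -->
  (EX g:G_n n. near m dl (act (xi s) g) (xi t))"
 unfolding npath_def by blast+

lemma pathin_T_D: "pathin T xi ==> t:{0..1} ==> xi t:Chars" unfolding pathin_T_iff by blast

lemma pathin_npath:
 assumes "pathin T xi"
 shows "npath n 0 1 xi"
 unfolding npath_def
proof (intro conjI ballI allI impI)
 fix t dl :: real and m assume h: "t:{0..1}" "dl > 0"
 obtain d where "d > 0" "!!s. s:{0..1} ==> \<bar>s - t\<bar> < d ==> near m dl (xi s) (xi t)"
  using pathin_near[OF assms h] by blast
 thus "EX d>0. ALL s:{0..1}. \<bar>s - t\<bar> < d --> (EX g:G_n n. near m dl (act (xi s) g) (xi t))"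
  using act_one[OF pathin_T_D[OF assms]] subgroup.one_closed[OF G_n_subgroup] by metis
qed (rule pathin_T_D[OF assms])

text \<open>For each t, an automorphism bringing \<open>xi' t\<close> near \<open>xi t\<close> is
  unique modulo \<open>G_n n\<close> by \<open>same_coset\<close>. Its coset being trivial is a
  locally constant condition on t, and it holds at 0.\<close>

lemma rigidity:
 assumes s: "separates n m ep" and xi: "npath n 0 1 xi" and xi': "npath n 0 1 xi'"
  and close: "!!t. t:{0..1} ==> EX tu:carrier GG. near m (ep / 2) (act (xi' t) tu) (xi t)"
  and start: "EX tu:G_n n. near m (ep / 2) (act (xi' 0) tu) (xi 0)" and t: "t:{0..1}"
 shows "EX tu:G_n n. near m (ep / 2) (act (xi' t) tu) (xi t)"
proof -
 define P where "P t <-> (EX tu:G_n n. near m (ep / 2) (act (xi' t) tu) (xi t))" for t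
 have P_iff: "P t <-> tu:G_n n"
  if t: "t:{0..1}" and tu: "tu:carrier GG" "near m (ep / 2) (act (xi' t) tu) (xi t)" for t tu
 proof
  assume "P t"
  then obtain ups where ups: "ups:G_n n" "near m (ep / 2) (act (xi' t) ups) (xi t)" unfolding P_def by blast
  show "tu:G_n n"
  by (rule G_n_coset[OF ups(1) tu(1) same_coset[OF s npathD(1)[OF xi' t] G_nD(2)[OF ups(1)] tu(1) ups(2) tu(2)]])
 qed (use tu in \<open>auto simp: P_def\<close>)
 have "P t"
 proof (rule interval_locally_constant[OF _ _ t])
  show "P 0" using start unfolding P_def .
  fix t :: real assume t: "t:{0..1}"
  obtain tu where tu: "tu:carrier GG" "near m (ep / 2) (act (xi' t) tu) (xi t)" using close[OF t] by blast
  obtain dl where dl: "dl > 0" "near m (ep / 2 - dl) (act (xi' t) tu) (xi t)" using near_slack[OF tu(2)] by blast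
  obtain d where d: "d > 0" "!!s. s:{0..1} ==> \<bar>s - t\<bar> < d ==> EX g:G_n n. near m (dl / 2) (act (xi s) g) (xi t)"
  using npathD(2)[OF xi t, of "dl / 2" m] dl(1) by auto
  obtain d' where d': "d' > 0" "!!s. s:{0..1} ==> \<bar>s - t\<bar> < d' ==> EX g:G_n n. near m (dl / 2) (act (xi' s) g) (xi' t)"
  using npathD(2)[OF xi' t, of "dl / 2" m] dl(1) by auto
  have "P s <-> P t" if st: "s:{0..1}" "\<bar>s - t\<bar> < min d d'" for s
  proof -
  obtain g where g: "g:G_n n" "near m (dl / 2) (act (xi s) g) (xi t)" using d(2)[of s] st by auto
  obtain g' where g': "g':G_n n" "near m (dl / 2) (act (xi' s) g') (xi' t)" using d'(2)[of s] st by auto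
  note C = G_nD(2)[OF g(1)] G_nD(2)[OF g'(1)]
  have ig: "ginv g:carrier GG" using C(1) by simp
  have "near m (ep / 2 - dl / 2) (act (act (xi' s) g') tu) (xi t)"
  by (rule near_trans[OF near_act[OF g'(2) tu(1)] dl(2)]) simp
  hence "near m (ep / 2) (act (act (xi' s) g') tu) (act (xi s) g)"
  by (rule near_trans[OF _ near_sym[OF g(2)]]) simp
  from near_act[OF this ig] have "near m (ep / 2) (act (act (act (xi' s) g') tu) (ginv g)) (xi s)"
  using act_inv(1)[OF npathD(1)[OF xi st(1)] C(1)] by simp
  \<comment> \<open>The automorphism at t, corrected by the elements \<open>g\<close> and
    \<open>g'\<close> that compare s with t, works at s. Sandwiching by \<open>G_n n\<close> does
    not affect membership in \<open>G_n n\<close>.\<close>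
  hence "near m (ep / 2) (act (xi' s) (g' *G (tu *G ginv g))) (xi s)"
  using C tu(1) by (simp add: act_act G.m_assoc)
  hence "P s <-> g' *G (tu *G ginv g):G_n n"
  using P_iff[OF st(1), of "g' *G (tu *G ginv g)"] C tu(1) by simp
  thus ?thesis using G_n_sandwich[OF g(1) g'(1) tu(1)] P_iff[OF t tu] by simp
  qed
  thus "EX d>0. ALL s:{0..1}. \<bar>s - t\<bar> < d --> (P s <-> P t)"
  using d(1) d'(1) by (intro exI[of _ "min d d'"]) simp
 qed
 thus ?thesis unfolding P_def .
qed

definition nlift :: "nat => (real => ('a => complex) set) => real => real => (real => 'a => complex) => bool" where
 "nlift n ga a b xi <-> npath n a b xi & (ALL t:{a..b}. q (xi t) = ga t)"

lemma fiber_neighbour: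
 assumes ga: "pathin Y ga" and t: "t:{0..1}" and kp: "kp:Chars" "q kp = ga t" and dl: "dl > 0"
 shows "EX d>0. ALL s:{0..1}. \<bar>s - t\<bar> < d --> (EX rh:Chars. near m dl rh kp & q rh = ga s)"
proof -
 let ?N = "{rh:Chars. near m dl rh kp}"
 have "ga t:q ` ?N" using kp near_refl[OF dl] by (intro image_eqI[of _ _ kp]) auto
 from path_open[OF ga q_open[OF T_open_near] t this]
 obtain d where d: "d > 0 & (ALL s:{0..1}. \<bar>s - t\<bar> < d --> ga s:q ` ?N)" by (rule exE)
 have "EX rh:Chars. near m dl rh kp & q rh = ga s" if "s:{0..1}" "\<bar>s - t\<bar> < d" for s
 proof -
  have "ga s:q ` ?N" using d that by blast
  then obtain rh where "rh : ?N" "ga s = q rh" by (rule imageE)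
  thus ?thesis by auto
 qed
 thus ?thesis using d by blast
qed

text \<open>Near \<open>t0\<close>, any choice of fibre points close to a fixed \<open>rh\<close> is
  continuous modulo \<open>G_n n\<close>. A fibre point truly close to \<open>xi t\<close> differs
  from \<open>xi s\<close> by an automorphism that moves it by less than ep, so
  \<open>separates\<close> puts this automorphism into \<open>G_n n\<close>.\<close>

lemma local_nlift:
 assumes ga: "pathin Y ga" and t0: "t0:{0..1}"
 shows "EX d>0. EX xi. ALL a b. 0 <= a --> b <= 1 --> (ALL t:{a..b}. \<bar>t - t0\<bar> < d) --> nlift n ga a b xi"
proof -
 obtain m ep where s: "separates n m ep" using exists_separates by blast
 hence ep: "ep > 0" unfolding separates_def by blast
 have "ga t0:topspace Y" using continuous_map_image_subset_topspace[OF ga[unfolded pathin_def]] t0 by auto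
 then obtain rh where rh: "rh:Chars" "q rh = ga t0" unfolding Y_topspace by auto
 obtain d where d: "d > 0" "!!s. s:{0..1} ==> \<bar>s - t0\<bar> < d ==> EX kp:Chars. near m (ep / 4) kp rh & q kp = ga s"
  using fiber_neighbour[OF ga t0 rh, of "ep / 4" m] ep by auto
 \<comment> \<open>Three distances of ep / 4 are added below, which stays within ep.\<close>
 define xi where "xi s = (SOME kp. kp:Chars & near m (ep / 4) kp rh & q kp = ga s)" for s
 have xi: "xi s:Chars & near m (ep / 4) (xi s) rh & q (xi s) = ga s" if "s:{0..1}" "\<bar>s - t0\<bar> < d" for s
 proof -
  have "EX kp. kp:Chars & near m (ep / 4) kp rh & q kp = ga s" using d(2)[OF that] by blast
  from someI_ex[OF this] show ?thesis unfolding xi_def .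
 qed
 have "nlift n ga a b xi" if ab: "0 <= a" "b <= 1" "!!t. t:{a..b} ==> \<bar>t - t0\<bar> < d" for a b
  unfolding nlift_def npath_def
 proof (intro conjI ballI allI impI)
  have X: "xi s:Chars" "near m (ep / 4) (xi s) rh" "q (xi s) = ga s" if "s:{a..b}" for s
  using xi[of s] ab(3)[OF that] that ab(1,2) by auto
  show "xi t:Chars" "q (xi t) = ga t" if "t:{a..b}" for t using X[OF that] by auto
  fix t dl :: real and m' assume t: "t:{a..b}" and dl: "dl > 0"
  have t01: "t:{0..1}" using t ab by auto
  obtain e where e: "e > 0" "!!s. s:{0..1} ==> \<bar>s - t\<bar> < e ==>
  EX kp:Chars. near (max m m') (min dl (ep / 4)) kp (xi t) & q kp = ga s"
  using fiber_neighbour[OF ga t01 X(1,3)[OF t], of "min dl (ep / 4)" "max m m'"] ep dl by auto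
  have "EX g:G_n n. near m' dl (act (xi s) g) (xi t)" if s': "s:{a..b}" "\<bar>s - t\<bar> < e" for s
  proof -
  obtain kp where kp: "kp:Chars" "near (max m m') (min dl (ep / 4)) kp (xi t)" "q kp = ga s"
  using e(2)[of s] s' ab by auto
  then obtain g where g: "g:carrier GG" "kp = act (xi s) g" using q_eq_iff[OF X(1)[OF s'(1)] kp(1)] X(3)[OF s'(1)] by auto
  have "near m (ep / 4) kp (xi t)" by (rule near_mono[OF kp(2)]) auto
  hence "near m (ep / 2) kp rh" by (rule near_trans[OF _ X(2)[OF t]]) simp
  hence "near m ep kp (xi s)" by (rule near_trans[OF _ near_sym[OF X(2)[OF s'(1)]]]) (use ep in simp)
  hence "g:G_n n" using separatesD[OF s X(1)[OF s'(1)] g(1)] g(2) by simp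
  moreover have "near m' dl kp (xi t)" by (rule near_mono[OF kp(2)]) auto
  ultimately show ?thesis using g(2) by blast
  qed
  thus "EX d>0. ALL s:{a..b}. \<bar>s - t\<bar> < d --> (EX g:G_n n. near m' dl (act (xi s) g) (xi t))"
  using e(1) by blast
 qed
 thus ?thesis using d(1) by blast
qed

lemma nlift_act:
 assumes "nlift n ga a b xi" "tu:carrier GG"
 shows "nlift n ga a b (%s. act (xi s) tu)"
proof -
 have p: "npath n a b xi" and f: "!!t. t:{a..b} ==> q (xi t) = ga t" using assms(1) unfolding nlift_def by auto
 show ?thesis
  unfolding nlift_def npath_def
 proof (intro conjI ballI allI impI)
  show "act (xi t) tu:Chars" "q (act (xi t) tu) = ga t" if "t:{a..b}" for t
  using act_X q_act npathD(1)[OF p that] f[OF that] assms(2) by auto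
  fix t dl :: real and m assume t: "t:{a..b}" and dl: "dl > 0"
  obtain d where d: "d > 0" "!!s. s:{a..b} ==> \<bar>s - t\<bar> < d ==> EX g:G_n n. near m dl (act (xi s) g) (xi t)"
  using npathD(2)[OF p t dl, of m] by blast
  have "EX g:G_n n. near m dl (act (act (xi s) tu) g) (act (xi t) tu)" if s: "s:{a..b}" "\<bar>s - t\<bar> < d" for s
  proof -
  obtain g where g: "g:G_n n" "near m dl (act (xi s) g) (xi t)" using d(2)[OF s] by blast
  note gC = G_nD(2)[OF g(1)]
  have "act (act (xi s) tu) (ginv tu *G (g *G tu)) = act (act (xi s) g) tu"
  using gC assms(2) by (simp add: act_act flip: G.m_assoc)
  thus ?thesis using near_act[OF g(2) assms(2)] G_n_conj[OF g(1) assms(2)] by metis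
  qed
  thus "EX d>0. ALL s:{a..b}. \<bar>s - t\<bar> < d --> (EX g:G_n n. near m dl (act (act (xi s) tu) g) (act (xi t) tu))"
  using d(1) by blast
 qed
qed

lemma nlift_glue:
 assumes ab: "a <= b" "b <= c" and l: "nlift n ga a b xi" "nlift n ga b c xi'" "xi b = xi' b"
 shows "nlift n ga a c (%t. if t <= b then xi t else xi' t)"
proof -
 define et where "et t = (if t <= b then xi t else xi' t)" for t
 have p: "npath n a b xi" "npath n b c xi'" using l(1,2) unfolding nlift_def by auto
 have "nlift n ga a c et"
  unfolding nlift_def npath_def
 proof (intro conjI ballI allI impI)
  show "et t:Chars" "q (et t) = ga t" if "t:{a..c}" for t
  using that l unfolding et_def nlift_def npath_def by auto
  fix t dl :: real and m assume t: "t:{a..c}" and dl: "dl > 0"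
  let ?Q = "%s. EX g:G_n n. near m dl (act (et s) g) (et t)"
  have left: "EX d>0. ALL s:{a..b}. \<bar>s - t\<bar> < d --> ?Q s" if "t <= b"
  using npathD(2)[OF p(1), of t dl m] that t dl unfolding et_def by auto
  have right: "EX d>0. ALL s:{b..c}. \<bar>s - t\<bar> < d --> ?Q s" if "t >= b"
  proof -
  have "t:{b..c}" using that t by simp
  from npathD(2)[OF p(2) this dl, of m]
  obtain d where d: "d > 0" "!!s. s:{b..c} ==> \<bar>s - t\<bar> < d ==> EX g:G_n n. near m dl (act (xi' s) g) (xi' t)"
  by blast
  have "et s = xi' s" if "s >= b" for s using that l(3) unfolding et_def by auto
  thus ?thesis using d that by (intro exI[of _ d]) auto
  qed
  consider "t < b" | "t = b" | "t > b" by linarith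
  thus "EX d>0. ALL s:{a..c}. \<bar>s - t\<bar> < d --> ?Q s"
  proof cases
  case 1
  then obtain d where "d > 0" "ALL s:{a..b}. \<bar>s - t\<bar> < d --> ?Q s" using left by auto
  thus ?thesis using 1 by (intro exI[of _ "min d (b - t)"]) auto
  next
  case 2
  then obtain d d' where "d > 0" "ALL s:{a..b}. \<bar>s - t\<bar> < d --> ?Q s" "d' > 0" "ALL s:{b..c}. \<bar>s - t\<bar> < d' --> ?Q s"
  using left right by auto
  thus ?thesis by (intro exI[of _ "min d d'"]) (auto simp: linorder_not_le)
  next
  case 3
  then obtain d where "d > 0" "ALL s:{b..c}. \<bar>s - t\<bar> < d --> ?Q s" using right by auto
  thus ?thesis using 3 by (intro exI[of _ "min d (t - b)"]) auto
  qed
 qed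
 thus ?thesis unfolding et_def .
qed

text \<open>Local lifts can be translated by the Galois group to start at any point of the fibre, so
  they can be glued; the interval is covered by bisection.\<close>

lemma nlift_exists:
 assumes ga: "pathin Y ga" and kp: "kp:Chars" "q kp = ga 0"
 shows "EX xi. nlift n ga 0 1 xi & xi 0 = kp"
proof -
 let ?P = "%a b. 0 <= a & b <= 1 --> (ALL kp:Chars. q kp = ga a --> (EX xi. nlift n ga a b xi & xi a = kp))"
 have "?P 0 1"
 proof (rule Bolzano[of 0 1 ?P])
  fix a b c :: real assume h: "?P a b" "?P b c" "a <= b" "b <= c"
  show "?P a c"
  proof (intro impI ballI)
  fix kp assume ac: "0 <= a & c <= 1" and kp: "kp:Chars" "q kp = ga a"
  obtain xi where xi: "nlift n ga a b xi" "xi a = kp" using h(1,3,4) ac kp by auto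
  have "xi b:Chars" "q (xi b) = ga b" using xi(1) h(3) unfolding nlift_def npath_def by auto
  then obtain xi' where xi': "nlift n ga b c xi'" "xi' b = xi b" using h(2,3,4) ac by auto
  show "EX xi. nlift n ga a c xi & xi a = kp"
  using nlift_glue[OF h(3,4) xi(1) xi'(1)] xi(2) xi'(2) h(3) by (intro exI) auto
  qed
 next
  fix x :: real assume x: "0 <= x" "x <= 1"
  obtain d xi where d: "d > 0" and xi: "!!a b. 0 <= a ==> b <= 1 ==> (!!t. t:{a..b} ==> \<bar>t - x\<bar> < d) ==> nlift n ga a b xi"
  using local_nlift[OF ga, of x n] x by (metis atLeastAtMost_iff)
  have "?P a b" if ab: "a <= x" "x <= b" "b - a < d" for a b
  proof (intro impI ballI)
  fix kp assume ab': "0 <= a & b <= 1" and kp: "kp:Chars" "q kp = ga a"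
  have l: "nlift n ga a b xi" by (rule xi) (use ab ab' in auto)
  hence a: "xi a:Chars" "q (xi a) = ga a" using ab unfolding nlift_def npath_def by auto
  then obtain tu where "tu:carrier GG" "kp = act (xi a) tu" using q_eq_iff[OF a(1) kp(1)] kp(2) by auto
  thus "EX xi. nlift n ga a b xi & xi a = kp" using nlift_act[OF l] by blast
  qed
  thus "EX d>0. ALL a b. a <= x & x <= b & b - a < d --> ?P a b" using d by blast
 qed simp
 thus ?thesis using kp by simp
qed

lemma nlift_unique:
 assumes l: "nlift n ga 0 1 xi" "nlift n ga 0 1 xi'" "xi 0 = xi' 0" and t: "t:{0..1}"
 shows "EX g:G_n n. xi' t = act (xi t) g"
proof -
 obtain m ep where s: "separates n m ep" using exists_separates by blast
 hence ep: "ep / 2 > 0" unfolding separates_def by simp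
 have p: "npath n 0 1 xi" "npath n 0 1 xi'" using l unfolding nlift_def by auto
 have ex: "EX tu:carrier GG. xi t = act (xi' t) tu" if t: "t:{0..1}" for t
  using q_eq_iff[OF npathD(1)[OF p(2) t] npathD(1)[OF p(1) t]] l t unfolding nlift_def by auto
 have "EX tu:G_n n. near m (ep / 2) (act (xi' t) tu) (xi t)"
 proof (rule rigidity[OF s p _ _ t])
  show "EX tu:carrier GG. near m (ep / 2) (act (xi' t) tu) (xi t)" if "t:{0..1}" for t
  using ex[OF that] near_refl[OF ep] by metis
  have "act (xi' 0) \<one>\<^bsub>GG\<^esub> = xi 0" using act_one[OF npathD(1)[OF p(2), of 0]] l(3) by simp
  thus "EX tu:G_n n. near m (ep / 2) (act (xi' 0) tu) (xi 0)"
  using near_refl[OF ep] subgroup.one_closed[OF G_n_subgroup] by metis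
 qed
 then obtain ups where ups: "ups:G_n n" "near m (ep / 2) (act (xi' t) ups) (xi t)" by blast
 obtain tu where tu: "tu:carrier GG" "xi t = act (xi' t) tu" using ex[OF t] by blast
 have tun: "tu:G_n n"
 proof (rule G_n_coset[OF ups(1) tu(1)], rule same_coset[OF s npathD(1)[OF p(2) t] G_nD(2)[OF ups(1)] tu(1) ups(2)])
  show "near m (ep / 2) (act (xi' t) tu) (xi t)" unfolding tu(2)[symmetric] by (rule near_refl[OF ep])
 qed
 have "xi' t = act (xi t) (ginv tu)" unfolding tu(2) using act_inv(1)[OF npathD(1)[OF p(2) t] tu(1)] by simp
 thus ?thesis using subgroup.m_inv_closed[OF G_n_subgroup tun] by blast
qed

text \<open>Lifts of successive levels k with the same start differ, pointwise in t, by elements of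
  \<open>G_n k\<close>, whose infinite product converges. The limit agrees with the level-k lift on
  \<open>R k\<close>; there \<open>G_n k\<close> acts trivially, so continuity modulo
  \<open>G_n k\<close> is genuine continuity of the coordinates.\<close>

theorem lift_exists:
 assumes ga: "pathin Y ga" and kp: "kp:Chars" "q kp = ga 0"
 shows "EX xi. pathin T xi & xi 0 = kp & (ALL t:{0..1}. q (xi t) = ga t)"
proof -
 obtain xi where xi: "!!n. nlift n ga 0 1 (xi n)" "!!n. xi n 0 = kp" using nlift_exists[OF assms] by metis
 have p: "npath n 0 1 (xi n)" for n using xi(1)[of n] unfolding nlift_def by blast
 have "EX rh:carrier GG. ALL k. EX h:G_n k. act (xi 0 t) rh = act (xi k t) h" if t: "t:{0..1}" for t
 proof -
  have "nlift k ga 0 1 (xi (Suc k))" for k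
  using xi(1)[of "Suc k"] G_n_antimono[of k "Suc k"] unfolding nlift_def npath_def by (meson le_SucI order_refl subsetD)
  hence "EX g:G_n k. xi (Suc k) t = act (xi k t) g" for k using nlift_unique[OF xi(1) _ _ t] xi(2) by metis
  then obtain g where g: "!!k. g k:G_n k" "!!k. xi (Suc k) t = act (xi k t) (g k)" by metis
  \<comment> \<open>Partial products of the correcting automorphisms; \<open>G_limit\<close>
    provides their limit \<open>rh\<close>.\<close>
  define tu where "tu = rec_nat \<one>\<^bsub>GG\<^esub> (%k tu. tu *G g k)"
  have tus: "tu 0 = \<one>\<^bsub>GG\<^esub>" "tu (Suc k) = tu k *G g k" for k unfolding tu_def by auto
  have tuC: "tu k:carrier GG" for k by (induction k) (use tus G_nD(2)[OF g(1)] in auto)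
  have xitu: "xi k t = act (xi 0 t) (tu k)" for k
  proof (induction k)
  case 0
  thus ?case using act_one[OF npathD(1)[OF p t]] tus by simp
  next
  case (Suc k)
  thus ?case using g(2)[of k] act_act[OF tuC G_nD(2)[OF g(1)]] tus by simp
  qed
  have "EX rh:carrier GG. ALL k. ALL x:E (0 + k). rh x = tu k x"
  proof (rule G_limit[OF tuC])
  fix k x assume "x:E (0 + k)"
  thus "tu (Suc k) x = tu k x"
  using tus(2)[of k] G_mult[OF tuC G_nD(2)[OF g(1)], of x k k] G_nD(4)[OF g(1), of x k] E_carrier by auto
  qed
  then obtain rh where rh: "rh:carrier GG" "!!k x. x:E k ==> rh x = tu k x" by auto
  have "EX h:G_n k. act (xi 0 t) rh = act (xi k t) h" for k
  proof (intro bexI)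
  show "act (xi 0 t) rh = act (xi k t) (ginv tu k *G rh)"
  unfolding xitu[of k] using tuC rh(1) by (simp add: act_act flip: G.m_assoc)
  show "ginv tu k *G rh:G_n k"
  unfolding G_n_iff[OF tuC rh(1)] using rh(2)[OF subsetD[OF R_E]] by simp
  qed
  thus ?thesis using rh(1) by blast
 qed
 then obtain rh where rh: "!!t. t:{0..1} ==> rh t:carrier GG & (ALL k. EX h:G_n k. act (xi 0 t) (rh t) = act (xi k t) h)" by metis
 define \<Xi> where "\<Xi> t = act (xi 0 t) (rh t)" for t
 have \<Xi>R: "\<Xi> t x = xi k t x" if tx: "t:{0..1}" "x:R k" for t x k
 proof -
  obtain h where "h:G_n k" "\<Xi> t = act (xi k t) h" unfolding \<Xi>_def using rh[OF tx(1)] by blast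
  thus ?thesis using act_G_n tx(2) by simp
 qed
 have \<Xi>C: "\<Xi> t:Chars" and \<Xi>q: "q (\<Xi> t) = ga t" if t: "t:{0..1}" for t
  unfolding \<Xi>_def using act_X[OF npathD(1)[OF p t]] q_act[OF npathD(1)[OF p t]] rh[OF t] xi(1)[of 0] t
  unfolding nlift_def by auto
 have "continuous_on {0..1} (%t. \<Xi> t x)" if x: "x:U" for x
  unfolding continuous_on_iff
 proof (intro ballI allI impI)
  fix t e :: real assume t: "t:{0..1}" and e: "e > 0"
  obtain k where k: "x:R k" using R_exhaust x by blast
  obtain d where d: "d > 0" "!!s. s:{0..1} ==> \<bar>s - t\<bar> < d ==> EX g:G_n k. near k e (act (xi k s) g) (xi k t)"
  using npathD(2)[OF p[of k] t e, of k] by blast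
  have "dist (\<Xi> s x) (\<Xi> t x) < e" if s: "s:{0..1}" "dist s t < d" for s
  proof -
  obtain g where g: "g:G_n k" "near k e (act (xi k s) g) (xi k t)" using d(2)[of s] s by (auto simp: dist_real_def)
  hence "cmod (xi k s x - xi k t x) < e" using k act_G_n[OF g(1) k] unfolding near_def by fastforce
  thus ?thesis using \<Xi>R[OF s(1) k] \<Xi>R[OF t k] by (simp add: dist_norm)
  qed
  thus "EX d>0. ALL s:{0..1}. dist s t < d --> dist (\<Xi> s x) (\<Xi> t x) < e" using d(1) by blast
 qed
 hence "pathin T \<Xi>" unfolding pathin_T_iff using \<Xi>C by blast
 moreover have "\<Xi> 0 = kp" by (rule Chars_eqI[OF \<Xi>C kp(1)]) (use \<Xi>R[of 0] xi(2) in auto)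
 ultimately show ?thesis using \<Xi>q by blast
qed

lemma lift_unique:
 assumes "pathin T xi" "pathin T xi'" "xi 0 = xi' 0" "!!t. t:{0..1} ==> q (xi t) = q (xi' t)" and t: "t:{0..1}"
 shows "xi t = xi' t"
proof (rule Chars_eqI[OF pathin_T_D[OF assms(1) t] pathin_T_D[OF assms(2) t]])
 fix n x assume x: "x:R n"
 have "nlift n (%t. q (xi t)) 0 1 xi" "nlift n (%t. q (xi t)) 0 1 xi'"
  unfolding nlift_def using pathin_npath assms by auto
 then obtain g where "g:G_n n" "xi' t = act (xi t) g" using nlift_unique[where n = n and ga = "%t. q (xi t)" and xi = xi and xi' = xi' and t = t] assms(3) t by blast
 thus "xi t x = xi' t x" using act_G_n x by simp
qed

lemma free_action: "kp:Chars ==> tu:carrier GG ==> ups:carrier GG ==> act kp tu = act kp ups ==> tu = ups"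
proof -
 assume h: "kp:Chars" "tu:carrier GG" "ups:carrier GG" "act kp tu = act kp ups"
 have "tu x = ups x" if x: "x:R n" for x n
 proof -
  obtain m ep where s: "separates n m ep" using exists_separates by blast
  hence e: "ep / 2 > 0" unfolding separates_def by simp
  have "ginv tu *G ups:G_n n"
  by (rule same_coset[OF s h(1-3) near_refl[OF e]]) (use h(4) near_refl[OF e] in simp)
  thus ?thesis unfolding G_n_iff[OF h(2,3)] using x by blast
 qed
 hence "tu x = ups x" if "x:U" for x using R_exhaust that by blast
 moreover have "tu \<zero> = ups \<zero>" using Aut_simps(2)[OF G_Aut[OF h(2)]] Aut_simps(2)[OF G_Aut[OF h(3)]] by simp
 ultimately show "tu = ups" by (intro G_eqI[OF h(2,3)]) auto
qed

end

section \<open>Loops and their winding numbers\<close>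

lemma cis_path_continuous: "continuous_on S (%t. cis (2 * pi * t))"
 by (intro continuous_intros)

lemma cis_path_image: "(%t. cis (2 * pi * t)) ` {0..1} = sphere 0 1"
proof
 show "sphere 0 1 <= (%t. cis (2 * pi * t)) ` {0..1}"
 proof
  fix w :: complex assume w: "w:sphere 0 1"
  have "w = cis (Arg2pi w)" using Arg2pi_eq[of w] w by (simp add: cis_conv_exp)
  moreover have "0 <= Arg2pi w" "Arg2pi w < 2 * pi" using Arg2pi[of w] by auto
  ultimately show "w:(%t. cis (2 * pi * t)) ` {0..1}"
  by (intro image_eqI[of _ _ "Arg2pi w / (2 * pi)"]) auto
 qed
qed auto

lemma Arg2pi_cis: "0 <= t ==> t < 1 ==> Arg2pi (cis (2 * pi * t)) = 2 * pi * t"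
 using Arg2pi_unique[of 1 "2 * pi * t" "cis (2 * pi * t)"] by (simp add: cis_conv_exp)

lemma compact_quotient_map:
 fixes f :: "'c::metric_space => 'd::metric_space"
 assumes "continuous_on S f" "compact S" "f ` S = S'"
 shows "quotient_map (top_of_set S) (top_of_set S') f"
proof (rule continuous_closed_imp_quotient_map)
 show c: "continuous_map (top_of_set S) (top_of_set S') f"
  using assms by (auto simp: continuous_map_in_subtopology continuous_map_iff_continuous)
 show "closed_map (top_of_set S) (top_of_set S') f"
  by (rule continuous_imp_closed_map_gen[OF _ Hausdorff_imp_kc_space[OF Hausdorff_space_subtopology[OF Hausdorff_space_euclidean]] c])
  (use assms in \<open>simp add: compact_space_subtopology\<close>)
qed (use assms in auto)

lemma quotient_map_cis: "quotient_map (top_of_set {0..1}) unit_circle (%t. cis (2 * pi * t))"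
 by (rule compact_quotient_map[OF cis_path_continuous _ cis_path_image]) simp

lemma quotient_map_cis_prod:
 "quotient_map (top_of_set ({0..1} \<times> {0..1})) (prod_topology (top_of_set {0..1::real}) unit_circle) (%(s, t). (s, cis (2 * pi * t)))"
 unfolding prod_topology_subtopology_eu
proof (rule compact_quotient_map)
 show "(%(s, t). (s, cis (2 * pi * t))) ` ({0..1} \<times> {0..1}) = {0..1} \<times> sphere 0 1"
  unfolding cis_path_image[symmetric] by force
 show "continuous_on ({0..1} \<times> {0..1}) (%(s::real, t). (s, cis (2 * pi * t)))"
  unfolding case_prod_unfold by (intro continuous_intros)
qed (auto intro: compact_Times)

definition loop_of :: "(real => 'y) => complex => 'y" where
 "loop_of p = (\<lambda>w\<in>sphere 0 1. p (Arg2pi w / (2 * pi)))"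

lemma loop_of_cis:
 assumes "p 0 = p 1" "t:{0..1}"
 shows "loop_of p (cis (2 * pi * t)) = p t"
proof (cases "t = 1")
 case True
 have "Arg2pi 1 = 0" using Arg2pi_cis[of 0] by simp
 thus ?thesis unfolding loop_of_def using True assms by simp
next
 case False
 hence "Arg2pi (cis (2 * pi * t)) = 2 * pi * t" using assms(2) by (intro Arg2pi_cis) auto
 thus ?thesis unfolding loop_of_def by simp
qed

lemma integer_path_zero:
 fixes d :: "real => real"
 assumes "continuous_on {0..1} d" "!!t. t:{0..1} ==> d t:\<int>" "d 0 = 0" "t:{0..1}"
 shows "d t = 0"
proof (rule interval_locally_constant[OF _ _ assms(4)])
 fix t :: real assume t: "t:{0..1}"
 obtain e where e: "e > 0" "!!s. s:{0..1} ==> dist s t < e ==> dist (d s) (d t) < 1"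
  using bspec[OF assms(1)[unfolded continuous_on_iff] t, THEN spec, of 1] by auto
 have "d s = d t" if "s:{0..1}" "\<bar>s - t\<bar> < e" for s
 proof -
  have "\<bar>d s - d t\<bar> < 1" using e(2)[of s] that by (simp add: dist_real_def)
  moreover have "d s - d t:\<int>" using assms(2) that(1) t by (intro Ints_diff) auto
  ultimately have "d s - d t = 0" using Ints_nonzero_abs_less1 by blast
  thus ?thesis by simp
 qed
 thus "EX e>0. ALL s:{0..1}. \<bar>s - t\<bar> < e --> (d s = 0 <-> d t = 0)" using e(1) by metis
qed (rule assms(3))

lemma circle_path_lift:
 assumes u: "continuous_on {0..1::real} u" "!!t. t:{0..1} ==> cmod (u t) = 1" "u 0 = 1"
 shows "EX f. continuous_on {0..1} f & f 0 = 0 & (ALL t:{0..1}. u t = cis (2 * pi * f t))"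
proof -
 have nz: "u t ~= 0" if "t:{0..1}" for t using u(2)[OF that] by auto
 obtain g where g: "continuous_on {0..1} g" "!!t. t:{0..1} ==> u t = exp (g t)"
  using continuous_logarithm_on_contractible[OF u(1) convex_imp_contractible nz] by (metis convex_real_interval(5))
 define f where "f t = Im (g t - g 0) / (2 * pi)" for t
 have "u t = cis (2 * pi * f t)" if t: "t:{0..1}" for t
 proof -
  have "u t = exp (g t - g 0)" using g(2)[OF t] g(2)[of 0] u(3) by (simp add: exp_diff)
  moreover have "Re (g t - g 0) = 0" using u(2)[OF t] norm_exp_eq_Re[of "g t - g 0"] calculation by simp
  ultimately show ?thesis unfolding f_def by (simp add: exp_eq_polar)
 qed
 moreover have "continuous_on {0..1} f" unfolding f_def by (intro continuous_intros g(1)) auto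
 ultimately show ?thesis unfolding f_def by (intro exI[of _ f]) (auto simp: f_def)
qed

context pointed_abelian_closure
begin

lemma twist_act: "tu:carrier GG ==> act (twist kp f) tu = twist (act kp tu) (%x. f (tu x))"
 unfolding act_def twist_def by (rule restrict_ext) (use G_U in auto)

lemma twist_twist: "twist (twist kp f) g = twist kp (%x. f x + g x)"
 unfolding twist_def by (auto simp: restrict_def cis_mult[symmetric] distrib_left)

lemma twist_cong: "(!!x. x:U ==> f x = g x) ==> twist kp f = twist kp g"
 unfolding twist_def by (rule restrict_ext) simp

lemma twist_zero: "kp:Chars ==> twist kp (%x. 0) = kp"
proof (rule extensionalityI[OF _ X_D(1)])
 show "twist kp (%x. 0) x = kp x" if "x:U" for x unfolding twist_def using that by simp
qed (auto simp: twist_def)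

lemma twist_eqD:
 assumes "kp:Chars" "twist kp f = twist kp g" "x:U"
 shows "g x - f x:\<int>"
proof -
 have "kp x * cis (2 * pi * f x) = kp x * cis (2 * pi * g x)"
  using fun_cong[OF assms(2), of x] assms(3) unfolding twist_def by simp
 hence "cis (2 * pi * g x) / cis (2 * pi * f x) = 1" using X_D(5)[OF assms(1,3)] by simp
 thus ?thesis unfolding cis_divide using cis_2pi_eq_1_iff[of "g x - f x"] by (simp add: right_diff_distrib)
qed

lemma additive_diff: "additive f ==> additive g ==> additive (%x. f x - g x)"
 "additive f ==> additive g ==> additive (%x. f x + g x)" "additive f ==> additive (%x. c * f x)"
 unfolding add_hom_def by (auto simp: algebra_simps)

lemma additive_act: "additive f ==> tu:carrier GG ==> additive (%x. f (tu x))"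
 using additiveD[of f] G_U[of tu] G_mult_hom[of tu] unfolding add_hom_def by simp

lemma twist_unique:
 assumes "kp:Chars" "additive f" "additive g" "twist kp f = twist kp g" "x:U"
 shows "f x = g x"
proof -
 have "g x - f x = 0"
  by (rule additive_integer_zero[OF additive_diff(1)[OF assms(3,2)] _ assms(5)]) (rule twist_eqD[OF assms(1,4)])
 thus ?thesis by simp
qed

text \<open>Each coordinate of \<open>xi t / xi 0\<close> lifts to the reals starting at 0. The
  failure of additivity is a continuous integer-valued function of t that vanishes at 0, hence
  everywhere.\<close>

lemma path_winding:
 assumes xi: "pathin T xi"
 shows "EX f. (ALL x:U. continuous_on {0..1} (%t. f t x)) & (ALL t:{0..1}. additive (f t) & xi t = twist (xi 0) (f t))
  & (ALL x:U. f 0 x = 0)"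
proof -
 have C: "xi t:Chars" if "t:{0..1}" for t using pathin_T_D[OF xi that] .
 have C0: "xi 0:Chars" by (rule C) simp
 have cont: "continuous_on {0..1} (%t. xi t x)" if "x:U" for x using xi that unfolding pathin_T_iff by blast
 have "EX f. continuous_on {0..1} f & f 0 = 0 & (ALL t:{0..1}. xi t x / xi 0 x = cis (2 * pi * f t))" if x: "x:U" for x
 proof (rule circle_path_lift)
  show "continuous_on {0..1} (%t. xi t x / xi 0 x)" by (intro continuous_intros cont[OF x]) (use X_D(5)[OF C0 x] in auto)
  show "cmod (xi t x / xi 0 x) = 1" if "t:{0..1}" for t
  using X_D(2)[OF C[OF that] x] X_D(2)[OF C0 x] by (simp add: norm_divide)
  show "xi 0 x / xi 0 x = 1" using X_D(5)[OF C0 x] by simp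
 qed
 then obtain f where f: "!!x. x:U ==> continuous_on {0..1} (f x) & f x 0 = 0 & (ALL t:{0..1}. xi t x / xi 0 x = cis (2 * pi * f x t))"
  by metis
 have eq: "xi t x = xi 0 x * cis (2 * pi * f x t)" if "x:U" "t:{0..1}" for x t
 proof -
  have "xi t x / xi 0 x = cis (2 * pi * f x t)" using f[OF that(1)] that(2) by blast
  thus ?thesis using X_D(5)[OF C0 that(1)] by (simp add: field_simps)
 qed
 have "additive (%x. f x t)" if t: "t:{0..1}" for t
  unfolding add_hom_def
 proof (intro ballI)
  fix x y assume xy: "x:U" "y:U"
  have xyU: "x \<otimes> y:U" using xy by (simp add: integral_iff)
  have "f (x \<otimes> y) t - f x t - f y t = 0"
  proof (rule integer_path_zero[OF _ _ _ t])
  show "continuous_on {0..1} (%t. f (x \<otimes> y) t - f x t - f y t)"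
  using f[OF xy(1)] f[OF xy(2)] f[OF xyU] by (intro continuous_intros) auto
  show "f (x \<otimes> y) 0 - f x 0 - f y 0 = 0" using f[OF xy(1)] f[OF xy(2)] f[OF xyU] by simp
  fix s :: real assume s: "s:{0..1}"
  have "xi 0 x * xi 0 y * cis (2 * pi * f (x \<otimes> y) s) = (xi 0 x * cis (2 * pi * f x s)) * (xi 0 y * cis (2 * pi * f y s))"
  using X_D(3)[OF C[OF s] xy] unfolding eq[OF xyU s] eq[OF xy(1) s] eq[OF xy(2) s] X_D(3)[OF C0 xy] .
  also have "\<dots> = xi 0 x * xi 0 y * (cis (2 * pi * f x s) * cis (2 * pi * f y s))" by (simp only: mult_ac)
  finally have m: "xi 0 x * xi 0 y * cis (2 * pi * f (x \<otimes> y) s) = xi 0 x * xi 0 y * (cis (2 * pi * f x s) * cis (2 * pi * f y s))" .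
  have nz: "xi 0 x * xi 0 y ~= 0" using X_D(5)[OF C0 xy(1)] X_D(5)[OF C0 xy(2)] by simp
  have "cis (2 * pi * f (x \<otimes> y) s) = cis (2 * pi * f x s) * cis (2 * pi * f y s)"
  using m by (simp only: mult_left_cancel[OF nz])
  hence "cis (2 * pi * f (x \<otimes> y) s) = cis (2 * pi * f x s + 2 * pi * f y s)" unfolding cis_mult .
  hence "cis (2 * pi * f (x \<otimes> y) s) / cis (2 * pi * f x s + 2 * pi * f y s) = 1" by simp
  thus "f (x \<otimes> y) s - f x s - f y s:\<int>"
  unfolding cis_divide using cis_2pi_eq_1_iff[of "f (x \<otimes> y) s - f x s - f y s"] by (simp add: algebra_simps)
  qed
  thus "f (x *M y) t = f x t + f y t" by simp
 qed
 moreover have "xi t = twist (xi 0) (%x. f x t)" if t: "t:{0..1}" for t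
 proof (rule extensionalityI[OF X_D(1)[OF C[OF t]]])
  show "xi t x = twist (xi 0) (%x. f x t) x" if "x:U" for x unfolding twist_def using eq[OF that t] that by simp
 qed (auto simp: twist_def)
 moreover have "continuous_on {0..1} (%t. f x t)" "f x 0 = 0" if "x:U" for x using f[OF that] by auto
 ultimately show ?thesis by (intro exI[of _ "%t x. f x t"]) blast
qed

lemma twist_continuous:
 assumes "kp:Chars" "!!s. s:topspace S ==> additive (c s)" "!!x. x:U ==> continuous_map S euclideanreal (%s. c s x)"
 shows "continuous_map S T (%s. twist kp (c s))"
 unfolding T_continuous_iff
proof (intro conjI ballI)
 show "(%s. twist kp (c s)) ` topspace S <= Chars" using twist_X[OF assms(1)] assms(2) by blast
 fix x assume x: "x:U"
 have "continuous_map euclideanreal euclidean (%r. kp x * cis (2 * pi * r))"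
  by (simp, intro continuous_intros)
 from continuous_map_compose[OF assms(3)[OF x] this] show "continuous_map S euclidean (%s. twist kp (c s) x)"
  unfolding twist_def o_def using x by simp
qed

lemma twist_path:
 assumes "kp:Chars" "additive f"
 shows "pathin T (%t. twist kp (%x. t * f x))"
 unfolding pathin_def
 by (rule twist_continuous[OF assms(1) additive_diff(3)[OF assms(2)]]) (simp, intro continuous_intros)

abbreviation x0 where "x0 \<equiv> q ps"

definition Loops where "Loops = topspace (loop_space Y x0)"

lemma Loops_iff: "ga:Loops <-> ga:extensional (sphere 0 1) & continuous_map unit_circle Y ga & ga 1 = x0"
 unfolding Loops_def loop_space_def compact_open_topology_def topspace_subtopology topology_generated_by_topspace
 by (auto intro!: exI[of _ "{}"] exI[of _ "{f:extensional (sphere 0 1). continuous_map unit_circle Y f}"])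

lemma loop_path: "continuous_map unit_circle Y ga ==> pathin Y (%t. ga (cis (2 * pi * t)))"
 using continuous_map_compose[OF quotient_imp_continuous_map[OF quotient_map_cis], of Y ga] unfolding pathin_def o_def .

abbreviation is_lift where "is_lift \<equiv> is_lift_of_loop L F \<iota> ps"

lemma is_liftD:
 assumes "is_lift ga xi"
 shows "pathin T xi" "xi 0 = ps" "!!t. t:{0..1} ==> q (xi t) = ga (cis (2 * pi * t))" "!!t. t:{0..1} ==> xi t:Chars"
 using assms pathin_T_D unfolding is_lift_of_loop_def by auto

lemma loop_lift:
 assumes "ga:Loops"
 shows "EX xi tu. is_lift ga xi & tu:carrier GG & xi 1 = act ps tu"
proof -
 have ga: "continuous_map unit_circle Y ga" "ga 1 = x0" using assms unfolding Loops_iff by auto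
 obtain xi where xi: "pathin T xi" "xi 0 = ps" "ALL t:{0..1}. q (xi t) = ga (cis (2 * pi * t))"
  using lift_exists[OF loop_path[OF ga(1)] ps] ga(2) by auto
 hence "q ps = q (xi 1)" using ga(2) by simp
 then obtain tu where "tu:carrier GG" "xi 1 = act ps tu" using q_eq_iff[OF ps pathin_T_D[OF xi(1), of 1]] by auto
 thus ?thesis using xi unfolding is_lift_of_loop_def by blast
qed

text \<open>Since \<open>act ps tu\<close> is the Galois translate of \<open>ps\<close> by the
  inverse of \<open>tu\<close>, this is already the inverse that occurs in the definition of
  monodromy.\<close>

definition endpt :: "(complex => ('a => complex) set) => 'a => 'a" where
 "endpt ga = (THE tu. tu:carrier GG & (EX xi. is_lift ga xi & xi 1 = act ps tu))"

lemma lift_end_unique: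
 assumes "is_lift ga xi" "is_lift ga xi'" "tu:carrier GG" "tu':carrier GG" "xi 1 = act ps tu" "xi' 1 = act ps tu'"
 shows "tu = tu'"
proof -
 have "xi 1 = xi' 1" by (rule lift_unique[OF is_liftD(1)[OF assms(1)] is_liftD(1)[OF assms(2)]])
  (use is_liftD(2,3)[OF assms(1)] is_liftD(2,3)[OF assms(2)] in auto)
 thus ?thesis using free_action[OF ps assms(3,4)] assms(5,6) by simp
qed

lemma endpt_eq: "is_lift ga xi ==> tu:carrier GG ==> xi 1 = act ps tu ==> endpt ga = tu"
 unfolding endpt_def by (rule the_equality) (use lift_end_unique in blast)+

lemma endpt:
 assumes "ga:Loops"
 obtains xi where "is_lift ga xi" "xi 1 = act ps (endpt ga)" "endpt ga:carrier GG"
proof -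
 obtain xi tu where h: "is_lift ga xi" "tu:carrier GG" "xi 1 = act ps tu" using loop_lift[OF assms] by blast
 thus ?thesis using that[of xi] endpt_eq[OF h] by simp
qed

definition W :: "('a => 'a) set" where
 "W = {tu:carrier GG. EX f. additive f & act ps tu = twist ps f}"

definition wind :: "('a => 'a) => 'a => real" where
 "wind tu = (SOME f. additive f & act ps tu = twist ps f)"

lemma W_G: "tu:W ==> tu:carrier GG" unfolding W_def by blast

lemma W_I: "tu:carrier GG ==> additive f ==> act ps tu = twist ps f ==> tu:W" unfolding W_def by blast

lemma wind: "tu:W ==> additive (wind tu)" "tu:W ==> act ps tu = twist ps (wind tu)"
proof -
 assume "tu:W"
 hence "EX f. additive f & act ps tu = twist ps f" unfolding W_def by blast
 from someI_ex[OF this] show "additive (wind tu)" "act ps tu = twist ps (wind tu)" unfolding wind_def by auto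
qed

lemma wind_eq:
 assumes "tu:carrier GG" "additive f" "act ps tu = twist ps f" "x:U"
 shows "wind tu x = f x"
proof -
 have "tu:W" by (rule W_I[OF assms(1-3)])
 thus ?thesis using twist_unique[OF ps wind(1) assms(2) _ assms(4)] wind(2) assms(3) by metis
qed

lemma lift_winding:
 assumes "is_lift ga xi" "tu:carrier GG" "xi 1 = act ps tu"
 shows "EX f. (ALL x:U. continuous_on {0..1} (%t. f t x)) & (ALL t:{0..1}. additive (f t)) &
  (ALL t:{0..1}. xi t = twist ps (f t)) & (ALL x:U. f 0 x = 0) & tu:W & (ALL x:U. f 1 x = wind tu x)"
proof -
 obtain f where f: "ALL x:U. continuous_on {0..1} (%t. f t x)"
  "ALL t:{0..1}. additive (f t) & xi t = twist ps (f t)" "ALL x:U. f 0 x = 0"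
  using path_winding[OF is_liftD(1)[OF assms(1)]] unfolding is_liftD(2)[OF assms(1)] by blast
 have 1: "additive (f 1)" "act ps tu = twist ps (f 1)" using f(2) assms(3) by auto
 have "ALL x:U. f 1 x = wind tu x" using wind_eq[OF assms(2) 1] by simp
 thus ?thesis using f W_I[OF assms(2) 1] by blast
qed

lemma endpt_W: "ga:Loops ==> endpt ga:W"
 by (erule endpt) (use lift_winding in blast)

lemma loop_of_Loops:
 assumes "pathin Y p" "p 0 = x0" "p 1 = x0"
 shows "loop_of p:Loops"
 unfolding Loops_iff
proof (intro conjI)
 show "loop_of p:extensional (sphere 0 1)" unfolding loop_of_def by simp
 show "loop_of p 1 = x0" using loop_of_cis[of p 0] assms by simp
 have e: "loop_of p (cis (2 * pi * t)) = p t" if "t:{0..1}" for t using loop_of_cis[of p t] assms that by simp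
 show "continuous_map unit_circle Y (loop_of p)"
 proof (rule continuous_compose_quotient_map[OF quotient_map_cis])
  show "continuous_map (top_of_set {0..1}) Y (loop_of p \<circ> (%t. cis (2 * pi * t)))"
  by (rule continuous_map_eq[OF assms(1)[unfolded pathin_def]]) (simp add: e)
 qed
qed

lemma path_loop:
 assumes "pathin T xi" "xi 0 = ps" "tu:carrier GG" "xi 1 = act ps tu"
 shows "loop_of (%t. q (xi t)):Loops" "is_lift (loop_of (%t. q (xi t))) xi" "endpt (loop_of (%t. q (xi t))) = tu"
proof -
 have ends: "q (xi 0) = x0" "q (xi 1) = x0" using assms q_act[OF ps] by auto
 show "loop_of (%t. q (xi t)):Loops"
  by (rule loop_of_Loops) (use pathin_compose[OF assms(1) q_continuous] ends in \<open>auto simp: o_def\<close>)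
 show l: "is_lift (loop_of (%t. q (xi t))) xi"
  unfolding is_lift_of_loop_def using assms(1,2) loop_of_cis[of "%t. q (xi t)"] ends by auto
 show "endpt (loop_of (%t. q (xi t))) = tu" by (rule endpt_eq[OF l assms(3,4)])
qed

lemma endpt_surj:
 assumes "tu:W"
 shows "EX ga:Loops. endpt ga = tu"
proof -
 let ?xi = "%t. twist ps (%x. t * wind tu x)"
 have "?xi 0 = ps" using twist_zero[OF ps] by simp
 moreover have "?xi 1 = act ps tu" using wind(2)[OF assms] by simp
 ultimately show ?thesis using path_loop[OF twist_path[OF ps wind(1)[OF assms]] _ W_G[OF assms]] by blast
qed

text \<open>The additive logarithms of the two lifts are interpolated linearly. They agree at both
  ends, at 1 because the winding function is determined by \<open>tu\<close>, so every intermediate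
  path projects to a loop at the base point.\<close>

lemma same_endpt_homotopic:
 assumes "ga:Loops" "ga':Loops" "endpt ga = endpt ga'"
 shows "homotopic_with (%h. h 1 = x0) unit_circle Y ga ga'"
proof -
 define tu where "tu = endpt ga"
 obtain xi where xi: "is_lift ga xi" "xi 1 = act ps tu" "tu:carrier GG" unfolding tu_def using endpt[OF assms(1)] by blast
 obtain xi' where xi': "is_lift ga' xi'" "xi' 1 = act ps tu" unfolding tu_def assms(3) using endpt[OF assms(2)] by blast
 obtain f where f0: "ALL x:U. continuous_on {0..1} (%t. f t x)" "ALL t:{0..1}. additive (f t)"
  "ALL t:{0..1}. xi t = twist ps (f t)" "ALL x:U. f 0 x = 0" "tu:W" "ALL x:U. f 1 x = wind tu x"
  using lift_winding[OF xi(1,3,2)] by blast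
 have f: "!!x. x:U ==> continuous_on {0..1} (%t. f t x)" "!!t. t:{0..1} ==> additive (f t)"
  "!!t. t:{0..1} ==> xi t = twist ps (f t)" "!!x. x:U ==> f 0 x = 0" "tu:W" "!!x. x:U ==> f 1 x = wind tu x"
  using f0 by blast+
 obtain f' where f'0: "ALL x:U. continuous_on {0..1} (%t. f' t x)" "ALL t:{0..1}. additive (f' t)"
  "ALL t:{0..1}. xi' t = twist ps (f' t)" "ALL x:U. f' 0 x = 0" "tu:W" "ALL x:U. f' 1 x = wind tu x"
  using lift_winding[OF xi'(1) xi(3) xi'(2)] by blast
 have f': "!!x. x:U ==> continuous_on {0..1} (%t. f' t x)" "!!t. t:{0..1} ==> additive (f' t)"
  "!!t. t:{0..1} ==> xi' t = twist ps (f' t)" "!!x. x:U ==> f' 0 x = 0" "tu:W" "!!x. x:U ==> f' 1 x = wind tu x"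
  using f'0 by blast+
 define c where "c st x = (1 - fst st) * f (snd st) x + fst st * f' (snd st) x" for st :: "real \<times> real" and x
 define k where "k st = q (twist ps (c st))" for st
 have kc: "continuous_map (top_of_set ({0..1} \<times> {0..1})) Y k"
 proof -
  have "continuous_map (top_of_set ({0..1} \<times> {0..1})) T (%st. twist ps (c st))"
  proof (rule twist_continuous[OF ps])
  show "additive (c st)" if "st:topspace (top_of_set ({0..1} \<times> {0..1}))" for st
  unfolding c_def using additive_diff(2,3) f(2) f'(2) that by (auto simp: mem_Times_iff)
  fix x assume x: "x:U"
  have "continuous_on ({0..1} \<times> {0..1}) (%st::real \<times> real. f (snd st) x)"
  by (rule continuous_on_compose2[OF f(1)[OF x] continuous_on_snd[OF continuous_on_id]]) auto
  moreover have "continuous_on ({0..1} \<times> {0..1}) (%st::real \<times> real. f' (snd st) x)"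
  by (rule continuous_on_compose2[OF f'(1)[OF x] continuous_on_snd[OF continuous_on_id]]) auto
  ultimately show "continuous_map (top_of_set ({0..1} \<times> {0..1})) euclideanreal (%st. c st x)"
  unfolding c_def by (simp, intro continuous_intros)
  qed
  from continuous_map_compose[OF this q_continuous] show ?thesis unfolding k_def o_def .
 qed
 have kend: "k (s, 0) = x0" "k (s, 1) = x0" for s
 proof -
  have "twist ps (c (s, 0)) = twist ps (%x. 0)" by (rule twist_cong) (simp add: c_def f(4) f'(4))
  thus "k (s, 0) = x0" unfolding k_def using twist_zero[OF ps] by simp
  have "twist ps (c (s, 1)) = twist ps (f 1)" by (rule twist_cong) (simp add: c_def f(6) f'(6) algebra_simps)
  hence "twist ps (c (s, 1)) = act ps tu" using f(3)[of 1] xi(2) by simp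
  thus "k (s, 1) = x0" unfolding k_def using q_act[OF ps xi(3)] by simp
 qed
 define h where "h sw = loop_of (%t. k (fst sw, t)) (snd sw)" for sw :: "real \<times> complex"
 have hk: "h (s, cis (2 * pi * t)) = k (s, t)" if "t:{0..1}" for s t
  unfolding h_def using loop_of_cis[of "%t. k (s, t)" t] kend that by simp
 have "continuous_map (prod_topology (top_of_set {0..1}) unit_circle) Y h"
 proof (rule continuous_compose_quotient_map[OF quotient_map_cis_prod])
  show "continuous_map (top_of_set ({0..1} \<times> {0..1})) Y (h \<circ> (%(s, t). (s, cis (2 * pi * t))))"
  by (rule continuous_map_eq[OF kc]) (auto simp: hk)
 qed
 moreover have "h (0, w) = ga w & h (1, w) = ga' w" if w: "w:sphere 0 1" for w
 proof -
  obtain t where t: "t:{0..1}" "w = cis (2 * pi * t)" using w cis_path_image by blast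
  have "twist ps (c (0, t)) = xi t" "twist ps (c (1, t)) = xi' t"
  unfolding f(3)[OF t(1)] f'(3)[OF t(1)] by (auto intro!: twist_cong simp: c_def)
  thus ?thesis using hk[OF t(1)] is_liftD(3)[OF xi(1) t(1)] is_liftD(3)[OF xi'(1) t(1)] t(2) unfolding k_def by simp
 qed
 moreover have "h (s, 1) = x0" for s using hk[of 0 s] kend by simp
 ultimately show ?thesis by (subst homotopic_with) auto
qed

text \<open>The lift of the second piece must start at \<open>act ps bt\<close>: it is the lift of
  \<open>ga\<close> translated by \<open>bt\<close>. It ends at \<open>act (act ps al) bt\<close>,
  which for a right action is \<open>act ps (al *G bt)\<close>.\<close>

lemma loop_prod:
 assumes "ga:Loops" "dl:Loops"
 shows "loop_prod ga dl:Loops" "endpt (loop_prod ga dl) = endpt ga *G endpt dl"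
proof -
 define al bt where "al = endpt ga" and "bt = endpt dl"
 obtain xi where xi: "is_lift ga xi" "xi 1 = act ps al" "al:carrier GG" unfolding al_def using endpt[OF assms(1)] by blast
 obtain et where et: "is_lift dl et" "et 1 = act ps bt" "bt:carrier GG" unfolding bt_def using endpt[OF assms(2)] by blast
 define ze where "ze t = (if t <= 1/2 then et (2 * t) else act (xi (2 * t - 1)) bt)" for t :: real
 have zeC: "ze t:Chars" if "t:{0..1}" for t
  unfolding ze_def using is_liftD(4)[OF et(1), of "2 * t"] is_liftD(4)[OF xi(1), of "2 * t - 1"] act_X et(3) that by auto
 have "continuous_on {0..1} (%t. ze t x)" if x: "x:U" for x
 proof -
  have c: "continuous_on {0..1} (%t. et t x)" "continuous_on {0..1} (%t. act (xi t) bt x)"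
  using is_liftD(1)[OF et(1)] is_liftD(1)[OF xi(1)] x G_U[OF et(3) x] unfolding pathin_T_iff act_def by auto
  have "continuous_on ({0..1/2} Un {1/2..1}) (%t. if t <= 1/2 then et (2 * t) x else act (xi (2 * t - 1)) bt x)"
  proof (rule continuous_on_cases)
  show "continuous_on {0..1/2::real} (%t. et (2 * t) x)"
  by (rule continuous_on_compose2[OF c(1)]) (auto intro!: continuous_intros)
  show "continuous_on {1/2..1::real} (%t. act (xi (2 * t - 1)) bt x)"
  by (rule continuous_on_compose2[OF c(2)]) (auto intro!: continuous_intros)
  have "et 1 x = act (xi 0) bt x" using et(2) is_liftD(2)[OF xi(1)] by simp
  thus "ALL t. t:{0..1/2} & \<not> t <= 1/2 \<or> t:{1/2..1} & t <= 1/2 --> et (2 * t) x = act (xi (2 * t - 1)) bt x"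
  proof (intro allI impI)
  fix t :: real assume "t:{0..1/2} & \<not> t <= 1/2 \<or> t:{1/2..1} & t <= 1/2"
  hence t: "t = 1/2" by auto
  show "et (2 * t) x = act (xi (2 * t - 1)) bt x" unfolding t using \<open>et 1 x = act (xi 0) bt x\<close> by simp
  qed
  qed auto
  moreover have "{0..1/2} Un {1/2..1} = {0..1::real}" by auto
  ultimately show ?thesis unfolding ze_def by (simp add: if_distribR if_distrib[of "%g. g x"] cong: if_cong)
 qed
 hence zep: "pathin T ze" unfolding pathin_T_iff using zeC by blast
 have ze0: "ze 0 = ps" unfolding ze_def using is_liftD(2)[OF et(1)] by simp
 have ze1: "ze 1 = act ps (al *G bt)" unfolding ze_def using xi(2) act_act[OF xi(3) et(3)] by simp
 have G: "al *G bt:carrier GG" using xi(3) et(3) by simp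
 note pl = path_loop[OF zep ze0 G ze1]
 have "loop_prod ga dl = loop_of (%t. q (ze t))"
 proof (rule extensionalityI[of _ "sphere 0 1"])
  fix w :: complex assume w: "w:sphere 0 1"
  obtain t where t: "t:{0..1}" "w = cis (2 * pi * t)" using w cis_path_image by blast
  have w2: "w\<^sup>2 = cis (2 * pi * (2 * t))" unfolding t(2) by (simp add: Complex.DeMoivre mult_ac)
  have r: "loop_of (%t. q (ze t)) w = q (ze t)" using is_liftD(3)[OF pl(2) t(1)] t(2) by simp
  consider "t <= 1/2" | "1/2 < t" "t < 1" | "t = 1" using t(1) by fastforce
  thus "loop_prod ga dl w = loop_of (%t. q (ze t)) w"
  proof cases
  case 1
  have "Im w >= 0" unfolding t(2) using 1 t(1) by (simp add: sin_ge_zero)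
  hence "loop_prod ga dl w = dl (cis (2 * pi * (2 * t)))" unfolding loop_prod_def using w w2 by simp
  thus ?thesis unfolding r unfolding ze_def using 1 is_liftD(3)[OF et(1), of "2 * t"] t(1) by simp
  next
  case 2
  have "sin (2 * pi * t) < 0" using 2 by (intro sin_lt_zero) auto
  hence "\<not> Im w >= 0" unfolding t(2) by simp
  moreover have "cis (2 * pi * (2 * t)) = cis (2 * pi * (2 * t - 1))"
  by (simp add: right_diff_distrib cis_divide[symmetric])
  ultimately have "loop_prod ga dl w = ga (cis (2 * pi * (2 * t - 1)))" unfolding loop_prod_def using w w2 by simp
  thus ?thesis unfolding r unfolding ze_def
  using 2 is_liftD(3)[OF xi(1), of "2 * t - 1"] q_act[OF is_liftD(4)[OF xi(1), of "2 * t - 1"] et(3)] by simp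
  next
  case 3
  \<comment> \<open>At the end of the interval the point of the circle is 1, where
    \<open>loop_prod\<close> takes its first branch; the value is the base point all the
    same.\<close>
  hence "w = 1" using t(2) by simp
  thus ?thesis unfolding r using 3 ze1 q_act[OF ps G] assms(2) by (simp add: loop_prod_def Loops_iff)
  qed
 qed (auto simp: loop_prod_def loop_of_def)
 thus "loop_prod ga dl:Loops" "endpt (loop_prod ga dl) = endpt ga *G endpt dl"
  using pl(1,3) unfolding al_def bt_def by auto
qed

text \<open>By compactness of the interval, finitely many conditions of compact-open type keep a
  loop in images of small neighbourhoods of the lift. These images are open since \<open>q\<close>
  is.\<close>

lemma loop_control:
 assumes ga: "is_lift ga xi" and ep: "ep > 0"
 shows "EX \<C>. finite \<C> & (ALL (C, V):\<C>. compactin unit_circle C & openin Y V & ga ` C <= V) &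
  (ALL ga'. (ALL (C, V):\<C>. ga' ` C <= V) --> (ALL t:{0..1}. EX kp:Chars. near m ep kp (xi t) & q kp = ga' (cis (2 * pi * t))))"
proof -
 note p = is_liftD(1)[OF ga]
 have "EX d>0. ALL s:{0..1}. \<bar>s - t\<bar> < d --> near m (ep / 2) (xi s) (xi t)" if "t:{0..1}" for t
  by (rule pathin_near[OF p that]) (use ep in simp)
 then obtain d where d: "!!t. t:{0..1} ==> d t > 0 & (ALL s:{0..1}. \<bar>s - t\<bar> < d t --> near m (ep / 2) (xi s) (xi t))" by metis
 have "{0..1} <= (\<Union>t\<in>{0..1}. ball t (d t / 2))" using d by force
 then obtain D where D: "D <= {0..1}" "finite D" "{0..1} <= (\<Union>t\<in>D. ball t (d t / 2))"
  using compactE_image[of "{0..1::real}" "{0..1}" "%t. ball t (d t / 2)"] by auto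
 \<comment> \<open>Closed balls make the arcs compact, and half the radius leaves each arc inside
   the region where \<open>xi\<close> is near \<open>xi t\<close>.\<close>
 define I where "I t = cball t (d t / 2) Int {0..1}" for t
 define V where "V t = q ` {kp:Chars. near m (ep / 2) kp (xi t)}" for t
 define \<C> where "\<C> = (%t. ((%s. cis (2 * pi * s)) ` I t, V t)) ` D"
 have nI: "near m (ep / 2) (xi s) (xi t)" if "t:D" "s:I t" for s t
 proof -
  have "\<bar>s - t\<bar> <= d t / 2" "s:{0..1}" using that(2) unfolding I_def by (auto simp: dist_real_def abs_minus_commute)
  thus ?thesis using d[of t] D(1) that(1) by force
 qed
 have "compactin unit_circle ((%s. cis (2 * pi * s)) ` I t)" for t
  unfolding compactin_subtopology compactin_euclidean_iff
  using compact_continuous_image[OF cis_path_continuous, of "I t"] by (auto simp: I_def compact_Int_closed)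
 moreover have "openin Y (V t)" for t unfolding V_def by (rule q_open[OF T_open_near])
 moreover have "ga ` (%s. cis (2 * pi * s)) ` I t <= V t" if t: "t:D" for t
 proof clarify
  fix s assume s: "s:I t"
  hence s01: "s:{0..1}" unfolding I_def by blast
  show "ga (cis (2 * pi * s)):V t"
  unfolding V_def is_liftD(3)[OF ga s01, symmetric] using nI[OF t s] is_liftD(4)[OF ga s01] by blast
 qed
 moreover have "EX kp:Chars. near m ep kp (xi s) & q kp = ga' (cis (2 * pi * s))"
  if g: "ALL (C, V):\<C>. ga' ` C <= V" and s: "s:{0..1}" for ga' s
 proof -
  obtain t where t: "t:D" "s:ball t (d t / 2)" using D(3) s by blast
  hence sI: "s:I t" unfolding I_def using s by auto
  have "ga' (cis (2 * pi * s)):V t" using g t(1) sI unfolding \<C>_def by auto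
  then obtain kp where kp: "kp:Chars" "near m (ep / 2) kp (xi t)" "q kp = ga' (cis (2 * pi * s))" unfolding V_def by auto
  have "near m ep kp (xi s)" by (rule near_trans[OF kp(2) near_sym[OF nI[OF t(1) sI]]]) simp
  thus ?thesis using kp by blast
 qed
 ultimately show ?thesis using D(2) unfolding \<C>_def by (intro exI[of _ \<C>]) (auto simp: \<C>_def)
qed

definition same_at :: "nat => ('a => 'a) => ('a => 'a) => bool" where
 "same_at n tu tu' <-> (ALL x:R n. tu x = tu' x & wind tu x = wind tu' x)"

text \<open>By \<open>rigidity\<close> the lifts stay close up to \<open>G_n n\<close>, which is
  invisible on \<open>R n\<close>. So the endpoints agree there, the difference of winding numbers
  is an integer, and closeness along the whole path forces this integer to be 0.\<close>

lemma close_endpt: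
 assumes s: "separates n m ep" and ga: "is_lift ga xi" "tu:carrier GG" "xi 1 = act ps tu"
  and ga': "is_lift ga' xi'" "tu':carrier GG" "xi' 1 = act ps tu'"
  and close: "!!t. t:{0..1} ==> EX kp:Chars. near m (ep / 2) kp (xi t) & q kp = ga' (cis (2 * pi * t))"
 shows "same_at n tu tu'"
proof -
 have ep: "ep > 0" "ep <= 1" "n <= m" using s unfolding separates_def by auto
 have g: "EX g:G_n n. near m (ep / 2) (act (xi' t) g) (xi t)" if t: "t:{0..1}" for t
 proof (rule rigidity[OF s pathin_npath[OF is_liftD(1)[OF ga(1)]] pathin_npath[OF is_liftD(1)[OF ga'(1)]] _ _ t])
  show "EX g:carrier GG. near m (ep / 2) (act (xi' t) g) (xi t)" if t: "t:{0..1}" for t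
  proof -
  obtain kp where kp: "kp:Chars" "near m (ep / 2) kp (xi t)" "q kp = ga' (cis (2 * pi * t))" using close[OF t] by blast
  thus ?thesis using q_eq_iff[OF is_liftD(4)[OF ga'(1) t] kp(1)] is_liftD(3)[OF ga'(1) t] by auto
  qed
  have "act (xi' 0) \<one>\<^bsub>GG\<^esub> = xi 0" using act_one[OF ps] is_liftD(2)[OF ga(1)] is_liftD(2)[OF ga'(1)] by simp
  thus "EX g:G_n n. near m (ep / 2) (act (xi' 0) g) (xi 0)"
  using near_refl[of "ep / 2" m] ep(1) subgroup.one_closed[OF G_n_subgroup] by (metis half_gt_zero)
 qed
 have eq: "tu x = tu' x" if x: "x:R n" for x
 proof -
  obtain h where h: "h:G_n n" "near m (ep / 2) (act (xi' 1) h) (xi 1)" using g[of 1] by auto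
  note hC = G_nD(2)[OF h(1)]
  have "ginv tu *G (tu' *G h):G_n n"
  by (rule same_coset[OF s ps ga(2), where rh = "xi 1"])
  (use h(2) ga ga' hC near_refl[of "ep / 2" m] ep(1) in \<open>auto simp: act_act\<close>)
  hence "tu x = (tu' *G h) x" using G_n_iff[OF ga(2) G.m_closed[OF ga'(2) hC]] x by blast
  thus ?thesis using G_mult[OF ga'(2) hC R_carrier(1)[OF x]] G_nD(3)[OF h(1) x] by simp
 qed
 obtain f where f0: "ALL x:U. continuous_on {0..1} (%t. f t x)" "ALL t:{0..1}. additive (f t)"
  "ALL t:{0..1}. xi t = twist ps (f t)" "ALL x:U. f 0 x = 0" "tu:W" "ALL x:U. f 1 x = wind tu x"
  using lift_winding[OF ga] by blast
 have f: "!!x. x:U ==> continuous_on {0..1} (%t. f t x)" "!!t. t:{0..1} ==> additive (f t)"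
  "!!t. t:{0..1} ==> xi t = twist ps (f t)" "!!x. x:U ==> f 0 x = 0" "tu:W" "!!x. x:U ==> f 1 x = wind tu x"
  using f0 by blast+
 obtain f' where f'0: "ALL x:U. continuous_on {0..1} (%t. f' t x)" "ALL t:{0..1}. additive (f' t)"
  "ALL t:{0..1}. xi' t = twist ps (f' t)" "ALL x:U. f' 0 x = 0" "tu':W" "ALL x:U. f' 1 x = wind tu' x"
  using lift_winding[OF ga'] by blast
 have f': "!!x. x:U ==> continuous_on {0..1} (%t. f' t x)" "!!t. t:{0..1} ==> additive (f' t)"
  "!!t. t:{0..1} ==> xi' t = twist ps (f' t)" "!!x. x:U ==> f' 0 x = 0" "tu':W" "!!x. x:U ==> f' 1 x = wind tu' x"
  using f'0 by blast+
 have "wind tu x = wind tu' x" if x: "x:R n" for x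
 proof -
  have xU: "x:U" and xm: "x:R m" using R_U[OF x] R_mono[OF ep(3)] x by auto
  define d where "d t = f' t x - f t x" for t
  have dc: "continuous_on {0..1} d" unfolding d_def by (intro continuous_intros f(1) f'(1) xU)
  have cosd: "cos (2 * pi * d t) > 0" if t: "t:{0..1}" for t
  proof -
  obtain h where h: "h:G_n n" "near m (ep / 2) (act (xi' t) h) (xi t)" using g[OF t] by blast
  have "cmod (xi' t x - xi t x) < ep / 2" using h(2) xm act_G_n[OF h(1) x] unfolding near_def by fastforce
  hence l: "cmod (xi' t x - xi t x) < 1" using ep(2) by linarith
  have "xi' t x - xi t x = ps x * cis (2 * pi * f t x) * (cis (2 * pi * d t) - 1)"
  proof -
  have "cis (2 * pi * f' t x) = cis (2 * pi * f t x) * cis (2 * pi * d t)"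
  unfolding d_def cis_mult by (simp add: algebra_simps)
  thus ?thesis unfolding f(3)[OF t] f'(3)[OF t] twist_def using xU by (simp add: algebra_simps)
  qed
  hence "cmod (cis (2 * pi * d t) - 1) < 1" using l X_D(2)[OF ps xU] by (simp add: norm_mult)
  hence "\<bar>Re (cis (2 * pi * d t) - 1)\<bar> < 1" using abs_Re_le_cmod[of "cis (2 * pi * d t) - 1"] by linarith
  thus ?thesis by simp
  qed
  \<comment> \<open>The difference \<open>d\<close> starts at 0 and would pass through 1/4 or -1/4
    on its way to a larger absolute value, but there the cosine vanishes.\<close>
  have "\<bar>d 1\<bar> < 1 / 4"
  proof (rule ccontr)
  assume "\<not> \<bar>d 1\<bar> < 1 / 4"
  moreover have "\<bar>d 0\<bar> <= 1 / 4" unfolding d_def using f(4)[OF xU] f'(4)[OF xU] by simp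
  moreover have "continuous_on {0..1} (%t. \<bar>d t\<bar>)" by (intro continuous_intros dc)
  ultimately obtain t where t: "0 <= t" "t <= 1" "\<bar>d t\<bar> = 1 / 4"
  using IVT'[of "%t. \<bar>d t\<bar>" 0 "1 / 4" 1] by auto
  hence "d t = 1 / 4 \<or> d t = - (1 / 4)" by (auto simp: abs_if split: if_splits)
  hence "cos (2 * pi * d t) = cos (pi / 2)"
  proof
  assume h: "d t = 1 / 4"
  show ?thesis unfolding h by simp
  next
  assume h: "d t = - (1 / 4)"
  show ?thesis unfolding h by simp
  qed
  thus False using cosd[of t] t by simp
  qed
  moreover have "d 1:\<int>"
  proof -
  have "xi 1 x = xi' 1 x" unfolding ga(3) ga'(3) act_def using eq[OF x] xU by simp
  hence "ps x * cis (2 * pi * f 1 x) = ps x * cis (2 * pi * f' 1 x)"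
  using f(3)[of 1] f'(3)[of 1] xU unfolding twist_def by simp
  hence "cis (2 * pi * f' 1 x) / cis (2 * pi * f 1 x) = 1" using X_D(5)[OF ps xU] by simp
  thus ?thesis unfolding cis_divide d_def using cis_2pi_eq_1_iff[of "f' 1 x - f 1 x"] by (simp add: right_diff_distrib)
  qed
  ultimately have "d 1 = 0" using Ints_nonzero_abs_less1[of "d 1"] by auto
  thus ?thesis unfolding d_def using f(6)[OF xU] f'(6)[OF xU] by simp
 qed
 thus ?thesis unfolding same_at_def using eq by blast
qed

text \<open>For each n the endpoint, as seen on \<open>R n\<close>, is locally constant in the
  homotopy parameter: nearby stages meet the finitely many conditions of
  \<open>loop_control\<close>, and \<open>close_endpt\<close> applies.\<close>

lemma homotopic_same_endpt:
 assumes L: "ga:Loops" "ga':Loops" and h: "homotopic_with (%h. h 1 = x0) unit_circle Y ga ga'"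
 shows "endpt ga = endpt ga'"
proof -
 obtain h :: "real \<times> complex => _" where h: "continuous_map (prod_topology (top_of_set {0..1}) unit_circle) Y h" "!!w. h (0, w) = ga w"
  "!!w. h (1, w) = ga' w" "!!s. s:{0..1} ==> h (s, 1) = x0"
  using h unfolding homotopic_with_def by auto
 define Gm' where "Gm' s = (\<lambda>w\<in>sphere 0 1. h (s, w))" for s :: real
 have GmL: "Gm' s:Loops" if s: "s:{0..1}" for s
 proof -
  have "continuous_map unit_circle (prod_topology (top_of_set {0..1}) unit_circle) (%w. (s, w))"
  proof -
  have "continuous_on (sphere 0 1) (%w::complex. (s, w))" by (intro continuous_intros)
  thus ?thesis unfolding prod_topology_subtopology_eu using s by (auto simp: continuous_map_in_subtopology)
  qed
  from continuous_map_compose[OF this h(1)] have "continuous_map unit_circle Y (%w. h (s, w))" unfolding o_def .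
  hence "continuous_map unit_circle Y (Gm' s)" unfolding Gm'_def by (rule continuous_map_eq) simp
  thus ?thesis unfolding Loops_iff using h(4)[OF s] by (simp add: Gm'_def)
 qed
 have "endpt (Gm' 0) x = endpt (Gm' 1) x" if x: "x:R n" for x n
 proof -
  obtain m ep where s: "separates n m ep" using exists_separates by blast
  hence ep: "ep / 2 > 0" unfolding separates_def by simp
  have "endpt (Gm' 1) x = endpt (Gm' 0) x"
  proof (rule interval_locally_constant[where P = "%s. endpt (Gm' s) x = endpt (Gm' 0) x"])
  fix u :: real assume u: "u:{0..1}"
  obtain xi where xi: "is_lift (Gm' u) xi" "xi 1 = act ps (endpt (Gm' u))" "endpt (Gm' u):carrier GG"
  using endpt[OF GmL[OF u]] by blast
  from loop_control[OF xi(1) ep, of m]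
  obtain \<C> where \<C>0: "finite \<C> & (ALL (C, V):\<C>. compactin unit_circle C & openin Y V & Gm' u ` C <= V) &
  (ALL ga'. (ALL (C, V):\<C>. ga' ` C <= V) --> (ALL t:{0..1}. EX kp:Chars. near m (ep / 2) kp (xi t) & q kp = ga' (cis (2 * pi * t))))"
  by (rule exE)
  note \<C>1 = conjunct1[OF \<C>0] and \<C>3 = mp[OF spec[OF conjunct2[OF conjunct2[OF \<C>0]]]]
  have \<C>2: "compactin unit_circle C & openin Y V & Gm' u ` C <= V" if "(C, V):\<C>" for C V
  using bspec[OF conjunct1[OF conjunct2[OF \<C>0]] that] by simp
  \<comment> \<open>The tube lemma turns openness of the preimage of \<open>V\<close> around the
    slice over u into one interval of parameters that serves the whole compact set.\<close>
  have "EX d>0. ALL v:{0..1}. \<bar>v - u\<bar> < d --> Gm' v ` fst CV <= snd CV" if CV: "CV:\<C>" for CV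
  proof -
  obtain C V where cv: "CV = (C, V)" by (cases CV)
  note c = \<C>2[OF CV[unfolded cv]]
  let ?P = "prod_topology (top_of_set {0..1::real}) unit_circle"
  have Cs: "C <= sphere 0 1" using compactin_subset_topspace[of unit_circle C] c by auto
  have o: "openin ?P {p:topspace ?P. h p:V}" using openin_continuous_map_preimage[OF h(1)] c by blast
  have "{u} \<times> C <= {p:topspace ?P. h p:V}" using c Cs u by (auto simp: Gm'_def image_subset_iff subset_iff)
  then obtain A B where AB: "openin (top_of_set {0..1}) A" "u:A" "C <= B" "A \<times> B <= {p:topspace ?P. h p:V}"
  using tube_lemma_right[OF o, of C u] c u by auto
  obtain d where d: "d > 0" "ball u d Int {0..1} <= A" using AB(1,2) unfolding openin_contains_ball by blast
  have cc: "Gm' v ` C <= V" if "v:{0..1}" "\<bar>v - u\<bar> < d" for v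
  proof -
  have "v:A" using d(2) that by (auto simp: dist_real_def abs_minus_commute)
  thus ?thesis using AB(3,4) Cs by (auto simp: Gm'_def subset_iff)
  qed
  show ?thesis unfolding cv fst_conv snd_conv using d(1) cc by blast
  qed
  then obtain d where d: "!!CV. CV:\<C> ==> d CV > 0 & (ALL v:{0..1}. \<bar>v - u\<bar> < d CV --> Gm' v ` fst CV <= snd CV)" by metis
  obtain e where e: "e > 0" "!!CV. CV:\<C> ==> e <= d CV" using finite_positive_bound[OF \<C>1, of d] d by blast
  have "endpt (Gm' v) x = endpt (Gm' u) x" if v: "v:{0..1}" "\<bar>v - u\<bar> < e" for v
  proof -
  have "ALL (C, V):\<C>. Gm' v ` C <= V"
  proof clarify
  fix C V w assume CV: "(C, V):\<C>" "w:C"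
  have "Gm' v ` C <= V" using d[OF CV(1)] e(2)[OF CV(1)] v by auto
  thus "Gm' v w:V" using CV(2) by blast
  qed
  note cl = \<C>3[OF this]
  obtain xi' where xi': "is_lift (Gm' v) xi'" "xi' 1 = act ps (endpt (Gm' v))" "endpt (Gm' v):carrier GG"
  using endpt[OF GmL[OF v(1)]] by blast
  have "same_at n (endpt (Gm' u)) (endpt (Gm' v))"
  by (rule close_endpt[OF s xi(1,3,2) xi'(1,3,2)]) (use cl in blast)
  thus ?thesis unfolding same_at_def using x by auto
  qed
  thus "EX d>0. ALL v:{0..1}. \<bar>v - u\<bar> < d --> (endpt (Gm' v) x = endpt (Gm' 0) x) = (endpt (Gm' u) x = endpt (Gm' 0) x)"
  using e(1) by metis
  qed auto
  thus ?thesis by simp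
 qed
 moreover have "Gm' 0 = ga" "Gm' 1 = ga'"
  by (rule extensionalityI[of _ "sphere 0 1"], use h(2,3) L in \<open>auto simp: Gm'_def Loops_iff\<close>)+
 ultimately have R: "endpt ga x = endpt ga' x" if "x:R n" for x n using that by metis
 have G: "endpt ga:carrier GG" "endpt ga':carrier GG" using endpt_W W_G L by auto
 have "endpt ga x = endpt ga' x" if "x:carrier L" for x
 proof (cases "x = \<zero>")
  case True
  thus ?thesis using Aut_simps(2)[OF G_Aut[OF G(1)]] Aut_simps(2)[OF G_Aut[OF G(2)]] by simp
 qed (use R R_exhaust[OF that] in blast)
 thus ?thesis by (rule G_eqI[OF G])
qed

lemma loop_class_eq: "ga:Loops ==> loop_class Y x0 ga = {dl:Loops. endpt dl = endpt ga}"
 unfolding loop_class_def Loops_def[symmetric]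
proof (rule Collect_cong, rule conj_cong[OF refl])
 fix dl assume "ga:Loops" "dl:Loops"
 thus "homotopic_with (%h. h 1 = x0) unit_circle Y ga dl <-> endpt dl = endpt ga"
  using same_endpt_homotopic[of ga dl] homotopic_same_endpt[of ga dl] by argo
qed

end

section \<open>The loop topology\<close>

lemma (in group) congruence_normal:
 assumes refl: "!!x. x:carrier G ==> S x x"
  and sym: "!!x y. x:carrier G ==> y:carrier G ==> S x y ==> S y x"
  and mult: "!!x y x' y'. x:carrier G ==> y:carrier G ==> x':carrier G ==> y':carrier G ==>
  S x x' ==> S y y' ==> S (x \<otimes> y) (x' \<otimes> y')"
 defines "N \<equiv> {x:carrier G. S x \<one>}"
 shows "normal N G" "x:carrier G ==> y:carrier G ==> N #> x = N #> y <-> S x y"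
proof -
 have tr: "S (a \<otimes> c) (b \<otimes> c)" "S (c \<otimes> a) (c \<otimes> b)"
  if "a:carrier G" "b:carrier G" "c:carrier G" "S a b" for a b c
  using mult[of a c b c] mult[of c a c b] refl[of c] that by auto
 show n: "normal N G"
  unfolding normal_inv_iff
 proof (intro conjI ballI)
  show "subgroup N G"
  proof (rule subgroupI)
  show "N <= carrier G" "N ~= {}" unfolding N_def using refl[of \<one>] by auto
  show "inv a:N" if "a:N" for a
  using that tr(1)[of a \<one> "inv a"] sym[of "\<one>" "inv a"] unfolding N_def by simp
  show "a \<otimes> b:N" if "a:N" "b:N" for a b
  using that mult[of a b \<one> \<one>] unfolding N_def by simp
  qed
  fix a h assume "a:carrier G" "h:N"
  thus "a \<otimes> h \<otimes> inv a:N"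
  using tr(2)[of h \<one> a] tr(1)[of "a \<otimes> h" "a" "inv a"] unfolding N_def by simp
 qed
 assume xy: "x:carrier G" "y:carrier G"
 have s: "subgroup N G" using n by (simp add: normal_inv_iff)
 have "N #> x = N #> y <-> x:N #> y"
  using repr_independence[OF _ xy(2) s] rcos_self[OF xy(1) s] by blast
 also have "\<dots> <-> x \<otimes> inv y:N" by (rule subgroup.rcos_module[OF s is_group xy(2,1)])
 also have "\<dots> <-> S x y"
  using tr(1)[of "x \<otimes> inv y" \<one> y] tr(1)[of x y "inv y"] xy unfolding N_def by (auto simp: m_assoc)
 finally show "N #> x = N #> y <-> S x y" .
qed

text \<open>Isolates the formal part of the conclusion: a decreasing sequence of congruences whose
  classes are basic neighbourhoods, complete and separated, with infinitely many classes at every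
  level. Completeness for filters and the description as an inverse limit follow without reference
  to loops.\<close>

locale congruence_topology = group C for C :: "'g monoid" (structure) +
 fixes S :: "nat => 'g => 'g => bool" and T :: "'g topology"
 assumes refl: "x:carrier C ==> S n x x"
  and sym: "S n x y ==> S n y x"
  and trans: "S n x y ==> S n y w ==> S n x w"
  and mult: "x:carrier C ==> y:carrier C ==> x':carrier C ==> y':carrier C ==>
  S n x x' ==> S n y y' ==> S n (x \<otimes> y) (x' \<otimes> y')"
  and mono: "m <= n ==> S n x y ==> S m x y"
  and openin_iff: "openin T V <-> V <= carrier C & (ALL c:V. EX n. ALL x:carrier C. S n c x --> x:V)"
  and complete: "(!!n::nat. c n:carrier C) ==> (!!n. S n (c n) (c (Suc n))) ==> EX x:carrier C. ALL n. S n (c n) x"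
  and separated: "x:carrier C ==> y:carrier C ==> (!!n. S n x y) ==> x = y"
  and infinite: "EX c::nat => 'g. (ALL i. c i:carrier C) & (ALL i j. S n (c i) (c j) --> i = j)"
begin

definition N where "N n = {x:carrier C. S n x \<one>}"

lemma N_normal: "normal (N n) C"
 unfolding N_def by (rule congruence_normal[where S = "S n"]) (use refl sym mult in blast)+

lemma N_coset: "x:carrier C ==> y:carrier C ==> N n #> x = N n #> y <-> S n x y"
 unfolding N_def by (rule congruence_normal(2)[where S = "S n"]) (use refl sym mult in blast)+

lemma open_class: "c:carrier C ==> openin T {x:carrier C. S n c x}"
 unfolding openin_iff using trans by blast

lemma topspace_T: "topspace T = carrier C"
proof
 show "topspace T <= carrier C" using openin_topspace[of T] unfolding openin_iff by blast
 have "openin T (carrier C)" unfolding openin_iff by blast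
 thus "carrier C <= topspace T" by (rule openin_subset)
qed

lemma inv_cong:
 assumes "x:carrier C" "y:carrier C" "S n x y"
 shows "S n (inv x) (inv y)"
proof -
 have "S n (inv x \<otimes> x) (inv x \<otimes> y)" using assms by (intro mult refl) auto
 hence "S n (inv x \<otimes> x \<otimes> inv y) (inv x \<otimes> y \<otimes> inv y)" using assms by (intro mult refl) auto
 thus ?thesis using assms sym by (simp add: m_assoc)
qed

lemma inv_mult_cong: "x:carrier C ==> y:carrier C ==> S n (inv x \<otimes> y) \<one> <-> S n x y"
proof
 assume xy: "x:carrier C" "y:carrier C"
 show "S n x y" if "S n (inv x \<otimes> y) \<one>"
 proof -
  have "S n (x \<otimes> (inv x \<otimes> y)) (x \<otimes> \<one>)" using xy that by (intro mult refl) auto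
  thus ?thesis using xy sym by (simp flip: m_assoc)
 qed
 show "S n (inv x \<otimes> y) \<one>" if "S n x y"
 proof -
  have "S n (inv x \<otimes> y) (inv x \<otimes> x)" using xy sym[OF that] by (intro mult refl) auto
  thus ?thesis using xy by simp
 qed
qed

lemma topological: "topological_group C T"
 unfolding topological_group_def
proof (intro conjI)
 show "group C" by (rule is_group)
 show "topspace T = carrier C" by (rule topspace_T)
 show "continuous_map T T (%x. inv x)"
  unfolding continuous_map_def topspace_T
 proof (intro conjI allI impI)
  fix V assume V: "openin T V"
  show "openin T {x:carrier C. inv x:V}"
  unfolding openin_iff
  proof (intro conjI ballI)
  fix c assume "c:{x:carrier C. inv x:V}"
  hence c: "c:carrier C" "inv c:V" by auto
  obtain n where "!!x. x:carrier C ==> S n (inv c) x ==> x:V" using V c(2) unfolding openin_iff by blast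
  thus "EX n. ALL x:carrier C. S n c x --> x:{x:carrier C. inv x:V}" using inv_cong[OF c(1)] by blast
  qed blast
 qed auto
 show "continuous_map (prod_topology T T) T (%(x, y). x \<otimes> y)"
  unfolding continuous_map_def topspace_prod_topology topspace_T
 proof (intro conjI allI impI)
  fix V assume V: "openin T V"
  show "openin (prod_topology T T) {p:carrier C \<times> carrier C. (case p of (x, y) => x \<otimes> y):V}"
  unfolding openin_prod_topology_alt
  proof (intro allI impI)
  fix a b assume "(a, b):{p:carrier C \<times> carrier C. (case p of (x, y) => x \<otimes> y):V}"
  hence ab: "a:carrier C" "b:carrier C" "a \<otimes> b:V" by auto
  obtain n where n: "!!x. x:carrier C ==> S n (a \<otimes> b) x ==> x:V" using V ab(3) unfolding openin_iff by blast
  have "x \<otimes> y:V" if "x:carrier C" "y:carrier C" "S n a x" "S n b y" for x y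
  using n[of "x \<otimes> y"] mult[OF ab(1,2) that(1,2,3,4)] that by simp
  thus "EX A B. openin T A & openin T B & a:A & b:B &
  A \<times> B <= {p:carrier C \<times> carrier C. (case p of (x, y) => x \<otimes> y):V}"
  using open_class[OF ab(1), of n] open_class[OF ab(2), of n] refl ab
  by (intro exI[of _ "{x:carrier C. S n a x}"] exI[of _ "{x:carrier C. S n b x}"]) auto
  qed
 qed auto
qed

text \<open>There is a countable base at the unit, so a Cauchy filter reduces to a sequence: members
  of the filter that are small to order n are chosen for all n, and points in their finite
  intersections converge to a limit of the filter.\<close>

lemma complete_group: "complete_topological_group C T"
 unfolding complete_topological_group_def
proof (intro conjI allI impI)
 fix \<F> :: "'g filter"
 assume F: "\<F> ~= bot & (\<forall>\<^sub>F x in \<F>. x:carrier C) & two_sided_cauchy_filter C T \<F>"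
 have "EX Q. eventually Q \<F> & (ALL x y. Q x --> Q y --> S n x y) & (ALL x. Q x --> x:carrier C)" for n
 proof -
  have "openin T {x:carrier C. S n \<one> x}" "\<one>:{x:carrier C. S n \<one> x}" using open_class refl by auto
  hence "\<forall>\<^sub>F (x, y) in \<F> \<times>\<^sub>F \<F>. inv x \<otimes> y:{x:carrier C. S n \<one> x} & x \<otimes> inv y:{x:carrier C. S n \<one> x}"
  using F unfolding two_sided_cauchy_filter_def by blast
  then obtain Q where Q: "eventually Q \<F>" "!!x y. Q x ==> Q y ==> S n \<one> (inv x \<otimes> y)"
  unfolding eventually_prod_same by auto
  have "eventually (%x. Q x & x:carrier C) \<F>" using Q(1) F by (simp add: eventually_conj)
  moreover have "S n x y" if "Q x & x:carrier C" "Q y & y:carrier C" for x y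
  using Q(2)[of x y] that sym inv_mult_cong[of x y n] by blast
  ultimately show ?thesis by (intro exI[of _ "%x. Q x & x:carrier C"]) blast
 qed
 then obtain Q where Q: "!!n. eventually (Q n) \<F>" "!!n x y. Q n x ==> Q n y ==> S n x y" "!!n x. Q n x ==> x:carrier C" by metis
 \<comment> \<open>The point of index n lies in the first n + 1 sets at once, so consecutive points
   share a set of every order up to n.\<close>
 have "EX c. ALL k<=n. Q k c" for n
 proof -
  have "eventually (%c. ALL k:{..n}. Q k c) \<F>" by (rule eventually_ball_finite) (use Q(1) in auto)
  from eventually_happens'[OF conjunct1[OF F] this] show ?thesis by auto
 qed
 then obtain c where c: "!!n k. k <= n ==> Q k (c n)" by metis
 have cC: "c n:carrier C" for n using Q(3)[OF c[of n n]] by simp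
 have "EX x:carrier C. ALL n. S n (c n) x"
 proof (rule complete[OF cC])
  show "S n (c n) (c (Suc n))" for n by (rule Q(2)[OF c c]) simp_all
 qed
 then obtain x where x: "x:carrier C" "!!n. S n (c n) x" by (elim bexE) simp
 have "limitin T (%y. y) x \<F>"
  unfolding limitin_def topspace_T
 proof (intro conjI allI impI)
  show "x:carrier C" by (rule x(1))
  fix V assume V: "openin T V & x:V"
  then obtain n where n: "!!y. y:carrier C ==> S n x y ==> y:V" unfolding openin_iff by blast
  show "eventually (%y. y:V) \<F>"
  proof (rule eventually_mono[OF Q(1)[of n]])
  fix y assume y: "Q n y"
  have "S n x y" by (rule trans[OF sym[OF x(2)] Q(2)[OF c y]]) simp
  thus "y:V" using n Q(3)[OF y] by blast
  qed
 qed
 thus "EX x. limitin T (%y. y) x \<F>" by blast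
qed (rule topological)

text \<open>Multiplication by the larger subgroup turns a coset of \<open>N n\<close> into the coset
  of \<open>N m\<close> that contains it, without a choice of representative.\<close>

definition trans_map :: "'g set => 'g set => 'g set => 'g set" where "trans_map A A' B = A <#> B"

lemma N_antimono: "m <= n ==> N n <= N m" unfolding N_def using mono by blast

lemma N_subset: "N n <= carrier C" unfolding N_def by blast

lemma trans_map_coset: "N n <= N m ==> x:carrier C ==> trans_map (N m) (N n) (N n #> x) = N m #> x"
proof -
 assume h: "N n <= N m" "x:carrier C"
 interpret Nm: normal "N m" C by (rule N_normal)
 interpret Nn: normal "N n" C by (rule N_normal)
 have "N m <#> (N n #> x) = (N m <#> N n) #> x" by (rule setmult_rcos_assoc[OF N_subset N_subset h(2)])
 also have "N m <#> N n = N m"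
 proof
  show "N m <#> N n <= N m" unfolding set_mult_def using h(1) Nm.m_closed by blast
  show "N m <= N m <#> N n"
  proof
  fix y assume y: "y:N m"
  hence "y = y \<otimes> \<one>" using N_subset by auto
  thus "y:N m <#> N n" unfolding set_mult_def using y Nn.one_closed by blast
  qed
 qed
 finally show ?thesis unfolding trans_map_def .
qed

lemma coset_quotient: "carrier (C Mod N n) = (%x. N n #> x) ` carrier C"
 unfolding FactGroup_def RCOSETS_def by auto

text \<open>The index set consists of the subgroups \<open>N n\<close> themselves, under reverse
  inclusion: different n may give the same subgroup, and the order has to be antisymmetric.
  Surjectivity of the map to the limit is the completeness assumption, injectivity is
  separatedness.\<close>

lemma inverse_limit_group: "is_inverse_limit_of_discrete_infinite_groups C T"
proof -
 define I where "I = range N"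
 define r where "r = {(A, B). A:I & B:I & B <= A}"
 define H where "H A = C Mod A" for A
 define \<Psi> where "\<Psi> c = (\<lambda>A\<in>I. A #> c)" for c
 have Hc: "carrier (H (N n)) = (%x. N n #> x) ` carrier C" for n unfolding H_def by (rule coset_quotient)
 have Hm: "(N n #> x) \<otimes>\<^bsub>H (N n)\<^esub> (N n #> y) = N n #> (x \<otimes> y)" if "x:carrier C" "y:carrier C" for n x y
  unfolding H_def FactGroup_def using normal.rcos_sum[OF N_normal that] by simp
 have sys: "inverse_system_of_groups I r H trans_map"
  unfolding inverse_system_of_groups_def
 proof (intro conjI)
  show "I ~= {}" unfolding I_def by blast
  show "partial_order_on I r"
  unfolding partial_order_on_def preorder_on_def refl_on_def trans_def antisym_def r_def by auto
  show "ALL i:I. ALL j:I. EX k:I. (i, k):r & (j, k):r"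
  proof (intro ballI)
  fix i j assume "i:I" "j:I"
  then obtain m n where "i = N m" "j = N n" unfolding I_def by blast
  thus "EX k:I. (i, k):r & (j, k):r"
  using N_antimono[of m "max m n"] N_antimono[of n "max m n"] unfolding r_def I_def by (intro bexI[of _ "N (max m n)"]) auto
  qed
  show "ALL i:I. group (H i)" unfolding I_def H_def using normal.factorgroup_is_group[OF N_normal] by blast
  show "ALL i:I. ALL j:I. (i, j):r --> trans_map i j:hom (H j) (H i)"
  proof (intro ballI impI)
  fix i j assume ij: "i:I" "j:I" "(i, j):r"
  then obtain m n where mn: "i = N m" "j = N n" "N n <= N m" unfolding I_def r_def by auto
  note tc = trans_map_coset[OF mn(3)]
  show "trans_map i j:hom (H j) (H i)"
  unfolding mn(1,2)
  proof (rule homI)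
  show "trans_map (N m) (N n) B:carrier (H (N m))" if "B:carrier (H (N n))" for B
  using that tc unfolding Hc by auto
  show "trans_map (N m) (N n) (B \<otimes>\<^bsub>H (N n)\<^esub> Z) = trans_map (N m) (N n) B \<otimes>\<^bsub>H (N m)\<^esub> trans_map (N m) (N n) Z"
  if XZ: "B:carrier (H (N n))" "Z:carrier (H (N n))" for B Z
  proof -
  obtain x y where "x:carrier C" "B = N n #> x" "y:carrier C" "Z = N n #> y" using XZ unfolding Hc by auto
  thus ?thesis using tc Hm by simp
  qed
  qed
  qed
  show "ALL i:I. ALL x:carrier (H i). trans_map i i x = x"
  unfolding I_def using trans_map_coset[OF subset_refl] Hc by auto
  show "ALL i:I. ALL j:I. ALL k:I. (i, j):r & (j, k):r --> (ALL x:carrier (H k). trans_map i j (trans_map j k x) = trans_map i k x)"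
  proof (intro ballI impI)
  fix i j k B assume h: "i:I" "j:I" "k:I" "(i, j):r & (j, k):r" "B:carrier (H k)"
  then obtain l m n where e: "i = N l" "j = N m" "k = N n" "N m <= N l" "N n <= N m" unfolding I_def r_def by auto
  then obtain x where x: "x:carrier C" "B = N n #> x" using h(5) Hc by auto
  show "trans_map i j (trans_map j k B) = trans_map i k B"
  unfolding e(1-3) x(2) using trans_map_coset[OF _ x(1)] e(4,5) by simp
  qed
 qed
 have inf: "ALL i:I. infinite (carrier (H i))"
 proof
  fix i assume "i:I"
  then obtain n where n: "i = N n" unfolding I_def by blast
  obtain c :: "nat => 'g" where c: "!!i. c i:carrier C" "!!i j. S n (c i) (c j) ==> i = j" using infinite by blast
  have "inj (%i. N n #> c i)" by (rule injI) (use c N_coset in blast)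
  hence "infinite (range (%i. N n #> c i))" using finite_imageD by blast
  moreover have "range (%i. N n #> c i) <= carrier (H i)" unfolding n Hc using c(1) by blast
  ultimately show "infinite (carrier (H i))" using finite_subset by blast
 qed
 define P where "P = carrier (inverse_limit I r H trans_map)"
 have P_iff: "y:P <-> y:PiE I (%i. carrier (H i)) & (ALL i:I. ALL j:I. (i, j):r --> trans_map i j (y j) = y i)" for y
  unfolding P_def inverse_limit_def product_group_def by auto
 have \<Psi>P: "\<Psi> c:P" if c: "c:carrier C" for c
  unfolding P_iff
 proof (intro conjI ballI impI)
  show "\<Psi> c:PiE I (%i. carrier (H i))" unfolding \<Psi>_def I_def using c Hc by auto
  fix i j assume "i:I" "j:I" "(i, j):r"
  thus "trans_map i j (\<Psi> c j) = \<Psi> c i" unfolding \<Psi>_def I_def r_def using trans_map_coset c by auto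
 qed
 have \<Psi>N: "\<Psi> c (N n) = N n #> c" for c n unfolding \<Psi>_def I_def by simp
 have inj: "inj_on \<Psi> (carrier C)"
 proof (rule inj_onI)
  fix x y assume h: "x:carrier C" "y:carrier C" "\<Psi> x = \<Psi> y"
  have "S n x y" for n using fun_cong[OF h(3), of "N n"] N_coset[OF h(1,2)] unfolding \<Psi>N by blast
  thus "x = y" by (rule separated[OF h(1,2)])
 qed
 have surj: "\<Psi> ` carrier C = P"
 proof
  show "\<Psi> ` carrier C <= P" using \<Psi>P by blast
  show "P <= \<Psi> ` carrier C"
  proof
  fix y assume y: "y:P"
  have "EX c:carrier C. y (N n) = N n #> c" for n
  proof -
  have "y (N n):carrier (H (N n))" using y unfolding P_iff by (auto simp: I_def PiE_def Pi_def)
  thus ?thesis unfolding Hc by blast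
  qed
  then obtain c where c: "!!n. c n:carrier C" "!!n. y (N n) = N n #> c n" by metis
  have "S n (c n) (c (Suc n))" for n
  proof -
  have sub: "N (Suc n) <= N n" by (rule N_antimono) simp
  have m: "N n:I" "N (Suc n):I" "(N n, N (Suc n)):r" using sub unfolding I_def r_def by auto
  hence "trans_map (N n) (N (Suc n)) (y (N (Suc n))) = y (N n)" using conjunct2[OF y[unfolded P_iff]] by simp
  thus ?thesis using trans_map_coset[OF sub c(1)] c N_coset[OF c(1) c(1), of n n "Suc n"] by simp
  qed
  hence "EX x:carrier C. ALL n. S n (c n) x" by (intro complete[OF c(1)])
  then obtain x where x: "x:carrier C" "!!n. S n (c n) x" by (elim bexE) simp
  have "y = \<Psi> x"
  proof (rule extensionalityI[of _ I])
  show "y:extensional I" using y unfolding P_iff by (auto simp: PiE_def)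
  show "\<Psi> x:extensional I" unfolding \<Psi>_def by simp
  fix i assume "i:I"
  then obtain n where n: "i = N n" unfolding I_def by blast
  show "y i = \<Psi> x i" unfolding n \<Psi>N c(2) using N_coset[OF c(1) x(1)] x(2) by blast
  qed
  thus "y:\<Psi> ` carrier C" using x(1) by blast
  qed
 qed
 have iso: "\<Psi>:iso C (inverse_limit I r H trans_map)"
 proof (rule isoI)
  show "\<Psi>:hom C (inverse_limit I r H trans_map)"
  proof (rule homI)
  show "\<Psi> x:carrier (inverse_limit I r H trans_map)" if "x:carrier C" for x using \<Psi>P[OF that] unfolding P_def .
  fix x y assume xy: "x:carrier C" "y:carrier C"
  have "\<Psi> (x \<otimes> y) = (\<lambda>i\<in>I. \<Psi> x i \<otimes>\<^bsub>H i\<^esub> \<Psi> y i)"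
  unfolding \<Psi>_def by (rule restrict_ext) (auto simp: I_def Hm[OF xy])
  thus "\<Psi> (x \<otimes> y) = \<Psi> x \<otimes>\<^bsub>inverse_limit I r H trans_map\<^esub> \<Psi> y"
  unfolding inverse_limit_def product_group_def by simp
  qed
  show "bij_betw \<Psi> (carrier C) (carrier (inverse_limit I r H trans_map))"
  unfolding bij_betw_def using inj surj unfolding P_def by blast
 qed
 define D where "D = product_topology (%i. discrete_topology (carrier (H i))) I"
 have D_P: "topspace (inverse_limit_topology I r H trans_map) = P"
 proof -
  have "P <= PiE I (%i. carrier (H i))"
  by (rule subsetI) (rule conjunct1[OF iffD1[OF P_iff]])
  thus ?thesis
  unfolding inverse_limit_topology_def topspace_subtopology topspace_product_topology P_def[symmetric] by auto
 qed
 have "homeomorphic_map T (inverse_limit_topology I r H trans_map) \<Psi>"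
 proof (rule bijective_open_imp_homeomorphic_map)
  show "\<Psi> ` topspace T = topspace (inverse_limit_topology I r H trans_map)" unfolding topspace_T D_P by (rule surj)
  show "inj_on \<Psi> (topspace T)" unfolding topspace_T by (rule inj)
  show "continuous_map T (inverse_limit_topology I r H trans_map) \<Psi>"
  unfolding inverse_limit_topology_def continuous_map_in_subtopology continuous_map_componentwise P_def[symmetric]
  proof (intro conjI ballI)
  show "\<Psi> ` topspace T <= extensional I" unfolding \<Psi>_def by auto
  show "\<Psi>:topspace T \<rightarrow> P" unfolding topspace_T by (rule Pi_I) (rule \<Psi>P)
  fix i assume "i:I"
  then obtain n where n: "i = N n" unfolding I_def by blast
  show "continuous_map T (discrete_topology (carrier (H i))) (%x. \<Psi> x i)"
  unfolding continuous_map_def topspace_T topspace_discrete_topology openin_discrete_topology n \<Psi>N Hc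
  proof (intro conjI allI impI)
  fix V show "openin T {x:carrier C. N n #> x:V}"
  unfolding openin_iff
  proof (intro conjI ballI)
  fix c assume c: "c:{x:carrier C. N n #> x:V}"
  have "N n #> x = N n #> c" if "x:carrier C" "S n c x" for x using N_coset[of c x n] c that by simp
  thus "EX n'. ALL x:carrier C. S n' c x --> x:{x:carrier C. N n #> x:V}"
  using c by (intro exI[of _ n]) auto
  qed blast
  qed auto
  qed
  show "open_map T (inverse_limit_topology I r H trans_map) \<Psi>"
  unfolding open_map_def
  proof (intro allI impI)
  fix V assume V: "openin T V"
  show "openin (inverse_limit_topology I r H trans_map) (\<Psi> ` V)"
  proof (subst openin_subopen, intro ballI)
  fix y assume "y:\<Psi> ` V"
  then obtain c where c: "c:V" "y = \<Psi> c" by blast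
  have cC: "c:carrier C" using V c(1) unfolding openin_iff by blast
  obtain n where n: "!!x. x:carrier C ==> S n c x ==> x:V" using V c(1) unfolding openin_iff by blast
  let ?B = "{f:topspace D. f (N n):{N n #> c}}"
  have "continuous_map D (discrete_topology (carrier (H (N n)))) (%f. f (N n))"
  unfolding D_def by (rule continuous_map_product_projection) (simp add: I_def)
  hence "openin D ?B"
  by (rule openin_continuous_map_preimage) (use cC Hc in \<open>auto simp: openin_discrete_topology\<close>)
  hence o: "openin (inverse_limit_topology I r H trans_map) (?B Int P)"
  unfolding inverse_limit_topology_def D_def[symmetric] P_def[symmetric] openin_subtopology by blast
  have "?B Int P <= \<Psi> ` V"
  proof
  fix f assume f: "f : ?B Int P"
  then obtain x where x: "x:carrier C" "f = \<Psi> x" using surj by blast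
  hence "N n #> c = N n #> x" using f \<Psi>N by simp
  hence "S n c x" using N_coset[OF cC x(1)] by blast
  thus "f:\<Psi> ` V" using n x by blast
  qed
  moreover have "y : ?B Int P"
  using c(2) \<Psi>P[OF cC] \<Psi>N P_iff unfolding D_def topspace_product_topology topspace_discrete_topology by auto
  ultimately show "EX W. openin (inverse_limit_topology I r H trans_map) W & y:W & W <= \<Psi> ` V" using o by blast
  qed
  qed
 qed
 thus ?thesis unfolding is_inverse_limit_of_discrete_infinite_groups_def
  using sys inf iso by (intro exI[of _ I] exI[of _ r] exI[of _ H] exI[of _ trans_map] exI[of _ \<Psi>]) blast
qed

end

section \<open>The fundamental group as a subgroup of the Galois group\<close>

context pointed_abelian_closure
begin

abbreviation FG where "FG \<equiv> fundamental_group Y x0"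
abbreviation monod where "monod \<equiv> monodromy L F \<iota> ps"

lemma galois_action_inv: "tu:carrier GG ==> galois_action L F (ginv tu) ps = act ps tu"
 unfolding galois_action_def act_def compose_def by simp

lemma mono_class:
 assumes "ga:Loops"
 shows "monod (loop_class Y x0 ga) = endpt ga"
 unfolding monodromy_def
proof (rule the_equality)
 show "endpt ga:carrier GG & (ALL ga':loop_class Y x0 ga. EX xi. is_lift ga' xi & xi 1 = galois_action L F (ginv endpt ga) ps)"
 proof (intro conjI ballI)
  show G: "endpt ga:carrier GG" using endpt_W[OF assms] W_G by blast
  fix ga' assume "ga':loop_class Y x0 ga"
  hence g: "ga':Loops" "endpt ga' = endpt ga" unfolding loop_class_eq[OF assms] by auto
  obtain xi where "is_lift ga' xi" "xi 1 = act ps (endpt ga')" using endpt[OF g(1)] by blast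
  thus "EX xi. is_lift ga' xi & xi 1 = galois_action L F (ginv endpt ga) ps"
  unfolding galois_action_inv[OF G] using g(2) by auto
 qed
 fix tu assume h: "tu:carrier GG & (ALL ga':loop_class Y x0 ga. EX xi. is_lift ga' xi & xi 1 = galois_action L F (ginv tu) ps)"
 have "ga:loop_class Y x0 ga" unfolding loop_class_eq[OF assms] using assms by blast
 then obtain xi where "is_lift ga xi" "xi 1 = act ps tu" using h galois_action_inv by auto
 thus "tu = endpt ga" using endpt_eq h by blast
qed

lemma carrier_FG: "carrier FG = loop_class Y x0 ` Loops"
 unfolding fundamental_group_def Loops_def by simp

lemma FG_E: assumes "c:carrier FG" obtains ga where "ga:Loops" "c = loop_class Y x0 ga" "monod c = endpt ga"
 using assms mono_class unfolding carrier_FG by blast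

lemma FG_W: "c:carrier FG ==> monod c:W"
 using endpt_W by (auto elim!: FG_E)

lemma FG_G: "c:carrier FG ==> monod c:carrier GG" using FG_W W_G by blast

lemma mono_inj: "c:carrier FG ==> c':carrier FG ==> monod c = monod c' ==> c = c'"
 by (elim FG_E) (simp add: loop_class_eq)

lemma FG_surj: "tu:W ==> EX c:carrier FG. monod c = tu"
 using endpt_surj[of tu] mono_class unfolding carrier_FG by blast

lemma FG_mult:
 assumes "c:carrier FG" "c':carrier FG"
 shows "c \<otimes>\<^bsub>FG\<^esub> c':carrier FG" "monod (c \<otimes>\<^bsub>FG\<^esub> c') = monod c *G monod c'"
proof -
 obtain ga where ga: "ga:Loops" "c = loop_class Y x0 ga" "monod c = endpt ga" using FG_E[OF assms(1)] .
 obtain dl where dl: "dl:Loops" "c' = loop_class Y x0 dl" "monod c' = endpt dl" using FG_E[OF assms(2)] .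
 have all: "loop_class Y x0 (loop_prod ga' dl') = loop_class Y x0 (loop_prod ga dl)" if "ga':c" "dl':c'" for ga' dl'
 proof -
  have "ga':Loops" "endpt ga' = endpt ga" "dl':Loops" "endpt dl' = endpt dl"
  using that unfolding ga(2) dl(2) loop_class_eq[OF ga(1)] loop_class_eq[OF dl(1)] by auto
  thus ?thesis using loop_class_eq[OF loop_prod(1)] loop_prod(2) ga(1) dl(1) by simp
 qed
 have ne: "c ~= {}" "c' ~= {}"
  unfolding ga(2) dl(2) loop_class_eq[OF ga(1)] loop_class_eq[OF dl(1)] using ga(1) dl(1) by auto
 have "c \<otimes>\<^bsub>FG\<^esub> c' = (\<Union>ga'\<in>c. \<Union>dl'\<in>c'. loop_class Y x0 (loop_prod ga' dl'))"
  unfolding fundamental_group_def by simp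
 also have "\<dots> = (\<Union>ga'\<in>c. \<Union>dl'\<in>c'. loop_class Y x0 (loop_prod ga dl))"
  by (intro SUP_cong refl) (rule all)
 finally have e: "c \<otimes>\<^bsub>FG\<^esub> c' = loop_class Y x0 (loop_prod ga dl)" using ne by simp
 show "c \<otimes>\<^bsub>FG\<^esub> c':carrier FG" unfolding e carrier_FG using loop_prod(1)[OF ga(1) dl(1)] by blast
 show "monod (c \<otimes>\<^bsub>FG\<^esub> c') = monod c *G monod c'"
  unfolding e mono_class[OF loop_prod(1)[OF ga(1) dl(1)]] ga(3) dl(3) by (rule loop_prod(2)[OF ga(1) dl(1)])
qed

lemma FG_one: "\<one>\<^bsub>FG\<^esub>:carrier FG" "monod \<one>\<^bsub>FG\<^esub> = \<one>\<^bsub>GG\<^esub>"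
proof -
 have p: "pathin T (%t. ps)" unfolding pathin_T_iff using ps by auto
 have a: "ps = act ps \<one>\<^bsub>GG\<^esub>" using act_one[OF ps] by simp
 note pl = path_loop[OF p refl G.one_closed a]
 have "(\<lambda>w\<in>sphere 0 1. x0) = loop_of (%t. x0)" unfolding loop_of_def by simp
 hence L: "(\<lambda>w\<in>sphere 0 1. x0):Loops" "endpt (\<lambda>w\<in>sphere 0 1. x0) = \<one>\<^bsub>GG\<^esub>" using pl(1,3) by auto
 have e: "\<one>\<^bsub>FG\<^esub> = loop_class Y x0 (\<lambda>w\<in>sphere 0 1. x0)" unfolding fundamental_group_def by simp
 show "\<one>\<^bsub>FG\<^esub>:carrier FG" unfolding e carrier_FG using L(1) by blast
 show "monod \<one>\<^bsub>FG\<^esub> = \<one>\<^bsub>GG\<^esub>" unfolding e mono_class[OF L(1)] by (rule L(2))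
qed

text \<open>The winding function is a crossed homomorphism. Because of the argument
  \<open>ups x\<close>, congruences on \<open>R n\<close> respect products only since
  \<open>R n\<close> is stable under automorphisms.\<close>

lemma wind_mult:
 assumes "tu:W" "ups:W"
 shows "tu *G ups:W" "x:U ==> wind (tu *G ups) x = wind ups x + wind tu (ups x)"
proof -
 note G = W_G[OF assms(1)] W_G[OF assms(2)]
 have "act ps (tu *G ups) = act (twist ps (wind tu)) ups" using act_act[OF G, of ps] wind(2)[OF assms(1)] by simp
 also have "\<dots> = twist (act ps ups) (%x. wind tu (ups x))" by (rule twist_act[OF G(2)])
 also have "\<dots> = twist ps (%x. wind ups x + wind tu (ups x))" unfolding wind(2)[OF assms(2)] twist_twist ..
 finally have e: "act ps (tu *G ups) = twist ps (%x. wind ups x + wind tu (ups x))" .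
 have a: "additive (%x. wind ups x + wind tu (ups x))"
  by (rule additive_diff(2)[OF wind(1)[OF assms(2)] additive_act[OF wind(1)[OF assms(1)] G(2)]])
 have m: "tu *G ups:carrier GG" using G by simp
 show "tu *G ups:W" by (rule W_I[OF m a e])
 show "wind (tu *G ups) x = wind ups x + wind tu (ups x)" if "x:U" by (rule wind_eq[OF m a e that])
qed

lemma W_inv: assumes "tu:W" shows "ginv tu:W"
proof -
 note G = W_G[OF assms]
 have iG: "ginv tu:carrier GG" using G by simp
 let ?f = "%x. wind tu ((ginv tu) x)"
 have f: "additive ?f" by (rule additive_act[OF wind(1)[OF assms] iG])
 have "ps = act (act ps tu) (ginv tu)" using act_inv(1)[OF ps G] by simp
 also have "\<dots> = twist (act ps (ginv tu)) ?f" unfolding wind(2)[OF assms] by (rule twist_act[OF iG])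
 finally have "twist ps (%x. - 1 * ?f x) = twist (act ps (ginv tu)) (%x. 0)"
  using twist_twist[of "act ps (ginv tu)" ?f "%x. - 1 * ?f x"] by simp
 hence "act ps (ginv tu) = twist ps (%x. - 1 * ?f x)" using twist_zero[OF act_X[OF ps iG]] by simp
 thus ?thesis by (rule W_I[OF iG additive_diff(3)[OF f]])
qed

lemma FG_group: "group FG"
proof (rule groupI)
 show "c \<otimes>\<^bsub>FG\<^esub> c':carrier FG" if "c:carrier FG" "c':carrier FG" for c c' by (rule FG_mult(1)[OF that])
 show "\<one>\<^bsub>FG\<^esub>:carrier FG" by (rule FG_one)
 show "a \<otimes>\<^bsub>FG\<^esub> b \<otimes>\<^bsub>FG\<^esub> c = a \<otimes>\<^bsub>FG\<^esub> (b \<otimes>\<^bsub>FG\<^esub> c)" if "a:carrier FG" "b:carrier FG" "c:carrier FG" for a b c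
  by (rule mono_inj) (use that in \<open>simp_all add: FG_mult FG_G G.m_assoc\<close>)
 show "\<one>\<^bsub>FG\<^esub> \<otimes>\<^bsub>FG\<^esub> c = c" if "c:carrier FG" for c
  by (rule mono_inj) (use that in \<open>simp_all add: FG_mult FG_one FG_G\<close>)
 show "EX b:carrier FG. b \<otimes>\<^bsub>FG\<^esub> c = \<one>\<^bsub>FG\<^esub>" if c: "c:carrier FG" for c
 proof -
  obtain b where b: "b:carrier FG" "monod b = ginv monod c" using FG_surj[OF W_inv[OF FG_W[OF c]]] by blast
  have "b \<otimes>\<^bsub>FG\<^esub> c = \<one>\<^bsub>FG\<^esub>"
  by (rule mono_inj) (use b c in \<open>simp_all add: FG_mult FG_one FG_G\<close>)
  thus ?thesis using b(1) by blast
 qed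
qed

lemma mono_mon: "monod:mon FG GG"
 unfolding mon_def hom_def
proof (intro CollectI conjI ballI)
 show "inj_on monod (carrier FG)" by (rule inj_onI) (rule mono_inj)
qed (use FG_G FG_mult(2) in auto)

lemma same_at_mult:
 assumes W: "tu:W" "ups:W" "tu':W" "ups':W" and h: "same_at n tu tu'" "same_at n ups ups'"
 shows "same_at n (tu *G ups) (tu' *G ups')"
 unfolding same_at_def
proof
 fix x assume x: "x:R n"
 have "ups' x:R n" by (rule R_image_G[OF W_G[OF W(4)] x])
 hence "ups x = ups' x" "wind ups x = wind ups' x" "tu (ups' x) = tu' (ups' x)" "wind tu (ups' x) = wind tu' (ups' x)"
  using h x unfolding same_at_def by auto
 thus "(tu *G ups) x = (tu' *G ups') x & wind (tu *G ups) x = wind (tu' *G ups') x"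
  using wind_mult(2)[OF W(1,2) R_U[OF x]] wind_mult(2)[OF W(3,4) R_U[OF x]]
  G_mult[OF W_G[OF W(1)] W_G[OF W(2)] R_carrier(1)[OF x]] G_mult[OF W_G[OF W(3)] W_G[OF W(4)] R_carrier(1)[OF x]] by simp
qed

text \<open>As \<open>n\<close> grows, such elements tend to \<open>1\<close> in the Krull topology but not in the loop topology,
which sees winding numbers: this distinguishes the two topologies.\<close>

lemma exists_winding: "EX tu:W Int G_n n. wind tu (\<one> \<oplus> \<one>) ~= 0"
proof -
 obtain h where h: "additive h" "!!x. x:Eu n ==> h x:\<int>" "h (\<one> \<oplus> \<one>) ~= 0" using integer_hom_Eu[of n] by blast
 have "twist ps h x = ps x" if "x:Eu n" for x
  unfolding twist_def using Eu_U[OF that] cis_2pi_eq_1_iff[of "h x"] h(2)[OF that] by simp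
 then obtain tu f where tu: "tu:G_n n" "additive f" "ALL x:Eu n. f x = 0" "act ps tu = twist (twist ps h) f"
  using character_core[OF twist_X[OF ps h(1)] ps, of n] by blast
 note e = tu(4)[unfolded twist_twist] and a = additive_diff(2)[OF h(1) tu(2)]
 note two = two_not_mu(1)[of n]
 have "wind tu (\<one> \<oplus> \<one>) = h (\<one> \<oplus> \<one>) + f (\<one> \<oplus> \<one>)" by (rule wind_eq[OF G_nD(2)[OF tu(1)] a e Eu_U[OF two]])
 hence "wind tu (\<one> \<oplus> \<one>) ~= 0" using h(3) tu(3) two by auto
 thus ?thesis using tu(1) W_I[OF G_nD(2)[OF tu(1)] a e] by blast
qed

text \<open>An element of \<open>G_n n\<close> turns \<open>act ps ups\<close> into a twist of
  \<open>ps\<close>, and multiplying \<open>ups\<close> by this element changes nothing on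
  \<open>R n\<close>.\<close>

lemma W_dense: "ups:carrier GG ==> EX tu:W. ALL x:R n. tu x = ups x"
proof -
 assume s: "ups:carrier GG"
 obtain al f where al: "al:G_n n" "additive f" "act (act ps ups) al = twist ps f"
  using character_dense[OF ps act_X[OF ps s], of n] by blast
 note aG = G_nD(2)[OF al(1)]
 have "ups *G al:W" by (rule W_I[OF _ al(2)]) (use s aG al(3) act_act[OF s aG] in simp_all)
 moreover have "(ups *G al) x = ups x" if "x:R n" for x
  using G_mult[OF s aG R_carrier(1)[OF that]] G_nD(3)[OF al(1) that] by simp
 ultimately show ?thesis by blast
qed

text \<open>The automorphisms converge by \<open>G_limit\<close>, and the winding functions are
  eventually constant on each element. Both the additivity of the limit and its relation to
  \<open>rh\<close> involve finitely many elements at a time, hence hold at some finite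
  stage.\<close>

lemma W_limit:
 assumes tu: "!!k::nat. tu k:W" and coh: "!!k. same_at (n + k) (tu k) (tu (Suc k))"
 shows "EX rh:W. ALL k. same_at (n + k) (tu k) rh"
proof -
 have G: "tu k:carrier GG" for k using tu W_G by blast
 have "EX rh:carrier GG. ALL k. ALL x:E (n + k). rh x = tu k x"
 proof (rule G_limit[OF G])
  show "tu (Suc k) x = tu k x" if x: "x:E (n + k)" for k x
  by (rule G_eq_on_E[OF G G _ x]) (use coh[of k] in \<open>auto simp: same_at_def\<close>)
 qed
 then obtain rh where rh: "rh:carrier GG" "!!k x. x:E (n + k) ==> rh x = tu k x" by blast
 have wc: "wind (tu j) x = wind (tu k) x" if "k <= j" "x:R (n + k)" for j k x
  using that(1)
 proof (induction j rule: dec_induct)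
  case (step i)
  have "x:R (n + i)" using R_mono[of "n + k" "n + i"] that(2) step(1) by auto
  thus ?case using coh[of i] step(3) unfolding same_at_def by simp
 qed simp
 define kx where "kx x = (SOME k. x:R (n + k))" for x
 have ex: "EX k. S <= R (n + k)" if S: "finite S" "S <= U" for S
 proof -
  obtain m where "m >= n" "S <= R m" using R_exhaust_finite[OF S] by blast
  thus ?thesis by (intro exI[of _ "m - n"]) simp
 qed
 define f where "f x = wind (tu (kx x)) x" for x
 have fw: "f x = wind (tu k) x" if x: "x:R (n + k)" for k x
 proof -
  have "x:R (n + kx x)" unfolding kx_def by (rule someI[of _ k]) (rule x)
  hence "wind (tu (max k (kx x))) x = wind (tu (kx x)) x" by (intro wc) auto
  moreover have "wind (tu (max k (kx x))) x = wind (tu k) x" by (intro wc x) auto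
  ultimately show ?thesis unfolding f_def by simp
 qed
 have f: "additive f"
  unfolding add_hom_def
 proof (intro ballI)
  fix x y assume xy: "x:U" "y:U"
  have "{x, y, x \<otimes> y} <= U" using xy by (simp add: integral_iff)
  then obtain k where k: "{x, y, x \<otimes> y} <= R (n + k)" using ex[of "{x, y, x \<otimes> y}"] by auto
  thus "f (x *M y) = f x + f y" using fw[of x k] fw[of y k] fw[of "x \<otimes> y" k] additiveD[OF wind(1)[OF tu] xy, of k] by simp
 qed
 have e: "act ps rh = twist ps f"
  unfolding act_def twist_def
 proof (rule restrict_ext)
  fix x assume x: "x:U"
  obtain k where k: "x:R (n + k)" using ex[of "{x}"] x by auto
  have "ps (tu k x) = ps x * cis (2 * pi * wind (tu k) x)"
  using fun_cong[OF wind(2)[OF tu, of k], of x] x unfolding act_def twist_def by simp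
  thus "ps (rh x) = ps x * cis (2 * pi * f x)" using rh(2)[OF subsetD[OF R_E k]] fw[OF k] by simp
 qed
 have "same_at (n + k) (tu k) rh" for k
  unfolding same_at_def using rh(2)[OF subsetD[OF R_E]] wind_eq[OF rh(1) f e R_U] fw by auto
 thus ?thesis using W_I[OF rh(1) f e] by blast
qed

text \<open>Exact agreement of the lifts on \<open>R n\<close> at all times is a strong condition,
  but it suffices: the competing loops in \<open>openin_loop_topology\<close> arise from twists by
  additive functions that vanish on \<open>R n\<close>. The proof follows the generation of the
  topology, with compactness of the preimage of \<open>C\<close> in the interval for the basic
  sets.\<close>

lemma compact_open_shadow:
 assumes "generate_topology_on {{f:extensional (topspace unit_circle). continuous_map unit_circle Y f & f ` C <= V} | C V.
  compactin unit_circle C & openin Y V} A" "ga:A" "is_lift ga xi"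
 shows "EX n. ALL ga':Loops. ALL xi'. is_lift ga' xi' --> (ALL t:{0..1}. ALL x:R n. xi' t x = xi t x) --> ga':A"
 using assms
proof (induction A rule: generate_topology_on.induct)
 case Empty
 thus ?case by simp
next
 case (Int A B)
 hence m: "ga:A" "ga:B" by auto
 obtain n1 where n1: "!!ga' xi'. ga':Loops ==> is_lift ga' xi' ==> ALL t:{0..1}. ALL x:R n1. xi' t x = xi t x ==> ga':A"
  using Int.IH(1)[OF m(1) Int.prems(2)] by blast
 obtain n2 where n2: "!!ga' xi'. ga':Loops ==> is_lift ga' xi' ==> ALL t:{0..1}. ALL x:R n2. xi' t x = xi t x ==> ga':B"
  using Int.IH(2)[OF m(2) Int.prems(2)] by blast
 have "R n1 <= R (max n1 n2)" "R n2 <= R (max n1 n2)" by (auto intro!: R_mono)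
 thus ?case using n1 n2 by (intro exI[of _ "max n1 n2"]) (simp add: subset_iff)
next
 case (UN K)
 then obtain A where A: "A:K" "ga:A" by blast
 obtain n where "ALL ga':Loops. ALL xi'. is_lift ga' xi' --> (ALL t:{0..1}. ALL x:R n. xi' t x = xi t x) --> ga':A"
  using UN.IH[OF A UN.prems(2)] by blast
 thus ?case using A(1) by (intro exI[of _ n]) blast
next
 case (Basis A)
 then obtain C V where CV: "A = {f:extensional (topspace unit_circle). continuous_map unit_circle Y f & f ` C <= V}"
  "compactin unit_circle C" "openin Y V" by blast
 have Cs: "C <= sphere 0 1" using compactin_subset_topspace[OF CV(2)] by simp
 have cC: "compact C" using CV(2) by (simp add: compactin_subtopology)
 define K where "K = {0..1} Int (%t. cis (2 * pi * t)) -` C"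
 have "closed ((%t. cis (2 * pi * t)) -` C)"
  by (rule closed_vimage[OF compact_imp_closed[OF cC] cis_path_continuous])
 hence cK: "compact K" unfolding K_def by (intro compact_Int_closed) auto
 define P where "P = {kp:Chars. q kp:V}"
 have "openin T P" using openin_continuous_map_preimage[OF q_continuous CV(3)] unfolding P_def Chars_def by simp
 hence P: "EX m. EX dl>0. ALL kp':Chars. near m dl kp' kp --> kp':P" if "kp:P" for kp
  using that unfolding T_open_iff by blast
 note lift = is_liftD[OF Basis.prems(2)]
 have "EX m d. d > 0 & (ALL s:{0..1}. \<bar>s - t\<bar> < d --> (ALL kp:Chars. (ALL x:R m. kp x = xi s x) --> kp:P))" if t: "t:K" for t
 proof -
  have t01: "t:{0..1}" "cis (2 * pi * t):C" using t unfolding K_def by auto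
  have "xi t:P" unfolding P_def using lift(4)[OF t01(1)] lift(3)[OF t01(1)] Basis.prems(1) t01(2) unfolding CV(1) by auto
  then obtain m dl where m: "dl > 0" "!!kp'. kp':Chars ==> near m dl kp' (xi t) ==> kp':P" using P by blast
  obtain d where d: "d > 0" "!!s. s:{0..1} ==> \<bar>s - t\<bar> < d ==> near m dl (xi s) (xi t)"
  using pathin_near[OF lift(1) t01(1) m(1)] by blast
  have "kp:P" if "s:{0..1}" "\<bar>s - t\<bar> < d" "kp:Chars" "ALL x:R m. kp x = xi s x" for s kp
  using m(2)[OF that(3)] d(2)[OF that(1,2)] that(4) unfolding near_def by simp
  thus ?thesis using d(1) by blast
 qed
 then obtain m d where md: "!!t. t:K ==> d t > 0 & (ALL s:{0..1}. \<bar>s - t\<bar> < d t --> (ALL kp:Chars. (ALL x:R (m t). kp x = xi s x) --> kp:P))"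
  by metis
 have "K <= (\<Union>t\<in>K. ball t (d t))" using md by force
 then obtain D where D: "D <= K" "finite D" "K <= (\<Union>t\<in>D. ball t (d t))"
  using compactE_image[OF cK, of K "%t. ball t (d t)"] by auto
 obtain n where n: "!!t. t:D ==> m t <= n" using finite_nat_set_iff_bounded_le[of "m ` D"] D(2) by auto
 have "ga':A" if g: "ga':Loops" "is_lift ga' xi'" "ALL t:{0..1}. ALL x:R n. xi' t x = xi t x" for ga' xi'
 proof -
  have "ga' w:V" if w: "w:C" for w
  proof -
  have "w:(%t. cis (2 * pi * t)) ` {0..1}" unfolding cis_path_image using w Cs by blast
  then obtain s where s: "s:{0..1}" "w = cis (2 * pi * s)" by blast
  hence "s:K" unfolding K_def using w by simp
  then obtain t where t: "t:D" "s:ball t (d t)" using D(3) by blast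
  have tK: "t:K" and st: "\<bar>s - t\<bar> < d t" using t D(1) by (auto simp: dist_real_def abs_minus_commute)
  have "ALL x:R (m t). xi' s x = xi s x" using g(3) s(1) R_mono[OF n[OF t(1)]] by blast
  hence "xi' s:P" using md[OF tK] s(1) st is_liftD(4)[OF g(2) s(1)] by blast
  thus ?thesis unfolding P_def s(2) using is_liftD(3)[OF g(2) s(1)] by simp
  qed
  thus ?thesis unfolding CV(1) using g(1) unfolding Loops_iff by auto
 qed
 thus ?case by blast
qed

text \<open>In one direction, a class congruent to \<open>c\<close> has a representative whose lift
  agrees with that of a loop in \<open>c\<close> on \<open>R n\<close>. In the other, loops close in
  the compact-open topology have congruent endpoints, by \<open>loop_control\<close> and
  \<open>close_endpt\<close>.\<close>

lemma openin_loop_topology: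
 "openin (loop_topology Y x0) V <-> V <= carrier FG & (ALL c:V. EX n. ALL c':carrier FG. same_at n (monod c) (monod c') --> c':V)"
proof -
 let ?B = "{{f:extensional (topspace unit_circle). continuous_map unit_circle Y f & f ` C <= V} | C V. compactin unit_circle C & openin Y V}"
 let ?P = "{ga:Loops. loop_class Y x0 ga:V}"
 have o: "openin (loop_topology Y x0) V <-> V <= carrier FG & openin (loop_space Y x0) ?P"
  unfolding loop_topology_def openin_quotient_topology carrier_FG Loops_def by simp
 have "openin (loop_space Y x0) ?P <-> (ALL c:V. EX n. ALL c':carrier FG. same_at n (monod c) (monod c') --> c':V)" if V: "V <= carrier FG"
 proof
  assume "openin (loop_space Y x0) ?P"
  then obtain A where A: "openin (compact_open_topology unit_circle Y) A" "?P = A Int {ga. ga 1 = x0}"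
  unfolding loop_space_def openin_subtopology by blast
  have gA: "generate_topology_on ?B A" using A(1) unfolding compact_open_topology_def openin_topology_generated_by_iff .
  show "ALL c:V. EX n. ALL c':carrier FG. same_at n (monod c) (monod c') --> c':V"
  proof
  fix c assume c: "c:V"
  hence cFG: "c:carrier FG" using V by blast
  obtain ga where ga: "ga:Loops" "c = loop_class Y x0 ga" "monod c = endpt ga" using FG_E[OF cFG] .
  have "ga : ?P" using c ga by simp
  hence gaA: "ga:A" unfolding A(2) by blast
  obtain xi where xi: "is_lift ga xi" "xi 1 = act ps (endpt ga)" using endpt[OF ga(1)] by blast
  from compact_open_shadow[OF gA gaA xi(1)]
  obtain n where n: "ALL ga':Loops. ALL xi'. is_lift ga' xi' --> (ALL t:{0..1}. ALL x:R n. xi' t x = xi t x) --> ga':A" by (rule exE)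
  have "c':V" if c': "c':carrier FG" "same_at n (monod c) (monod c')" for c'
  proof -
  define tu tu' where "tu = monod c" and "tu' = monod c'"
  have W: "tu:W" "tu':W" unfolding tu_def tu'_def using FG_W cFG c'(1) by auto
  \<comment> \<open>Twisting the given lift by t times this difference moves its end from
    \<open>tu\<close> to \<open>tu'\<close>, with no change on \<open>R n\<close>.\<close>
  define g where "g x = wind tu' x - wind tu x" for x
  have g: "additive g" unfolding g_def by (rule additive_diff(1)[OF wind(1)[OF W(2)] wind(1)[OF W(1)]])
  have g0: "g x = 0" if "x:R n" for x using c'(2) that unfolding same_at_def g_def tu_def tu'_def by simp
  define xi' where "xi' t = twist (xi t) (%x. t * g x)" for t
  have "pathin T xi'"
  unfolding pathin_T_iff
  proof (intro conjI ballI)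
  show "xi' t:Chars" if "t:{0..1}" for t unfolding xi'_def by (rule twist_X[OF is_liftD(4)[OF xi(1) that] additive_diff(3)[OF g]])
  fix x assume x: "x:U"
  have "continuous_on {0..1} (%t. xi t x)" using is_liftD(1)[OF xi(1)] x unfolding pathin_T_iff by blast
  hence "continuous_on {0..1} (%t. xi t x * cis (2 * pi * (t * g x)))" by (intro continuous_intros)
  thus "continuous_on {0..1} (%t. xi' t x)" unfolding xi'_def twist_def using x by simp
  qed
  moreover have "xi' 0 = ps" unfolding xi'_def using twist_zero[OF ps] is_liftD(2)[OF xi(1)] by simp
  moreover have "xi' 1 = act ps tu'"
  proof -
  have "xi' 1 = twist (twist ps (wind tu)) g" unfolding xi'_def using xi(2) wind(2)[OF W(1)] ga(3) tu_def by simp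
  also have "\<dots> = twist ps (wind tu')" unfolding twist_twist g_def by simp
  finally show ?thesis using wind(2)[OF W(2)] by simp
  qed
  ultimately have l: "loop_of (%t. q (xi' t)):Loops" "is_lift (loop_of (%t. q (xi' t))) xi'" "endpt (loop_of (%t. q (xi' t))) = tu'"
  using path_loop[OF _ _ W_G[OF W(2)]] by auto
  have "xi' t x = xi t x" if "x:R n" for t x unfolding xi'_def twist_def using g0[OF that] R_U[OF that] by simp
  hence "loop_of (%t. q (xi' t)):A" using n l(1,2) by blast
  hence "loop_of (%t. q (xi' t)) : ?P" unfolding A(2) using l(1) unfolding Loops_iff by simp
  hence V': "loop_class Y x0 (loop_of (%t. q (xi' t))):V" by simp
  moreover have "loop_class Y x0 (loop_of (%t. q (xi' t))) = c'"
  by (rule mono_inj) (use V' V c'(1) mono_class[OF l(1)] l(3) tu'_def in auto)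
  ultimately show ?thesis by simp
  qed
  thus "EX n. ALL c':carrier FG. same_at n (monod c) (monod c') --> c':V" by blast
  qed
 next
  assume h: "ALL c:V. EX n. ALL c':carrier FG. same_at n (monod c) (monod c') --> c':V"
  show "openin (loop_space Y x0) ?P"
  proof (subst openin_subopen, intro ballI)
  fix ga assume "ga : ?P"
  hence ga: "ga:Loops" "loop_class Y x0 ga:V" by auto
  obtain n where n: "!!c'. c':carrier FG ==> same_at n (endpt ga) (monod c') ==> c':V"
  using bspec[OF h ga(2)] unfolding mono_class[OF ga(1)] by blast
  obtain m ep where s: "separates n m ep" using exists_separates by blast
  hence ep: "ep / 2 > 0" unfolding separates_def by simp
  obtain xi where xi: "is_lift ga xi" "xi 1 = act ps (endpt ga)" "endpt ga:carrier GG" using endpt[OF ga(1)] by blast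
  from loop_control[OF xi(1) ep, of m]
  obtain \<C> where \<C>0: "finite \<C> & (ALL (C, V):\<C>. compactin unit_circle C & openin Y V & ga ` C <= V) &
  (ALL ga'. (ALL (C, V):\<C>. ga' ` C <= V) --> (ALL t:{0..1}. EX kp:Chars. near m (ep / 2) kp (xi t) & q kp = ga' (cis (2 * pi * t))))"
  by (rule exE)
  note \<C>3 = mp[OF spec[OF conjunct2[OF conjunct2[OF \<C>0]]]]
  have \<C>2: "compactin unit_circle C & openin Y V & ga ` C <= V" if "(C, V):\<C>" for C V
  using bspec[OF conjunct1[OF conjunct2[OF \<C>0]] that] by simp
  define B where "B CV = {f:extensional (topspace unit_circle). continuous_map unit_circle Y f & f ` fst CV <= snd CV}" for CV
  \<comment> \<open>The pair of empty sets keeps the intersection within the continuous extensional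
    maps even when the finite set of conditions is empty.\<close>
  define A where "A = (\<Inter>CV\<in>insert ({}, {}) \<C>. B CV)"
  have "openin (compact_open_topology unit_circle Y) (B CV)" if "CV:insert ({}, {}) \<C>" for CV
  unfolding compact_open_topology_def
  proof (rule topology_generated_by_Basis)
  show "B CV : ?B" unfolding B_def using that \<C>2[of "fst CV" "snd CV"]
  by (intro CollectI exI[of _ "fst CV"] exI[of _ "snd CV"]) auto
  qed
  hence "openin (compact_open_topology unit_circle Y) A" unfolding A_def
  by (intro openin_INT2) (use conjunct1[OF \<C>0] in auto)
  hence oA: "openin (loop_space Y x0) (A Int {ga. ga 1 = x0})" unfolding loop_space_def openin_subtopology by blast
  have "ga:A Int {ga. ga 1 = x0}" using ga(1) \<C>2 unfolding A_def B_def Loops_iff by fastforce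
  moreover have "A Int {ga. ga 1 = x0} <= ?P"
  proof
  fix ga' assume g: "ga':A Int {ga. ga 1 = x0}"
  hence L: "ga':Loops" unfolding A_def B_def Loops_iff by auto
  have "ALL (C, V):\<C>. ga' ` C <= V" using g unfolding A_def B_def by fastforce
  note cl = \<C>3[OF this]
  obtain xi' where xi': "is_lift ga' xi'" "xi' 1 = act ps (endpt ga')" "endpt ga':carrier GG" using endpt[OF L] by blast
  have "same_at n (endpt ga) (endpt ga')"
  by (rule close_endpt[OF s xi(1,3,2) xi'(1,3,2)]) (use cl in blast)
  hence "loop_class Y x0 ga':V" using n[of "loop_class Y x0 ga'"] mono_class[OF L] L unfolding carrier_FG by simp
  thus "ga' : ?P" using L by simp
  qed
  ultimately show "EX W. openin (loop_space Y x0) W & ga:W & W <= ?P" using oA by blast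
  qed
 qed
 thus ?thesis using o by blast
qed

section \<open>The Krull topology and the final comparison\<close>

lemma krull_neighbourhood:
 assumes "openin (krull_topology L F) V" "ups:V"
 shows "EX n. ALL tu:carrier GG. (ALL x:R n. tu x = ups x) --> tu:V"
proof -
 have "generate_topology_on {ups <#\<^bsub>GG\<^esub> carrier (galois_group L E') | ups E'.
  ups:carrier GG & subfield E' L & F <= E' & finite_dimension F E'} V"
  using assms(1) unfolding krull_topology_def openin_topology_generated_by_iff .
 thus ?thesis using assms(2)
 proof (induction V rule: generate_topology_on.induct)
  case (Int A B)
  then obtain n1 n2 where n: "!!tu. tu:carrier GG ==> ALL x:R n1. tu x = ups x ==> tu:A"
  "!!tu. tu:carrier GG ==> ALL x:R n2. tu x = ups x ==> tu:B" by blast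
  have "R n1 <= R (max n1 n2)" "R n2 <= R (max n1 n2)" by (auto intro!: R_mono)
  thus ?case using n by (intro exI[of _ "max n1 n2"]) (simp add: subset_iff)
 next
  case (UN K)
  thus ?case by blast
 next
  case (Basis A)
  then obtain al E' where E': "A = al <#\<^bsub>GG\<^esub> carrier (galois_group L E')" "al:carrier GG" "subfield E' L" "F <= E'" "finite_dimension F E'"
  by blast
  have sub: "carrier (galois_group L E') <= carrier GG" by (rule galois_group_mono[OF E'(4)])
  obtain h where h: "h:carrier (galois_group L E')" "ups = al *G h" using Basis.prems unfolding E'(1) l_coset_def by blast
  have hG: "h:carrier GG" and sG: "ups:carrier GG" using sub h E'(2) by auto
  obtain k where "dimension k F E'" using E'(5) unfolding finite_dimension_def by blast
  then obtain Us where Us: "set Us <= carrier L" "Span F Us = E'" using exists_base[OF F_subfield] by blast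
  \<comment> \<open>A spanning set of the finite extension fits into some \<open>R n\<close>, so the
    values on \<open>R n\<close> determine the coset of the Galois group over that
    extension.\<close>
  obtain n where n: "set Us - {\<zero>} <= R n" using R_exhaust_finite[of "set Us - {\<zero>}" 0] Us(1) by auto
  have "tu:A" if tu: "tu:carrier GG" "ALL x:R n. tu x = ups x" for tu
  proof -
  define bt where "bt = ginv al *G tu"
  have bt: "bt:carrier GG" unfolding bt_def using E'(2) tu(1) by simp
  have hs: "h = ginv al *G ups" unfolding h(2) using E'(2) hG by (simp flip: G.m_assoc)
  have hE: "h x = x" if "x:E'" for x using h(1) that unfolding carrier_galois_group by blast
  have UE: "set Us <= E'" using Span_base_incl[OF F_subfield Us(1)] Us(2) by simp
  have fu: "bt u = u" if u: "u:set Us" for u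
  proof (cases "u = \<zero>")
  case True
  thus ?thesis using Aut_simps(2)[OF G_Aut[OF bt]] by simp
  next
  case False
  hence uR: "u:R n" and uL: "u:carrier L" using n u Us(1) by auto
  have "bt u = h u" unfolding bt_def hs using G_mult[of "ginv al" tu u] G_mult[of "ginv al" ups u] E'(2) tu sG uR uL by simp
  thus ?thesis using hE UE u by auto
  qed
  note A = G_Aut[OF bt]
  have fk: "bt k = k" if "k:F" for k using bt that unfolding G_iff by blast
  have "bt (combine Ks Vs) = combine Ks Vs" if "set Ks <= F" "set Vs <= set Us" for Ks Vs
  using that
  proof (induction Ks Vs rule: combine.induct)
  case (1 k Ks u Vs)
  have c: "k:carrier L" "u:carrier L" "combine Ks Vs:carrier L"
  using 1(2,3) F_carrier Us(1) combine_in_carrier[of Ks Vs] by auto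
  thus ?case using 1 Aut_simps(3,4)[OF A] fk[of k] fu[of u] by simp
  qed (auto simp: Aut_simps(2)[OF A])
  hence "bt x = x" if "x:E'" for x
  using that unfolding Us(2)[symmetric] Span_eq_combine_set[OF F_subfield Us(1)] by blast
  hence "bt:carrier (galois_group L E')" using bt unfolding carrier_galois_group by blast
  moreover have "tu = al *G bt" unfolding bt_def using E'(2) tu(1) by (simp flip: G.m_assoc)
  ultimately show ?thesis unfolding E'(1) l_coset_def by blast
  qed
  thus ?case by blast
 qed simp
qed

lemma topspace_krull: "topspace (krull_topology L F) = carrier GG"
proof
 show "topspace (krull_topology L F) <= carrier GG"
  unfolding krull_topology_def topology_generated_by_topspace l_coset_def
  using galois_group_mono G.m_closed by (clarsimp simp: subset_iff) blast
 have fd: "finite_dimension F F" by (rule finite_dimensionI[OF dimension_one[OF F_subfield]])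
 have "carrier GG <= \<one>\<^bsub>GG\<^esub> <#\<^bsub>GG\<^esub> carrier GG" unfolding l_coset_def by auto
 thus "carrier GG <= topspace (krull_topology L F)"
  unfolding krull_topology_def topology_generated_by_topspace using F_subfield fd G.one_closed by blast
qed

lemma path_connected_Y: "path_connected_space Y"
 unfolding path_connected_space_def Y_topspace
proof (intro ballI)
 fix a b assume "a:q ` Chars" "b:q ` Chars"
 then obtain kp kp' where k: "kp:Chars" "a = q kp" "kp':Chars" "b = q kp'" by blast
 obtain tu f where tu: "tu:G_n 0" "additive f" "act kp' tu = twist kp f" using character_dense[OF k(1,3), of 0] by blast
 have "pathin Y (q \<circ> (%t. twist kp (%x. t * f x)))" by (rule pathin_compose[OF twist_path[OF k(1) tu(2)] q_continuous])
 moreover have "q (twist kp (%x. 0 * f x)) = a" "q (twist kp (%x. 1 * f x)) = b"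
  using twist_zero[OF k(1)] tu(3)[symmetric] q_act[OF k(3) G_nD(2)[OF tu(1)]] k by auto
 ultimately show "EX g. pathin Y g & g 0 = a & g 1 = b"
  by (intro exI[of _ "q \<circ> (%t. twist kp (%x. t * f x))"]) simp
qed

lemma mono_dense: "Abstract_Topology.closure_of (krull_topology L F) (monod ` carrier FG) = carrier GG"
proof
 show "Abstract_Topology.closure_of (krull_topology L F) (monod ` carrier FG) <= carrier GG"
  using closure_of_subset_topspace[of "krull_topology L F"] unfolding topspace_krull .
 show "carrier GG <= Abstract_Topology.closure_of (krull_topology L F) (monod ` carrier FG)"
 proof
  fix ups assume s: "ups:carrier GG"
  have "EX y. y:monod ` carrier FG & y:V" if V: "ups:V" "openin (krull_topology L F) V" for V
  proof -
  obtain n where n: "!!tu. tu:carrier GG ==> ALL x:R n. tu x = ups x ==> tu:V" using krull_neighbourhood[OF V(2,1)] by blast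
  obtain tu where tu: "tu:W" "ALL x:R n. tu x = ups x" using W_dense[OF s, of n] by blast
  obtain c where "c:carrier FG" "monod c = tu" using FG_surj[OF tu(1)] by blast
  thus ?thesis using n[OF W_G[OF tu(1)] tu(2)] by blast
  qed
  thus "ups:Abstract_Topology.closure_of (krull_topology L F) (monod ` carrier FG)"
  unfolding in_closure_of topspace_krull using s by blast
 qed
qed

lemma same_at_refl: "same_at n tu tu" and same_at_sym: "same_at n tu tu' ==> same_at n tu' tu"
 and same_at_trans: "same_at n tu tu' ==> same_at n tu' tu'' ==> same_at n tu tu''"
 unfolding same_at_def by auto

lemma mono_continuous: "continuous_map (loop_topology Y x0) (krull_topology L F) monod"
proof -
 have ts: "topspace (loop_topology Y x0) = carrier FG"
  unfolding loop_topology_def topspace_quotient_topology carrier_FG Loops_def ..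
 show ?thesis
  unfolding continuous_map_def ts topspace_krull
 proof (intro conjI allI impI)
  show "monod:carrier FG \<rightarrow> carrier GG" using FG_G by blast
  fix V assume V: "openin (krull_topology L F) V"
  show "openin (loop_topology Y x0) {c:carrier FG. monod c:V}"
  unfolding openin_loop_topology
  proof (intro conjI ballI)
  fix c assume "c:{c:carrier FG. monod c:V}"
  then obtain n where n: "!!tu. tu:carrier GG ==> ALL x:R n. tu x = monod c x ==> tu:V"
  using krull_neighbourhood[OF V] by blast
  have "c':{c:carrier FG. monod c:V}" if "c':carrier FG" "same_at n (monod c) (monod c')" for c'
  using n[OF FG_G[OF that(1)]] that unfolding same_at_def by auto
  thus "EX n. ALL c':carrier FG. same_at n (monod c) (monod c') --> c':{c:carrier FG. monod c:V}" by blast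
  qed blast
 qed
qed

lemma two_R: "EX n. \<one> \<oplus> \<one>:R n"
 using R_exhaust[of "\<one> \<oplus> \<one>"] Eu_U[OF two_not_mu(1)] by blast

text \<open>The set \<open>V\<close> prescribes winding number 0 at the number 2. A Krull
  neighbourhood of 1 restricts only the values of automorphisms, so by \<open>exists_winding\<close>
  it contains elements of \<open>W\<close> that violate this.\<close>

lemma not_pullback: "loop_topology Y x0 ~= pullback_topology (carrier FG) monod (krull_topology L F)"
proof
 assume eq: "loop_topology Y x0 = pullback_topology (carrier FG) monod (krull_topology L F)"
 obtain n0 where n0: "\<one> \<oplus> \<one>:R n0" using two_R by blast
 define V where "V = {c:carrier FG. same_at n0 \<one>\<^bsub>GG\<^esub> (monod c)}"
 have "openin (loop_topology Y x0) V"
  unfolding openin_loop_topology V_def using same_at_trans by blast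
 then obtain A where A: "openin (krull_topology L F) A" "V = monod -` A Int carrier FG"
  unfolding eq openin_pullback_topology by blast
 have "\<one>\<^bsub>FG\<^esub>:V" unfolding V_def using FG_one same_at_refl by simp
 hence "\<one>\<^bsub>GG\<^esub>:A" unfolding A(2) using FG_one(2) by simp
 then obtain n where n: "!!tu. tu:carrier GG ==> ALL x:R n. tu x = \<one>\<^bsub>GG\<^esub> x ==> tu:A"
  using krull_neighbourhood[OF A(1)] by blast
 obtain tu where tu: "tu:W" "tu:G_n n" "wind tu (\<one> \<oplus> \<one>) ~= 0" using exists_winding[of n] by blast
 have "\<one>\<^bsub>GG\<^esub>:G_n n" by (rule subgroup.one_closed[OF G_n_subgroup])
 hence "tu:A" using n[OF W_G[OF tu(1)]] G_nD(3) tu(2) by metis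
 moreover obtain c where c: "c:carrier FG" "monod c = tu" using FG_surj[OF tu(1)] by blast
 ultimately have "c:V" unfolding A(2) by simp
 hence "wind tu (\<one> \<oplus> \<one>) = wind \<one>\<^bsub>GG\<^esub> (\<one> \<oplus> \<one>)" unfolding V_def same_at_def using n0 c(2) by auto
 also have "\<dots> = 0"
 proof (rule wind_eq[of _ "%x. 0"])
  show "additive (%x. 0)" unfolding add_hom_def by simp
  show "act ps \<one>\<^bsub>GG\<^esub> = twist ps (%x. 0)" using act_one[OF ps] twist_zero[OF ps] by simp
 qed (use Eu_U[OF two_not_mu(1)] in auto)
 finally show False using tu(3) by simp
qed

text \<open>The levels are shifted to start where \<open>R n\<close> contains the number 2. Then
  every level has infinitely many classes: powers of an element with nonzero winding number at 2 are
  pairwise incongruent.\<close>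

lemma FG_congruence_topology: "EX S. congruence_topology FG S (loop_topology Y x0)"
proof -
 obtain n where two: "\<one> \<oplus> \<one>:R n" using two_R by blast
 interpret P: group FG by (rule FG_group)
 have same_mono: "same_at j tu tu'" if "i <= j'" "j <= i" "same_at i tu tu'" for i j j' tu tu'
  using that R_mono[OF that(2)] unfolding same_at_def by blast
 define S where "S k c c' <-> same_at (n + k) (monod c) (monod c')" for k c c'
 have "congruence_topology FG S (loop_topology Y x0)"
 proof (rule congruence_topology.intro[OF FG_group], rule congruence_topology_axioms.intro)
  show "S k c c" for k c unfolding S_def by (rule same_at_refl)
  show "S k c' c" if "S k c c'" for k c c' using that unfolding S_def by (rule same_at_sym)
  show "S k a c" if "S k a b" "S k b c" for k a b c using that unfolding S_def by (rule same_at_trans)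
  show "S k (a \<otimes>\<^bsub>FG\<^esub> b) (a' \<otimes>\<^bsub>FG\<^esub> b')"
  if "a:carrier FG" "b:carrier FG" "a':carrier FG" "b':carrier FG" "S k a a'" "S k b b'" for a b a' b' k
  using same_at_mult[OF FG_W FG_W FG_W FG_W that(5,6)[unfolded S_def]] that(1-4) FG_mult(2) unfolding S_def by simp
  show "S j a b" if "j <= k" "S k a b" for j k a b
  unfolding S_def by (rule same_mono[OF order_refl _ that(2)[unfolded S_def]]) (use that(1) in simp)
  show "openin (loop_topology Y x0) V <-> V <= carrier FG & (ALL c:V. EX k. ALL x:carrier FG. S k c x --> x:V)" for V
  proof -
  have "(EX k. ALL x:carrier FG. same_at k (monod c) (monod x) --> x:V) <->
  (EX k. ALL x:carrier FG. same_at (n + k) (monod c) (monod x) --> x:V)" for c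
  proof
  assume "EX k. ALL x:carrier FG. same_at k (monod c) (monod x) --> x:V"
  then obtain k where k: "ALL x:carrier FG. same_at k (monod c) (monod x) --> x:V" by blast
  have "same_at k tu tu'" if "same_at (n + k) tu tu'" for tu tu' by (rule same_mono[OF order_refl _ that]) simp
  thus "EX k. ALL x:carrier FG. same_at (n + k) (monod c) (monod x) --> x:V" using k by blast
  qed blast
  thus ?thesis unfolding openin_loop_topology S_def by simp
  qed
  show "EX x:carrier FG. ALL k. S k (c k) x"
  if c: "!!k. c k:carrier FG" "!!k. S k (c k) (c (Suc k))" for c :: "nat => _"
  proof -
  obtain rh where rh: "rh:W" "ALL k. same_at (n + k) (monod (c k)) rh"
  using W_limit[of "%k. monod (c k)" n] FG_W[OF c(1)] c(2)[unfolded S_def] by blast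
  thus ?thesis unfolding S_def using FG_surj[OF rh(1)] by auto
  qed
  show "a = b" if ab: "a:carrier FG" "b:carrier FG" "!!k. S k a b" for a b
  proof (rule mono_inj[OF ab(1,2)], rule G_eqI[OF FG_G[OF ab(1)] FG_G[OF ab(2)]])
  fix x assume x: "x:carrier L"
  show "monod a x = monod b x"
  proof (cases "x = \<zero>")
  case True
  thus ?thesis using Aut_simps(2)[OF G_Aut[OF FG_G[OF ab(1)]]] Aut_simps(2)[OF G_Aut[OF FG_G[OF ab(2)]]] by simp
  next
  case False
  then obtain k where "x:R k" using R_exhaust[OF x] by blast
  hence "x:R (n + k)" using R_mono[of k "n + k"] by auto
  thus ?thesis using ab(3)[of k] unfolding S_def same_at_def by blast
  qed
  qed
  fix k :: nat
  obtain tu where tu: "tu:W" "tu:G_n (n + k)" "wind tu (\<one> \<oplus> \<one>) ~= 0" using exists_winding[of "n + k"] by blast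
  have twoR: "\<one> \<oplus> \<one>:R (n + k)" using two R_mono[of n "n + k"] by auto
  obtain c where c: "c:carrier FG" "monod c = tu" using FG_surj[OF tu(1)] by blast
  \<comment> \<open>As \<open>tu\<close> fixes the number 2, the crossed homomorphism rule becomes
    plain additivity there.\<close>
  have pow: "wind (monod (c [^]\<^bsub>FG\<^esub> i)) (\<one> \<oplus> \<one>) = real i * wind tu (\<one> \<oplus> \<one>)" for i :: nat
  proof (induction i)
  case 0
  have "wind \<one>\<^bsub>GG\<^esub> (\<one> \<oplus> \<one>) = 0"
  proof (rule wind_eq[of _ "%x. 0"])
  show "additive (%x. 0)" unfolding add_hom_def by simp
  show "act ps \<one>\<^bsub>GG\<^esub> = twist ps (%x. 0)" using act_one[OF ps] twist_zero[OF ps] by simp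
  qed (use Eu_U[OF two_not_mu(1)] in auto)
  thus ?case using FG_one(2) by simp
  next
  case (Suc i)
  have ci: "c [^]\<^bsub>FG\<^esub> i:carrier FG" using c(1) by simp
  have "tu (\<one> \<oplus> \<one>) = \<one> \<oplus> \<one>" by (rule G_nD(3)[OF tu(2) twoR])
  thus ?case
  using Suc wind_mult(2)[OF FG_W[OF ci] tu(1) R_U[OF twoR]] FG_mult(2)[OF ci c(1)] c(2) by (simp add: algebra_simps)
  qed
  have "i = j" if "S k (c [^]\<^bsub>FG\<^esub> i) (c [^]\<^bsub>FG\<^esub> j)" for i j :: nat
  proof -
  have "real i * wind tu (\<one> \<oplus> \<one>) = real j * wind tu (\<one> \<oplus> \<one>)" using that twoR pow unfolding S_def same_at_def by metis
  thus ?thesis using tu(3) by simp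
  qed
  thus "EX d::nat => _. (ALL i. d i:carrier FG) & (ALL i j. S k (d i) (d j) --> i = j)"
  using c(1) by (intro exI[of _ "%i. c [^]\<^bsub>FG\<^esub> i"]) auto
 qed
 thus ?thesis by blast
qed

end

theorem theorem1p6:
  fixes L :: "('a, 'b) ring_scheme" and F K :: "'a set"
    and \<iota> :: "rat set \<Rightarrow> 'a" and \<psi> :: "'a \<Rightarrow> complex"
  assumes closure: "algebraic_closure L F"
    and char_0: "\<And>n::nat. n > 0 \<Longrightarrow> add_pow L n \<one>\<^bsub>L\<^esub> \<noteq> \<zero>\<^bsub>L\<^esub>"
    and roots_of_unity:
      "\<And>z n::nat. z \<in> carrier L \<Longrightarrow> n > 0 \<Longrightarrow> z [^]\<^bsub>L\<^esub> n = \<one>\<^bsub>L\<^esub> \<Longrightarrow> z \<in> F"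
    and embedding: "\<iota> \<in> mon rat_mod_int (mult_of (L\<lparr>carrier := F\<rparr>))"
    and K_subfield: "subfield K L"
    and K_number_field: "ring.finite_dimension L (generate_field L {}) K"
    and F_abelian: "abelian_extension (L\<lparr>carrier := F\<rparr>) K"
    and base_point: "\<psi> \<in> topspace (X_closure L \<iota>)"
  shows "path_connected_space (X_field L F \<iota>)
    \<and> monodromy L F \<iota> \<psi> \<in> mon (pi1_path L F \<iota> \<psi>) (galois_group L F)
    \<and> Abstract_Topology.closure_of (krull_topology L F)
        (monodromy L F \<iota> \<psi> ` carrier (pi1_path L F \<iota> \<psi>)) = carrier (galois_group L F)
    \<and> complete_topological_group (pi1_path L F \<iota> \<psi>) (pi1_loop_topology L F \<iota> \<psi>)
    \<and> is_inverse_limit_of_discrete_infinite_groups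
        (pi1_path L F \<iota> \<psi>) (pi1_loop_topology L F \<iota> \<psi>)
    \<and> continuous_map (pi1_loop_topology L F \<iota> \<psi>) (krull_topology L F) (monodromy L F \<iota> \<psi>)
    \<and> pi1_loop_topology L F \<iota> \<psi> \<noteq>
        pullback_topology (carrier (pi1_path L F \<iota> \<psi>)) (monodromy L F \<iota> \<psi>) (krull_topology L F)"
proof -
  have "field L" using closure unfolding algebraic_closure_def by blast
  hence "abelian_closure L F K \<iota>"
    by (rule abelian_closure.intro) (rule abelian_closure_axioms.intro; fact)
  hence p: "pointed_abelian_closure L F K \<iota> \<psi>"
    by (rule pointed_abelian_closure.intro) (rule pointed_abelian_closure_axioms.intro, fact)
  obtain S where ct: "congruence_topology (pi1_path L F \<iota> \<psi>) S (pi1_loop_topology L F \<iota> \<psi>)"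
    using pointed_abelian_closure.FG_congruence_topology[OF p] by (rule exE)
  show ?thesis
    by (intro conjI pointed_abelian_closure.path_connected_Y[OF p] pointed_abelian_closure.mono_mon[OF p]
      pointed_abelian_closure.mono_dense[OF p] congruence_topology.complete_group[OF ct]
      congruence_topology.inverse_limit_group[OF ct] pointed_abelian_closure.mono_continuous[OF p]
      pointed_abelian_closure.not_pullback[OF p])
qed

end
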